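(* Let $\kappa=\pm1$. Let $-\frac12<s_0\le 0$ and $f\in H^{s_0}(\mathbb{T})$. Consider the Cauchy problem $i\partial_t u+\Delta u=\kappa\,\overline{u}^{2}$ on $\mathbb{R}\times\mathbb{T}$, $u(0,x)=f(x)$. Then there exist $b>\frac12$ and $T>0$ such that there exists a unique solution $u$ of this Cauchy problem in the space $$Y_T^{0,b}=e^{it\Delta}f+X^{0,b}([-T,T]\times\mathbb{T}).$$ Moreover, given $0<T'<T$, there exists $R=R(T')>0$ such that the map $\tilde f\mapsto\tilde u$ (sending the initial datum $\tilde f$ to the corresponding solution $\tilde u\in e^{it\Delta}\tilde f+X^{0,b}([-T',T']\times\mathbb{T})$), defined on $\{\tilde f\in H^{s_0}(\mathbb{T}):\|\tilde f-f\|_{H^{s_0}}<R\}$, is Lipschitz, in the sense that $\tilde f\mapsto \tilde u-e^{it\Delta}\tilde f$ is Lipschitz from this set (with the $H^{s_0}$ norm) into $X^{0,b}([-T',T']\times\mathbb{T})$.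
   Context: $\mathbb{T}=\mathbb{R}/2\pi\mathbb{Z}$, $\Delta=\partial_x^2$, $\langle x\rangle=(1+|x|^2)^{1/2}$. Fourier coefficients: $\breve f(n)=\frac1{2\pi}\int_{-\pi}^{\pi}e^{-inx}f(x)\,dx$; $e^{it\Delta}f(x)=\sum_{n\in\mathbb{Z}}\breve f(n)e^{-in^2t}e^{inx}$. $H^{s}(\mathbb{T})$ is the Sobolev space with norm $\big(\sum_{n}\langle n\rangle^{2s}|\breve f(n)|^2\big)^{1/2}$. Space-time Fourier transform: $\widetilde F(\tau,n)=\frac1{2\pi}\int_{\mathbb{R}}\int_{-\pi}^{\pi}e^{-i(\tau t+nx)}F(t,x)\,dx\,dt$. For $s,b\in\mathbb{R}$, $X^{s,b}=X^{s,b}(\mathbb{R}\times\mathbb{T})$ is the completion of $C^\infty(\mathbb{T},\mathcal{S}(\mathbb{R}))$ for the norm $\|F\|_{X^{s,b}}=\big(\sum_{n\in\mathbb{Z}}\int_{\mathbb{R}}\langle\tau+n^2\rangle^{2b}\langle n\rangle^{2s}|\widetilde F(\tau,n)|^2d\tau\big)^{1/2}$. For $T>0$, $X^{s,b}([-T,T]\times\mathbb{T})$ is the corresponding restriction space, with $\|F\|=\inf\|\psi(t/T)G\|_{X^{s,b}}$, the infimum being over $G\in X^{s,b}$ coinciding with $F$ on $[-T,T]\times\mathbb{T}$ and $\psi\in\mathcal{S}(\mathbb{R})$ with $\psi=1$ on $[-1,1]$. A solution of the Cauchy problem with datum $f$ means a solution of the integral equation $u(t)=e^{it\Delta}f-i\kappa\int_0^t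 e^{i(t-t')\Delta}\big(\overline{u}^{2}\big)(t')\,dt'$; writing $u_0=e^{it\Delta}f$ and $u=u_0+v$, with $v\in X^{0,b}([-T,T]\times\mathbb{T})$, the integral term is $-i\kappa\int_0^te^{i(t-t')\Delta}\big(\overline{u_0}^2+2\overline{u_0}\,\overline{v}+\overline{v}^2\big)(t')\,dt'$, each of the three terms being understood by continuous extension from smooth $f$ and $v$. *)

theory Defs
  imports "HOL-Analysis.Analysis"
begin

text \<open>
  Functions on the torus are \<open>2 * pi\<close>-periodic functions on the reals. A periodic distribution
  is represented by its family of Fourier coefficients, of type \<^typ>\<open>int \<Rightarrow> complex\<close>, and a
  time-dependent one by the curve \<open>t \<mapsto> (n \<mapsto> n-th Fourier coefficient at time t)\<close>.
\<close>

definition jbr :: "real \<Rightarrow> real" where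
  "jbr x = sqrt (1 + x\<^sup>2)"

definition fcoeff :: "(real \<Rightarrow> complex) \<Rightarrow> int \<Rightarrow> complex" where
  "fcoeff f n = (LBINT x:{-pi..pi}. exp (- (\<i> * of_int n * of_real x)) * f x) / (2 * of_real pi)"

definition smooth_torus :: "(real \<Rightarrow> complex) set" where
  "smooth_torus = {f. (\<forall>x. f (x + 2 * pi) = f x) \<and>
     (\<exists>D. D 0 = f \<and> (\<forall>j x. (D j has_vector_derivative D (Suc j) x) (at x)))}"

definition schwartz :: "(real \<Rightarrow> complex) set" where
  "schwartz = {\<psi>. \<exists>D. D 0 = \<psi> \<and>
     (\<forall>j t. (D j has_vector_derivative D (Suc j) t) (at t)) \<and>
     (\<forall>j k. \<exists>C. \<forall>t. \<bar>t\<bar> ^ k * norm (D j t) \<le> C)}"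

text \<open>
  The space \<open>C\<^sup>\<infinity>(\<T>, \<S>(\<real>))\<close>; functions take the arguments \<open>t\<close>, \<open>x\<close>, and \<open>D j l\<close> is the mixed
  partial derivative of order \<open>j\<close> in \<open>t\<close> and \<open>l\<close> in \<open>x\<close>.
\<close>

definition smooth_schwartz :: "(real \<Rightarrow> real \<Rightarrow> complex) set" where
  "smooth_schwartz = {F. (\<forall>t x. F t (x + 2 * pi) = F t x) \<and>
     (\<exists>D. D 0 0 = F \<and>
       (\<forall>j l t x. ((\<lambda>r. D j l r x) has_vector_derivative D (Suc j) l t x) (at t)) \<and>
       (\<forall>j l t x. ((\<lambda>y. D j l t y) has_vector_derivative D j (Suc l) t x) (at x)) \<and>
       (\<forall>j l k. \<exists>C. \<forall>t x. \<bar>t\<bar> ^ k * norm (D j l t x) \<le> C))}"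

definition Hs :: "real \<Rightarrow> (int \<Rightarrow> complex) set" where
  "Hs s = {f. (\<lambda>n. jbr (of_int n) powr (2 * s) * (norm (f n))\<^sup>2) summable_on UNIV}"

definition Hs_norm :: "real \<Rightarrow> (int \<Rightarrow> complex) \<Rightarrow> real" where
  "Hs_norm s f = sqrt (\<Sum>\<^sub>\<infinity>n. jbr (of_int n) powr (2 * s) * (norm (f n))\<^sup>2)"

definition st_fourier :: "(real \<Rightarrow> real \<Rightarrow> complex) \<Rightarrow> real \<Rightarrow> int \<Rightarrow> complex" where
  "st_fourier F \<tau> n =
     (LBINT t. LBINT x:{-pi..pi}. exp (- (\<i> * of_real (\<tau> * t + of_int n * x))) * F t x)
       / (2 * of_real pi)"

definition Xsb_smooth_norm :: "real \<Rightarrow> real \<Rightarrow> (real \<Rightarrow> real \<Rightarrow> complex) \<Rightarrow> real" where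
  "Xsb_smooth_norm s b F = sqrt (\<Sum>\<^sub>\<infinity>n. LBINT \<tau>.
     jbr (\<tau> + (of_int n)\<^sup>2) powr (2 * b) * jbr (of_int n) powr (2 * s)
       * (norm (st_fourier F \<tau> n))\<^sup>2)"

text \<open>
  The completion of \<^const>\<open>smooth_schwartz\<close>, realised for \<open>b > 1/2\<close> as a space of curves: by the
  Cauchy-Schwarz inequality in \<open>\<tau>\<close>, for such \<open>b\<close> the Fourier coefficients of a Cauchy sequence
  converge uniformly in \<open>t\<close>, and the limit curve determines the element of the completion.
  The definitions below are only meant for \<open>b > 1/2\<close>.
\<close>

definition Xsb_represents ::
    "real \<Rightarrow> real \<Rightarrow> (nat \<Rightarrow> real \<Rightarrow> real \<Rightarrow> complex) \<Rightarrow> (real \<Rightarrow> int \<Rightarrow> complex) \<Rightarrow> bool" where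
  "Xsb_represents s b \<Phi> F \<longleftrightarrow>
     (\<forall>k. \<Phi> k \<in> smooth_schwartz) \<and>
     (\<forall>e>0. \<exists>K. \<forall>k\<ge>K. \<forall>m\<ge>K. Xsb_smooth_norm s b (\<lambda>t x. \<Phi> k t x - \<Phi> m t x) < e) \<and>
     (\<forall>t n. (\<lambda>k. fcoeff (\<Phi> k t) n) \<longlonglongrightarrow> F t n)"

definition Xsb :: "real \<Rightarrow> real \<Rightarrow> (real \<Rightarrow> int \<Rightarrow> complex) set" where
  "Xsb s b = {F. \<exists>\<Phi>. Xsb_represents s b \<Phi> F}"

definition Xsb_norm :: "real \<Rightarrow> real \<Rightarrow> (real \<Rightarrow> int \<Rightarrow> complex) \<Rightarrow> real" where
  "Xsb_norm s b F =
     (THE L. \<exists>\<Phi>. Xsb_represents s b \<Phi> F \<and> (\<lambda>k. Xsb_smooth_norm s b (\<Phi> k)) \<longlonglongrightarrow> L)"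

text \<open>
  Elements of the restriction space are extensional (\<^const>\<open>undefined\<close> outside \<open>[-T, T]\<close>), so that
  equality in it is equality of functions.
\<close>

definition XT :: "real \<Rightarrow> real \<Rightarrow> real \<Rightarrow> (real \<Rightarrow> int \<Rightarrow> complex) set" where
  "XT s b T = (\<lambda>G. restrict G {-T..T}) ` Xsb s b"

definition XT_norm :: "real \<Rightarrow> real \<Rightarrow> real \<Rightarrow> (real \<Rightarrow> int \<Rightarrow> complex) \<Rightarrow> real" where
  "XT_norm s b T F = Inf {Xsb_norm s b (\<lambda>t n. \<psi> (t / T) * G t n) | \<psi> G.
     G \<in> Xsb s b \<and> (\<forall>t\<in>{-T..T}. G t = F t) \<and>
     \<psi> \<in> schwartz \<and> (\<forall>r\<in>{-1..1}. \<psi> r = 1)}"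

definition schroedinger :: "real \<Rightarrow> (int \<Rightarrow> complex) \<Rightarrow> int \<Rightarrow> complex" where
  "schroedinger t f n = exp (- (\<i> * (of_int n)\<^sup>2 * of_real t)) * f n"

definition free_smooth :: "(real \<Rightarrow> complex) \<Rightarrow> real \<Rightarrow> real \<Rightarrow> complex" where
  "free_smooth f t x = (\<Sum>\<^sub>\<infinity>n. schroedinger t (fcoeff f) n * exp (\<i> * of_int n * of_real x))"

text \<open>The integral over \<open>[0, t]\<close> is oriented, so that \<open>t < 0\<close> is covered.\<close>

definition duhamel :: "(real \<Rightarrow> real \<Rightarrow> complex) \<Rightarrow> real \<Rightarrow> int \<Rightarrow> complex" where
  "duhamel G t n = (LBINT r=ereal 0..ereal t. schroedinger (t - r) (fcoeff (G r)) n)"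

text \<open>
  The continuous extensions, from smooth data, of the three parts of the Duhamel term of
  \<open>cnj (u0 + v)\<^sup>2\<close>. Smooth functions are dense, so each extension is unique if it exists.
\<close>

definition extends_free_free ::
    "real \<Rightarrow> real \<Rightarrow> real \<Rightarrow> ((int \<Rightarrow> complex) \<Rightarrow> real \<Rightarrow> int \<Rightarrow> complex) \<Rightarrow> bool" where
  "extends_free_free s b T \<Phi> \<longleftrightarrow>
     (\<forall>f\<in>Hs s. \<Phi> f \<in> XT 0 b T) \<and>
     (\<forall>f\<in>smooth_torus.
        \<Phi> (fcoeff f) = restrict (duhamel (\<lambda>t x. (cnj (free_smooth f t x))\<^sup>2)) {-T..T}) \<and>
     (\<forall>fs f. (\<forall>k. fs k \<in> Hs s) \<longrightarrow> f \<in> Hs s \<longrightarrow>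
        (\<lambda>k. Hs_norm s (\<lambda>n. fs k n - f n)) \<longlonglongrightarrow> 0 \<longrightarrow>
        (\<lambda>k. XT_norm 0 b T (\<lambda>t n. \<Phi> (fs k) t n - \<Phi> f t n)) \<longlonglongrightarrow> 0)"

definition extends_free_rest ::
    "real \<Rightarrow> real \<Rightarrow> real \<Rightarrow>
       ((int \<Rightarrow> complex) \<Rightarrow> (real \<Rightarrow> int \<Rightarrow> complex) \<Rightarrow> real \<Rightarrow> int \<Rightarrow> complex) \<Rightarrow> bool" where
  "extends_free_rest s b T \<Phi> \<longleftrightarrow>
     (\<forall>f\<in>Hs s. \<forall>v\<in>XT 0 b T. \<Phi> f v \<in> XT 0 b T) \<and>
     (\<forall>f\<in>smooth_torus. \<forall>v\<in>smooth_schwartz.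
        \<Phi> (fcoeff f) (\<lambda>t\<in>{-T..T}. fcoeff (v t)) =
          restrict (duhamel (\<lambda>t x. 2 * cnj (free_smooth f t x) * cnj (v t x))) {-T..T}) \<and>
     (\<forall>fs f vs v. (\<forall>k. fs k \<in> Hs s) \<longrightarrow> f \<in> Hs s \<longrightarrow> (\<forall>k. vs k \<in> XT 0 b T) \<longrightarrow> v \<in> XT 0 b T \<longrightarrow>
        (\<lambda>k. Hs_norm s (\<lambda>n. fs k n - f n)) \<longlonglongrightarrow> 0 \<longrightarrow>
        (\<lambda>k. XT_norm 0 b T (\<lambda>t n. vs k t n - v t n)) \<longlonglongrightarrow> 0 \<longrightarrow>
        (\<lambda>k. XT_norm 0 b T (\<lambda>t n. \<Phi> (fs k) (vs k) t n - \<Phi> f v t n)) \<longlonglongrightarrow> 0)"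

definition extends_rest_rest ::
    "real \<Rightarrow> real \<Rightarrow> ((real \<Rightarrow> int \<Rightarrow> complex) \<Rightarrow> real \<Rightarrow> int \<Rightarrow> complex) \<Rightarrow> bool" where
  "extends_rest_rest b T \<Phi> \<longleftrightarrow>
     (\<forall>v\<in>XT 0 b T. \<Phi> v \<in> XT 0 b T) \<and>
     (\<forall>v\<in>smooth_schwartz.
        \<Phi> (\<lambda>t\<in>{-T..T}. fcoeff (v t)) = restrict (duhamel (\<lambda>t x. (cnj (v t x))\<^sup>2)) {-T..T}) \<and>
     (\<forall>vs v. (\<forall>k. vs k \<in> XT 0 b T) \<longrightarrow> v \<in> XT 0 b T \<longrightarrow>
        (\<lambda>k. XT_norm 0 b T (\<lambda>t n. vs k t n - v t n)) \<longlonglongrightarrow> 0 \<longrightarrow>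
        (\<lambda>k. XT_norm 0 b T (\<lambda>t n. \<Phi> (vs k) t n - \<Phi> v t n)) \<longlonglongrightarrow> 0)"

definition YT :: "real \<Rightarrow> real \<Rightarrow> (int \<Rightarrow> complex) \<Rightarrow> (real \<Rightarrow> int \<Rightarrow> complex) set" where
  "YT b T f = {(\<lambda>t\<in>{-T..T}. \<lambda>n. schroedinger t f n + v t n) | v. v \<in> XT 0 b T}"

definition remainder ::
    "real \<Rightarrow> (int \<Rightarrow> complex) \<Rightarrow> (real \<Rightarrow> int \<Rightarrow> complex) \<Rightarrow> real \<Rightarrow> int \<Rightarrow> complex" where
  "remainder T f u = (\<lambda>t\<in>{-T..T}. \<lambda>n. u t n - schroedinger t f n)"

text \<open>
  A solution in \<^const>\<open>YT\<close> of the integral equation with datum \<open>f\<close> in \<open>H\<^sup>s\<close>. It is part of the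
  definition that the three continuous extensions exist on the whole spaces.
\<close>

definition is_solution ::
    "real \<Rightarrow> real \<Rightarrow> real \<Rightarrow> real \<Rightarrow> (int \<Rightarrow> complex) \<Rightarrow> (real \<Rightarrow> int \<Rightarrow> complex) \<Rightarrow> bool" where
  "is_solution \<kappa> s b T f u \<longleftrightarrow> u \<in> YT b T f \<and>
     (\<exists>\<Phi>1 \<Phi>2 \<Phi>3. extends_free_free s b T \<Phi>1 \<and> extends_free_rest s b T \<Phi>2 \<and>
        extends_rest_rest b T \<Phi>3 \<and>
        (\<forall>t\<in>{-T..T}. \<forall>n. u t n = schroedinger t f n - \<i> * of_real \<kappa> *
           (\<Phi>1 f t n + \<Phi>2 f (remainder T f u) t n + \<Phi>3 (remainder T f u) t n)))"

end

theory Submission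
 imports Defs "HOL-Probability.Probability"
begin

text \<open>
 In the interaction picture an element of \<open>X\<^sup>0\<^sup>,\<^sup>b\<close> is a function on \<open>\<int> \<times> \<real>\<close> in a weighted \<open>L\<^sup>2\<close>, and the
 Duhamel integral of \<open>cnj u * cnj v\<close> is a bilinear form with the resonance function
 \<open>n\<^sup>2 + k\<^sup>2 + (n + k)\<^sup>2\<close>. As no interaction is resonant, one of the three modulations is as large as the squares
 of the frequencies, and Cauchy-Schwarz with a count of the lattice points near a level of the resonance
 function shows that two free evolutions with data in \<open>H\<^sup>s\<close>, \<open>s > -1/2\<close>, or one of them and a remainder,
 produce a term in \<open>X\<^sup>0\<^sup>,\<^sup>b\<close>. Localising the Duhamel kernel to \<open>[-T, T]\<close> gains a positive power of \<open>T\<close>, so the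
 remainder is the fixed point of a contraction. The difference of two remainders solves a homogeneous
 linear equation; it vanishes on a short interval around \<open>0\<close> and then, by translation in time, on one around
 every point of \<open>[-T, T]\<close>. The Duhamel terms are local in time, so they do not depend on the extensions
 chosen, and density of smooth data identifies them with every continuous extension.
\<close>

text \<open>The exponent -1/2 comes from one count. In \<open>Xsb 0 b\<close> the Duhamel term
  divides by the modulation \<open>y\<close> and carries the weight \<open>jbr y powr b\<close>;
  with \<open>\<theta>\<close> spent on the power of \<open>T\<close>, the squared interaction keeps
  the weight \<open>jbr y powr (- q)\<close>, \<open>q = 2 * (1 - b - \<theta>)\<close>.
  Non-resonance trades it for \<open>jbr (om n k) powr (- q)\<close>. Each data weight costs a
  factor \<open>jbr (om n k) powr (- s)\<close>, so two of them need \<open>- 2 * s \<le> q\<close>,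
  while \<open>1/2 < b\<close> leaves only \<open>q < 1\<close>.

  For \<open>s < 0\<close> the square of a free evolution is not a product of functions, so the
  bilinear term \<open>J\<close> is defined on the frequency side. It is identified with an integral
  over physical time for factors in \<open>wm 0 b\<close>; locality in time, visible there, reaches
  rough data by truncation in \<open>n\<close>. A second difficulty is that a remainder is given
  only on \<open>[-T, T]\<close>, with an infimum over extensions and cutoffs as norm. Hence
  estimates assert the existence of one small representative (\<open>lb\<close>), and equations are
  compared as curves.\<close>

abbreviation "ZZ \<equiv> count_space UNIV"
abbreviation "bor \<equiv> borel_measurable borel"
abbreviation "null f \<equiv> f \<longlonglongrightarrow> 0"
abbreviation "nnl f \<equiv> \<integral>\<^sup>+x. ennreal (f x) \<partial>(lborel :: real measure)"
abbreviation "nns f \<equiv> \<integral>\<^sup>+k. ennreal (f k) \<partial>ZZ"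

subsection \<open>The bracket\<close>

lemma jbr_ge1: "1 \<le> jbr x"
 by (simp add: jbr_def)

lemma jbr_pos [simp]: "0 < jbr x"
 using jbr_ge1[of x] by linarith

lemma jbr_nonneg [simp]: "0 \<le> jbr x" and jbr_neq0 [simp]: "jbr x \<noteq> 0"
 using jbr_pos[of x] by linarith+

lemma jbr_square: "(jbr x)\<^sup>2 = 1 + x\<^sup>2"
 by (simp add: jbr_def)

lemma jbr_minus [simp]: "jbr (- x) = jbr x"
 by (simp add: jbr_def)

lemma abs_le_jbr: "\<bar>x\<bar> \<le> jbr x"
 unfolding jbr_def by (rule real_le_rsqrt) simp

lemma jbr_powr_double: "jbr x powr (2 * a) = (1 + x\<^sup>2) powr a"
proof -
 have "jbr x powr (2 * a) = (jbr x powr 2) powr a"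
  by (simp only: powr_powr)
 also have "\<dots> = (jbr x)\<^sup>2 powr a"
  by simp
 finally show ?thesis by (simp only: jbr_square)
qed

lemma continuous_jbr [continuous_intros]:
 "continuous_on S f ==> continuous_on S (\<lambda>x. jbr (f x))"
 unfolding jbr_def by (intro continuous_intros)

lemma measurable_jbr [measurable]: "jbr \<in> bor"
 by (intro borel_measurable_continuous_onI continuous_intros)

lemma jbr_mono: "\<bar>x\<bar> \<le> \<bar>y\<bar> ==> jbr x \<le> jbr y"
 unfolding jbr_def using abs_le_square_iff by auto

lemma one_plus_square_add: "1 + (x + y)\<^sup>2 \<le> 2 * ((1 + x\<^sup>2) * (1 + (y::real)\<^sup>2))"
proof -
 have "0 \<le> (x - y)\<^sup>2 + 2 * (x * y)\<^sup>2" by simp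
 moreover have "(x - y)\<^sup>2 + 2 * (x * y)\<^sup>2 = 2 * ((1 + x\<^sup>2) * (1 + y\<^sup>2)) - (1 + (x + y)\<^sup>2) - 1"
  by (simp add: power2_eq_square algebra_simps)
 ultimately show ?thesis by linarith
qed

text \<open>Peetre's inequality: in this form weights are moved between the terms of a sum.\<close>

lemma jbr_add: "jbr (x + y) \<le> 2 * (jbr x * jbr y)"
proof -
 have "jbr (x + y) \<le> sqrt (2 * ((1 + x\<^sup>2) * (1 + y\<^sup>2)))"
  unfolding jbr_def by (rule real_sqrt_le_mono) (rule one_plus_square_add)
 also have "\<dots> = sqrt 2 * (jbr x * jbr y)"
  by (simp add: jbr_def real_sqrt_mult)
 also have "\<dots> \<le> 2 * (jbr x * jbr y)"
  by (intro mult_right_mono) (auto simp: sqrt2_less_2 less_imp_le)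
 finally show ?thesis .
qed

lemma jbr_add_powr:
 assumes "0 \<le> a"
 shows "jbr (x + y) powr a \<le> 2 powr a * (jbr x powr a * jbr y powr a)"
proof -
 have "jbr (x + y) powr a \<le> (2 * (jbr x * jbr y)) powr a"
  by (intro powr_mono2 jbr_add assms) auto
 then show ?thesis by (simp add: powr_mult)
qed

lemma jbr_powr_ge1: "0 \<le> a ==> 1 \<le> jbr x powr a"
 by (simp add: ge_one_powr_ge_zero jbr_ge1)

lemma jbr_powr_mono: "a \<le> b ==> jbr x powr a \<le> jbr x powr b"
 by (simp add: powr_mono jbr_ge1)

lemma nn_integral_symmetric_le:
 fixes f :: "real => ennreal"
 assumes [measurable]: "f \<in> bor" and even: "\<And>x. f (- x) = f x"
 shows "(\<integral>\<^sup>+x. f x \<partial>lborel) \<le> 2 * (\<integral>\<^sup>+x. f x * indicator {0..} x \<partial>lborel)"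
proof -
 have "(\<integral>\<^sup>+x. f x \<partial>lborel) \<le>
   (\<integral>\<^sup>+x. f x * indicator {0..} x + f x * indicator {..0} x \<partial>lborel)"
  by (intro nn_integral_mono) (auto split: split_indicator)
 also have "\<dots> = (\<integral>\<^sup>+x. f x * indicator {0..} x \<partial>lborel) + (\<integral>\<^sup>+x. f x * indicator {..0} x \<partial>lborel)"
  by (intro nn_integral_add) auto
 also have "(\<integral>\<^sup>+x. f x * indicator {..0} x \<partial>lborel) =
   (\<integral>\<^sup>+x. f (0 + (-1) * x) * indicator {..0} (0 + (-1) * x) \<partial>lborel)"
  by (subst nn_integral_real_affine[where c="-1" and t=0]) (auto intro: borel_measurable_times)
 also have "\<dots> = (\<integral>\<^sup>+x. f x * indicator {0..} x \<partial>lborel)"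
  by (intro nn_integral_cong) (auto simp: even split: split_indicator)
 finally show ?thesis by (simp add: mult_2)
qed

text \<open>On the half line the bracket is comparable to \<open>1 + x\<close>, whose powers have an
  elementary primitive; evenness supplies the other half.\<close>

lemma nn_integral_jbr_finite:
 assumes p: "1 < p"
 shows "nnl (\<lambda>x. jbr x powr (- p)) < \<infinity>"
proof -
 have le: "jbr x powr (- p) \<le> 2 powr p * (1 + x) powr (- p)" if "0 \<le> x" for x
 proof -
  have "1 + x \<le> 2 * jbr x"
   using jbr_ge1[of x] abs_le_jbr[of x] that by simp
  then have "(1 + x) powr p \<le> 2 powr p * jbr x powr p"
   using p that powr_mono2[of p "1 + x" "2 * jbr x"] by (simp add: powr_mult)
  moreover have "0 < (1 + x) powr p" "0 < jbr x powr p" using that by (auto simp: less_le)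
  ultimately show ?thesis by (simp add: powr_minus field_simps)
 qed
 have "(\<integral>\<^sup>+x. ennreal (jbr x powr (- p)) * indicator {0..} x \<partial>lborel) \<le>
   (\<integral>\<^sup>+x. ennreal (2 powr p * (1 + x) powr (- p)) * indicator {0..} x \<partial>lborel)"
  by (intro nn_integral_mono) (auto split: split_indicator intro!: ennreal_leI le)
 also have "\<dots> = ennreal (0 - (- (2 powr p / (p - 1)) * (1 + 0) powr (1 - p)))"
 proof (rule nn_integral_FTC_atLeast)
  show "((\<lambda>x. - (2 powr p / (p - 1)) * (1 + x) powr (1 - p)) has_real_derivative
    2 powr p * (1 + x) powr (- p)) (at x)" if "0 \<le> x" for x
  proof -
   have "((\<lambda>x. (1 + x) powr (1 - p)) has_real_derivative (1 - p) * (1 + x) powr (1 - p - 1)) (at x)"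
    using that by (intro DERIV_fun_powr[where g="\<lambda>x. 1 + x" and m=1, simplified]) (auto intro!: derivative_eq_intros)
   then have "((\<lambda>x. - (2 powr p / (p - 1)) * (1 + x) powr (1 - p)) has_real_derivative
     - (2 powr p / (p - 1)) * ((1 - p) * (1 + x) powr (1 - p - 1))) (at x)"
    by (rule DERIV_cmult)
   moreover have "- (2 powr p / (p - 1)) * ((1 - p) * (1 + x) powr (1 - p - 1)) = 2 powr p * (1 + x) powr (- p)"
    using p by (simp add: field_simps)
   ultimately show ?thesis by simp
  qed
  have "((\<lambda>x. (1 + x) powr (1 - p)) \<longlongrightarrow> 0) at_top"
   by (rule tendsto_neg_powr) (use p in \<open>auto intro: filterlim_tendsto_add_at_top tendsto_const filterlim_ident\<close>)
  then show "((\<lambda>x. - (2 powr p / (p - 1)) * (1 + x) powr (1 - p)) \<longlongrightarrow> 0) at_top"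
   by (rule tendsto_mult_right_zero)
 qed auto
 finally have "(\<integral>\<^sup>+x. ennreal (jbr x powr (- p)) * indicator {0..} x \<partial>lborel) < \<infinity>"
  by (auto simp: less_top[symmetric] top_unique)
 then have "2 * (\<integral>\<^sup>+x. ennreal (jbr x powr (- p)) * indicator {0..} x \<partial>lborel) < \<infinity>"
  by (simp add: ennreal_mult_less_top)
 moreover have "nnl (\<lambda>x. jbr x powr (- p)) \<le>
   2 * (\<integral>\<^sup>+x. ennreal (jbr x powr (- p)) * indicator {0..} x \<partial>lborel)"
  by (rule nn_integral_symmetric_le) auto
 ultimately show ?thesis by (rule le_less_trans[rotated])
qed

lemma integrable_jbr: "1 < p ==> integrable lborel (\<lambda>x. jbr x powr (- p))"
 by (intro integrableI_nonneg nn_integral_jbr_finite) auto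

lemma measurable_count_space_prod [measurable (raw)]:
 fixes f :: "int \<times> real => 'b::topological_space"
 assumes "\<And>n. (\<lambda>x. f (n, x)) \<in> bor"
 shows "f \<in> borel_measurable (count_space UNIV \<Otimes>\<^sub>M lborel)"
 by (intro measurable_pair_measure_countable1) (use assms in auto)

interpretation P: pair_sigma_finite "count_space (UNIV :: int set)" "lborel :: real measure"
 unfolding pair_sigma_finite_def
 using sigma_finite_measure_count_space_countable[of "UNIV :: int set"]
  lborel.sigma_finite_measure_axioms by auto

lemma nn_integral_sum_swap:
 fixes f :: "int => real => ennreal"
 assumes "\<And>n. f n \<in> bor"
 shows "(\<integral>\<^sup>+n. \<integral>\<^sup>+x. f n x \<partial>lborel \<partial>ZZ) = (\<integral>\<^sup>+x. \<integral>\<^sup>+n. f n x \<partial>ZZ \<partial>lborel)"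
 by (rule P.Fubini'[symmetric]) (auto intro!: measurable_count_space_prod assms)

text \<open>The bound is uniform in the shift \<open>a\<close>. On the unit interval to the right of
  \<open>k\<close> the bracket grows by a factor of at most 4, so each term is dominated by an
  integral over that interval, and these intervals tile the line.\<close>

lemma sum_jbr_shift_le:
 assumes "0 \<le> p"
 shows "nns (\<lambda>k. jbr (of_int k + a) powr (- p))
   \<le> ennreal (4 powr p) * nnl (\<lambda>x. jbr x powr (- p))"
proof -
 have le: "jbr (of_int k + a) powr (- p) \<le> 4 powr p * jbr (x + a) powr (- p)"
  if "x \<in> {of_int k..<of_int k + 1}" for k x
 proof -
  have "jbr (x + a) \<le> 2 * (jbr (of_int k + a) * jbr (x - of_int k))"
   using jbr_add[of "of_int k + a" "x - of_int k"] by (simp add: algebra_simps)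
  also have "jbr (x - of_int k) \<le> sqrt 4"
   unfolding jbr_def using that power2_le_imp_le
   by (intro real_sqrt_le_mono) (smt (verit) atLeastLessThan_iff power_le_one)
  finally have "jbr (x + a) \<le> 4 * jbr (of_int k + a)" by simp
  then have "jbr (x + a) powr p \<le> 4 powr p * jbr (of_int k + a) powr p"
   using assms powr_mono2[of p "jbr (x + a)" "4 * jbr (of_int k + a)"] by (simp add: powr_mult)
  moreover have "0 < jbr (x + a) powr p" "0 < jbr (of_int k + a) powr p" by (auto simp: less_le)
  ultimately show ?thesis by (simp add: powr_minus field_simps)
 qed
 have "nns (\<lambda>k. jbr (of_int k + a) powr (- p)) =
   (\<integral>\<^sup>+k. \<integral>\<^sup>+x. ennreal (jbr (of_int k + a) powr (- p)) * indicator {real_of_int k..<of_int k + 1} x \<partial>lborel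
    \<partial>ZZ)"
  by (intro nn_integral_cong) (subst nn_integral_cmult_indicator, auto)
 also have "\<dots> \<le> (\<integral>\<^sup>+k. \<integral>\<^sup>+x. ennreal (4 powr p * jbr (x + a) powr (- p)) *
    indicator {real_of_int k..<of_int k + 1} x \<partial>lborel \<partial>ZZ)"
  by (intro nn_integral_mono) (auto split: split_indicator intro!: ennreal_leI le)
 also have "\<dots> = (\<integral>\<^sup>+x. \<integral>\<^sup>+k. ennreal (4 powr p * jbr (x + a) powr (- p)) *
    indicator {real_of_int k..<of_int k + 1} x \<partial>count_space (UNIV :: int set) \<partial>lborel)"
  by (intro nn_integral_sum_swap) auto
 also have "\<dots> = nnl (\<lambda>x. 4 powr p * jbr (x + a) powr (- p))"
 proof (intro nn_integral_cong)
  fix x :: real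
  have "(indicator {real_of_int k..<of_int k + 1} x :: ennreal) = indicator {\<lfloor>x\<rfloor>} k" for k
   by (auto split: split_indicator simp: floor_unique; linarith)
  then have "(\<integral>\<^sup>+k. ennreal (4 powr p * jbr (x + a) powr (- p)) *
    indicator {real_of_int k..<of_int k + 1} x \<partial>count_space (UNIV :: int set)) =
    ennreal (4 powr p * jbr (x + a) powr (- p)) *
     (\<integral>\<^sup>+k. indicator {\<lfloor>x\<rfloor>} k \<partial>count_space (UNIV :: int set))"
   by (simp add: nn_integral_cmult)
  then show "(\<integral>\<^sup>+k. ennreal (4 powr p * jbr (x + a) powr (- p)) *
    indicator {real_of_int k..<of_int k + 1} x \<partial>count_space (UNIV :: int set)) =
    ennreal (4 powr p * jbr (x + a) powr (- p))"
   by simp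
 qed
 also have "\<dots> = nnl (\<lambda>x. 4 powr p * jbr x powr (- p))"
  using nn_integral_real_affine[of "\<lambda>x. ennreal (4 powr p * jbr x powr (- p))" 1 a]
  by (simp add: add.commute)
 also have "\<dots> = ennreal (4 powr p) * nnl (\<lambda>x. jbr x powr (- p))"
  by (simp add: ennreal_mult nn_integral_cmult)
 finally show ?thesis .
qed

subsection \<open>Square integrable functions\<close>

definition sqi :: "'a measure => ('a => complex) => ennreal" where
 "sqi M f = (\<integral>\<^sup>+x. ennreal ((norm (f x))\<^sup>2) \<partial>M)"

definition L2 :: "'a measure => ('a => complex) set" where
 "L2 M = {f \<in> borel_measurable M. sqi M f < \<infinity>}"

definition l2 :: "'a measure => ('a => complex) => real" where
 "l2 M f = sqrt (enn2real (sqi M f))"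

lemma l2_nonneg [simp]: "0 \<le> l2 M f"
 by (simp add: l2_def)

lemma L2_measurable: "f \<in> L2 M ==> f \<in> borel_measurable M"
 by (simp add: L2_def)

lemma sqi_l2: "f \<in> L2 M ==> sqi M f = ennreal ((l2 M f)\<^sup>2)"
 by (simp add: L2_def l2_def)

lemma l2_leI:
 assumes "f \<in> borel_measurable M" "sqi M f \<le> ennreal (c\<^sup>2)" "0 \<le> c"
 shows "f \<in> L2 M" "l2 M f \<le> c"
proof -
 show "f \<in> L2 M"
  using assms by (auto simp: L2_def less_top[symmetric] top_unique)
 have "enn2real (sqi M f) \<le> c\<^sup>2"
  using assms(2) enn2real_leI by (metis zero_le_power2)
 then show "l2 M f \<le> c"
  unfolding l2_def using assms(3) real_le_lsqrt real_sqrt_le_iff by (metis real_sqrt_abs abs_of_nonneg)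
qed

lemma ennreal_square_le_imp_le:
 assumes "a\<^sup>2 \<le> b\<^sup>2" shows "a \<le> (b :: ennreal)"
proof (cases b)
 case (real y)
 then have "a \<noteq> top"
  using assms by (auto simp: power2_eq_square ennreal_mult[symmetric] top_unique)
 then obtain x where x: "a = ennreal x" "0 \<le> x"
  by (cases a) auto
 then have "x\<^sup>2 \<le> y\<^sup>2"
  using assms real by (simp add: ennreal_power)
 then have "x \<le> y"
  using real(1) by (rule power2_le_imp_le)
 then show ?thesis
  unfolding x(1) real(2) by (rule ennreal_leI)
qed simp

lemma sqi_mono_AE: "AE x in M. norm (f x) \<le> norm (g x) ==> sqi M f \<le> sqi M g"
 unfolding sqi_def by (intro nn_integral_mono_AE) (auto intro!: ennreal_leI power_mono elim!: eventually_mono)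

lemma L2_mono_AE:
 assumes "AE x in M. norm (f x) \<le> norm (g x)" "f \<in> borel_measurable M" "g \<in> L2 M"
 shows "f \<in> L2 M" "l2 M f \<le> l2 M g"
proof -
 have "sqi M f \<le> ennreal ((l2 M g)\<^sup>2)"
  using sqi_mono_AE[OF assms(1)] sqi_l2[OF assms(3)] by simp
 then show "f \<in> L2 M" "l2 M f \<le> l2 M g"
  using l2_leI[OF assms(2)] by auto
qed

lemma integrable_L2_mult:
 assumes "f \<in> L2 M" "g \<in> L2 M"
 shows "(\<integral>\<^sup>+x. ennreal (norm (f x * g x)) \<partial>M) \<le> ennreal (l2 M f * l2 M g)"
  and "integrable M (\<lambda>x. f x * g x)"
  and "(\<integral>x. norm (f x * g x) \<partial>M) \<le> l2 M f * l2 M g"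
proof -
 have [measurable]: "f \<in> borel_measurable M" "g \<in> borel_measurable M"
  using assms by (auto simp: L2_def)
 have "(\<integral>\<^sup>+x. ennreal (norm (f x)) * ennreal (norm (g x)) \<partial>M)\<^sup>2 \<le>
   (\<integral>\<^sup>+x. ennreal (norm (f x)) ^ 2 \<partial>M) * (\<integral>\<^sup>+x. ennreal (norm (g x)) ^ 2 \<partial>M)"
  by (rule Cauchy_Schwarz_nn_integral) auto
 also have "\<dots> = ennreal ((l2 M f * l2 M g)\<^sup>2)"
  using assms[THEN sqi_l2] by (simp add: sqi_def ennreal_power power_mult_distrib ennreal_mult)
 also have "\<dots> = (ennreal (l2 M f * l2 M g))\<^sup>2"
  by (simp add: ennreal_power)
 finally have "(\<integral>\<^sup>+x. ennreal (norm (f x * g x)) \<partial>M)\<^sup>2 \<le> (ennreal (l2 M f * l2 M g))\<^sup>2"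
  by (simp add: norm_mult ennreal_mult)
 then show le: "(\<integral>\<^sup>+x. ennreal (norm (f x * g x)) \<partial>M) \<le> ennreal (l2 M f * l2 M g)"
  by (rule ennreal_square_le_imp_le)
 then show "integrable M (\<lambda>x. f x * g x)"
  by (intro integrableI_bounded) (auto simp: less_top[symmetric] top_unique)
 then show "(\<integral>x. norm (f x * g x) \<partial>M) \<le> l2 M f * l2 M g"
  using le by (subst integral_eq_nn_integral) (auto intro!: enn2real_leI)
qed

lemma L2_add:
 assumes "f \<in> L2 M" "g \<in> L2 M"
 shows "(\<lambda>x. f x + g x) \<in> L2 M" "l2 M (\<lambda>x. f x + g x) \<le> l2 M f + l2 M g"
proof -
 have [measurable]: "f \<in> borel_measurable M" "g \<in> borel_measurable M"
  using assms by (auto simp: L2_def)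
 have pt: "ennreal ((norm (f x + g x))\<^sup>2) \<le>
   ennreal ((norm (f x))\<^sup>2) + (2 * ennreal (norm (f x * g x)) + ennreal ((norm (g x))\<^sup>2))" for x
 proof -
  have "(norm (f x + g x))\<^sup>2 \<le> (norm (f x) + norm (g x))\<^sup>2"
   by (intro power_mono norm_triangle_ineq) auto
  also have "\<dots> = (norm (f x))\<^sup>2 + (2 * norm (f x * g x) + (norm (g x))\<^sup>2)"
   by (simp add: power2_sum norm_mult)
  finally have "ennreal ((norm (f x + g x))\<^sup>2) \<le> ennreal ((norm (f x))\<^sup>2 + (2 * norm (f x * g x) + (norm (g x))\<^sup>2))"
   by (rule ennreal_leI)
  then show ?thesis by (simp add: ennreal_plus ennreal_mult)
 qed
 have "sqi M (\<lambda>x. f x + g x) \<le> (\<integral>\<^sup>+x. ennreal ((norm (f x))\<^sup>2) +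
   (2 * ennreal (norm (f x * g x)) + ennreal ((norm (g x))\<^sup>2)) \<partial>M)"
  unfolding sqi_def by (intro nn_integral_mono pt)
 also have "\<dots> = sqi M f + (2 * (\<integral>\<^sup>+x. ennreal (norm (f x * g x)) \<partial>M) + sqi M g)"
  by (simp add: sqi_def nn_integral_add nn_integral_cmult)
 also have "\<dots> \<le> ennreal ((l2 M f)\<^sup>2) + (2 * ennreal (l2 M f * l2 M g) + ennreal ((l2 M g)\<^sup>2))"
  using integrable_L2_mult(1)[OF assms] by (simp add: sqi_l2 assms add_mono mult_left_mono)
 also have "\<dots> = ennreal ((l2 M f)\<^sup>2) + (ennreal (2 * (l2 M f * l2 M g)) + ennreal ((l2 M g)\<^sup>2))"
  by (subst ennreal_mult) auto
 also have "\<dots> = ennreal ((l2 M f)\<^sup>2 + (2 * (l2 M f * l2 M g) + (l2 M g)\<^sup>2))"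
  by (subst ennreal_plus[symmetric], simp, simp)+ simp
 also have "\<dots> = ennreal ((l2 M f + l2 M g)\<^sup>2)"
  by (simp add: power2_sum)
 finally show "(\<lambda>x. f x + g x) \<in> L2 M" "l2 M (\<lambda>x. f x + g x) \<le> l2 M f + l2 M g"
  by (rule l2_leI[rotated]; simp)+
qed

lemma L2_cmult:
 assumes "f \<in> L2 M"
 shows "(\<lambda>x. c * f x) \<in> L2 M" "l2 M (\<lambda>x. c * f x) = norm c * l2 M f"
proof -
 have [measurable]: "f \<in> borel_measurable M"
  using assms by (auto simp: L2_def)
 have "sqi M (\<lambda>x. c * f x) = ennreal ((norm c)\<^sup>2) * sqi M f"
  unfolding sqi_def by (subst nn_integral_cmult[symmetric])
   (auto simp: norm_mult power_mult_distrib ennreal_mult)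
 also have "\<dots> = ennreal ((norm c * l2 M f)\<^sup>2)"
  by (simp add: sqi_l2[OF assms] power_mult_distrib ennreal_mult)
 finally have eq: "sqi M (\<lambda>x. c * f x) = ennreal ((norm c * l2 M f)\<^sup>2)" .
 then show "(\<lambda>x. c * f x) \<in> L2 M"
  by (intro l2_leI(1)[where c="norm c * l2 M f"]) auto
 show "l2 M (\<lambda>x. c * f x) = norm c * l2 M f"
  by (simp add: l2_def[of M "\<lambda>x. c * f x"] eq)
qed

lemma L2_diff:
 assumes "f \<in> L2 M" "g \<in> L2 M"
 shows "(\<lambda>x. f x - g x) \<in> L2 M" "l2 M (\<lambda>x. f x - g x) \<le> l2 M f + l2 M g"
 using L2_add[OF assms(1) L2_cmult(1)[OF assms(2), of "-1"]] L2_cmult(2)[OF assms(2), of "-1"] by auto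

lemma L2_zero [simp]: "(\<lambda>x. 0) \<in> L2 M" "l2 M (\<lambda>x. 0) = 0"
 by (auto simp: L2_def l2_def sqi_def)

lemma l2_diff_commute: "l2 M (\<lambda>x. f x - g x) = l2 M (\<lambda>x. g x - f x)"
 by (simp add: l2_def sqi_def norm_minus_commute)

lemma l2_diff_ge:
 assumes "f \<in> L2 M" "g \<in> L2 M"
 shows "\<bar>l2 M f - l2 M g\<bar> \<le> l2 M (\<lambda>x. f x - g x)"
 using L2_add(2)[OF L2_diff(1)[OF assms] assms(2)] L2_add(2)[OF L2_diff(1)[OF assms(2,1)] assms(1)]
 by (simp add: l2_diff_commute[of M g f])

lemma l2_tendsto:
 assumes "\<And>k. f k \<in> L2 M" "g \<in> L2 M" "null (\<lambda>k. l2 M (\<lambda>x. f k x - g x))"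
 shows "(\<lambda>k. l2 M (f k)) \<longlonglongrightarrow> l2 M g"
proof -
 have "null (\<lambda>k. l2 M (f k) - l2 M g)"
  by (rule Lim_null_comparison[OF _ assms(3)]) (auto intro!: always_eventually l2_diff_ge assms)
 then show ?thesis by (simp add: LIM_zero_iff)
qed

lemma l2_eq_0_AE:
 assumes "f \<in> L2 M" "l2 M f = 0"
 shows "AE x in M. f x = 0"
proof -
 have [measurable]: "f \<in> borel_measurable M"
  using assms by (auto simp: L2_def)
 have "sqi M f = 0"
  using sqi_l2[OF assms(1)] assms(2) by simp
 then have "AE x in M. ennreal ((norm (f x))\<^sup>2) = 0"
  unfolding sqi_def by (subst (asm) nn_integral_0_iff_AE) auto
 then show ?thesis by (auto elim!: eventually_mono simp: ennreal_eq_0_iff)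
qed

lemma L2_dominated_convergence:
 assumes "\<And>k. f k \<in> borel_measurable M" "g \<in> borel_measurable M" "w \<in> L2 M"
  and "AE x in M. (\<lambda>k. f k x) \<longlonglongrightarrow> g x" "\<And>k. AE x in M. norm (f k x) \<le> norm (w x)"
 shows "g \<in> L2 M" "null (\<lambda>k. l2 M (\<lambda>x. f k x - g x))"
proof -
 have [measurable]: "\<And>k. f k \<in> borel_measurable M" "g \<in> borel_measurable M" "w \<in> borel_measurable M"
  using assms by (auto simp: L2_def)
 have "AE x in M. \<forall>k. norm (f k x) \<le> norm (w x)"
  using assms(5) by (simp add: AE_all_countable)
 with assms(4) have le: "AE x in M. norm (g x) \<le> norm (w x)"
  by eventually_elim (auto intro: LIMSEQ_le_const2[OF tendsto_norm])
 then show g: "g \<in> L2 M"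
  by (rule L2_mono_AE) (use assms in auto)
 have "(\<lambda>k. sqi M (\<lambda>x. f k x - g x)) \<longlonglongrightarrow> (\<integral>\<^sup>+x. 0 \<partial>M)"
  unfolding sqi_def
 proof (rule nn_integral_dominated_convergence[where w="\<lambda>x. ennreal ((2 * norm (w x))\<^sup>2)"])
  show "AE x in M. ennreal ((norm (f k x - g x))\<^sup>2) \<le> ennreal ((2 * norm (w x))\<^sup>2)" for k
   using assms(5)[of k] le
  proof eventually_elim
   case (elim x)
   then have "norm (f k x - g x) \<le> 2 * norm (w x)"
    using norm_triangle_ineq4[of "f k x" "g x"] by linarith
   then show ?case by (intro ennreal_leI power_mono) auto
  qed
  show "AE x in M. (\<lambda>k. ennreal ((norm (f k x - g x))\<^sup>2)) \<longlonglongrightarrow> 0"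
   using assms(4)
  proof eventually_elim
   case (elim x)
   then have "(\<lambda>k. ennreal ((norm (f k x - g x))\<^sup>2)) \<longlonglongrightarrow> ennreal ((norm (g x - g x))\<^sup>2)"
    by (intro tendsto_intros)
   then show ?case by simp
  qed
  show "(\<integral>\<^sup>+x. ennreal ((2 * norm (w x))\<^sup>2) \<partial>M) < \<infinity>"
   using L2_cmult(1)[OF assms(3), of 2] by (simp add: L2_def sqi_def norm_mult)
 qed auto
 then have "(\<lambda>k. enn2real (sqi M (\<lambda>x. f k x - g x))) \<longlonglongrightarrow> enn2real 0"
  by (intro tendsto_enn2real) auto
 then have "(\<lambda>k. sqrt (enn2real (sqi M (\<lambda>x. f k x - g x)))) \<longlonglongrightarrow> sqrt 0"
  by (intro tendsto_real_sqrt) simp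
 then show "null (\<lambda>k. l2 M (\<lambda>x. f k x - g x))"
  by (simp add: l2_def)
qed

text \<open>Since \<open>d j \<le> (1/2) ^ j + 2 ^ j * (d j)\<^sup>2\<close>, square sums with a
  growing weight control plain sums. This turns integrals of squared increments into pointwise
  convergence of a subsequence.\<close>

lemma summable_of_weighted_squares:
 fixes d :: "nat => real"
 assumes "\<And>j. 0 \<le> d j" "(\<Sum>j. ennreal (2 ^ j * (d j)\<^sup>2)) < \<infinity>"
 shows "summable d"
proof -
 have s: "summable (\<lambda>j. 2 ^ j * (d j)\<^sup>2)"
  using assms(2) by (intro summable_suminf_not_top) (auto simp: less_top)
 have "summable (\<lambda>j. (1/2) ^ j + 2 ^ j * (d j)\<^sup>2)"
  by (intro summable_add s) (auto intro: summable_geometric)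
 moreover have "norm (d j) \<le> (1/2) ^ j + 2 ^ j * (d j)\<^sup>2" for j
 proof -
  have "0 \<le> (2 ^ j * d j - 1)\<^sup>2 + 2 ^ j * d j" using assms(1)[of j] by simp
  then have "2 ^ j * d j \<le> 1 + (2 ^ j)\<^sup>2 * (d j)\<^sup>2"
   by (simp add: power2_eq_square algebra_simps)
  then have "2 ^ j * d j \<le> 2 ^ j * ((1/2) ^ j + 2 ^ j * (d j)\<^sup>2)"
   by (simp add: power_divide power2_eq_square algebra_simps)
  then show ?thesis using assms(1)[of j] by (simp add: mult_le_cancel_left)
 qed
 ultimately show ?thesis by (intro summable_comparison_test[of d]) auto
qed

text \<open>Riesz-Fischer. A subsequence with increments of norm at most \<open>(1/2) ^ j\<close>
  converges almost everywhere, and Fatou's lemma bounds the distance of the whole sequence to its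
  limit.\<close>

lemma L2_complete:
 assumes f: "\<And>k. f k \<in> L2 M"
  and Cauchy: "\<And>e. 0 < e ==> \<exists>K. \<forall>k\<ge>K. \<forall>m\<ge>K. l2 M (\<lambda>x. f k x - f m x) < e"
 obtains g where "g \<in> L2 M" "null (\<lambda>k. l2 M (\<lambda>x. f k x - g x))"
proof -
 have [measurable]: "f k \<in> borel_measurable M" for k
  using f by (auto simp: L2_def)
 have "\<exists>K. \<forall>k\<ge>K. \<forall>m\<ge>K. l2 M (\<lambda>x. f k x - f m x) < (1/2) ^ j" for j
  by (rule Cauchy) simp
 then obtain K where K: "\<And>j k m. K j \<le> k ==> K j \<le> m ==> l2 M (\<lambda>x. f k x - f m x) < (1/2) ^ j"
  by metis
 \<comment> \<open>Partial sums make \<open>r j\<close> dominate all of \<open>K 0\<close>, ...,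
   \<open>K j\<close>: consecutive indices are both beyond \<open>K j\<close>, and every late index
   is beyond a fixed \<open>K i\<close>.\<close>
 define r where "r j = (\<Sum>i\<le>j. K i)" for j
 have r: "K j \<le> r j" "K j \<le> r (Suc j)" for j
  by (auto simp: r_def intro: member_le_sum trans_le_add1)
 have "(\<integral>\<^sup>+x. (\<Sum>j. ennreal (2 ^ j * (norm (f (r (Suc j)) x - f (r j) x))\<^sup>2)) \<partial>M) =
   (\<Sum>j. (\<integral>\<^sup>+x. ennreal (2 ^ j * (norm (f (r (Suc j)) x - f (r j) x))\<^sup>2) \<partial>M))"
  by (intro nn_integral_suminf) auto
 also have "\<dots> = (\<Sum>j. ennreal (2 ^ j) * sqi M (\<lambda>x. f (r (Suc j)) x - f (r j) x))"
  by (simp add: sqi_def nn_integral_cmult ennreal_mult)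
 also have "\<dots> \<le> (\<Sum>j. ennreal ((1/2) ^ j))"
 proof (intro suminf_le)
  fix j
  have "sqi M (\<lambda>x. f (r (Suc j)) x - f (r j) x) \<le> ennreal (((1/2) ^ j)\<^sup>2)"
   unfolding sqi_l2[OF L2_diff(1)[OF f f]] using K[OF r(2,1)]
   by (intro ennreal_leI power_mono) (auto intro: less_imp_le)
  then have "ennreal (2 ^ j) * sqi M (\<lambda>x. f (r (Suc j)) x - f (r j) x) \<le> ennreal (2 ^ j) * ennreal (((1/2) ^ j)\<^sup>2)"
   by (intro mult_left_mono) auto
  also have "\<dots> = ennreal (2 ^ j * ((1/2) ^ j)\<^sup>2)" by (simp add: ennreal_mult)
  also have "(2::real) ^ j * ((1/2) ^ j)\<^sup>2 = (1/2) ^ j" by (simp add: power2_eq_square power_divide)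
  finally show "ennreal (2 ^ j) * sqi M (\<lambda>x. f (r (Suc j)) x - f (r j) x) \<le> ennreal ((1/2) ^ j)" .
 qed auto
 also have "\<dots> < \<infinity>"
  by (subst suminf_ennreal2) (simp_all add: summable_geometric)
 finally have fin: "(\<integral>\<^sup>+x. (\<Sum>j. ennreal (2 ^ j * (norm (f (r (Suc j)) x - f (r j) x))\<^sup>2)) \<partial>M) < \<infinity>" .
 have "AE x in M. (\<Sum>j. ennreal (2 ^ j * (norm (f (r (Suc j)) x - f (r j) x))\<^sup>2)) \<noteq> \<infinity>"
  by (rule nn_integral_noteq_infinite) (measurable, use fin in \<open>simp add: less_top\<close>)
 then have conv: "AE x in M. convergent (\<lambda>j. f (r j) x)"
 proof eventually_elim
  case (elim x)
  then have "summable (\<lambda>j. norm (f (r (Suc j)) x - f (r j) x))"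
   by (intro summable_of_weighted_squares) (auto simp: less_top)
  then have "summable (\<lambda>j. f (r (Suc j)) x - f (r j) x)"
   by (rule summable_norm_cancel)
  then have "(\<lambda>n. (\<Sum>j<n. f (r (Suc j)) x - f (r j) x)) \<longlonglongrightarrow> (\<Sum>j. f (r (Suc j)) x - f (r j) x)"
   by (rule summable_LIMSEQ)
  then have "(\<lambda>n. f (r n) x - f (r 0) x + f (r 0) x) \<longlonglongrightarrow> (\<Sum>j. f (r (Suc j)) x - f (r j) x) + f (r 0) x"
   by (intro tendsto_intros) (simp add: sum_lessThan_telescope[of "\<lambda>j. f (r j) x"])
  then show ?case by (auto simp: convergent_def)
 qed
 define g where "g x = lim (\<lambda>j. f (r j) x)" for x
 have [measurable]: "g \<in> borel_measurable M"
  unfolding g_def by measurable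
 have lim: "AE x in M. (\<lambda>j. f (r j) x) \<longlonglongrightarrow> g x"
  using conv by eventually_elim (simp add: g_def convergent_LIMSEQ_iff)
 have bound: "l2 M (\<lambda>x. f k x - g x) \<le> (1/2) ^ i \<and> (\<lambda>x. f k x - g x) \<in> L2 M" if "K i \<le> k" for i k
 proof -
  have "sqi M (\<lambda>x. f k x - g x) = (\<integral>\<^sup>+x. liminf (\<lambda>j. ennreal ((norm (f k x - f (r j) x))\<^sup>2)) \<partial>M)"
   unfolding sqi_def
  proof (intro nn_integral_cong_AE, use lim in eventually_elim)
   case (elim x)
   then have "(\<lambda>j. ennreal ((norm (f k x - f (r j) x))\<^sup>2)) \<longlonglongrightarrow> ennreal ((norm (f k x - g x))\<^sup>2)"
    by (intro tendsto_intros)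
   from lim_imp_Liminf[OF _ this] show ?case by simp
  qed
  also have "\<dots> \<le> liminf (\<lambda>j. (\<integral>\<^sup>+x. ennreal ((norm (f k x - f (r j) x))\<^sup>2) \<partial>M))"
   by (rule nn_integral_liminf) auto
  also have "\<dots> \<le> ennreal (((1/2) ^ i)\<^sup>2)"
  proof (rule Liminf_le)
   show "\<forall>\<^sub>F j in sequentially. (\<integral>\<^sup>+x. ennreal ((norm (f k x - f (r j) x))\<^sup>2) \<partial>M) \<le> ennreal (((1/2) ^ i)\<^sup>2)"
    using eventually_ge_at_top[of i]
   proof eventually_elim
    case (elim j)
    have "K i \<le> r j"
     unfolding r_def using elim by (intro member_le_sum) auto
    then have "l2 M (\<lambda>x. f k x - f (r j) x) < (1/2) ^ i"
     using that K by blast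
    then have "ennreal ((l2 M (\<lambda>x. f k x - f (r j) x))\<^sup>2) \<le> ennreal (((1/2) ^ i)\<^sup>2)"
     by (intro ennreal_leI power_mono) auto
    then show ?case
     using sqi_l2[OF L2_diff(1)[OF f f], of k "r j"] by (simp add: sqi_def)
   qed
  qed simp
  finally have le: "sqi M (\<lambda>x. f k x - g x) \<le> ennreal (((1/2) ^ i)\<^sup>2)" .
  show ?thesis
   using l2_leI[OF _ le] by simp
 qed
 have "(\<lambda>x. f (K 0) x - (f (K 0) x - g x)) \<in> L2 M"
  by (rule L2_diff(1)) (use f bound in auto)
 then have g: "g \<in> L2 M" by simp
 moreover have "null (\<lambda>k. l2 M (\<lambda>x. f k x - g x))"
 proof (rule LIMSEQ_I)
  fix e :: real assume "0 < e"
  then obtain i where "(1/2) ^ i < e" using real_arch_pow_inv[of e "1/2"] by auto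
  then show "\<exists>k0. \<forall>k\<ge>k0. norm (l2 M (\<lambda>x. f k x - g x) - 0) < e"
   using bound[of i] by (intro exI[of _ "K i"]) (auto intro: le_less_trans)
 qed
 ultimately show ?thesis by (rule that)
qed

subsection \<open>Smooth functions on the line\<close>

text \<open>One notion for Schwartz functions, for functions of polynomial growth together with all
  their derivatives, and for smooth periodic functions: they differ only in
  \<open>Q\<close>.\<close>

definition jet :: "((real => complex) => bool) => (real => complex) => bool" where
 "jet Q f \<longleftrightarrow> (\<exists>D. D 0 = f \<and>
   (\<forall>j t. (D j has_vector_derivative D (Suc j) t) (at t)) \<and> (\<forall>j. Q (D j)))"

text \<open>Smoothness by coinduction: it is enough to exhibit a class closed under differentiation,
  so that no formula for higher derivatives has to be written down.\<close>

lemma jet_coinduct: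
 assumes "f \<in> S"
  and "\<And>g. g \<in> S ==> Q g \<and> (\<exists>g'\<in>S. \<forall>t. (g has_vector_derivative g' t) (at t))"
 shows "jet Q f"
proof -
 obtain nxt where nxt: "\<And>g. g \<in> S ==> nxt g \<in> S"
   "\<And>g t. g \<in> S ==> (g has_vector_derivative nxt g t) (at t)"
  using assms(2) by metis
 define D where "D j = (nxt ^^ j) f" for j
 have "D j \<in> S" for j
  by (induction j) (auto simp: D_def assms(1) nxt)
 then show ?thesis
  unfolding jet_def using nxt assms(2)
  by (intro exI[of _ D]) (auto simp: D_def)
qed

lemma jet_deriv:
 assumes "jet Q f"
 obtains f' where "jet Q f'" "\<And>t. (f has_vector_derivative f' t) (at t)"
proof -
 obtain D where D: "D 0 = f" "\<And>j t. (D j has_vector_derivative D (Suc j) t) (at t)" "\<And>j. Q (D j)"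
  using assms unfolding jet_def by blast
 have "jet Q (D 1)"
  unfolding jet_def by (intro exI[of _ "\<lambda>j. D (Suc j)"]) (use D in auto)
 moreover have "(f has_vector_derivative D 1 t) (at t)" for t
  using D(2)[of 0 t] D(1) by simp
 ultimately show ?thesis by (rule that)
qed

lemma jet_imp: "jet Q f ==> Q f"
 unfolding jet_def by metis

lemma jet_continuous: "jet Q f ==> continuous_on S f"
 by (meson jet_deriv continuous_at_imp_continuous_on has_vector_derivative_continuous)

definition rapid :: "(real => complex) => bool" where
 "rapid f \<longleftrightarrow> (\<forall>k. \<exists>C. \<forall>t. \<bar>t\<bar> ^ k * norm (f t) \<le> C)"

definition slow :: "(real => complex) => bool" where
 "slow f \<longleftrightarrow> (\<exists>C k. \<forall>t. norm (f t) \<le> C * (1 + \<bar>t\<bar>) ^ k)"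

lemma schwartz_eq: "schwartz = Collect (jet rapid)"
 unfolding schwartz_def jet_def rapid_def by auto

lemma slowI: "(\<And>t. norm (f t) \<le> C * (1 + \<bar>t\<bar>) ^ k) ==> slow f"
 unfolding slow_def by auto

lemma slowE:
 assumes "slow f"
 obtains C k where "0 \<le> C" "\<And>t. norm (f t) \<le> C * (1 + \<bar>t\<bar>) ^ k"
proof -
 obtain C k where C: "\<And>t. norm (f t) \<le> C * (1 + \<bar>t\<bar>) ^ k"
  using assms unfolding slow_def by auto
 then have "0 \<le> C" using norm_ge_zero[of "f 0"] order_trans by (metis C abs_zero add.right_neutral mult.right_neutral power_one)
 then show ?thesis using C that by blast
qed

lemma slow_add:
 assumes "slow f" "slow g" shows "slow (\<lambda>t. f t + g t)"
proof -
 obtain C k where C: "0 \<le> C" "\<And>t. norm (f t) \<le> C * (1 + \<bar>t\<bar>) ^ k" using assms(1) by (rule slowE) auto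
 obtain B l where B: "0 \<le> B" "\<And>t. norm (g t) \<le> B * (1 + \<bar>t\<bar>) ^ l" using assms(2) by (rule slowE) auto
 show ?thesis
 proof (rule slowI)
  fix t
  have "norm (f t + g t) \<le> C * (1 + \<bar>t\<bar>) ^ k + B * (1 + \<bar>t\<bar>) ^ l"
   using C(2)[of t] B(2)[of t] norm_triangle_le by (smt (verit))
  also have "\<dots> \<le> C * (1 + \<bar>t\<bar>) ^ (k + l) + B * (1 + \<bar>t\<bar>) ^ (k + l)"
   using C(1) B(1) by (intro add_mono mult_left_mono power_increasing) auto
  finally show "norm (f t + g t) \<le> (C + B) * (1 + \<bar>t\<bar>) ^ (k + l)" by (simp add: algebra_simps)
 qed
qed

lemma slow_mult:
 assumes "slow f" "slow g" shows "slow (\<lambda>t. f t * g t)"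
proof -
 obtain C k where C: "0 \<le> C" "\<And>t. norm (f t) \<le> C * (1 + \<bar>t\<bar>) ^ k" using assms(1) by (rule slowE) auto
 obtain B l where B: "0 \<le> B" "\<And>t. norm (g t) \<le> B * (1 + \<bar>t\<bar>) ^ l" using assms(2) by (rule slowE) auto
 show ?thesis
 proof (rule slowI)
  fix t
  have "norm (f t * g t) \<le> (C * (1 + \<bar>t\<bar>) ^ k) * (B * (1 + \<bar>t\<bar>) ^ l)"
   unfolding norm_mult using C B by (intro mult_mono) auto
  then show "norm (f t * g t) \<le> (C * B) * (1 + \<bar>t\<bar>) ^ (k + l)"
   by (simp add: power_add algebra_simps)
 qed
qed

lemma slow_const: "slow (\<lambda>t. c)"
 by (rule slowI[of _ "norm c" 0]) simp

lemma jet_slow_add: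
 assumes "jet slow f" "jet slow g" shows "jet slow (\<lambda>t. f t + g t)"
proof (rule jet_coinduct[where S="{\<lambda>t. f t + g t | f g. jet slow f \<and> jet slow g}"])
 fix h assume "h \<in> {\<lambda>t. f t + g t | f g. jet slow f \<and> jet slow g}"
 then obtain f g where fg: "h = (\<lambda>t. f t + g t)" "jet slow f" "jet slow g" by auto
 obtain f' where f': "jet slow f'" "\<And>t. (f has_vector_derivative f' t) (at t)"
  using fg(2) by (rule jet_deriv) auto
 obtain g' where g': "jet slow g'" "\<And>t. (g has_vector_derivative g' t) (at t)"
  using fg(3) by (rule jet_deriv) auto
 show "slow h \<and> (\<exists>h'\<in>{\<lambda>t. f t + g t | f g. jet slow f \<and> jet slow g}. \<forall>t. (h has_vector_derivative h' t) (at t))"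
  unfolding fg(1) using f' g' jet_imp[OF fg(2)] jet_imp[OF fg(3)]
  by (intro conjI slow_add bexI[of _ "\<lambda>t. f' t + g' t"])
   (auto intro!: has_vector_derivative_add)
qed (use assms in auto)

text \<open>By the Leibniz rule products of two functions are not closed under differentiation; sums
  of such products are.\<close>

inductive_set slow_products :: "(real => complex) set" where
 prod: "jet slow f ==> jet slow g ==> (\<lambda>t. f t * g t) \<in> slow_products"
| add: "f \<in> slow_products ==> g \<in> slow_products ==> (\<lambda>t. f t + g t) \<in> slow_products"

lemma jet_slow_mult:
 assumes "jet slow f" "jet slow g" shows "jet slow (\<lambda>t. f t * g t)"
proof (rule jet_coinduct[where S=slow_products])
 fix h assume "h \<in> slow_products"
 then show "slow h \<and> (\<exists>h'\<in>slow_products. \<forall>t. (h has_vector_derivative h' t) (at t))"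
 proof induction
  case (prod f g)
  obtain f' where f': "jet slow f'" "\<And>t. (f has_vector_derivative f' t) (at t)"
   using prod(1) by (rule jet_deriv) auto
  obtain g' where g': "jet slow g'" "\<And>t. (g has_vector_derivative g' t) (at t)"
   using prod(2) by (rule jet_deriv) auto
  show ?case
   using f' g' prod jet_imp[OF prod(1)] jet_imp[OF prod(2)]
   by (intro conjI slow_mult bexI[of _ "\<lambda>t. f t * g' t + f' t * g t"])
    (auto intro!: has_vector_derivative_mult slow_products.intros)
 next
  case (add f g)
  then obtain f' g' where "f' \<in> slow_products" "\<And>t. (f has_vector_derivative f' t) (at t)"
   "g' \<in> slow_products" "\<And>t. (g has_vector_derivative g' t) (at t)" by blast
  then show ?case
   using add by (intro conjI slow_add bexI[of _ "\<lambda>t. f' t + g' t"])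
    (auto intro!: has_vector_derivative_add slow_products.intros)
 qed
qed (use assms in \<open>auto intro: slow_products.intros\<close>)

lemma jet_slow_const: "jet slow (\<lambda>t. c)"
 by (rule jet_coinduct[where S="range (\<lambda>c t. c)"])
  (auto intro!: slow_const exI[of _ 0] has_vector_derivative_const)

lemma jet_slow_ident: "jet slow of_real"
proof (rule jet_coinduct[where S="insert of_real (range (\<lambda>c t. c))"])
 fix g :: "real => complex" assume "g \<in> insert of_real (range (\<lambda>c t. c))"
 then consider "g = of_real" | c where "g = (\<lambda>t. c)" by auto
 then show "slow g \<and> (\<exists>g'\<in>insert of_real (range (\<lambda>c t. c)). \<forall>t. (g has_vector_derivative g' t) (at t))"
 proof cases
  case 1
  have "slow of_real" by (rule slowI[of _ 1 1]) auto
  moreover have "(of_real has_vector_derivative (1::complex)) (at t)" for t :: real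
   by (rule has_vector_derivative_of_real[OF DERIV_ident, unfolded of_real_1])
  ultimately show ?thesis using 1 by auto
 next
  case 2
  then show ?thesis by (auto intro!: slow_const exI[of _ 0] has_vector_derivative_const)
 qed
qed simp

lemma jet_slow_minus: "jet slow f ==> jet slow (\<lambda>t. - f t)"
 using jet_slow_mult[OF jet_slow_const[of "-1"], of f] by simp

lemma power_mult_exp_bounded:
 fixes c :: real
 assumes "0 < c"
 obtains B where "0 \<le> B" "\<And>t. (1 + \<bar>t\<bar>) ^ K * exp (- (c * t\<^sup>2)) \<le> B"
proof -
 \<comment> \<open>\<open>m\<close> compensates a small \<open>c\<close>, and the exponent is raised
   to \<open>N > 0\<close> because the bound \<open>(1 + x / N) ^ N \<le> exp x\<close> divides by
   it.\<close>
 define m where "m = max 1 (1 / c)"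
 define N where "N = Suc K"
 have m: "1 \<le> m" "1 \<le> m * c" using assms by (auto simp: m_def max_def field_simps)
 have "(1 + \<bar>t\<bar>) ^ K * exp (- (c * t\<^sup>2)) \<le> (2 * m * real N) ^ N" for t
 proof -
  have "(1 + \<bar>t\<bar>) ^ K \<le> (1 + \<bar>t\<bar>) ^ N" by (simp add: N_def power_increasing)
  also have "\<dots> \<le> (2 * m * (1 + c * t\<^sup>2)) ^ N"
  proof (rule power_mono)
   have "1 + \<bar>t\<bar> \<le> 2 * (1 + t\<^sup>2)"
   proof -
    have "1 + a \<le> 2 * (1 + a\<^sup>2)" for a :: real
    proof -
     have "0 \<le> (a - 1)\<^sup>2 + 3 * a\<^sup>2 + 1" by simp
     then show ?thesis by (simp add: power2_eq_square algebra_simps)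
    qed
    from this[of "\<bar>t\<bar>"] show ?thesis by simp
   qed
   also have "\<dots> \<le> 2 * (m + m * c * t\<^sup>2)"
    using m mult_right_mono[of 1 "m * c" "t\<^sup>2"] by simp
   finally show "1 + \<bar>t\<bar> \<le> 2 * m * (1 + c * t\<^sup>2)" by (simp add: algebra_simps)
  qed simp
  also have "\<dots> \<le> (2 * m * real N * (1 + c * t\<^sup>2 / real N)) ^ N"
   using m assms by (intro power_mono) (auto simp: N_def field_simps)
  also have "\<dots> = (2 * m * real N) ^ N * (1 + c * t\<^sup>2 / real N) ^ N" by (simp add: power_mult_distrib)
  also have "\<dots> \<le> (2 * m * real N) ^ N * exp (c * t\<^sup>2)"
  proof (intro mult_left_mono exp_ge_one_plus_x_over_n_power_n)
   have "0 \<le> c * t\<^sup>2" using assms by simp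
   then show "- real N \<le> c * t\<^sup>2" by (simp add: N_def)
  qed (use m in \<open>auto simp: N_def\<close>)
  finally show ?thesis by (simp add: exp_minus field_simps)
 qed
 moreover have "0 \<le> (2 * m * real N) ^ N" using m by simp
 ultimately show ?thesis using that by blast
qed

text \<open>The functions \<open>G * exp (- w)\<close> with \<open>G\<close> of slow growth form a
  class closed under differentiation, \<open>G\<close> being replaced by \<open>G' - G * w'\<close>.
  Both the cutoff \<open>bump\<close> and the approximants in \<open>approx_schwartz\<close> are of
  this form.\<close>

lemma schwartz_gaussian_type:
 assumes G: "jet slow G" and w: "jet slow w"
  and c: "0 < c" "\<And>t. norm (exp (- w t)) \<le> C * exp (- (c * t\<^sup>2))"
 shows "(\<lambda>t. G t * exp (- w t)) \<in> schwartz"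
 unfolding schwartz_eq mem_Collect_eq
proof (rule jet_coinduct[where S="{\<lambda>t. G t * exp (- w t) | G. jet slow G}"])
 obtain w' where w': "jet slow w'" "\<And>t. (w has_vector_derivative w' t) (at t)"
  using w by (rule jet_deriv) auto
 have C: "0 \<le> C" using order_trans[OF norm_ge_zero c(2)[of 0]] by simp
 fix h assume "h \<in> {\<lambda>t. G t * exp (- w t) | G. jet slow G}"
 then obtain G where G: "h = (\<lambda>t. G t * exp (- w t))" "jet slow G" by auto
 obtain G' where G': "jet slow G'" "\<And>t. (G has_vector_derivative G' t) (at t)"
  using G(2) by (rule jet_deriv) auto
 obtain A m where A: "0 \<le> A" "\<And>t. norm (G t) \<le> A * (1 + \<bar>t\<bar>) ^ m"
  using jet_imp[OF G(2)] by (rule slowE) auto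
 have "rapid h"
  unfolding rapid_def
 proof
  fix k
  obtain B where B: "\<And>t. (1 + \<bar>t\<bar>) ^ (k + m) * exp (- (c * t\<^sup>2)) \<le> B"
   by (rule power_mult_exp_bounded[OF c(1)]) auto
  have "\<bar>t\<bar> ^ k * norm (h t) \<le> A * C * B" for t
  proof -
   have "\<bar>t\<bar> ^ k * norm (h t) \<le> (1 + \<bar>t\<bar>) ^ k * ((A * (1 + \<bar>t\<bar>) ^ m) * (C * exp (- (c * t\<^sup>2))))"
    unfolding G(1) norm_mult using A c(2)
    by (intro mult_mono power_mono) (auto intro!: mult_nonneg_nonneg)
   also have "\<dots> = A * C * ((1 + \<bar>t\<bar>) ^ (k + m) * exp (- (c * t\<^sup>2)))"
    by (simp add: power_add)
   also have "\<dots> \<le> A * C * B" using A C B by (intro mult_left_mono) auto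
   finally show ?thesis .
  qed
  then show "\<exists>C. \<forall>t. \<bar>t\<bar> ^ k * norm (h t) \<le> C" by blast
 qed
 moreover have "(h has_vector_derivative ((G' t + - (G t * w' t)) * exp (- w t))) (at t)" for t
 proof -
  have "((\<lambda>t. exp (- w t)) has_vector_derivative (- w' t) * exp (- w t)) (at t)"
   using field_vector_diff_chain_at[OF has_vector_derivative_minus[OF w'(2)] DERIV_exp]
   by (simp add: o_def)
  from has_vector_derivative_mult[OF G'(2) this] show ?thesis
   unfolding G(1) by (simp add: algebra_simps)
 qed
 moreover have "jet slow (\<lambda>t. G' t + - (G t * w' t))"
  by (intro jet_slow_add jet_slow_minus jet_slow_mult G' G w')
 ultimately show "rapid h \<and> (\<exists>h'\<in>{\<lambda>t. G t * exp (- w t) | G. jet slow G}.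
   \<forall>t. (h has_vector_derivative h' t) (at t))"
  by (intro conjI bexI[where x="\<lambda>t. (G' t + - (G t * w' t)) * exp (- w t)"]) auto
qed (use G in auto)

text \<open>A quadratic bound on the Taylor remainder replaces theorems on differentiation under the
  integral sign; it also handles the gluing point of \<open>flat\<close>.\<close>

lemma has_vector_derivative_quadratic:
 fixes f :: "real => 'a::real_normed_vector"
 assumes "\<And>s. norm (f s - f t - (s - t) *\<^sub>R d) \<le> C * (s - t)\<^sup>2"
 shows "(f has_vector_derivative d) (at t)"
 unfolding has_vector_derivative_def has_derivative_at_within
proof (intro conjI bounded_linear_scaleR_left)
 have "((\<lambda>s. norm (s - t) * C) \<longlongrightarrow> norm (t - t) * C) (at t)"
  by (intro tendsto_intros)
 then have lim: "((\<lambda>s. \<bar>s - t\<bar> * C) \<longlongrightarrow> 0) (at t)" by simp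
 show "((\<lambda>s. (f s - f t - (s - t) *\<^sub>R d) /\<^sub>R norm (s - t)) \<longlongrightarrow> 0) (at t)"
 proof (rule Lim_null_comparison[OF _ lim])
  show "\<forall>\<^sub>F s in at t. norm ((f s - f t - (s - t) *\<^sub>R d) /\<^sub>R norm (s - t)) \<le> \<bar>s - t\<bar> * C"
   unfolding eventually_at_filter
  proof (intro always_eventually allI impI)
   fix s assume "s \<noteq> t"
   then have "norm (f s - f t - (s - t) *\<^sub>R d) / \<bar>s - t\<bar> \<le> C * (s - t)\<^sup>2 / \<bar>s - t\<bar>"
    using assms[of s] by (intro divide_right_mono) auto
   also have "\<dots> = \<bar>s - t\<bar> * C"
   proof -
    have "(s - t)\<^sup>2 = \<bar>s - t\<bar> * \<bar>s - t\<bar>" by (simp add: power2_eq_square)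
    then show ?thesis using \<open>s \<noteq> t\<close> by (simp only: ) (simp del: abs_mult_self_eq add: field_simps)
   qed
   finally show "norm ((f s - f t - (s - t) *\<^sub>R d) /\<^sub>R norm (s - t)) \<le> \<bar>s - t\<bar> * C"
    by (simp add: divide_inverse mult.commute)
  qed
 qed
qed

section \<open>A smooth cutoff function\<close>

text \<open>The functions \<open>flat p x = p (1 / x) exp (- 1 / x)\<close> are closed under differentiation and
 vanish to infinite order at \<open>0\<close>.\<close>

definition flat :: "real poly => real => real" where
 "flat p x = (if 0 < x then poly p (1 / x) * exp (- (1 / x)) else 0)"

lemma poly_exp_bounded:
 fixes p :: "real poly"
 obtains C where "0 \<le> C" "\<And>y. 0 \<le> y ==> \<bar>poly p y\<bar> * exp (- y) \<le> C"
proof -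
 have mono: "y ^ i * exp (- y) \<le> real i ^ i" if "0 \<le> y" for y :: real and i
 proof (cases "i = 0")
  case False
  have "y ^ i = real i ^ i * (y / real i) ^ i"
   using False by (simp add: power_divide)
  also have "\<dots> \<le> real i ^ i * (1 + y / real i) ^ i"
   using that by (intro mult_left_mono power_mono) auto
  also have "\<dots> \<le> real i ^ i * exp y"
   using that False by (intro mult_left_mono exp_ge_one_plus_x_over_n_power_n) auto
  finally show ?thesis by (simp add: exp_minus field_simps)
 qed (use that in simp)
 have "\<bar>poly p y\<bar> * exp (- y) \<le> (\<Sum>i\<le>degree p. \<bar>coeff p i\<bar> * real i ^ i)" if "0 \<le> y" for y
 proof -
  have "\<bar>poly p y\<bar> * exp (- y) \<le> (\<Sum>i\<le>degree p. \<bar>coeff p i * y ^ i\<bar>) * exp (- y)"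
   unfolding poly_altdef by (intro mult_right_mono sum_abs) auto
  also have "\<dots> = (\<Sum>i\<le>degree p. \<bar>coeff p i\<bar> * (y ^ i * exp (- y)))"
   using that by (simp add: sum_distrib_right abs_mult mult.assoc)
  also have "\<dots> \<le> (\<Sum>i\<le>degree p. \<bar>coeff p i\<bar> * real i ^ i)"
   by (intro sum_mono mult_left_mono mono that) auto
  finally show ?thesis .
 qed
 moreover have "0 \<le> (\<Sum>i\<le>degree p. \<bar>coeff p i\<bar> * real i ^ i)"
  by (intro sum_nonneg) auto
 ultimately show ?thesis using that by blast
qed

lemma flat_bounded:
 obtains C where "0 \<le> C" "\<And>x. \<bar>flat p x\<bar> \<le> C"
proof -
 obtain C where C: "0 \<le> C" "\<And>y. 0 \<le> y ==> \<bar>poly p y\<bar> * exp (- y) \<le> C"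
  by (rule poly_exp_bounded[of p]) auto
 have "\<bar>flat p x\<bar> \<le> C" for x
  using C(1) C(2)[of "1 / x"] by (auto simp: flat_def abs_mult)
 then show ?thesis using C that by blast
qed

text \<open>The chain rule for \<open>1 / x\<close> gives the polynomial
  \<open>X\<^sup>2 * (p - p')\<close>. At \<open>0\<close> the remainder is quadratic because
  \<open>p * X\<^sup>2\<close> again defines a bounded function of the family.\<close>

lemma flat_has_derivative:
 "(flat p has_real_derivative flat ([:0, 0, 1:] * (p - pderiv p)) x) (at x)"
proof -
 consider "0 < x" | "x < 0" | "x = 0" by linarith
 then show ?thesis
 proof cases
  case 1
  have "((\<lambda>x. poly p (1 / x) * exp (- (1 / x))) has_real_derivative
    poly ([:0, 0, 1:] * (p - pderiv p)) (1 / x) * exp (- (1 / x))) (at x)"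
   using 1 by (auto intro!: derivative_eq_intros DERIV_chain2[OF poly_DERIV]
    simp: algebra_simps power2_eq_square divide_simps)
  then have "(flat p has_real_derivative poly ([:0, 0, 1:] * (p - pderiv p)) (1 / x) * exp (- (1 / x))) (at x)"
   by (rule has_field_derivative_transform_within_open[where S="{0<..}"]) (use 1 in \<open>auto simp: flat_def\<close>)
  then show ?thesis using 1 by (simp add: flat_def)
 next
  case 2
  have "((\<lambda>x. 0) has_real_derivative 0) (at x)" by simp
  then have "(flat p has_real_derivative 0) (at x)"
   by (rule has_field_derivative_transform_within_open[where S="{..<0}"]) (use 2 in \<open>auto simp: flat_def\<close>)
  then show ?thesis using 2 by (simp add: flat_def)
 next
  case 3
  obtain C where C: "0 \<le> C" "\<And>x. \<bar>flat (p * [:0, 0, 1:]) x\<bar> \<le> C"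
   by (rule flat_bounded[of "p * [:0, 0, 1:]"]) auto
  have "(flat p has_vector_derivative 0) (at 0)"
  proof (rule has_vector_derivative_quadratic[where C=C])
   fix s :: real
   show "norm (flat p s - flat p 0 - (s - 0) *\<^sub>R 0) \<le> C * (s - 0)\<^sup>2"
   proof (cases "0 < s")
    case True
    have "\<bar>flat p s\<bar> = \<bar>flat (p * [:0, 0, 1:]) s\<bar> * s\<^sup>2"
     using True by (simp add: flat_def abs_mult power2_eq_square)
    also have "\<dots> \<le> C * s\<^sup>2" by (intro mult_right_mono C) auto
    finally show ?thesis by (simp add: flat_def)
   qed (use C in \<open>simp add: flat_def\<close>)
  qed
  then show ?thesis using 3 by (simp add: has_real_derivative_iff_has_vector_derivative flat_def)
 qed
qed

lemma jet_slow_flat: "jet slow (\<lambda>t. of_real (flat p (a * t + b)))"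
\<comment> \<open>The scalar \<open>c\<close> absorbs the factors \<open>a\<close> that the chain
  rule produces.\<close>
proof (rule jet_coinduct[where S="{\<lambda>t. of_real (c * flat p (a * t + b)) | c p. True}"])
 fix h :: "real => complex" assume "h \<in> {\<lambda>t. of_real (c * flat p (a * t + b)) | c p. True}"
 then obtain c p where h: "h = (\<lambda>t. of_real (c * flat p (a * t + b)))" by auto
 define p' where "p' = [:0, 0, 1:] * (p - pderiv p)"
 obtain C where C: "\<And>x. \<bar>flat p x\<bar> \<le> C" by (rule flat_bounded[of p]) auto
 have "slow h"
  unfolding h by (rule slowI[of _ "\<bar>c\<bar> * C" 0]) (use C in \<open>auto simp: abs_mult norm_mult intro!: mult_left_mono\<close>)
 moreover have "(h has_vector_derivative of_real (c * a * flat p' (a * t + b))) (at t)" for t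
 proof -
  have "((\<lambda>t. flat p (a * t + b)) has_real_derivative flat p' (a * t + b) * a) (at t)"
   unfolding p'_def by (rule DERIV_chain2[OF flat_has_derivative]) (auto intro!: derivative_eq_intros)
  from DERIV_cmult[OF this, of c] have "((\<lambda>t. c * flat p (a * t + b)) has_real_derivative c * a * flat p' (a * t + b)) (at t)"
   by (simp add: mult_ac)
  then show ?thesis unfolding h by (rule has_vector_derivative_of_real)
 qed
 moreover have "(\<lambda>t. complex_of_real (c * a * flat p' (a * t + b))) \<in> {\<lambda>t. of_real (c * flat p (a * t + b)) | c p. True}"
  by blast
 ultimately show "slow h \<and> (\<exists>h'\<in>{\<lambda>t. of_real (c * flat p (a * t + b)) | c p. True}.
   \<forall>t. (h has_vector_derivative h' t) (at t))"
  by (intro conjI bexI[where x="\<lambda>t. complex_of_real (c * a * flat p' (a * t + b))"] allI)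
qed (intro CollectI exI[of _ 1] exI[of _ p], simp)

text \<open>The flat terms vanish on \<open>[-1, 1]\<close> and tend to \<open>1\<close> at infinity, which gives the decay of a Gaussian.\<close>

definition bump :: "real => complex" where
 "bump t = exp (- (of_real t * of_real t * (of_real (flat 1 (1 * t + (-1))) + of_real (flat 1 ((-1) * t + (-1))))))"

lemma bump_eq_1: "\<bar>t\<bar> \<le> 1 ==> bump t = 1"
 by (auto simp: bump_def flat_def)

lemma bump_schwartz: "bump \<in> schwartz"
proof -
 define w :: "real => complex" where
  "w = (\<lambda>t. of_real t * of_real t * (of_real (flat 1 (1 * t + (-1))) + of_real (flat 1 ((-1) * t + (-1)))))"
 have "jet slow w"
  unfolding w_def by (intro jet_slow_mult jet_slow_add jet_slow_flat jet_slow_ident)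
 moreover have "norm (exp (- w t)) \<le> exp (4 * exp (-1)) * exp (- (exp (-1) * t\<^sup>2))" for t
 proof -
  define f where "f = flat 1 (t + -1) + flat 1 (- t + -1)"
  have f: "exp (-1) \<le> f" if "2 \<le> \<bar>t\<bar>"
   using that unfolding f_def flat_def by (auto simp: abs_if field_simps split: if_splits)
  have "0 \<le> f" by (auto simp: f_def flat_def)
  \<comment> \<open>For \<open>2 \<le> \<bar>t\<bar>\<close> one of the two arguments of
    \<open>flat\<close> is at least \<open>1\<close>, so \<open>f\<close> is at least
    \<open>exp (-1)\<close>; for smaller \<open>t\<close> the left side is not positive. The 4
    reappears as the constant factor \<open>exp (4 * exp (-1))\<close>.\<close>
  have "exp (-1) * (t\<^sup>2 - 4) \<le> t\<^sup>2 * f"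
  proof (cases "2 \<le> \<bar>t\<bar>")
   case True
   have "exp (-1) * (t\<^sup>2 - 4) \<le> exp (-1) * t\<^sup>2" by simp
   also have "\<dots> \<le> t\<^sup>2 * f" using mult_left_mono[OF f[OF True], of "t\<^sup>2"] by (simp add: mult.commute)
   finally show ?thesis .
  next
   case False
   then have "t\<^sup>2 \<le> 2\<^sup>2" by (intro power2_le_iff_abs_le[THEN iffD2]) auto
   then have "exp (-1) * (t\<^sup>2 - 4) \<le> 0" by (simp add: mult_le_0_iff)
   also have "0 \<le> t\<^sup>2 * f" using \<open>0 \<le> f\<close> by simp
   finally show ?thesis .
  qed
  then have "exp (- (t\<^sup>2 * f)) \<le> exp (4 * exp (-1) - exp (-1) * t\<^sup>2)"
   by (simp add: algebra_simps)
  moreover have "w t = of_real (t\<^sup>2 * f)"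
   by (simp add: w_def f_def power2_eq_square)
  moreover have "norm (exp (- complex_of_real x)) = exp (- x)" for x
   by simp
  ultimately have "norm (exp (- w t)) \<le> exp (4 * exp (-1) - exp (-1) * t\<^sup>2)"
   by (simp only:)
  then show ?thesis by (simp only: exp_diff exp_minus divide_inverse)
 qed
 ultimately have "(\<lambda>t. 1 * exp (- w t)) \<in> schwartz"
  by (intro schwartz_gaussian_type[where c="exp (-1)"] jet_slow_const) auto
 moreover have "(\<lambda>t. 1 * exp (- w t)) = bump" by (simp add: bump_def w_def fun_eq_iff)
 ultimately show ?thesis by simp
qed

subsection \<open>The Fourier transform on the line\<close>

definition ft :: "(real => complex) => real => complex" where
 "ft h y = (LBINT t. cis (- (y * t)) * h t)"

lemma measurable_cis [measurable]: "cis \<in> bor"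
 by (intro borel_measurable_continuous_onI continuous_intros)

lemma integrable_cis_mult:
 assumes "integrable M h" "f \<in> borel_measurable M"
 shows "integrable M (\<lambda>t. cis (f t) * h t)"
proof (rule Bochner_Integration.integrable_bound[OF assms(1)])
 have [measurable]: "f \<in> borel_measurable M" "h \<in> borel_measurable M" using assms by auto
 show "(\<lambda>t. cis (f t) * h t) \<in> borel_measurable M" by measurable
qed (auto simp: norm_mult)

lemma rapid_bound:
 assumes "rapid f"
 obtains C where "0 \<le> C" "\<And>t. norm (f t) \<le> C * jbr t powr (-2)" "\<And>t. norm (f t) \<le> C"
  "\<And>t. \<bar>t\<bar> * norm (f t) \<le> C"
proof -
 have "\<exists>C. \<forall>t. \<bar>t\<bar> ^ k * norm (f t) \<le> C" for k using assms unfolding rapid_def by blast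
 then obtain C where C: "\<And>k t. \<bar>t\<bar> ^ k * norm (f t) \<le> C k" by metis
 have "0 \<le> C k" for k using C[of 0 k] by (rule order_trans[rotated]) auto
 have b: "norm (f t) \<le> C 0" "\<bar>t\<bar> * norm (f t) \<le> C 1" "t\<^sup>2 * norm (f t) \<le> C 2" for t
  using C[of t 0] C[of t 1] C[of t 2] by auto
 have j: "jbr t powr (-2) = inverse (1 + t\<^sup>2)" for t
  using jbr_powr_double[of t "-1"] by (simp add: powr_minus)
 have "norm (f t) \<le> (C 0 + C 1 + C 2) * jbr t powr (-2)" for t
 proof -
  have "(1 + t\<^sup>2) * norm (f t) \<le> C 0 + C 2" using b(1,3)[of t] by (simp add: distrib_right)
  also have "\<dots> \<le> C 0 + C 1 + C 2" using \<open>0 \<le> C 1\<close> by simp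
  finally have "(1 + t\<^sup>2) * norm (f t) \<le> C 0 + C 1 + C 2" .
  moreover have "0 < 1 + t\<^sup>2" by (simp add: add_pos_nonneg)
  ultimately show ?thesis unfolding j by (simp add: field_simps)
 qed
 moreover have "norm (f t) \<le> C 0 + C 1 + C 2" "\<bar>t\<bar> * norm (f t) \<le> C 0 + C 1 + C 2" for t
  using b(1,2)[of t] \<open>0 \<le> C 0\<close> \<open>0 \<le> C 1\<close> \<open>0 \<le> C 2\<close> by linarith+
 moreover have "0 \<le> C 0 + C 1 + C 2" using \<open>0 \<le> C 0\<close> \<open>0 \<le> C 1\<close> \<open>0 \<le> C 2\<close> by simp
 ultimately show ?thesis using that by blast
qed

lemma rapid_integrable:
 assumes "rapid f" "f \<in> bor"
 shows "integrable lborel f"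
proof -
 obtain C where C: "\<And>t. norm (f t) \<le> C * jbr t powr (-2)" using assms(1) by (rule rapid_bound) auto
 have "integrable lborel (\<lambda>t. C * jbr t powr (-2))" by (intro integrable_mult_right integrable_jbr) auto
 then show ?thesis by (rule Bochner_Integration.integrable_bound) (use C assms in \<open>auto intro: order_trans[OF _ abs_ge_self]\<close>)
qed

lemma rapid_tendsto_0:
 assumes "rapid f"
 shows "(f \<longlongrightarrow> 0) at_top" "(f \<longlongrightarrow> 0) at_bot"
proof -
 obtain C where C: "\<And>t. \<bar>t\<bar> * norm (f t) \<le> C" using assms by (rule rapid_bound) auto
 have le: "norm (f t) \<le> C / \<bar>t\<bar>" if "t \<noteq> 0" for t
  using that C[of t] by (simp add: field_simps)
 have "((\<lambda>t. C / \<bar>t\<bar>) \<longlongrightarrow> 0) at_top"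
  by (intro tendsto_divide_0[OF tendsto_const] filterlim_at_top_imp_at_infinity filterlim_abs_real)
 then show "(f \<longlongrightarrow> 0) at_top"
  by (rule Lim_null_comparison[rotated]) (auto intro!: eventually_mono[OF eventually_gt_at_top[of 0]] le)
 have "((\<lambda>t. C / \<bar>t\<bar>) \<longlongrightarrow> 0) at_bot"
  by (intro tendsto_divide_0[OF tendsto_const] filterlim_at_top_imp_at_infinity
   filterlim_compose[OF filterlim_abs_real filterlim_uminus_at_top_at_bot, simplified])
 then show "(f \<longlongrightarrow> 0) at_bot"
  by (rule Lim_null_comparison[rotated]) (auto intro!: eventually_at_bot_linorderI[of "-1"] le)
qed

lemma schwartz_rapid: "h \<in> schwartz ==> rapid h"
 by (simp add: schwartz_eq jet_imp)

lemma schwartz_measurable [measurable_dest]: "h \<in> schwartz ==> h \<in> bor"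
 by (auto simp: schwartz_eq intro!: borel_measurable_continuous_onI jet_continuous)

lemma schwartz_integrable: "h \<in> schwartz ==> integrable lborel h"
 by (intro rapid_integrable schwartz_rapid schwartz_measurable)

lemma schwartz_deriv:
 assumes "h \<in> schwartz"
 obtains h' where "h' \<in> schwartz" "\<And>t. (h has_vector_derivative h' t) (at t)"
 using assms unfolding schwartz_eq mem_Collect_eq by (rule jet_deriv) auto

lemma integral_deriv_eq_0:
 assumes F: "\<And>t. (F has_vector_derivative f t) (at t)" "rapid F"
  and f: "integrable lborel f" "continuous_on UNIV f"
 shows "(LBINT t. f t) = (0::complex)"
proof -
 have "(LBINT t=-\<infinity>..\<infinity>. f t) = 0 - 0"
 proof (rule interval_integral_FTC_integrable)
  show "set_integrable lborel (einterval (- \<infinity>) \<infinity>) f"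
   using f by (simp add: set_integrable_def)
  show "((F \<circ> real_of_ereal) \<longlongrightarrow> 0) (at_right (- \<infinity>))" "((F \<circ> real_of_ereal) \<longlongrightarrow> 0) (at_left \<infinity>)"
   using rapid_tendsto_0[OF F(2)] by (simp_all add: ereal_tendsto_simps1)
 qed (use F f in \<open>auto simp: continuous_on_eq_continuous_at\<close>)
 then show ?thesis
  by (simp add: interval_lebesgue_integral_def set_lebesgue_integral_def)
qed

lemma cis_has_vector_derivative:
 "((\<lambda>t. cis (a * t)) has_vector_derivative \<i> * of_real a * cis (a * t)) (at t)"
proof -
 have "((\<lambda>t. cis (a * t)) has_derivative (\<lambda>x. (a * x) *\<^sub>R (\<i> * cis (a * t)))) (at t)"
  by (auto intro!: derivative_eq_intros)
 then show ?thesis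
  by (simp add: has_vector_derivative_def scaleR_conv_of_real mult_ac)
qed

lemma ft_deriv:
 assumes h: "\<And>t. (h has_vector_derivative h' t) (at t)" "rapid h" "rapid h'" "continuous_on UNIV h'"
 shows "ft h' y = \<i> * of_real y * ft h y"
proof -
 have ch: "continuous_on UNIV h"
  using h(1) by (meson continuous_at_imp_continuous_on has_vector_derivative_continuous)
 have i: "integrable lborel h" "integrable lborel h'"
  using h ch by (auto intro!: rapid_integrable borel_measurable_continuous_onI)
 have i2: "integrable lborel (\<lambda>t. cis (- (y * t)) * h' t)" "integrable lborel (\<lambda>t. cis (- (y * t)) * h t)"
  by (intro integrable_cis_mult i; measurable)+
 have "(LBINT t. cis (- (y * t)) * h' t + (- \<i> * of_real y) * (cis (- (y * t)) * h t)) = 0"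
 proof (rule integral_deriv_eq_0)
  show "((\<lambda>t. cis (- (y * t)) * h t) has_vector_derivative
    cis (- (y * t)) * h' t + (- \<i> * of_real y) * (cis (- (y * t)) * h t)) (at t)" for t
   using has_vector_derivative_mult[OF cis_has_vector_derivative[of "- y"] h(1)] by (simp add: mult.assoc)
  show "rapid (\<lambda>t. cis (- (y * t)) * h t)"
   using h(2) by (simp add: rapid_def norm_mult)
 qed (auto intro!: Bochner_Integration.integrable_add integrable_mult_right i2 continuous_intros ch h(4)
   simp del: mult_minus_left)
 then show ?thesis
  using i2 unfolding ft_def by (subst (asm) Bochner_Integration.integral_add) auto
qed

lemma norm_ft_le:
 assumes "integrable lborel h"
 shows "norm (ft h y) \<le> (LBINT t. norm (h t))"
proof -
 have "norm (ft h y) \<le> (LBINT t. norm (cis (- (y * t)) * h t))"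
  unfolding ft_def by (rule integral_norm_bound)
 then show ?thesis by (simp add: norm_mult)
qed

text \<open>\<open>(1 + \<tau>\<^sup>2) * ft h \<tau>\<close> is the transform of
  \<open>h - h''\<close>. The constant is explicit because it is needed uniformly over all Fourier
  coefficients of a smooth function.\<close>

lemma ft_decay:
 assumes h: "\<And>t. (h has_vector_derivative h' t) (at t)" "rapid h" "rapid h'"
  and h': "\<And>t. (h' has_vector_derivative h'' t) (at t)" "rapid h''" "continuous_on UNIV h''"
 shows "norm (ft h \<tau>) \<le> (LBINT t. norm (h t - h'' t)) * jbr \<tau> powr (-2)"
proof -
 have c: "continuous_on UNIV h" "continuous_on UNIV h'"
  using h(1) h'(1) by (meson continuous_at_imp_continuous_on has_vector_derivative_continuous)+
 have i: "integrable lborel h" "integrable lborel h''"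
  using h h' c by (auto intro!: rapid_integrable borel_measurable_continuous_onI)
 have "ft h'' \<tau> = (\<i> * of_real \<tau>) * (\<i> * of_real \<tau> * ft h \<tau>)"
  using ft_deriv[OF h c(2)] ft_deriv[OF h'(1) h(3) h'(2,3)] by simp
 also have "\<dots> = - of_real (\<tau>\<^sup>2) * ft h \<tau>"
  by (simp add: power2_eq_square algebra_simps)
 moreover have "ft (\<lambda>t. h t - h'' t) \<tau> = ft h \<tau> - ft h'' \<tau>"
  unfolding ft_def right_diff_distrib
  by (intro Bochner_Integration.integral_diff integrable_cis_mult i; measurable)
 ultimately have "ft (\<lambda>t. h t - h'' t) \<tau> = of_real (1 + \<tau>\<^sup>2) * ft h \<tau>"
  by (simp add: algebra_simps)
 then have "(1 + \<tau>\<^sup>2) * norm (ft h \<tau>) = norm (ft (\<lambda>t. h t - h'' t) \<tau>)"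
  by (simp only: norm_mult norm_of_real) simp
 also have "\<dots> \<le> (LBINT t. norm (h t - h'' t))"
  by (intro norm_ft_le Bochner_Integration.integrable_diff i)
 finally have "(1 + \<tau>\<^sup>2) * norm (ft h \<tau>) \<le> (LBINT t. norm (h t - h'' t))" .
 then have "norm (ft h \<tau>) \<le> (LBINT t. norm (h t - h'' t)) / (1 + \<tau>\<^sup>2)"
  by (subst pos_le_divide_eq) (simp_all add: add_pos_nonneg mult.commute)
 moreover have "jbr \<tau> powr (-2) = inverse (1 + \<tau>\<^sup>2)"
  using jbr_powr_double[of \<tau> "-1"] by (simp add: powr_minus)
 ultimately show ?thesis by (simp add: divide_inverse)
qed

lemma ft_schwartz_decay:
 assumes "h \<in> schwartz"
 obtains C where "0 \<le> C" "\<And>y. norm (ft h y) \<le> C * jbr y powr (-2)"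
proof -
 obtain h' where h': "h' \<in> schwartz" "\<And>t. (h has_vector_derivative h' t) (at t)"
  using assms by (rule schwartz_deriv) auto
 obtain h'' where h'': "h'' \<in> schwartz" "\<And>t. (h' has_vector_derivative h'' t) (at t)"
  using h'(1) by (rule schwartz_deriv) auto
 have "continuous_on UNIV h''" using h'' by (auto simp: schwartz_eq intro: jet_continuous)
 from ft_decay[OF h'(2) _ _ h''(2) _ this] show ?thesis
  using assms h'(1) h''(1) by (intro that[of "LBINT t. norm (h t - h'' t)"]) (auto intro: schwartz_rapid)
qed

section \<open>Inversion of the Fourier transform\<close>

text \<open>Integrating the exponential against a Gaussian regularises the inversion integral.\<close>

lemma integral_cis_gaussian:
 "(LBINT t. of_real (std_normal_density t) * cis (a * t)) = of_real (exp (- (a\<^sup>2) / 2))"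
proof -
 have "char std_normal_distribution a = (LBINT t. std_normal_density t *\<^sub>R iexp (a * t))"
  unfolding char_def by (subst integral_density) (auto simp: normal_density_nonneg)
 then show ?thesis
  by (simp add: char_std_normal_distribution scaleR_conv_of_real cis_conv_exp)
qed

lemma (in pair_sigma_finite) integrable_mult_prod:
 fixes f g F :: "_ => complex"
 assumes f: "integrable M1 f" and g: "integrable M2 g"
  and F: "F \<in> borel_measurable (M1 \<Otimes>\<^sub>M M2)" "\<And>x y. norm (F (x, y)) \<le> norm (f x) * norm (g y)"
 shows "integrable (M1 \<Otimes>\<^sub>M M2) F"
proof (rule integrableI_bounded)
 have [measurable]: "f \<in> borel_measurable M1" "g \<in> borel_measurable M2" using f g by auto
 have "(\<integral>\<^sup>+z. ennreal (norm (F z)) \<partial>(M1 \<Otimes>\<^sub>M M2)) \<le>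
   (\<integral>\<^sup>+z. ennreal (norm (f (fst z))) * ennreal (norm (g (snd z))) \<partial>(M1 \<Otimes>\<^sub>M M2))"
  by (intro nn_integral_mono) (use F in \<open>auto simp: ennreal_mult[symmetric] intro!: ennreal_leI\<close>)
 also have "\<dots> = (\<integral>\<^sup>+x. \<integral>\<^sup>+y. ennreal (norm (f x)) * ennreal (norm (g y)) \<partial>M2 \<partial>M1)"
  by (subst M2.nn_integral_fst[symmetric]) auto
 also have "\<dots> = (\<integral>\<^sup>+x. ennreal (norm (f x)) \<partial>M1) * (\<integral>\<^sup>+y. ennreal (norm (g y)) \<partial>M2)"
  by (simp add: nn_integral_cmult nn_integral_multc)
 also have "\<dots> < \<infinity>"
  using f g by (simp add: integrable_iff_bounded ennreal_mult_less_top)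
 finally show "(\<integral>\<^sup>+z. ennreal (norm (F z)) \<partial>(M1 \<Otimes>\<^sub>M M2)) < \<infinity>" .
qed (use F in auto)

lemma integrable_std_normal_density_complex: "integrable lborel (\<lambda>t. complex_of_real (std_normal_density t))"
 using integrable_normal_density[of 1 0] by (simp add: integrable_of_real)

lemma integrable_gaussian:
 assumes "0 < d"
 shows "integrable lborel (\<lambda>t. complex_of_real (exp (- (d * t)\<^sup>2 / 2)))"
proof -
 have "integrable lborel (\<lambda>t. complex_of_real (std_normal_density (0 + d * t)))"
  using assms by (intro lborel_integrable_real_affine integrable_std_normal_density_complex) auto
 then have "integrable lborel (\<lambda>t. complex_of_real (sqrt (2 * pi)) * complex_of_real (std_normal_density (0 + d * t)))"
  by (rule integrable_mult_right)
 then show ?thesis by (simp add: std_normal_density_def)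
qed

lemma integral_cis_gaussian_scaled:
 assumes "0 < d"
 shows "(LBINT y. of_real (exp (- (d * y)\<^sup>2 / 2)) * cis (a * y)) =
  complex_of_real (2 * pi / d * std_normal_density (a / d))"
proof -
 have "(LBINT r. of_real (std_normal_density r) * cis (a / d * r)) =
   of_real d * (LBINT y. of_real (std_normal_density (d * y)) * cis (a * y))"
  using assms by (subst lborel_integral_real_affine[where c=d and t=0])
   (auto simp: scaleR_conv_of_real)
 then have "of_real (exp (- ((a / d)\<^sup>2) / 2)) =
   of_real d * (LBINT y. of_real (std_normal_density (d * y)) * cis (a * y))"
  by (simp only: integral_cis_gaussian)
 also have "(LBINT y. of_real (std_normal_density (d * y)) * cis (a * y)) =
   complex_of_real (1 / sqrt (2 * pi)) * (LBINT y. of_real (exp (- (d * y)\<^sup>2 / 2)) * cis (a * y))"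
  by (subst integral_mult_right_zero[symmetric]) (simp add: std_normal_density_def)
 finally have "of_real d * (complex_of_real (1 / sqrt (2 * pi)) *
   (LBINT y. of_real (exp (- (d * y)\<^sup>2 / 2)) * cis (a * y))) = complex_of_real (exp (- ((a / d)\<^sup>2) / 2))"
  by simp
 then have "(LBINT y. of_real (exp (- (d * y)\<^sup>2 / 2)) * cis (a * y)) =
   complex_of_real (sqrt (2 * pi) / d * exp (- ((a / d)\<^sup>2) / 2))"
  using assms by (simp add: field_simps)
 also have "sqrt (2 * pi) / d * exp (- ((a / d)\<^sup>2) / 2) = 2 * pi / d * std_normal_density (a / d)"
 proof -
  define q where "q = sqrt (2 * pi)"
  have q: "2 * pi = q * q" "q \<noteq> 0" by (simp_all add: q_def)
  have "q / d * e = q * q / d * (1 / q * e)" for e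
   using q(2) by simp
  then have "sqrt (2 * pi) / d * e = 2 * pi / d * (1 / sqrt (2 * pi) * e)" for e
   unfolding q(1)[symmetric] unfolding q_def .
  then show ?thesis by (simp only: std_normal_density_def)
 qed
 finally show ?thesis .
qed

text \<open>By Fubini, damping in frequency is averaging in time over a normal variable scaled by
  \<open>d\<close>. Letting \<open>d\<close> tend to 0 gives inversion; the same identity computes
  the transforms of the approximants in \<open>approx_schwartz\<close>.\<close>

lemma gaussian_regularisation:
 assumes h: "integrable lborel h" and d: "0 < d"
 shows "(LBINT y. of_real (exp (- (d * y)\<^sup>2 / 2)) * (cis (t * y) * ft h y)) =
  2 * of_real pi * (LBINT r. of_real (std_normal_density r) * h (t + d * r))"
proof -
 have [measurable]: "h \<in> bor" using h by auto
 define E where "E y = complex_of_real (exp (- (d * y)\<^sup>2 / 2))" for y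
 have E: "integrable lborel E" unfolding E_def by (rule integrable_gaussian[OF d])
 have [measurable]: "E \<in> bor" using E by auto
 have "(LBINT y. E y * (cis (t * y) * ft h y)) =
   (LBINT y. LBINT s. E y * (cis (t * y) * (cis (- (y * s)) * h s)))"
  by (simp add: ft_def)
 also have "\<dots> = (LBINT s. LBINT y. E y * (cis (t * y) * (cis (- (y * s)) * h s)))"
 proof (rule lborel_pair.Fubini_integral[symmetric])
  show "integrable (lborel \<Otimes>\<^sub>M lborel) (\<lambda>(y, s). E y * (cis (t * y) * (cis (- (y * s)) * h s)))"
   by (rule lborel_pair.integrable_mult_prod[OF E h]) (auto simp: norm_mult)
 qed
 also have "\<dots> = (LBINT s. h s * of_real (2 * pi / d * std_normal_density ((t - s) / d)))"
 proof (rule Bochner_Integration.integral_cong[OF refl])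
  fix s
  have "cis ((t - s) * y) = cis (t * y) * cis (- (y * s))" for y
   by (simp add: cis_mult algebra_simps)
  then have "(LBINT y. E y * (cis (t * y) * (cis (- (y * s)) * h s))) =
    (LBINT y. h s * (of_real (exp (- (d * y)\<^sup>2 / 2)) * cis ((t - s) * y)))"
   by (intro Bochner_Integration.integral_cong) (simp_all add: E_def mult_ac)
  also have "\<dots> = h s * of_real (2 * pi / d * std_normal_density ((t - s) / d))"
   using d by (simp only: integral_mult_right_zero integral_cis_gaussian_scaled)
  finally show "(LBINT y. E y * (cis (t * y) * (cis (- (y * s)) * h s))) = \<dots>" .
 qed
 also have "\<dots> = d *\<^sub>R (LBINT r. h (t + d * r) * of_real (2 * pi / d * std_normal_density ((t - (t + d * r)) / d)))"
  using d by (subst lborel_integral_real_affine[where c=d and t=t]) auto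
 also have "\<dots> = (LBINT r. 2 * of_real pi * (of_real (std_normal_density r) * h (t + d * r)))"
  unfolding integral_scaleR_right[symmetric] using d
  by (intro Bochner_Integration.integral_cong) (auto simp: std_normal_density_def scaleR_conv_of_real)
 finally show ?thesis by (simp add: E_def)
qed

lemma gaussian_mollifier_tendsto:
 assumes h: "continuous_on UNIV h" "\<And>x. norm (h x) \<le> C" and d: "d \<longlonglongrightarrow> 0"
 shows "(\<lambda>n. LBINT r. of_real (std_normal_density r) * h (t + d n * r)) \<longlonglongrightarrow> (h t :: complex)"
proof -
 have [measurable]: "h \<in> bor" using h by (intro borel_measurable_continuous_onI)
 have "(\<lambda>n. LBINT r. of_real (std_normal_density r) * h (t + d n * r)) \<longlonglongrightarrow>
   (LBINT r. of_real (std_normal_density r) * h t)"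
 proof (rule integral_dominated_convergence[where w="\<lambda>r. C * std_normal_density r"])
  show "integrable lborel (\<lambda>r. C * std_normal_density r)"
   using integrable_normal_density[of 1 0] by simp
  show "AE r in lborel. (\<lambda>n. of_real (std_normal_density r) * h (t + d n * r)) \<longlonglongrightarrow> of_real (std_normal_density r) * h t"
  proof (intro AE_I2 tendsto_mult tendsto_const)
   fix r
   have "(\<lambda>n. t + d n * r) \<longlonglongrightarrow> t + 0 * r" by (intro tendsto_intros d)
   then show "(\<lambda>n. h (t + d n * r)) \<longlonglongrightarrow> h t"
    using h(1) by (intro isCont_tendsto_compose[where g=h]) (auto simp: continuous_on_eq_continuous_at)
  qed
  show "AE r in lborel. norm (of_real (std_normal_density r) * h (t + d n * r)) \<le> C * std_normal_density r" for n
   by (auto simp: norm_mult normal_density_nonneg mult.commute[of C] intro!: mult_left_mono h(2))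
 qed auto
 moreover have "(LBINT r. of_real (std_normal_density r) * h t) = h t"
 proof -
  have "(LBINT r. complex_of_real (std_normal_density r)) = of_real 1"
   unfolding integral_complex_of_real using integral_normal_density[of 1 0] by simp
  then show ?thesis by simp
 qed
 ultimately show ?thesis by simp
qed

theorem fourier_inversion:
 assumes h: "continuous_on UNIV h" "\<And>x. norm (h x) \<le> C" "integrable lborel h"
  and i: "integrable lborel (ft h)"
 shows "(LBINT y. cis (t * y) * ft h y) = 2 * of_real pi * h t"
proof (rule LIMSEQ_unique)
 define \<delta> :: "nat => real" where "\<delta> n = inverse (real (Suc n))" for n
 have \<delta>: "0 < \<delta> n" "\<delta> \<longlonglongrightarrow> 0" for n
  unfolding \<delta>_def by (simp, rule LIMSEQ_inverse_real_of_nat)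
 have [measurable]: "ft h \<in> bor" using i by auto
 show "(\<lambda>n. LBINT y. of_real (exp (- (\<delta> n * y)\<^sup>2 / 2)) * (cis (t * y) * ft h y)) \<longlonglongrightarrow>
   (LBINT y. cis (t * y) * ft h y)"
 proof (rule integral_dominated_convergence[where w="\<lambda>y. norm (ft h y)"])
  show "AE y in lborel. (\<lambda>n. of_real (exp (- (\<delta> n * y)\<^sup>2 / 2)) * (cis (t * y) * ft h y)) \<longlonglongrightarrow> cis (t * y) * ft h y"
  proof (intro AE_I2)
   fix y
   have "(\<lambda>n. complex_of_real (exp (- (\<delta> n * y)\<^sup>2 / 2)) * (cis (t * y) * ft h y)) \<longlonglongrightarrow>
     complex_of_real (exp (- (0 * y)\<^sup>2 / 2)) * (cis (t * y) * ft h y)"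
    by (intro tendsto_intros \<delta>) auto
   then show "(\<lambda>n. of_real (exp (- (\<delta> n * y)\<^sup>2 / 2)) * (cis (t * y) * ft h y)) \<longlonglongrightarrow> cis (t * y) * ft h y"
    by simp
  qed
 qed (use i in \<open>auto simp: norm_mult mult_left_le_one_le\<close>)
 show "(\<lambda>n. LBINT y. of_real (exp (- (\<delta> n * y)\<^sup>2 / 2)) * (cis (t * y) * ft h y)) \<longlonglongrightarrow> 2 * of_real pi * h t"
  unfolding gaussian_regularisation[OF h(3) \<delta>(1)]
  by (intro tendsto_mult tendsto_const gaussian_mollifier_tendsto[OF h(1,2) \<delta>(2)])
qed

lemma ft_measurable [measurable]:
 assumes [measurable]: "h \<in> bor"
 shows "ft h \<in> bor"
 unfolding ft_def by measurable

lemma schwartz_ft_integrable: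
 assumes "h \<in> schwartz"
 shows "integrable lborel (ft h)"
proof -
 obtain C where C: "\<And>y. norm (ft h y) \<le> C * jbr y powr (-2)"
  using assms by (rule ft_schwartz_decay) auto
 have [measurable]: "h \<in> bor" using assms by (rule schwartz_measurable)
 have "integrable lborel (\<lambda>t. C * jbr t powr (-2))" by (intro integrable_mult_right integrable_jbr) auto
 then show ?thesis
  by (rule Bochner_Integration.integrable_bound) (use C in \<open>auto intro: order_trans[OF _ abs_ge_self]\<close>)
qed

lemma schwartz_inversion:
 assumes "h \<in> schwartz"
 shows "(LBINT y. cis (t * y) * ft h y) = 2 * of_real pi * h t"
proof -
 obtain C where "\<And>t. norm (h t) \<le> C" using schwartz_rapid[OF assms] by (rule rapid_bound) auto
 then show ?thesis
  using assms by (intro fourier_inversion schwartz_integrable schwartz_ft_integrable)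
   (auto simp: schwartz_eq intro: jet_continuous)
qed

subsection \<open>Fourier series\<close>

lemma fcoeff_cis:
 "fcoeff f n = (LBINT x:{-pi..pi}. cis (- (of_int n * x)) * f x) / (2 * of_real pi)"
 by (simp add: fcoeff_def cis_conv_exp mult.assoc)

lemma set_integrable_continuous:
 fixes f :: "real => complex"
 assumes "continuous_on UNIV f"
 shows "set_integrable lborel {-pi..pi} f"
 unfolding set_integrable_def
 by (rule borel_integrable_compact[OF compact_Icc continuous_on_subset[OF assms]]) simp

lemma norm_fcoeff_le:
 assumes f: "f \<in> bor" "\<And>x. x \<in> {-pi..pi} ==> norm (f x) \<le> C"
 shows "norm (fcoeff f n) \<le> C"
proof -
 have "norm (LBINT x:{-pi..pi}. cis (- (of_int n * x)) * f x) \<le>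
   (LBINT x. norm (indicator {-pi..pi} x *\<^sub>R (cis (- (of_int n * x)) * f x)))"
  unfolding set_lebesgue_integral_def by (rule integral_norm_bound)
 also have "\<dots> \<le> (LBINT x. indicator {-pi..pi} x *\<^sub>R C)"
 proof (rule integral_mono')
  show "integrable lborel (\<lambda>x. indicator {-pi..pi} x *\<^sub>R C)" by simp
 qed (use f(2) in \<open>auto simp: norm_mult indicator_def order_trans[OF norm_ge_zero f(2)]\<close>)
 also have "\<dots> = 2 * pi * C" by simp
 finally show ?thesis by (simp add: fcoeff_cis norm_divide field_simps)
qed

lemma fcoeff_integrable:
 assumes "set_integrable lborel {-pi..pi} f"
 shows "set_integrable lborel {-pi..pi} (\<lambda>x. cis (- (of_int n * x)) * f x)"
proof -
 have "integrable lborel (\<lambda>x. cis (- (of_int n * x)) * (indicator {-pi..pi} x *\<^sub>R f x))"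
  using assms unfolding set_integrable_def by (rule integrable_cis_mult) measurable
 then show ?thesis by (simp add: set_integrable_def)
qed

lemma fcoeff_add:
 assumes "set_integrable lborel {-pi..pi} f" "set_integrable lborel {-pi..pi} g"
 shows "fcoeff (\<lambda>x. f x + g x) n = fcoeff f n + fcoeff g n"
 using set_integral_add(2)[OF fcoeff_integrable[OF assms(1), of n] fcoeff_integrable[OF assms(2), of n]]
 by (simp add: fcoeff_cis distrib_left add_divide_distrib)

lemma fcoeff_cmult: "fcoeff (\<lambda>x. c * f x) n = c * fcoeff f n"
proof -
 have "(LBINT x:{-pi..pi}. cis (- (of_int n * x)) * (c * f x)) =
   c * (LBINT x:{-pi..pi}. cis (- (of_int n * x)) * f x)"
  unfolding set_lebesgue_integral_def
  by (subst integral_mult_right_zero[symmetric]) (auto intro!: Bochner_Integration.integral_cong simp: mult_ac)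
 then show ?thesis by (simp add: fcoeff_cis)
qed

lemma fcoeff_diff:
 assumes "set_integrable lborel {-pi..pi} f" "set_integrable lborel {-pi..pi} g"
 shows "fcoeff (\<lambda>x. f x - g x) n = fcoeff f n - fcoeff g n"
 using set_integral_diff(2)[OF fcoeff_integrable[OF assms(1), of n] fcoeff_integrable[OF assms(2), of n]]
 by (simp add: fcoeff_cis right_diff_distrib diff_divide_distrib)

lemma cis_of_int_2pi [simp]: "cis (of_int n * (2 * pi)) = 1"
 using cis_multiple_2pi[of "of_int n"] by (simp add: mult_ac)

lemma cis_int_plus_2pi: "cis (of_int n * (x + 2 * pi)) = cis (of_int n * x)"
 by (simp add: distrib_left cis_mult[symmetric])

lemma fcoeff_deriv:
 assumes f: "\<And>x. (f has_vector_derivative f' x) (at x)" "continuous_on UNIV f'"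
  and per: "\<And>x. f (x + 2 * pi) = f x"
 shows "fcoeff f' n = \<i> * of_int n * fcoeff f n"
proof -
 have cf: "continuous_on UNIV f"
  using f(1) by (meson continuous_at_imp_continuous_on has_vector_derivative_continuous)
 define F where "F x = cis (- of_int n * x) * f x" for x
 have dF: "(F has_vector_derivative cis (- of_int n * x) * f' x + (\<i> * of_real (- of_int n) * cis (- of_int n * x)) * f x) (at x)" for x
  unfolding F_def by (rule has_vector_derivative_mult[OF cis_has_vector_derivative f(1)])
 have "(LBINT x=ereal (-pi)..ereal pi. cis (- of_int n * x) * f' x + (\<i> * of_real (- of_int n) * cis (- of_int n * x)) * f x) = F pi - F (- pi)"
 proof (rule interval_integral_FTC_finite[OF _ has_vector_derivative_at_within[OF dF]])
  have "continuous_on UNIV (\<lambda>x. cis (- of_int n * x) * f' x + (\<i> * of_real (- of_int n) * cis (- of_int n * x)) * f x)"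
   by (intro continuous_intros cf f(2))
  then show "continuous_on {min (- pi) pi..max (- pi) pi}
    (\<lambda>x. cis (- of_int n * x) * f' x + (\<i> * of_real (- of_int n) * cis (- of_int n * x)) * f x)"
   by (rule continuous_on_subset) simp
 qed
 also have "F pi = F (- pi)"
  using per[of "-pi"] cis_int_plus_2pi[of "-n" "-pi"] by (simp add: F_def)
 finally have "(LBINT x:{-pi..pi}. cis (- (of_int n * x)) * f' x + (- (\<i> * of_int n) * (cis (- (of_int n * x)) * f x))) = 0"
  by (subst (asm) interval_integral_Icc) (simp_all add: mult.assoc)
 moreover have "set_integrable lborel {-pi..pi} (\<lambda>x. cis (- (of_int n * x)) * f' x)"
  by (intro fcoeff_integrable set_integrable_continuous f(2))
 moreover have "set_integrable lborel {-pi..pi} (\<lambda>x. - (\<i> * of_int n) * (cis (- (of_int n * x)) * f x))"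
  by (intro set_integrable_continuous continuous_on_mult continuous_on_const cf continuous_intros)
 ultimately have "(LBINT x:{-pi..pi}. cis (- (of_int n * x)) * f' x) +
   (LBINT x:{-pi..pi}. - (\<i> * of_int n) * (cis (- (of_int n * x)) * f x)) = 0"
  using set_integral_add(2)[of lborel "{-pi..pi}" "\<lambda>x. cis (- (of_int n * x)) * f' x"
   "\<lambda>x. - (\<i> * of_int n) * (cis (- (of_int n * x)) * f x)"] by simp
 moreover have "(LBINT x:{-pi..pi}. - (\<i> * of_int n) * (cis (- (of_int n * x)) * f x)) =
   - (\<i> * of_int n) * (2 * of_real pi * fcoeff f n)"
 proof -
  have "2 * of_real pi * fcoeff (\<lambda>x. - (\<i> * of_int n) * f x) n =
    (LBINT x:{-pi..pi}. - (\<i> * of_int n) * (cis (- (of_int n * x)) * f x))"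
   unfolding fcoeff_cis by (simp add: mult.left_commute)
  then show ?thesis by (simp only: fcoeff_cmult mult.left_commute)
 qed
 ultimately have "2 * of_real pi * fcoeff f' n + - (\<i> * of_int n) * (2 * of_real pi * fcoeff f n) = 0"
  by (simp add: fcoeff_cis)
 then have "2 * complex_of_real pi * (fcoeff f' n - \<i> * of_int n * fcoeff f n) = 0"
  by (simp add: algebra_simps)
 then show ?thesis by simp
qed

lemma fcoeff_cis_cis: "fcoeff (\<lambda>x. cis (of_int k * x)) n = (if n = k then 1 else 0)"
proof -
 have d: "((\<lambda>x. cis (of_int k * x)) has_vector_derivative \<i> * of_real (of_int k) * cis (of_int k * x)) (at x)" for x
  by (rule cis_has_vector_derivative)
 have "fcoeff (\<lambda>x. \<i> * of_real (of_int k) * cis (of_int k * x)) n = \<i> * of_int n * fcoeff (\<lambda>x. cis (of_int k * x)) n"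
  by (rule fcoeff_deriv[OF d]) (auto intro!: continuous_intros simp: cis_int_plus_2pi)
 then have "(of_int k - of_int n) * fcoeff (\<lambda>x. cis (of_int k * x)) n = 0"
  by (simp add: fcoeff_cmult mult.assoc left_diff_distrib)
 moreover have "fcoeff (\<lambda>x. cis (of_int k * x)) n = 1" if "n = k"
  using that by (simp add: fcoeff_cis cis_mult set_lebesgue_integral_def scaleR_conv_of_real)
 ultimately show ?thesis by auto
qed

section \<open>Uniqueness of Fourier coefficients\<close>

inductive_set trig_polys :: "(real => complex) set" where
 base: "(\<lambda>x. c * cis (of_int n * x)) \<in> trig_polys"
| add: "f \<in> trig_polys ==> g \<in> trig_polys ==> (\<lambda>x. f x + g x) \<in> trig_polys"

lemma trig_polys_mult:
 assumes "f \<in> trig_polys" "g \<in> trig_polys"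
 shows "(\<lambda>x. f x * g x) \<in> trig_polys"
 using assms
proof induction
 case (base c n)
 from base show ?case
 proof (induction)
  case (base d m)
  have "(\<lambda>x. c * cis (of_int n * x) * (d * cis (of_int m * x))) = (\<lambda>x. (c * d) * cis (of_int (n + m) * x))"
   by (simp add: fun_eq_iff cis_mult[symmetric] distrib_right)
  then show ?case by (simp only: trig_polys.base)
 next
  case (add f g)
  then show ?case by (simp add: distrib_left trig_polys.add)
 qed
next
 case (add f1 f2)
 then show ?case by (simp add: distrib_right trig_polys.add)
qed

text \<open>Real polynomials in the coordinates of the circle are what the Stone-Weierstrass theorem
  supplies; the linear ones are handled by Euler's formulas.\<close>

lemma trig_polys_poly:
 fixes p :: "complex => real"
 assumes "real_polynomial_function p"
 shows "(\<lambda>x. complex_of_real (p (cis x))) \<in> trig_polys"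
 using assms
proof induction
 case (linear f)
 then have lin: "linear f" by (rule bounded_linear.linear)
 have "complex_of_real (f (cis x)) =
   (of_real (f 1) / 2 + of_real (f \<i>) / (2 * \<i>)) * cis (of_int 1 * x) + (of_real (f 1) / 2 - of_real (f \<i>) / (2 * \<i>)) * cis (of_int (-1) * x)" for x
 proof -
  have "cis x = cos x *\<^sub>R 1 + sin x *\<^sub>R \<i>" by (simp add: complex_eq_iff)
  then have "f (cis x) = cos x * f 1 + sin x * f \<i>"
   using lin by (simp only: linear_add linear_scale real_scaleR_def)
  then show ?thesis
   by (simp add: complex_eq_iff field_simps)
 qed
 then show ?case by (simp only:) (intro trig_polys.intros)
next
 case (const c)
 show ?case using trig_polys.base[of "of_real c" 0] by simp
next
 case (add f g)
 then show ?case by (simp add: trig_polys.add)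
next
 case (mult f g)
 then show ?case by (simp add: trig_polys_mult)
qed

text \<open>\<open>Arg\<close> jumps across the negative real axis, so continuity of
  \<open>G\<close> is checked on two overlapping arcs; on the second one, \<open>G\<close> is
  rewritten through the argument of \<open>- z\<close>, shifted by \<open>pi\<close>.\<close>

lemma periodic_circle_function:
 fixes g :: "real => complex"
 assumes g: "continuous_on UNIV g" and per: "\<And>x. g (x + 2 * pi) = g x"
 obtains G where "continuous_on (sphere 0 1) G" "\<And>x. G (cis x) = g x"
proof -
 have perZ: "g (x + 2 * pi * of_int k) = g x" for x k
 proof (induction k rule: int_induct[of _ 0])
  case base then show ?case by simp
 next
  case (step1 i)
  then show ?case using per[of "x + 2 * pi * of_int i"] by (simp add: algebra_simps)
 next
  case (step2 i)
  then show ?case using per[of "x + 2 * pi * of_int (i - 1)"] by (simp add: algebra_simps)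
 qed
 have eq: "g x = g y" if "cis x = cis y" for x y
 proof -
  have "cos x = cos y \<and> sin x = sin y" using that by (simp add: complex_eq_iff)
  then obtain n where "x = y + 2 * pi * of_int n"
   using sin_cos_eq_iff[of x y] by auto
  then show ?thesis using perZ by simp
 qed
 define G where "G z = g (Arg z)" for z
 have G: "G (cis x) = g x" for x
  unfolding G_def by (rule eq) (simp add: cis_Arg sgn_div_norm)
 define H where "H z = g (Arg (- z) + pi)" for z
 have "cis (Arg (- cis x) + pi) = cis x" for x
  using cis_Arg[of "- cis x"] by (simp add: cis_mult[symmetric] sgn_div_norm)
 then have H: "H (cis x) = g x" for x
  unfolding H_def by (rule eq)
 have G': "G z = H z" if "z \<in> sphere 0 1" for z
 proof -
  have "z = cis (Arg z)" using that by (subst cis_Arg) (auto simp: sgn_div_norm)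
  then show ?thesis using G H by metis
 qed
 let ?U = "sphere (0 :: complex) 1 \<inter> - \<real>\<^sub>\<le>\<^sub>0" and ?V = "sphere (0 :: complex) 1 \<inter> uminus -` (- \<real>\<^sub>\<le>\<^sub>0)"
 have cG: "continuous_on ?U G"
  unfolding G_def by (intro continuous_on_compose2[OF g] continuous_intros) auto
 have "continuous_on ?V H"
  unfolding H_def by (intro continuous_on_compose2[OF g] continuous_intros) auto
 then have cH: "continuous_on ?V G"
  by (rule continuous_on_eq) (use G' in auto)
 have o1: "open (- \<real>\<^sub>\<le>\<^sub>0 :: complex set)" by (simp add: open_Compl)
 have o2: "open (uminus -` (- \<real>\<^sub>\<le>\<^sub>0) :: complex set)" by (intro open_vimage o1 continuous_intros)
 have "continuous_on (?U \<union> ?V) G"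
  by (rule continuous_on_Un_local_open[OF _ _ cG cH])
   (auto intro!: openin_subset_trans[where U="sphere 0 1"] openin_open_Int o1 o2)
 moreover have "?U \<union> ?V = sphere 0 1"
 proof -
  have *: "x = 0" if "x \<in> \<real>\<^sub>\<le>\<^sub>0" "- x \<in> \<real>\<^sub>\<le>\<^sub>0" for x :: complex
   using that by (simp add: complex_nonpos_Reals_iff complex_eq_iff)
  have "x \<notin> \<real>\<^sub>\<le>\<^sub>0 \<or> - x \<notin> \<real>\<^sub>\<le>\<^sub>0" if "norm x = 1" for x :: complex
  proof (rule ccontr)
   assume "\<not> (x \<notin> \<real>\<^sub>\<le>\<^sub>0 \<or> - x \<notin> \<real>\<^sub>\<le>\<^sub>0)"
   with * have "x = 0" by blast
   then show False using that by simp
  qed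
  moreover have "norm x = 1" if "x \<in> sphere 0 1" for x :: complex
   using that by simp
  ultimately have "x \<notin> \<real>\<^sub>\<le>\<^sub>0 \<or> - x \<notin> \<real>\<^sub>\<le>\<^sub>0" if "x \<in> sphere 0 1" for x :: complex
   using that by blast
  then have "x \<in> - \<real>\<^sub>\<le>\<^sub>0 \<union> uminus -` (- \<real>\<^sub>\<le>\<^sub>0)" if "x \<in> sphere 0 1" for x :: complex
   using that by (simp only: vimage_eq Compl_iff Un_iff)
  then have "sphere 0 1 \<subseteq> - \<real>\<^sub>\<le>\<^sub>0 \<union> uminus -` (- \<real>\<^sub>\<le>\<^sub>0 :: complex set)"
   by (rule subsetI)
  then show ?thesis
   unfolding Int_Un_distrib[symmetric] by (rule Int_absorb2)
 qed
 ultimately show ?thesis using that[of G] G by simp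
qed

lemma fcoeff_trig_poly_orthogonal:
 assumes "p \<in> trig_polys" "continuous_on UNIV g" "\<And>n. fcoeff g n = 0"
 shows "(LBINT x:{-pi..pi}. p x * g x) = 0 \<and> continuous_on UNIV p"
 using assms(1)
proof induction
 case (base c n)
 have "fcoeff (\<lambda>x. c * g x) (- n) = 0" by (simp add: fcoeff_cmult assms(3))
 then show ?case by (auto simp: fcoeff_cis mult_ac intro!: continuous_intros)
next
 case (add f h)
 then show ?case
  using assms(2) by (auto simp: distrib_right set_integral_add set_integrable_continuous continuous_on_mult continuous_on_add)
qed

text \<open>Every trigonometric polynomial is orthogonal to \<open>g\<close>, and
  \<open>cnj g\<close> is a uniform limit of such polynomials; hence the integral of the squared
  modulus of \<open>g\<close> vanishes.\<close>

lemma fcoeff_zero_imp_zero: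
 assumes g: "continuous_on UNIV g" "\<And>x. g (x + 2 * pi) = g x" "\<And>n. fcoeff g n = 0"
 shows "\<And>x. x \<in> {-pi..pi} ==> g x = 0"
proof -
 have "bounded (g ` {-pi..pi})"
  by (intro compact_imp_bounded compact_continuous_image continuous_on_subset[OF g(1)]) auto
 then obtain C where C: "0 < C" "\<And>x. x \<in> {-pi..pi} ==> norm (g x) \<le> C"
  by (auto simp: bounded_pos)
 have gi: "set_integrable lborel {-pi..pi} (\<lambda>x. cnj (g x) * g x)"
  by (intro set_integrable_continuous continuous_intros g)
 obtain G where G: "continuous_on (sphere 0 1) G" "\<And>x. G (cis x) = g x"
  using periodic_circle_function[OF g(1,2)] by blast
 have small: "norm (LBINT x:{-pi..pi}. cnj (g x) * g x) \<le> e" if "0 < e" for e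
 proof -
  \<comment> \<open>\<open>2 * pi\<close> is the length of the interval and \<open>C\<close> a bound
    for \<open>g\<close>, so an error \<open>d\<close> in the approximation of \<open>cnj g\<close>
    changes the integral by at most \<open>e\<close>.\<close>
  define d where "d = e / (2 * pi * C)"
  have d: "0 < d" using that C by (simp add: d_def)
  have "\<exists>p. real_polynomial_function p \<and> (\<forall>z\<in>sphere 0 1. \<bar>Re (G z) - p z\<bar> < d / 2)"
   by (rule Stone_Weierstrass_real_polynomial_function[of "sphere 0 1" "\<lambda>z. Re (G z)" "d / 2"])
    (use G d in \<open>auto intro!: continuous_intros\<close>)
  then obtain p where p: "real_polynomial_function p" "\<And>z. z \<in> sphere 0 1 ==> \<bar>Re (G z) - p z\<bar> < d / 2" by blast
  have "\<exists>q. real_polynomial_function q \<and> (\<forall>z\<in>sphere 0 1. \<bar>Im (G z) - q z\<bar> < d / 2)"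
   by (rule Stone_Weierstrass_real_polynomial_function[of "sphere 0 1" "\<lambda>z. Im (G z)" "d / 2"])
    (use G d in \<open>auto intro!: continuous_intros\<close>)
  then obtain q where q: "real_polynomial_function q" "\<And>z. z \<in> sphere 0 1 ==> \<bar>Im (G z) - q z\<bar> < d / 2" by blast
  \<comment> \<open>The minus sign makes \<open>r\<close> approximate \<open>cnj g\<close>, to be
    integrated against \<open>g\<close>.\<close>
  define r where "r x = complex_of_real (p (cis x)) + (- \<i> * cis (of_int 0 * x)) * complex_of_real (q (cis x))" for x
  have "r \<in> trig_polys"
   unfolding r_def by (intro trig_polys.add trig_polys_mult trig_polys_poly p q trig_polys.base)
  then have r: "(LBINT x:{-pi..pi}. r x * g x) = 0" "continuous_on UNIV r"
   using fcoeff_trig_poly_orthogonal[OF _ g(1,3)] by auto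
  have close: "norm (cnj (g x) - r x) \<le> d" for x
  proof -
   have "norm (cnj (g x) - r x) \<le> \<bar>Re (cnj (g x) - r x)\<bar> + \<bar>Im (cnj (g x) - r x)\<bar>"
    by (rule cmod_le)
   also have "\<dots> \<le> d / 2 + d / 2"
    using p(2)[of "cis x"] q(2)[of "cis x"] by (intro add_mono) (auto simp: r_def G(2) abs_minus_commute)
   finally show ?thesis by simp
  qed
  have "(LBINT x:{-pi..pi}. cnj (g x) * g x) = (LBINT x:{-pi..pi}. cnj (g x) * g x) - (LBINT x:{-pi..pi}. r x * g x)"
   using r by simp
  also have "\<dots> = (LBINT x:{-pi..pi}. (cnj (g x) - r x) * g x)"
   unfolding left_diff_distrib
   by (intro set_integral_diff(2)[symmetric] set_integrable_continuous continuous_intros g r)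
  finally have "norm (LBINT x:{-pi..pi}. cnj (g x) * g x) = norm (2 * pi * fcoeff (\<lambda>x. (cnj (g x) - r x) * g x) 0)"
   by (simp add: fcoeff_cis)
  also have "\<dots> = 2 * pi * norm (fcoeff (\<lambda>x. (cnj (g x) - r x) * g x) 0)"
   by (simp add: norm_mult)
  also have "\<dots> \<le> 2 * pi * (d * C)"
  proof (intro mult_left_mono norm_fcoeff_le)
   show "(\<lambda>x. (cnj (g x) - r x) * g x) \<in> bor"
    by (intro borel_measurable_continuous_onI continuous_intros g r)
   show "norm ((cnj (g x) - r x) * g x) \<le> d * C" if "x \<in> {-pi..pi}" for x
    unfolding norm_mult using close[of x] C(2)[OF that] d by (intro mult_mono) auto
  qed auto
  also have "\<dots> = e" using C by (simp add: d_def)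
  finally show ?thesis .
 qed
 have "norm (LBINT x:{-pi..pi}. cnj (g x) * g x) \<le> 0"
  by (rule field_le_epsilon) (use small in auto)
 then have "(LBINT x:{-pi..pi}. cnj (g x) * g x) = 0" by simp
 moreover have "(LBINT x:{-pi..pi}. cnj (g x) * g x) = of_real (LBINT x:{-pi..pi}. (norm (g x))\<^sup>2)"
 proof -
  have "cnj (g x) * g x = of_real ((norm (g x))\<^sup>2)" for x
   by (simp only: complex_norm_square mult.commute)
  then show ?thesis by (simp only: set_integral_complex_of_real)
 qed
 ultimately have "(LBINT x:{-pi..pi}. (norm (g x))\<^sup>2) = 0" by simp
 moreover have cn: "continuous_on {-pi..pi} (\<lambda>x. (norm (g x))\<^sup>2)"
  by (intro continuous_intros continuous_on_subset[OF g(1)]) auto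
 ultimately have "integral (cbox (-pi) pi) (\<lambda>x. (norm (g x))\<^sup>2) = 0"
  using borel_integrable_compact[OF compact_Icc cn]
  by (subst (asm) set_borel_integral_eq_integral) (simp_all add: set_integrable_def)
 then have "((\<lambda>x. (norm (g x))\<^sup>2) has_integral 0) (cbox (-pi) pi)"
  using integrable_integral[OF integrable_continuous[of "-pi" pi "\<lambda>x. (norm (g x))\<^sup>2"]] cn by simp
 then have "(norm (g x))\<^sup>2 = 0" if "x \<in> cbox (-pi) pi" for x
  by (rule has_integral_0_cbox_imp_0[rotated 2]) (use cn that pi_gt_zero in \<open>auto simp: not_le\<close>)
 then show "\<And>x. x \<in> {-pi..pi} ==> g x = 0" by simp
qed

section \<open>Absolutely convergent trigonometric series\<close>

lemma integrable_count_space_iff: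
 fixes a :: "int => 'b::{banach, second_countable_topology}"
 shows "integrable ZZ a \<longleftrightarrow> (\<lambda>n. norm (a n)) summable_on UNIV"
 using abs_summable_equivalent[of a UNIV] by (simp add: abs_summable_on_def)

lemma infsum_eq_integral:
 fixes a :: "int => 'b::{banach, second_countable_topology}"
 assumes "integrable ZZ a"
 shows "(\<Sum>\<^sub>\<infinity>n. a n) = (\<integral>n. a n \<partial>ZZ)"
 using infsetsum_infsum[of a UNIV] assms by (simp add: abs_summable_on_def infsetsum_def)

lemma sum_jbr_finite:
 assumes "1 < p"
 shows "(\<integral>\<^sup>+k. ennreal (jbr (of_int k) powr (- p)) \<partial>count_space (UNIV :: int set)) < \<infinity>"
 using sum_jbr_shift_le[of p 0] nn_integral_jbr_finite[OF assms] assms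
 by (auto simp: ennreal_mult_less_top elim!: le_less_trans)

lemma integrable_count_space_decay:
 fixes a :: "int => complex"
 assumes "\<And>n. norm (a n) \<le> C * jbr (of_int n) powr (-2)"
 shows "integrable ZZ a"
proof -
 have "0 \<le> C * jbr (of_int 0) powr (-2)"
  by (rule order_trans[OF norm_ge_zero assms])
 then have C: "0 \<le> C" by (simp add: jbr_def)
 have "nns (\<lambda>n. norm (a n)) \<le>
   (\<integral>\<^sup>+n. ennreal C * ennreal (jbr (of_int n) powr (-2)) \<partial>ZZ)"
  using assms C by (intro nn_integral_mono) (auto simp: ennreal_mult[symmetric] intro!: ennreal_leI)
 also have "\<dots> < \<infinity>"
  using sum_jbr_finite[of 2] by (simp add: nn_integral_cmult ennreal_mult_less_top)
 finally show ?thesis by (intro integrableI_bounded) auto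
qed

lemma trig_series_continuous:
 assumes "integrable ZZ (a :: int => complex)"
 shows "continuous_on UNIV (\<lambda>x. \<integral>k. a k * cis (of_int k * x) \<partial>ZZ)"
 unfolding continuous_on_sequentially
proof (intro allI ballI impI)
 fix u and x :: real assume "(\<forall>n. u n \<in> UNIV) \<and> u \<longlonglongrightarrow> x"
 then have u: "u \<longlonglongrightarrow> x" by simp
 show "((\<lambda>x. \<integral>k. a k * cis (of_int k * x) \<partial>ZZ) \<circ> u) \<longlonglongrightarrow>
   (\<integral>k. a k * cis (of_int k * x) \<partial>ZZ)"
  unfolding o_def
  by (rule integral_dominated_convergence[where w="\<lambda>k. norm (a k)"])
   (use assms u in \<open>auto simp: norm_mult intro!: tendsto_intros\<close>)
qed

lemma integrable_trig_series:
 assumes "integrable ZZ (a :: int => complex)"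
 shows "integrable ZZ (\<lambda>k. a k * cis (f k))"
 using integrable_cis_mult[OF assms, of f] by (simp add: mult.commute)

text \<open>Absolute summability is asked of the first factor alone; the second is merely continuous
  and enters through its own coefficients. Fubini then gives the convolution.\<close>

lemma fcoeff_trig_series_mult:
 assumes a: "integrable ZZ (a :: int => complex)" and B: "continuous_on UNIV B"
 shows "fcoeff (\<lambda>x. (\<integral>k. a k * cis (of_int k * x) \<partial>ZZ) * B x) n =
  (\<integral>k. a k * fcoeff B (n - k) \<partial>ZZ)"
proof -
 have [measurable]: "B \<in> bor" using B by (intro borel_measurable_continuous_onI)
 define b where "b x = indicator {-pi..pi} x *\<^sub>R B x" for x
 have b: "integrable lborel b"
  using set_integrable_continuous[OF B] by (simp add: b_def[abs_def] set_integrable_def)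
 have [measurable]: "b \<in> bor" using b by auto
 have int: "integrable (count_space UNIV \<Otimes>\<^sub>M lborel) (\<lambda>(k, x). a k * cis (of_int k * x) * (cis (- (of_int n * x)) * b x))"
  by (rule P.integrable_mult_prod[OF a b]) (auto simp: norm_mult)
 have "(LBINT x:{-pi..pi}. cis (- (of_int n * x)) * ((\<integral>k. a k * cis (of_int k * x) \<partial>ZZ) * B x)) =
   (LBINT x. \<integral>k. a k * cis (of_int k * x) * (cis (- (of_int n * x)) * b x) \<partial>ZZ)"
  unfolding set_lebesgue_integral_def
  by (intro Bochner_Integration.integral_cong) (auto simp: b_def indicator_def)
 also have "\<dots> = (\<integral>k. (LBINT x. a k * cis (of_int k * x) * (cis (- (of_int n * x)) * b x)) \<partial>ZZ)"
  by (rule P.Fubini_integral[OF int])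
 also have "\<dots> = (\<integral>k. a k * (2 * of_real pi * fcoeff B (n - k)) \<partial>ZZ)"
 proof (rule Bochner_Integration.integral_cong[OF refl])
  fix k
  have "cis (- (of_int (n - k) * x)) = cis (of_int k * x) * cis (- (of_int n * x))" for x
   by (simp add: cis_mult left_diff_distrib)
  then have "(LBINT x. a k * cis (of_int k * x) * (cis (- (of_int n * x)) * b x)) =
    (LBINT x. a k * (indicator {-pi..pi} x *\<^sub>R (cis (- (of_int (n - k) * x)) * B x)))"
   by (intro Bochner_Integration.integral_cong) (auto simp: b_def indicator_def)
  then show "(LBINT x. a k * cis (of_int k * x) * (cis (- (of_int n * x)) * b x)) =
    a k * (2 * of_real pi * fcoeff B (n - k))"
   by (simp only: integral_mult_right_zero fcoeff_cis set_lebesgue_integral_def) simp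
 qed
 also have "\<dots> = 2 * of_real pi * (\<integral>k. a k * fcoeff B (n - k) \<partial>ZZ)"
  unfolding integral_mult_right_zero[symmetric] by (simp only: mult.left_commute)
 finally show ?thesis by (simp add: fcoeff_cis)
qed

lemma fcoeff_trig_series:
 assumes a: "integrable ZZ (a :: int => complex)"
 shows "fcoeff (\<lambda>x. \<integral>k. a k * cis (of_int k * x) \<partial>ZZ) n = a n"
proof -
 have "fcoeff (\<lambda>x. 1) m = (if m = 0 then 1 else 0)" for m
  using fcoeff_cis_cis[of 0 m] by simp
 then have "fcoeff (\<lambda>x. \<integral>k. a k * cis (of_int k * x) \<partial>ZZ) n =
   (\<integral>k. a k * (if n - k = 0 then 1 else 0) \<partial>ZZ)"
  using fcoeff_trig_series_mult[OF a continuous_on_const[of UNIV 1], of n] by simp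
 also have "\<dots> = (\<integral>k. indicator {n} k *\<^sub>R a n \<partial>ZZ)"
  by (intro Bochner_Integration.integral_cong) (auto simp: indicator_def)
 also have "\<dots> = a n" by simp
 finally show ?thesis .
qed

section \<open>Smooth periodic functions\<close>

definition smooth_periodic :: "(real => complex) => bool" where
 "smooth_periodic f \<longleftrightarrow> jet (\<lambda>g. \<forall>x. g (x + 2 * pi) = g x) f"

lemma periodic_deriv:
 assumes "\<And>x. (f has_vector_derivative f' x) (at x)" "\<And>x. f (x + c) = f x"
 shows "f' (x + c) = (f' x :: complex)"
proof -
 have "((\<lambda>x. x + c) has_vector_derivative 1) (at x)"
  by (auto intro!: derivative_eq_intros)
 then have "((\<lambda>x. f (x + c)) has_vector_derivative f' (x + c)) (at x)"
  using vector_diff_chain_at[of "\<lambda>x. x + c" 1 x f "f' (x + c)"] assms(1)[of "x + c"]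
  by (simp add: o_def)
 then have "(f has_vector_derivative f' (x + c)) (at x)" by (simp add: assms(2))
 then show ?thesis using assms(1) vector_derivative_unique_at by blast
qed

lemma smooth_torus_eq: "smooth_torus = Collect smooth_periodic"
proof (intro set_eqI iffI)
 fix f assume "f \<in> smooth_torus"
 then obtain D where D: "\<And>x. f (x + 2 * pi) = f x" "D 0 = f" "\<And>j x. (D j has_vector_derivative D (Suc j) x) (at x)"
  unfolding smooth_torus_def by auto
 have "\<forall>x. D j (x + 2 * pi) = D j x" for j
 proof (induction j)
  case (Suc j)
  then show ?case using periodic_deriv[OF D(3)[of j]] by blast
 qed (use D in auto)
 then show "f \<in> Collect smooth_periodic"
  unfolding smooth_periodic_def jet_def using D by auto
next
 fix f assume "f \<in> Collect smooth_periodic"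
 then show "f \<in> smooth_torus"
  unfolding smooth_periodic_def smooth_torus_def jet_def by auto
qed

lemma smooth_periodic_deriv:
 assumes "smooth_periodic f"
 obtains f' where "smooth_periodic f'" "\<And>x. (f has_vector_derivative f' x) (at x)"
 using assms unfolding smooth_periodic_def by (rule jet_deriv) auto

lemma smooth_periodic_continuous: "smooth_periodic f ==> continuous_on S f"
 unfolding smooth_periodic_def by (rule jet_continuous)

lemma smooth_periodic_per: "smooth_periodic f ==> f (x + 2 * pi) = f x"
 unfolding smooth_periodic_def using jet_imp by blast

lemma fcoeff_bounded:
 assumes "continuous_on UNIV f"
 obtains C where "0 \<le> C" "\<And>n. norm (fcoeff f n) \<le> C"
proof -
 have "bounded (f ` {-pi..pi})"
  by (intro compact_imp_bounded compact_continuous_image continuous_on_subset[OF assms]) auto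
 then obtain C where C: "0 < C" "\<And>x. x \<in> {-pi..pi} ==> norm (f x) \<le> C"
  by (auto simp: bounded_pos)
 then show ?thesis
  using assms by (intro that[of C] norm_fcoeff_le borel_measurable_continuous_onI) auto
qed

lemma fcoeff_decay:
 assumes f: "smooth_periodic f"
 obtains C where "0 \<le> C" "\<And>n. norm (fcoeff f n) \<le> C * jbr (of_int n) powr (-2)"
proof -
 obtain f' where f': "smooth_periodic f'" "\<And>x. (f has_vector_derivative f' x) (at x)"
  using f by (rule smooth_periodic_deriv) auto
 obtain f'' where f'': "smooth_periodic f''" "\<And>x. (f' has_vector_derivative f'' x) (at x)"
  using f'(1) by (rule smooth_periodic_deriv) auto
 note c = smooth_periodic_continuous[OF f] smooth_periodic_continuous[OF f'(1)] smooth_periodic_continuous[OF f''(1)]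
 have e: "fcoeff f'' n = \<i> * of_int n * (\<i> * of_int n * fcoeff f n)" for n
  using fcoeff_deriv[OF f'(2) c(2) smooth_periodic_per[OF f]] fcoeff_deriv[OF f''(2) c(3) smooth_periodic_per[OF f'(1)]]
  by simp
 obtain A where A: "0 \<le> A" "\<And>n. norm (fcoeff f n) \<le> A" by (rule fcoeff_bounded[OF c(1)]) auto
 obtain B where B: "0 \<le> B" "\<And>n. norm (fcoeff f'' n) \<le> B" by (rule fcoeff_bounded[OF c(3)]) auto
 have "norm (fcoeff f n) \<le> (A + B) * jbr (of_int n) powr (-2)" for n
 proof -
  have "norm (fcoeff f'' n) = (of_int n)\<^sup>2 * norm (fcoeff f n)"
   by (simp add: e norm_mult power2_eq_square)
  then have "(1 + (of_int n)\<^sup>2) * norm (fcoeff f n) \<le> A + B"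
   using A(2)[of n] B(2)[of n] by (simp add: distrib_right)
  then have "norm (fcoeff f n) \<le> (A + B) / (1 + (of_int n)\<^sup>2)"
   by (subst pos_le_divide_eq) (simp_all add: add_pos_nonneg mult.commute)
  moreover have "jbr (of_int n) powr (-2) = inverse (1 + (of_int n)\<^sup>2)"
   using jbr_powr_double[of "of_int n" "-1"] by (simp add: powr_minus)
  ultimately show ?thesis by (simp add: divide_inverse)
 qed
 then show ?thesis using A B that[of "A + B"] by auto
qed

lemma fcoeff_integrable_count_space:
 assumes "smooth_periodic f"
 shows "integrable ZZ (fcoeff f)"
 using assms by (rule fcoeff_decay) (rule integrable_count_space_decay)

text \<open>The difference of the two sides is continuous and periodic with vanishing coefficients,
  so uniqueness gives pointwise equality.\<close>

theorem fourier_series: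
 assumes f: "smooth_periodic f" and x: "x \<in> {-pi..pi}"
 shows "f x = (\<integral>k. fcoeff f k * cis (of_int k * x) \<partial>ZZ)"
proof -
 note a = fcoeff_integrable_count_space[OF f]
 note c = trig_series_continuous[OF a]
 have "f x - (\<integral>k. fcoeff f k * cis (of_int k * x) \<partial>ZZ) = 0"
 proof (rule fcoeff_zero_imp_zero[OF _ _ _ x])
  show "continuous_on UNIV (\<lambda>x. f x - (\<integral>k. fcoeff f k * cis (of_int k * x) \<partial>ZZ))"
   by (intro continuous_on_diff c smooth_periodic_continuous f)
  show "fcoeff (\<lambda>x. f x - (\<integral>k. fcoeff f k * cis (of_int k * x) \<partial>ZZ)) n = 0" for n
   by (subst fcoeff_diff) (auto intro!: set_integrable_continuous c smooth_periodic_continuous f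
    simp: fcoeff_trig_series[OF a])
 qed (simp add: smooth_periodic_per[OF f] cis_int_plus_2pi)
 then show ?thesis by simp
qed

lemma fcoeff_cnj: "fcoeff (\<lambda>x. cnj (f x)) n = cnj (fcoeff f (- n))"
proof -
 have "cnj (LBINT x. indicator {-pi..pi} x *\<^sub>R (cis (of_int n * x) * f x)) =
   (LBINT x. cnj (indicator {-pi..pi} x *\<^sub>R (cis (of_int n * x) * f x)))"
  by (rule Bochner_Integration.integral_cnj[symmetric])
 then show ?thesis
  by (simp add: fcoeff_cis set_lebesgue_integral_def cis_cnj)
qed

lemma fcoeff_cong:
 assumes "\<And>x. x \<in> {-pi..pi} ==> f x = g x"
 shows "fcoeff f n = fcoeff g n"
 unfolding fcoeff_cis set_lebesgue_integral_def
 by (intro arg_cong[where f="\<lambda>x. x / _"] Bochner_Integration.integral_cong) (auto simp: assms indicator_def)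

lemma fcoeff_cnj_mult:
 assumes a: "integrable ZZ (a :: int => complex)" and B: "continuous_on UNIV B"
  and A: "\<And>x. x \<in> {-pi..pi} ==> A x = (\<integral>k. a k * cis (of_int k * x) \<partial>ZZ)"
 shows "fcoeff (\<lambda>x. cnj (A x) * cnj (B x)) n = cnj (\<integral>k. a k * fcoeff B (- n - k) \<partial>ZZ)"
proof -
 have "fcoeff (\<lambda>x. cnj (A x) * cnj (B x)) n = cnj (fcoeff (\<lambda>x. A x * B x) (- n))"
  using fcoeff_cnj[of "\<lambda>x. A x * B x"] by simp
 also have "fcoeff (\<lambda>x. A x * B x) (- n) =
   fcoeff (\<lambda>x. (\<integral>k. a k * cis (of_int k * x) \<partial>ZZ) * B x) (- n)"
  by (intro fcoeff_cong) (simp add: A)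
 finally show ?thesis by (simp only: fcoeff_trig_series_mult[OF a B])
qed

subsection \<open>Smooth space-time functions\<close>

lemma norm_diff_le_deriv:
 fixes f :: "real => complex"
 assumes "\<And>x. (f has_vector_derivative f' x) (at x)" "\<And>x. x \<in> closed_segment s t ==> norm (f' x) \<le> B"
 shows "norm (f s - f t) \<le> B * \<bar>s - t\<bar>"
proof -
 have "norm (f s - f t) \<le> B * norm (s - t)"
 proof (rule differentiable_bound[where S="closed_segment s t" and f'="\<lambda>x h. h *\<^sub>R f' x"])
  show "(f has_derivative (\<lambda>h. h *\<^sub>R f' x)) (at x within closed_segment s t)" for x
   using assms(1)[of x] by (auto simp: has_vector_derivative_def intro: has_derivative_at_withinI)
  show "onorm (\<lambda>h. h *\<^sub>R f' x) \<le> B" if "x \<in> closed_segment s t" for x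
   by (rule onorm_bound)
    (use assms(2)[OF that] order_trans[OF norm_ge_zero assms(2)[OF that]] in
     \<open>auto simp: mult.commute[of B] intro: mult_left_mono\<close>)
 qed auto
 then show ?thesis by simp
qed

lemma taylor_second_order:
 fixes f :: "real => complex"
 assumes "\<And>x. (f has_vector_derivative f' x) (at x)" "\<And>x. (f' has_vector_derivative f'' x) (at x)"
  "\<And>x. norm (f'' x) \<le> B"
 shows "norm (f s - f t - (s - t) *\<^sub>R f' t) \<le> B * (s - t)\<^sup>2"
proof -
 define g where "g x = f x - x *\<^sub>R f' t" for x
 have "norm (g s - g t) \<le> (B * \<bar>s - t\<bar>) * \<bar>s - t\<bar>"
 proof (rule norm_diff_le_deriv[where f'="\<lambda>x. f' x - f' t"])
  show "(g has_vector_derivative f' x - f' t) (at x)" for x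
   unfolding g_def
   by (rule has_vector_derivative_diff[OF assms(1)]) (auto intro!: derivative_eq_intros)
  show "norm (f' x - f' t) \<le> B * \<bar>s - t\<bar>" if "x \<in> closed_segment s t" for x
  proof -
   have "norm (f' x - f' t) \<le> B * \<bar>x - t\<bar>"
    by (rule norm_diff_le_deriv[OF assms(2)]) (rule assms(3))
   also have "\<dots> \<le> B * \<bar>s - t\<bar>"
    using that order_trans[OF norm_ge_zero assms(3)]
    by (intro mult_left_mono) (auto simp: closed_segment_eq_real_ivl split: if_splits)
   finally show ?thesis .
  qed
 qed
 moreover have "g s - g t = f s - f t - (s - t) *\<^sub>R f' t"
  by (simp add: g_def algebra_simps)
 moreover have "(B * \<bar>s - t\<bar>) * \<bar>s - t\<bar> = B * (s - t)\<^sup>2"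
 proof -
  have "(s - t)\<^sup>2 = \<bar>s - t\<bar> * \<bar>s - t\<bar>" by (simp add: power2_eq_square)
  then show ?thesis by simp
 qed
 ultimately show ?thesis by simp
qed

text \<open>Periodicity is demanded of all mixed derivatives, so that a shifted family is again of
  this kind (\<open>ss_jet_shift\<close>); \<open>smooth_schwartz\<close> asks it of
  \<open>F\<close> alone.\<close>

definition ss_jet :: "(real => real => complex) => (nat => nat => real => real => complex) => bool" where
 "ss_jet F D \<longleftrightarrow> D 0 0 = F \<and>
   (\<forall>j l t x. ((\<lambda>r. D j l r x) has_vector_derivative D (Suc j) l t x) (at t)) \<and>
   (\<forall>j l t x. ((\<lambda>y. D j l t y) has_vector_derivative D j (Suc l) t x) (at x)) \<and>
   (\<forall>j l k. \<exists>C. \<forall>t x. \<bar>t\<bar> ^ k * norm (D j l t x) \<le> C) \<and>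
   (\<forall>j l t x. D j l t (x + 2 * pi) = D j l t x)"

lemma smooth_schwartz_iff: "F \<in> smooth_schwartz \<longleftrightarrow> (\<exists>D. ss_jet F D)"
proof
 assume "F \<in> smooth_schwartz"
 then obtain D where D: "D 0 0 = F"
    "\<And>j l t x. ((\<lambda>r. D j l r x) has_vector_derivative D (Suc j) l t x) (at t)"
    "\<And>j l t x. ((\<lambda>y. D j l t y) has_vector_derivative D j (Suc l) t x) (at x)"
    "\<forall>j l k. \<exists>C. \<forall>t x. \<bar>t\<bar> ^ k * norm (D j l t x) \<le> C" "\<And>t x. F t (x + 2 * pi) = F t x"
  unfolding smooth_schwartz_def mem_Collect_eq by blast
 have "D j 0 t (x + 2 * pi) = D j 0 t x" for j t x
 proof (induction j arbitrary: t)
  case (Suc j)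
  have "(\<lambda>r. D j 0 r (x + 2 * pi)) = (\<lambda>r. D j 0 r x)" using Suc by auto
  then show ?case using D(2)[of j 0 "x + 2 * pi" t] D(2)[of j 0 x t] vector_derivative_unique_at by metis
 qed (use D in auto)
 then have "D j l t (x + 2 * pi) = D j l t x" for j l t x
 proof (induction l arbitrary: x)
  case (Suc l)
  then show ?case using periodic_deriv[OF D(3)[of j l t], of "2 * pi" x] by blast
 qed
 then show "\<exists>D. ss_jet F D"
  unfolding ss_jet_def by (intro exI[of _ D] conjI allI) (use D in blast)+
next
 assume "\<exists>D. ss_jet F D"
 then obtain D where "ss_jet F D" by blast
 then show "F \<in> smooth_schwartz"
  unfolding ss_jet_def smooth_schwartz_def mem_Collect_eq
  by (intro exI[of _ D] conjI) auto
qed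

lemma ss_jet_shift: "ss_jet F D ==> ss_jet (D j l) (\<lambda>a b. D (j + a) (l + b))"
 unfolding ss_jet_def by auto

lemma ss_jet_bound:
 assumes "ss_jet F D"
 obtains C where "0 \<le> C" "\<And>t x. norm (F t x) \<le> C" "\<And>t x. norm (F t x) \<le> C * jbr t powr (-2)"
  "\<And>t x. \<bar>t\<bar> ^ k * norm (F t x) \<le> C"
proof -
 have "\<exists>C. \<forall>t x. \<bar>t\<bar> ^ k * norm (F t x) \<le> C" for k
  using assms unfolding ss_jet_def by metis
 then obtain C where C: "\<And>k t x. \<bar>t\<bar> ^ k * norm (F t x) \<le> C k" by metis
 have C0: "0 \<le> C k" for k using C[of 0 k undefined] by (rule order_trans[rotated]) auto
 have b: "norm (F t x) \<le> C 0" "t\<^sup>2 * norm (F t x) \<le> C 2" for t x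
  using C[of t 0 x] C[of t 2 x] by auto
 have j: "jbr t powr (-2) = inverse (1 + t\<^sup>2)" for t
  using jbr_powr_double[of t "-1"] by (simp add: powr_minus)
 define A where "A = C 0 + C 2 + C k"
 have "norm (F t x) \<le> A * jbr t powr (-2)" for t x
 proof -
  have "(1 + t\<^sup>2) * norm (F t x) \<le> A"
   using b[of t x] C0[of k] by (simp add: distrib_right A_def)
  then have "norm (F t x) \<le> A / (1 + t\<^sup>2)"
   by (subst pos_le_divide_eq) (simp_all add: add_pos_nonneg mult.commute)
  then show ?thesis by (simp add: j divide_inverse)
 qed
 moreover have "norm (F t x) \<le> A" "\<bar>t\<bar> ^ k * norm (F t x) \<le> A" for t x
  using C[of t k x] C[of t 0 x] C0[of k] C0[of 0] C0[of 2] by (auto simp: A_def)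
 moreover have "0 \<le> A" using C0[of k] C0[of 0] C0[of 2] by (auto simp: A_def)
 ultimately show ?thesis using that by blast
qed

lemma ss_jet_periodic:
 assumes "ss_jet F D"
 shows "smooth_periodic (F t)"
 unfolding smooth_periodic_def jet_def
 using assms unfolding ss_jet_def by (intro exI[of _ "\<lambda>l. D 0 l t"]) auto

lemma ss_jet_fcoeff_x:
 assumes "ss_jet F D"
 shows "fcoeff (D 0 1 t) n = \<i> * of_int n * fcoeff (F t) n"
proof (rule fcoeff_deriv)
 show "(F t has_vector_derivative D 0 1 t x) (at x)" for x
  using assms unfolding ss_jet_def One_nat_def by metis
 show "continuous_on UNIV (D 0 1 t)"
  by (rule smooth_periodic_continuous[OF ss_jet_periodic[OF ss_jet_shift[OF assms]]])
qed (use assms in \<open>auto simp: ss_jet_def\<close>)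

lemma ss_jet_fcoeff_rapid:
 assumes "ss_jet F D"
 shows "rapid (\<lambda>t. fcoeff (F t) n)"
 unfolding rapid_def
proof
 fix k
 obtain C where C: "\<And>t x. \<bar>t\<bar> ^ k * norm (F t x) \<le> C"
  using assms by (rule ss_jet_bound) auto
 have "\<bar>t\<bar> ^ k * norm (fcoeff (F t) n) \<le> C" for t
 proof -
  have "norm (fcoeff (\<lambda>x. of_real (\<bar>t\<bar> ^ k) * F t x) n) \<le> C"
  proof (rule norm_fcoeff_le)
   show "(\<lambda>x. of_real (\<bar>t\<bar> ^ k) * F t x) \<in> bor"
    by (intro borel_measurable_continuous_onI continuous_intros smooth_periodic_continuous[OF ss_jet_periodic[OF assms]])
   show "norm (of_real (\<bar>t\<bar> ^ k) * F t x) \<le> C" for x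
    using C[of t x] by (simp add: norm_mult norm_power)
  qed
  then show ?thesis by (simp add: fcoeff_cmult norm_mult norm_power)
 qed
 then show "\<exists>C. \<forall>t. \<bar>t\<bar> ^ k * norm (fcoeff (F t) n) \<le> C" by blast
qed

text \<open>\<open>taylor_second_order\<close> bounds the remainder uniformly in \<open>x\<close>,
  and taking a Fourier coefficient does not increase a uniform bound.\<close>

lemma ss_jet_fcoeff_deriv:
 assumes D: "ss_jet F D"
 shows "((\<lambda>t. fcoeff (F t) n) has_vector_derivative fcoeff (D 1 0 t) n) (at t)"
proof -
 obtain C where C: "0 \<le> C" "\<And>t x. norm (D 2 0 t x) \<le> C"
  using ss_jet_shift[OF D, of 2 0] by (rule ss_jet_bound) auto
 have c: "continuous_on UNIV (F s)" "continuous_on UNIV (D 1 0 s)" for s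
  using smooth_periodic_continuous[OF ss_jet_periodic[OF D]]
   smooth_periodic_continuous[OF ss_jet_periodic[OF ss_jet_shift[OF D]]] by auto
 show ?thesis
 proof (rule has_vector_derivative_quadratic[where C=C])
  fix s
  have "fcoeff (F s) n - fcoeff (F t) n - (s - t) *\<^sub>R fcoeff (D 1 0 t) n =
    fcoeff (\<lambda>x. F s x - F t x - of_real (s - t) * D 1 0 t x) n"
  proof -
   have "fcoeff (\<lambda>x. F s x - F t x - of_real (s - t) * D 1 0 t x) n =
     fcoeff (\<lambda>x. F s x - F t x) n - fcoeff (\<lambda>x. of_real (s - t) * D 1 0 t x) n"
    by (intro fcoeff_diff set_integrable_continuous continuous_intros c)
   also have "fcoeff (\<lambda>x. F s x - F t x) n = fcoeff (F s) n - fcoeff (F t) n"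
    by (intro fcoeff_diff set_integrable_continuous c)
   finally show ?thesis by (simp only: fcoeff_cmult scaleR_conv_of_real)
  qed
  also have "norm \<dots> \<le> C * (s - t)\<^sup>2"
  proof (rule norm_fcoeff_le)
   show "(\<lambda>x. F s x - F t x - of_real (s - t) * D 1 0 t x) \<in> bor"
    by (intro borel_measurable_continuous_onI continuous_intros c)
   fix x
   have "norm (F s x - F t x - (s - t) *\<^sub>R D 1 0 t x) \<le> C * (s - t)\<^sup>2"
   proof (rule taylor_second_order[where f''="\<lambda>r. D 2 0 r x"])
    show "((\<lambda>r. F r x) has_vector_derivative D 1 0 r x) (at r)"
       "((\<lambda>r. D 1 0 r x) has_vector_derivative D 2 0 r x) (at r)" for r
     using D unfolding ss_jet_def One_nat_def numeral_2_eq_2 by metis+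
   qed (rule C)
   then show "norm (F s x - F t x - of_real (s - t) * D 1 0 t x) \<le> C * (s - t)\<^sup>2"
    by (simp only: scaleR_conv_of_real)
  qed
  finally show "norm (fcoeff (F s) n - fcoeff (F t) n - (s - t) *\<^sub>R fcoeff (D 1 0 t) n) \<le> C * (s - t)\<^sup>2" .
 qed
qed

lemma smooth_schwartz_fcoeff:
 assumes "F \<in> smooth_schwartz"
 shows "(\<lambda>t. fcoeff (F t) n) \<in> schwartz"
 unfolding schwartz_eq mem_Collect_eq
proof (rule jet_coinduct[where S="{\<lambda>t. fcoeff (F t) n | F. \<exists>D. ss_jet F D}"])
 fix g assume "g \<in> {\<lambda>t. fcoeff (F t) n | F. \<exists>D. ss_jet F D}"
 then obtain F D where F: "g = (\<lambda>t. fcoeff (F t) n)" "ss_jet F D" by auto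
 show "rapid g \<and> (\<exists>g'\<in>{\<lambda>t. fcoeff (F t) n | F. \<exists>D. ss_jet F D}. \<forall>t. (g has_vector_derivative g' t) (at t))"
  using ss_jet_fcoeff_rapid[OF F(2)] ss_jet_fcoeff_deriv[OF F(2)] ss_jet_shift[OF F(2), of 1 0]
  unfolding F(1) by (intro conjI bexI[where x="\<lambda>t. fcoeff (D 1 0 t) n"]) auto
qed (use assms in \<open>auto simp: smooth_schwartz_iff\<close>)

lemma st_fourier_eq_ft: "st_fourier F y n = ft (\<lambda>t. fcoeff (F t) n) y"
proof -
 have "(LBINT x:{-pi..pi}. exp (- (\<i> * of_real (y * t + of_int n * x))) * F t x) =
   cis (- (y * t)) * (2 * of_real pi * fcoeff (F t) n)" for t
 proof -
  have "exp (- (\<i> * of_real (y * t + of_int n * x))) = cis (- (y * t)) * cis (- (of_int n * x))" for x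
   by (simp add: cis_conv_exp exp_add[symmetric] algebra_simps)
  then have "(LBINT x:{-pi..pi}. exp (- (\<i> * of_real (y * t + of_int n * x))) * F t x) =
    2 * of_real pi * fcoeff (\<lambda>x. cis (- (y * t)) * F t x) n"
   by (simp add: fcoeff_cis mult_ac)
  then show ?thesis by (simp only: fcoeff_cmult mult.left_commute)
 qed
 then have "st_fourier F y n = (LBINT t. 2 * of_real pi * (cis (- (y * t)) * fcoeff (F t) n)) / (2 * of_real pi)"
  unfolding st_fourier_def by (simp only: mult.left_commute)
 also have "\<dots> = (LBINT t. cis (- (y * t)) * fcoeff (F t) n)"
  by (simp only: integral_mult_right_zero) simp
 finally show ?thesis by (simp add: ft_def)
qed

text \<open>The constant must not depend on \<open>n\<close>: it is the integral of a majorant in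
  \<open>t\<close> that is common to all coefficients.\<close>

lemma ss_jet_ft_bound:
 assumes D: "ss_jet F D"
 obtains C where "0 \<le> C" "\<And>n y. norm (ft (\<lambda>t. fcoeff (F t) n) y) \<le> C * jbr y powr (-2)"
proof -
 obtain C where C: "0 \<le> C" "\<And>t x. norm (F t x) \<le> C * jbr t powr (-2)"
  using D by (rule ss_jet_bound) auto
 obtain B where B: "0 \<le> B" "\<And>t x. norm (D 2 0 t x) \<le> B * jbr t powr (-2)"
  using ss_jet_shift[OF D, of 2 0] by (rule ss_jet_bound) auto
 have c: "continuous_on UNIV (F s)" "continuous_on UNIV (D 2 0 s)" for s
  using smooth_periodic_continuous[OF ss_jet_periodic[OF D]]
   smooth_periodic_continuous[OF ss_jet_periodic[OF ss_jet_shift[OF D]]] by auto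
 define K where "K = (LBINT t. (C + B) * jbr t powr (-2))"
 have "norm (ft (\<lambda>t. fcoeff (F t) n) y) \<le> K * jbr y powr (-2)" for n y
 proof -
  have le: "norm (fcoeff (F t) n - fcoeff (D 2 0 t) n) \<le> (C + B) * jbr t powr (-2)" for t
  proof -
   have "norm (fcoeff (F t) n) \<le> C * jbr t powr (-2)"
    by (rule norm_fcoeff_le) (auto intro!: borel_measurable_continuous_onI c C)
   moreover have "norm (fcoeff (D 2 0 t) n) \<le> B * jbr t powr (-2)"
    by (rule norm_fcoeff_le) (auto intro!: borel_measurable_continuous_onI c B)
   ultimately show ?thesis
    using norm_triangle_ineq4[of "fcoeff (F t) n" "fcoeff (D 2 0 t) n"] by (simp add: distrib_right)
  qed
  have d1: "((\<lambda>t. fcoeff (F t) n) has_vector_derivative fcoeff (D 1 0 t) n) (at t)" for t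
   by (rule ss_jet_fcoeff_deriv[OF D])
  have d2: "((\<lambda>t. fcoeff (D 1 0 t) n) has_vector_derivative fcoeff (D 2 0 t) n) (at t)" for t
   using ss_jet_fcoeff_deriv[OF ss_jet_shift[OF D, of 1 0]] by (simp add: numeral_2_eq_2)
  have d3: "((\<lambda>t. fcoeff (D 2 0 t) n) has_vector_derivative fcoeff (D 3 0 t) n) (at t)" for t
   using ss_jet_fcoeff_deriv[OF ss_jet_shift[OF D, of 2 0]] by (simp add: numeral_2_eq_2 numeral_3_eq_3)
  note r = ss_jet_fcoeff_rapid[OF D] ss_jet_fcoeff_rapid[OF ss_jet_shift[OF D]]
  have "continuous_on UNIV (\<lambda>t. fcoeff (D 2 0 t) n)"
   using d3 by (meson continuous_at_imp_continuous_on has_vector_derivative_continuous)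
  from ft_decay[OF d1 r(1) r(2) d2 r(2) this]
  have "norm (ft (\<lambda>t. fcoeff (F t) n) y) \<le>
    (LBINT t. norm (fcoeff (F t) n - fcoeff (D 2 0 t) n)) * jbr y powr (-2)" .
  also have "\<dots> \<le> K * jbr y powr (-2)"
   unfolding K_def
   by (intro mult_right_mono integral_mono' integrable_mult_right integrable_jbr le)
    (auto intro!: mult_nonneg_nonneg add_nonneg_nonneg B C)
  finally show ?thesis .
 qed
 moreover have "0 \<le> K" unfolding K_def using B C by (intro integral_nonneg_AE) auto
 ultimately show ?thesis using that by blast
qed

text \<open>The decay has to beat the weight \<open>jbr (y + n\<^sup>2) powr (2 * b)\<close>, which
  for \<open>b \<le> 1\<close> can be of second order in \<open>y\<close> and of fourth order in
  \<open>n\<close>. Two derivatives in time and four in space suffice.\<close>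

lemma smooth_schwartz_st_fourier_bound:
 assumes "F \<in> smooth_schwartz"
 obtains C where "0 \<le> C" "\<And>n y. norm (st_fourier F y n) \<le> C * (jbr y powr (-2) * jbr (of_int n) powr (-4))"
proof -
 obtain D where D: "ss_jet F D" using assms smooth_schwartz_iff by blast
 obtain A where A: "0 \<le> A" "\<And>n y. norm (ft (\<lambda>t. fcoeff (F t) n) y) \<le> A * jbr y powr (-2)"
  using D by (rule ss_jet_ft_bound) auto
 obtain B where B: "0 \<le> B" "\<And>n y. norm (ft (\<lambda>t. fcoeff (D 0 4 t) n) y) \<le> B * jbr y powr (-2)"
  using ss_jet_shift[OF D, of 0 4] by (rule ss_jet_ft_bound) auto
 have step: "fcoeff (D 0 (Suc l) t) n = \<i> * of_int n * fcoeff (D 0 l t) n" for l t n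
  using ss_jet_fcoeff_x[OF ss_jet_shift[OF D, of 0 l]] by simp
 have "fcoeff (D 0 4 t) n = (\<i> * of_int n) ^ 4 * fcoeff (F t) n" for t n
  using D by (simp add: step numeral_eq_Suc ss_jet_def)
 then have four: "ft (\<lambda>t. fcoeff (D 0 4 t) n) y = of_int n ^ 4 * ft (\<lambda>t. fcoeff (F t) n) y" for n y
  unfolding ft_def by (simp add: power_mult_distrib mult.left_commute[of _ "of_int n ^ 4"])
 have "norm (st_fourier F y n) \<le> (2 * (A + B)) * (jbr y powr (-2) * jbr (of_int n) powr (-4))" for y n
 proof -
  let ?z = "norm (ft (\<lambda>t. fcoeff (F t) n) y)"
  have "(of_int n) ^ 4 * ?z \<le> B * jbr y powr (-2)"
   using B(2)[of n y] by (simp add: four norm_mult norm_power)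
  then have "(1 + (of_int n) ^ 4) * ?z \<le> (A + B) * jbr y powr (-2)"
   using A(2)[of n y] by (simp add: distrib_right)
  then have "2 * ((1 + (of_int n) ^ 4) * ?z) \<le> 2 * ((A + B) * jbr y powr (-2))"
   by (rule mult_left_mono) simp
  moreover have "(1 + (real_of_int n)\<^sup>2)\<^sup>2 \<le> 2 * (1 + (of_int n) ^ 4)"
  proof -
   have "0 \<le> ((real_of_int n)\<^sup>2 - 1)\<^sup>2" by simp
   then show ?thesis by (simp add: power2_eq_square algebra_simps numeral_eq_Suc)
  qed
  then have "(1 + (real_of_int n)\<^sup>2)\<^sup>2 * ?z \<le> 2 * (1 + (of_int n) ^ 4) * ?z"
   by (rule mult_right_mono) simp
  then have "(1 + (real_of_int n)\<^sup>2)\<^sup>2 * ?z \<le> 2 * ((1 + (of_int n) ^ 4) * ?z)"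
   by (simp only: mult.assoc)
  ultimately have "(1 + (real_of_int n)\<^sup>2)\<^sup>2 * ?z \<le> 2 * ((A + B) * jbr y powr (-2))"
   by (rule order_trans[rotated])
  moreover have "1 + (real_of_int n)\<^sup>2 \<noteq> 0"
   using zero_le_power2[of "real_of_int n"] by linarith
  ultimately have "?z \<le> 2 * ((A + B) * jbr y powr (-2)) / (1 + (real_of_int n)\<^sup>2)\<^sup>2"
   by (subst pos_le_divide_eq) (simp_all add: add_pos_nonneg mult.commute)
  moreover have "jbr (of_int n) powr (-4) = inverse ((1 + (real_of_int n)\<^sup>2)\<^sup>2)"
   using jbr_powr_double[of "of_int n" "-2"] powr_realpow[of "1 + (real_of_int n)\<^sup>2" 2]
   by (simp add: powr_minus add_pos_nonneg)
  ultimately show ?thesis by (simp only: st_fourier_eq_ft divide_inverse mult.assoc)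
 qed
 then show ?thesis using A B that[of "2 * (A + B)"] by auto
qed

lemma trig_sum_smooth_schwartz:
 assumes "finite I" "\<And>n. n \<in> I ==> c n \<in> schwartz"
 shows "(\<lambda>t x. \<Sum>n\<in>I. c n t * cis (of_int n * x)) \<in> smooth_schwartz"
proof -
 have "\<exists>D. \<forall>n\<in>I. D n 0 = c n \<and> (\<forall>j t. (D n j has_vector_derivative D n (Suc j) t) (at t)) \<and>
   (\<forall>j k. \<exists>C. \<forall>t. \<bar>t\<bar> ^ k * norm (D n j t) \<le> C)"
  using assms(2) unfolding schwartz_def mem_Collect_eq by (intro bchoice) auto
 then obtain D where D: "\<And>n. n \<in> I ==> D n 0 = c n"
   "\<And>n j t. n \<in> I ==> (D n j has_vector_derivative D n (Suc j) t) (at t)"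
   "\<And>n j k. n \<in> I ==> \<exists>C. \<forall>t. \<bar>t\<bar> ^ k * norm (D n j t) \<le> C"
  by blast
 define E where "E j l t x = (\<Sum>n\<in>I. D n j t * ((\<i> * of_int n) ^ l * cis (of_int n * x)))" for j l :: nat and t x
 have "E 0 0 = (\<lambda>t x. \<Sum>n\<in>I. c n t * cis (of_int n * x))"
  by (auto simp: E_def fun_eq_iff D(1) intro!: sum.cong)
 moreover have "((\<lambda>r. E j l r x) has_vector_derivative E (Suc j) l t x) (at t)" for j l t x
  unfolding E_def
  by (intro has_vector_derivative_sum has_vector_derivative_mult_left D(2))
 moreover have "((\<lambda>y. E j l t y) has_vector_derivative E j (Suc l) t x) (at x)" for j l t x
  unfolding E_def
 proof (intro has_vector_derivative_sum has_vector_derivative_mult_right)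
  fix n
  show "((\<lambda>y. (\<i> * of_int n) ^ l * cis (of_int n * y)) has_vector_derivative (\<i> * of_int n) ^ Suc l * cis (of_int n * x)) (at x)"
   using has_vector_derivative_mult_right[OF cis_has_vector_derivative[of "of_int n" x], of "(\<i> * of_int n) ^ l"]
   by (simp add: mult_ac)
 qed
 moreover have "\<exists>C. \<forall>t x. \<bar>t\<bar> ^ k * norm (E j l t x) \<le> C" for j l k
 proof -
  obtain C where C: "\<And>n t. n \<in> I ==> \<bar>t\<bar> ^ k * norm (D n j t) \<le> C n"
   using D(3)[of _ k j] by metis
  have "\<bar>t\<bar> ^ k * norm (E j l t x) \<le> (\<Sum>n\<in>I. C n * \<bar>of_int n\<bar> ^ l)" for t x
  proof -
   have "\<bar>t\<bar> ^ k * norm (E j l t x) \<le> \<bar>t\<bar> ^ k * (\<Sum>n\<in>I. norm (D n j t * ((\<i> * of_int n) ^ l * cis (of_int n * x))))"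
    unfolding E_def by (intro mult_left_mono norm_sum) auto
   also have "\<dots> = (\<Sum>n\<in>I. (\<bar>t\<bar> ^ k * norm (D n j t)) * \<bar>of_int n\<bar> ^ l)"
    by (simp add: sum_distrib_left norm_mult norm_power mult.assoc)
   also have "\<dots> \<le> (\<Sum>n\<in>I. C n * \<bar>of_int n\<bar> ^ l)"
    by (intro sum_mono mult_right_mono C) auto
   finally show ?thesis .
  qed
  then show ?thesis by blast
 qed
 ultimately show ?thesis
  unfolding smooth_schwartz_def mem_Collect_eq
  by (intro conjI exI[of _ E]) (auto simp: cis_int_plus_2pi)
qed

lemma fcoeff_trig_sum:
 assumes "finite I"
 shows "fcoeff (\<lambda>x. \<Sum>n\<in>I. c n * cis (of_int n * x)) m = (if m \<in> I then c m else 0)"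
 using assms
proof induction
 case empty
 show ?case using fcoeff_cmult[of 0 "\<lambda>x. 0" m] by simp
next
 case (insert k I)
 have "fcoeff (\<lambda>x. c k * cis (of_int k * x) + (\<Sum>n\<in>I. c n * cis (of_int n * x))) m =
   fcoeff (\<lambda>x. c k * cis (of_int k * x)) m + fcoeff (\<lambda>x. \<Sum>n\<in>I. c n * cis (of_int n * x)) m"
  by (intro fcoeff_add set_integrable_continuous continuous_intros)
 then show ?case using insert by (auto simp: fcoeff_cmult fcoeff_cis_cis)
qed

lemma smooth_schwartz_diff:
 assumes "F \<in> smooth_schwartz" "G \<in> smooth_schwartz"
 shows "(\<lambda>t x. F t x - G t x) \<in> smooth_schwartz"
proof -
 obtain D where D: "ss_jet F D" using assms smooth_schwartz_iff by blast
 obtain E where E: "ss_jet G E" using assms smooth_schwartz_iff by blast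
 have "\<exists>C. \<forall>t x. \<bar>t\<bar> ^ k * norm (D j l t x - E j l t x) \<le> C" for j l k
 proof -
  obtain A where A: "\<And>t x. \<bar>t\<bar> ^ k * norm (D j l t x) \<le> A" using D unfolding ss_jet_def by metis
  obtain B where B: "\<And>t x. \<bar>t\<bar> ^ k * norm (E j l t x) \<le> B" using E unfolding ss_jet_def by metis
  have "\<bar>t\<bar> ^ k * norm (D j l t x - E j l t x) \<le> A + B" for t x
  proof -
   have "\<bar>t\<bar> ^ k * norm (D j l t x - E j l t x) \<le> \<bar>t\<bar> ^ k * (norm (D j l t x) + norm (E j l t x))"
    by (intro mult_left_mono norm_triangle_ineq4) auto
   then show ?thesis using A[of t x] B[of t x] by (simp add: distrib_left)
  qed
  then show ?thesis by blast
 qed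
 then have "ss_jet (\<lambda>t x. F t x - G t x) (\<lambda>j l t x. D j l t x - E j l t x)"
  using D E unfolding ss_jet_def by (auto intro!: has_vector_derivative_diff)
 then show ?thesis using smooth_schwartz_iff by blast
qed

lemma smooth_schwartz_continuous_x: "F \<in> smooth_schwartz ==> continuous_on S (F t)"
 using smooth_schwartz_iff ss_jet_periodic smooth_periodic_continuous by blast

lemma fcoeff_smooth_schwartz_diff:
 assumes "F \<in> smooth_schwartz" "G \<in> smooth_schwartz"
 shows "fcoeff (\<lambda>x. F t x - G t x) n = fcoeff (F t) n - fcoeff (G t) n"
 by (intro fcoeff_diff set_integrable_continuous smooth_schwartz_continuous_x assms)

lemma st_fourier_diff:
 assumes "F \<in> smooth_schwartz" "G \<in> smooth_schwartz"
 shows "st_fourier (\<lambda>t x. F t x - G t x) y n = st_fourier F y n - st_fourier G y n"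
 unfolding st_fourier_eq_ft fcoeff_smooth_schwartz_diff[OF assms] ft_def right_diff_distrib
 by (intro Bochner_Integration.integral_diff integrable_cis_mult schwartz_integrable
  smooth_schwartz_fcoeff assms) measurable

subsection \<open>The weighted space on the Fourier side\<close>

abbreviation PM :: "(int \<times> real) measure" where
 "PM \<equiv> count_space UNIV \<Otimes>\<^sub>M lborel"

abbreviation "bPM \<equiv> borel_measurable PM"

text \<open>The second coordinate is the modulation \<open>\<tau> + n\<^sup>2\<close>, not the time
  frequency; in this variable the weight of \<open>Xsb s b\<close> is a product.\<close>

definition wm :: "real => real => (int \<times> real) measure" where
 "wm s b = density PM (\<lambda>z. ennreal (jbr (of_int (fst z)) powr (2 * s) * jbr (snd z) powr (2 * b)))"

lemma measurable_row:
 assumes "f \<in> bPM"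
 shows "(\<lambda>y. f (n, y)) \<in> bor"
proof -
 have "(\<lambda>y. f (n, y)) \<in> borel_measurable lborel"
  by (rule measurable_compose[OF _ assms]) measurable
 then show ?thesis by simp
qed

lemma measurable_PM_iff: "f \<in> bPM \<longleftrightarrow> (\<forall>n. (\<lambda>y. f (n, y)) \<in> bor)"
 using measurable_row measurable_count_space_prod by blast

lemma measurable_wm [simp]: "borel_measurable (wm s b) = bPM"
 unfolding wm_def by (intro measurable_cong_sets) auto

lemma nn_integral_PM:
 assumes "f \<in> bPM"
 shows "(\<integral>\<^sup>+z. f z \<partial>PM) = (\<integral>\<^sup>+n. \<integral>\<^sup>+y. f (n, y) \<partial>lborel \<partial>ZZ)"
 using lborel.nn_integral_fst[OF assms] by simp

definition wt :: "real => real => int => real => real" where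
 "wt s b n y = jbr (of_int n) powr (2 * s) * jbr y powr (2 * b)"

lemma wt_nonneg [simp]: "0 \<le> wt s b n y"
 by (simp add: wt_def)

lemma wt_measurable [measurable]: "wt s b n \<in> bor"
 unfolding wt_def by measurable

lemma sqi_wm:
 assumes "f \<in> bPM"
 shows "sqi (wm s b) f = (\<integral>\<^sup>+n. \<integral>\<^sup>+y. ennreal (wt s b n y * (norm (f (n, y)))\<^sup>2) \<partial>lborel \<partial>ZZ)"
proof -
 have [measurable]: "(\<lambda>y. f (n, y)) \<in> bor" for n
  by (rule measurable_row[OF assms])
 have m: "(\<lambda>z. ennreal (jbr (of_int (fst z)) powr (2 * s) * jbr (snd z) powr (2 * b))) \<in> bPM"
  by (rule measurable_count_space_prod) simp
 have m2: "(\<lambda>z. ennreal ((norm (f z))\<^sup>2)) \<in> bPM"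
  by (rule measurable_count_space_prod) simp
 have "sqi (wm s b) f = (\<integral>\<^sup>+z. ennreal (jbr (of_int (fst z)) powr (2 * s) * jbr (snd z) powr (2 * b)) *
   ennreal ((norm (f z))\<^sup>2) \<partial>PM)"
  unfolding sqi_def wm_def by (rule nn_integral_density[OF m m2])
 also have "\<dots> = (\<integral>\<^sup>+n. \<integral>\<^sup>+y. ennreal (wt s b n y) * ennreal ((norm (f (n, y)))\<^sup>2) \<partial>lborel \<partial>ZZ)"
  by (subst nn_integral_PM) (use m m2 in \<open>auto simp: wt_def intro!: borel_measurable_times_ennreal\<close>)
 finally show ?thesis by (simp add: ennreal_mult)
qed

lemma sqi_wm_row_le:
 assumes "f \<in> bPM"
 shows "nnl (\<lambda>y. wt s b n y * (norm (f (n, y)))\<^sup>2) \<le> sqi (wm s b) f"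
proof -
 have "nnl (\<lambda>y. wt s b n y * (norm (f (n, y)))\<^sup>2) =
   (\<integral>\<^sup>+k. (nnl (\<lambda>y. wt s b k y * (norm (f (k, y)))\<^sup>2)) * indicator {n} k \<partial>ZZ)"
  by (subst nn_integral_indicator_singleton) auto
 also have "\<dots> \<le> sqi (wm s b) f"
  unfolding sqi_wm[OF assms] by (intro nn_integral_mono) (auto split: split_indicator)
 finally show ?thesis .
qed

text \<open>For \<open>1/2 < b\<close>, the square of the constant with which the weighted square
  norm of a row controls its absolute integral. Its finiteness lets elements be evaluated at every
  time.\<close>

definition kb :: "real => real" where
 "kb b = enn2real (nnl (\<lambda>y. jbr y powr (- (2 * b))))"

lemma kb_nonneg [simp]: "0 \<le> kb b"
 by (simp add: kb_def)

lemma ennreal_kb: "1/2 < b ==> ennreal (kb b) = nnl (\<lambda>y. jbr y powr (- (2 * b)))"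
 unfolding kb_def using nn_integral_jbr_finite[of "2 * b"] by (simp add: less_top)

definition rowL1 :: "(int \<times> real => complex) => int => real" where
 "rowL1 f n = (LBINT y. norm (f (n, y)))"

lemma rowL1_nonneg [simp]: "0 \<le> rowL1 f n"
 unfolding rowL1_def by (intro integral_nonneg_AE) auto

lemma row_L1_bound:
 assumes f: "f \<in> bPM" and b: "1/2 < b"
 shows "ennreal (jbr (of_int n) powr (2 * s)) * (nnl (\<lambda>y. norm (f (n, y))))\<^sup>2 \<le>
  ennreal (kb b) * nnl (\<lambda>y. wt s b n y * (norm (f (n, y)))\<^sup>2)"
proof -
 have [measurable]: "(\<lambda>y. f (n, y)) \<in> bor"
  by (rule measurable_row[OF f])
 have "(nnl (\<lambda>y. norm (f (n, y))))\<^sup>2 =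
   (\<integral>\<^sup>+y. ennreal (jbr y powr (- b)) * ennreal (jbr y powr b * norm (f (n, y))) \<partial>lborel)\<^sup>2"
  by (simp add: ennreal_mult[symmetric] mult.assoc[symmetric] powr_add[symmetric])
 also have "\<dots> \<le> (\<integral>\<^sup>+y. (ennreal (jbr y powr (- b)))\<^sup>2 \<partial>lborel) *
   (\<integral>\<^sup>+y. (ennreal (jbr y powr b * norm (f (n, y))))\<^sup>2 \<partial>lborel)"
  by (rule Cauchy_Schwarz_nn_integral) auto
 also have "(\<integral>\<^sup>+y. (ennreal (jbr y powr (- b)))\<^sup>2 \<partial>lborel) = ennreal (kb b)"
  unfolding ennreal_kb[OF b] by (simp add: power2_eq_square ennreal_mult[symmetric] powr_add[symmetric])
 also have "(\<integral>\<^sup>+y. (ennreal (jbr y powr b * norm (f (n, y))))\<^sup>2 \<partial>lborel) =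
   nnl (\<lambda>y. jbr y powr (2 * b) * (norm (f (n, y)))\<^sup>2)"
  by (intro nn_integral_cong) (simp add: ennreal_power power_mult_distrib power2_eq_square[of "_ powr _"] powr_add[symmetric])
 finally have "ennreal (jbr (of_int n) powr (2 * s)) * (nnl (\<lambda>y. norm (f (n, y))))\<^sup>2 \<le>
   ennreal (jbr (of_int n) powr (2 * s)) * (ennreal (kb b) * nnl (\<lambda>y. jbr y powr (2 * b) * (norm (f (n, y)))\<^sup>2))"
  by (rule mult_left_mono) simp
 also have "\<dots> = ennreal (kb b) * (\<integral>\<^sup>+y. ennreal (jbr (of_int n) powr (2 * s)) * ennreal (jbr y powr (2 * b) * (norm (f (n, y)))\<^sup>2) \<partial>lborel)"
  by (subst nn_integral_cmult) (auto simp: mult.left_commute)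
 finally show ?thesis by (simp add: ennreal_mult[symmetric] wt_def mult.assoc)
qed

lemma L2_wm_measurable: "f \<in> L2 (wm s b) ==> f \<in> bPM"
 using L2_measurable[of f "wm s b"] by simp

lemma L2_row_measurable: "f \<in> L2 (wm s b) ==> (\<lambda>y. f (n, y)) \<in> bor"
 by (intro measurable_row L2_wm_measurable)

lemma L2_row_integrable:
 assumes f: "f \<in> L2 (wm s b)" and b: "1/2 < b"
 shows "integrable lborel (\<lambda>y. f (n, y))"
proof (rule integrableI_bounded)
 note m = L2_wm_measurable[OF f]
 have "ennreal (jbr (of_int n) powr (2 * s)) * (nnl (\<lambda>y. norm (f (n, y))))\<^sup>2 \<le>
   ennreal (kb b) * sqi (wm s b) f"
  by (rule order_trans[OF row_L1_bound[OF m b] mult_left_mono[OF sqi_wm_row_le[OF m]]]) simp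
 also have "\<dots> < \<infinity>"
  using f by (simp add: L2_def ennreal_mult_less_top)
 finally have "ennreal (jbr (of_int n) powr (2 * s)) * (nnl (\<lambda>y. norm (f (n, y))))\<^sup>2 < \<infinity>" .
 then show "nnl (\<lambda>y. norm (f (n, y))) < \<infinity>"
  by (auto simp: ennreal_mult_less_top power2_eq_square)
 show "(\<lambda>y. f (n, y)) \<in> borel_measurable lborel"
  using measurable_row[OF m] by simp
qed

lemma ennreal_rowL1:
 assumes "f \<in> L2 (wm s b)" "1/2 < b"
 shows "ennreal (rowL1 f n) = nnl (\<lambda>y. norm (f (n, y)))"
 unfolding rowL1_def using L2_row_integrable[OF assms]
 by (subst nn_integral_eq_integral) auto

lemma rowL1_le:
 assumes f: "f \<in> L2 (wm s b)" and b: "1/2 < b"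
 shows "rowL1 f n \<le> sqrt (kb b) * jbr (of_int n) powr (- s) * l2 (wm s b) f"
proof -
 note m = L2_wm_measurable[OF f]
 have "ennreal (jbr (of_int n) powr (2 * s)) * (ennreal (rowL1 f n))\<^sup>2 \<le> ennreal (kb b) * sqi (wm s b) f"
  unfolding ennreal_rowL1[OF f b]
  by (rule order_trans[OF row_L1_bound[OF m b] mult_left_mono[OF sqi_wm_row_le[OF m]]]) simp
 then have "jbr (of_int n) powr (2 * s) * (rowL1 f n)\<^sup>2 \<le> kb b * (l2 (wm s b) f)\<^sup>2"
  by (simp add: sqi_l2[OF f] ennreal_power ennreal_mult[symmetric])
 then have "(rowL1 f n)\<^sup>2 \<le> jbr (of_int n) powr (- (2 * s)) * (kb b * (l2 (wm s b) f)\<^sup>2)"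
  by (simp add: powr_minus field_simps)
 also have "\<dots> = (sqrt (kb b) * jbr (of_int n) powr (- s) * l2 (wm s b) f)\<^sup>2"
  by (simp add: power_mult_distrib power2_eq_square[of "_ powr _"] powr_add[symmetric])
 finally show ?thesis by (rule power2_le_imp_le) simp
qed

lemma rowL1_sum_le:
 assumes f: "f \<in> L2 (wm 0 b)" and b: "1/2 < b"
 shows "nns (\<lambda>n. (rowL1 f n)\<^sup>2) \<le> ennreal (kb b * (l2 (wm 0 b) f)\<^sup>2)"
proof -
 note m = L2_wm_measurable[OF f]
 have "nns (\<lambda>n. (rowL1 f n)\<^sup>2) \<le>
   (\<integral>\<^sup>+n. ennreal (kb b) * nnl (\<lambda>y. wt 0 b n y * (norm (f (n, y)))\<^sup>2) \<partial>ZZ)"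
  using row_L1_bound[OF m b, of _ 0]
  by (intro nn_integral_mono) (simp add: ennreal_rowL1[OF f b] flip: ennreal_power)
 also have "\<dots> = ennreal (kb b) * sqi (wm 0 b) f"
  by (simp add: nn_integral_cmult sqi_wm[OF m])
 finally show ?thesis by (simp add: sqi_l2[OF f] ennreal_mult)
qed

text \<open>\<open>cv f\<close> is the curve of Fourier coefficients that \<open>f\<close>
  represents, and \<open>ic f\<close> the same curve with the free evolution undone.\<close>

definition ic :: "(int \<times> real => complex) => real => int => complex" where
 "ic f t n = (LBINT y. cis (t * y) * f (n, y))"

definition cv :: "(int \<times> real => complex) => real => int => complex" where
 "cv f t n = cis (- ((of_int n)\<^sup>2 * t)) * ic f t n"

lemma norm_cv [simp]: "norm (cv f t n) = norm (ic f t n)"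
 by (simp add: cv_def norm_mult)

lemma ic_cv: "ic f t n = cis ((of_int n)\<^sup>2 * t) * cv f t n"
 by (simp add: cv_def mult.assoc[symmetric] cis_mult)

lemma norm_ic_le: "norm (ic f t n) \<le> rowL1 f n"
proof -
 have "norm (ic f t n) \<le> (LBINT y. norm (cis (t * y) * f (n, y)))"
  unfolding ic_def by (rule integral_norm_bound)
 then show ?thesis by (simp add: norm_mult rowL1_def)
qed

lemma ic_add:
 assumes "f \<in> L2 (wm s b)" "g \<in> L2 (wm s' b)" "1/2 < b"
 shows "ic (\<lambda>z. f z + g z) t n = ic f t n + ic g t n"
 unfolding ic_def distrib_left
 by (intro Bochner_Integration.integral_add integrable_cis_mult L2_row_integrable[OF assms(1)]
  L2_row_integrable[OF assms(2)] assms(3)) measurable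

lemma ic_diff:
 assumes "f \<in> L2 (wm s b)" "g \<in> L2 (wm s' b)" "1/2 < b"
 shows "ic (\<lambda>z. f z - g z) t n = ic f t n - ic g t n"
 unfolding ic_def right_diff_distrib
 by (intro Bochner_Integration.integral_diff integrable_cis_mult L2_row_integrable[OF assms(1)]
  L2_row_integrable[OF assms(2)] assms(3)) measurable

lemma ic_cmult: "ic (\<lambda>z. c * f z) t n = c * ic f t n"
 unfolding ic_def integral_mult_right_zero[symmetric] by (simp only: mult.left_commute)

lemma cv_add:
 assumes "f \<in> L2 (wm s b)" "g \<in> L2 (wm s' b)" "1/2 < b"
 shows "cv (\<lambda>z. f z + g z) t n = cv f t n + cv g t n"
 by (simp add: cv_def ic_add[OF assms] distrib_left)

lemma cv_diff:
 assumes "f \<in> L2 (wm s b)" "g \<in> L2 (wm s' b)" "1/2 < b"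
 shows "cv (\<lambda>z. f z - g z) t n = cv f t n - cv g t n"
 by (simp add: cv_def ic_diff[OF assms] right_diff_distrib)

lemma ic_tendsto:
 assumes f: "\<And>k. f k \<in> L2 (wm s b)" "g \<in> L2 (wm s b)" and b: "1/2 < b"
  and lim: "null (\<lambda>k. l2 (wm s b) (\<lambda>z. f k z - g z))"
 shows "(\<lambda>k. ic (f k) t n) \<longlonglongrightarrow> ic g t n"
proof -
 have "null (\<lambda>k. ic (f k) t n - ic g t n)"
 proof (rule Lim_null_comparison)
  show "null (\<lambda>k. sqrt (kb b) * jbr (of_int n) powr (- s) * l2 (wm s b) (\<lambda>z. f k z - g z))"
   using tendsto_mult_right_zero[OF lim] by simp
  show "\<forall>\<^sub>F k in sequentially. norm (ic (f k) t n - ic g t n) \<le>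
    sqrt (kb b) * jbr (of_int n) powr (- s) * l2 (wm s b) (\<lambda>z. f k z - g z)"
  proof (intro always_eventually allI)
   fix k
   have "norm (ic (f k) t n - ic g t n) = norm (ic (\<lambda>z. f k z - g z) t n)"
    by (simp add: ic_diff[OF f b])
   also have "\<dots> \<le> rowL1 (\<lambda>z. f k z - g z) n" by (rule norm_ic_le)
   also have "\<dots> \<le> sqrt (kb b) * jbr (of_int n) powr (- s) * l2 (wm s b) (\<lambda>z. f k z - g z)"
    by (rule rowL1_le[OF L2_diff(1)[OF f] b])
   finally show "norm (ic (f k) t n - ic g t n) \<le> \<dots>" .
  qed
 qed
 then show ?thesis by (simp add: LIM_zero_iff)
qed

lemma cv_tendsto:
 assumes "\<And>k. f k \<in> L2 (wm s b)" "g \<in> L2 (wm s b)" "1/2 < b"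
  and "null (\<lambda>k. l2 (wm s b) (\<lambda>z. f k z - g z))"
 shows "(\<lambda>k. cv (f k) t n) \<longlonglongrightarrow> cv g t n"
 unfolding cv_def by (intro tendsto_mult tendsto_const ic_tendsto[OF assms])

subsection \<open>Smooth functions on the Fourier side\<close>

text \<open>The shift passes from time frequency to modulation; the division by
  \<open>2 * pi\<close> is that of Fourier inversion, so that \<open>cv\<close> recovers the
  coefficients of \<open>F\<close>.\<close>

definition gam :: "(real => real => complex) => int \<times> real => complex" where
 "gam F z = st_fourier F (snd z - (of_int (fst z))\<^sup>2) (fst z) / (2 * of_real pi)"

lemma ic_gam:
 assumes "F \<in> smooth_schwartz"
 shows "ic (gam F) t n = cis ((of_int n)\<^sup>2 * t) * fcoeff (F t) n"
proof -
 define c where "c t = fcoeff (F t) n" for t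
 have c: "c \<in> schwartz" unfolding c_def by (rule smooth_schwartz_fcoeff[OF assms])
 define m where "m = (real_of_int n)\<^sup>2"
 have "ic (gam F) t n = (LBINT y. cis (t * y) * (ft c (y - m) / (2 * of_real pi)))"
  by (simp add: ic_def gam_def st_fourier_eq_ft c_def[abs_def] m_def)
 also have "\<dots> = (LBINT y. cis (t * (m + y)) * (ft c y / (2 * of_real pi)))"
  by (subst lborel_integral_real_affine[where c=1 and t=m]) auto
 also have "\<dots> = (LBINT y. cis (m * t) / (2 * of_real pi) * (cis (t * y) * ft c y))"
  by (intro Bochner_Integration.integral_cong) (simp_all add: distrib_left cis_mult[symmetric] mult_ac)
 also have "\<dots> = cis (m * t) * c t"
  unfolding integral_mult_right_zero schwartz_inversion[OF c] by simp
 finally show ?thesis by (simp add: c_def m_def)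
qed

lemma cv_gam: "F \<in> smooth_schwartz ==> cv (gam F) t n = fcoeff (F t) n"
 by (simp add: cv_def ic_gam mult.assoc[symmetric] cis_mult)

lemma st_fourier_measurable: "F \<in> smooth_schwartz ==> (\<lambda>y. st_fourier F y n) \<in> bor"
 unfolding st_fourier_eq_ft by (intro ft_measurable schwartz_measurable smooth_schwartz_fcoeff)

lemma gam_measurable: "F \<in> smooth_schwartz ==> gam F \<in> bPM"
 unfolding measurable_PM_iff gam_def using st_fourier_measurable by (auto intro: measurable_compose[of _ _ borel])

lemma gam_diff:
 assumes "F \<in> smooth_schwartz" "G \<in> smooth_schwartz"
 shows "gam (\<lambda>t x. F t x - G t x) = (\<lambda>z. gam F z - gam G z)"
 by (simp add: gam_def st_fourier_diff[OF assms] diff_divide_distrib fun_eq_iff)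

lemma smooth_weight_integrable:
 assumes F: "F \<in> smooth_schwartz" and b: "0 \<le> b" "b \<le> 1"
 obtains C where "\<And>n y. jbr (y + (of_int n)\<^sup>2) powr (2 * b) * (norm (st_fourier F y n))\<^sup>2 \<le>
   C * jbr y powr (-2) * jbr (of_int n) powr (-4)" "0 \<le> C"
proof -
 obtain C where C: "0 \<le> C" "\<And>n y. norm (st_fourier F y n) \<le> C * (jbr y powr (-2) * jbr (of_int n) powr (-4))"
  using F by (rule smooth_schwartz_st_fourier_bound) auto
 have "jbr (y + (of_int n)\<^sup>2) powr (2 * b) * (norm (st_fourier F y n))\<^sup>2 \<le>
   (4 * C\<^sup>2) * jbr y powr (-2) * jbr (of_int n) powr (-4)" for n y
 proof -
  have "jbr ((real_of_int n)\<^sup>2) \<le> (jbr (of_int n))\<^sup>2"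
  proof (rule power2_le_imp_le)
   have "1 + (x\<^sup>2)\<^sup>2 \<le> (1 + x\<^sup>2)\<^sup>2" for x :: real by (simp add: power2_sum)
   then show "(jbr ((real_of_int n)\<^sup>2))\<^sup>2 \<le> ((jbr (of_int n))\<^sup>2)\<^sup>2"
    by (simp add: jbr_square)
  qed simp
  then have "jbr ((real_of_int n)\<^sup>2) powr 2 \<le> (jbr (of_int n))\<^sup>2 powr 2"
   by (intro powr_mono2) auto
  then have m: "jbr ((real_of_int n)\<^sup>2) powr 2 \<le> jbr (of_int n) powr 4"
   by (simp add: powr_power)
  have "jbr (y + (of_int n)\<^sup>2) powr (2 * b) \<le> jbr (y + (of_int n)\<^sup>2) powr 2"
   using b by (intro jbr_powr_mono) auto
  also have "\<dots> \<le> 2 powr 2 * (jbr y powr 2 * jbr ((of_int n)\<^sup>2) powr 2)"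
   by (rule jbr_add_powr) simp
  also have "\<dots> \<le> 4 * (jbr y powr 2 * jbr (of_int n) powr 4)"
   using m by simp
  finally have "jbr (y + (of_int n)\<^sup>2) powr (2 * b) * (norm (st_fourier F y n))\<^sup>2 \<le>
    (4 * (jbr y powr 2 * jbr (of_int n) powr 4)) * (C * (jbr y powr (-2) * jbr (of_int n) powr (-4)))\<^sup>2"
   by (intro mult_mono power_mono C) auto
  also have "\<dots> = (4 * C\<^sup>2) * ((jbr y powr 2 * jbr y powr (-2)) * jbr y powr (-2)) *
    ((jbr (of_int n) powr 4 * jbr (of_int n) powr (-4)) * jbr (of_int n) powr (-4))"
   by (simp add: power2_eq_square mult_ac)
  also have "\<dots> = (4 * C\<^sup>2) * jbr y powr (-2) * jbr (of_int n) powr (-4)"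
  proof -
   have "x powr 2 * x powr (-2) = 1" "x powr 4 * x powr (-4) = 1" if "0 < x" for x :: real
    using that by (simp_all only: powr_add[symmetric]) simp_all
   then show ?thesis by (simp only: jbr_pos mult_1_left)
  qed
  finally show ?thesis .
 qed
 then show ?thesis by (rule that) simp
qed

lemma gam_L2:
 assumes F: "F \<in> smooth_schwartz" and b: "0 \<le> b" "b \<le> 1"
 shows "gam F \<in> L2 (wm 0 b)" and "Xsb_smooth_norm 0 b F = 2 * pi * l2 (wm 0 b) (gam F)"
proof -
 obtain C where C: "\<And>n y. jbr (y + (of_int n)\<^sup>2) powr (2 * b) * (norm (st_fourier F y n))\<^sup>2 \<le>
   C * jbr y powr (-2) * jbr (of_int n) powr (-4)" "0 \<le> C"
  using smooth_weight_integrable[OF F b] by blast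
 note [measurable] = st_fourier_measurable[OF F]
 define a where "a n = (LBINT y. jbr (y + (of_int n)\<^sup>2) powr (2 * b) * jbr (of_int n) powr (2 * 0)
    * (norm (st_fourier F y n))\<^sup>2)" for n
 have i: "integrable lborel (\<lambda>y. jbr (y + (of_int n)\<^sup>2) powr (2 * b) * jbr (of_int n) powr (2 * 0)
    * (norm (st_fourier F y n))\<^sup>2)" for n
 proof (rule Bochner_Integration.integrable_bound)
  show "integrable lborel (\<lambda>y. jbr (of_int n) powr (-4) * (C * jbr y powr (-2)))"
   by (intro integrable_mult_right integrable_jbr) simp
 qed (use C in \<open>auto simp: mult_ac\<close>)
 have a0: "0 \<le> a n" for n unfolding a_def by (intro integral_nonneg_AE) auto
 have rows: "nnl (\<lambda>y. wt 0 b n y * (norm (gam F (n, y)))\<^sup>2) = ennreal (a n / (2 * pi)\<^sup>2)" for n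
 proof -
  have "nnl (\<lambda>y. wt 0 b n y * (norm (gam F (n, y)))\<^sup>2) =
    nnl (\<lambda>y. wt 0 b n ((of_int n)\<^sup>2 + 1 * y) * (norm (gam F (n, (of_int n)\<^sup>2 + 1 * y)))\<^sup>2)"
   using measurable_row[OF gam_measurable[OF F]]
   by (subst nn_integral_real_affine[where c=1 and t="(of_int n)\<^sup>2"]) auto
  also have "\<dots> = (\<integral>\<^sup>+y. ennreal (1 / (2 * pi)\<^sup>2) * ennreal (jbr (y + (of_int n)\<^sup>2) powr (2 * b) * jbr (of_int n) powr (2 * 0)
    * (norm (st_fourier F y n))\<^sup>2) \<partial>lborel)"
   by (intro nn_integral_cong)
    (simp add: wt_def gam_def norm_divide power_divide ennreal_mult[symmetric] add.commute norm_mult)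
  also have "\<dots> = ennreal (1 / (2 * pi)\<^sup>2) * ennreal (a n)"
   unfolding a_def by (subst nn_integral_eq_integral[symmetric, OF i]) (auto intro!: nn_integral_cmult)
  finally show ?thesis by (simp add: ennreal_mult[symmetric] a0)
 qed
 have ale: "a n \<le> C * kb 1 * jbr (of_int n) powr (-4)" for n
 proof -
  have "ennreal (a n) = nnl (\<lambda>y. jbr (y + (of_int n)\<^sup>2) powr (2 * b) * jbr (of_int n) powr (2 * 0)
    * (norm (st_fourier F y n))\<^sup>2)"
   unfolding a_def by (subst nn_integral_eq_integral[symmetric, OF i]) auto
  also have "\<dots> \<le> (\<integral>\<^sup>+y. ennreal (C * jbr (of_int n) powr (-4)) * ennreal (jbr y powr (- (2 * 1))) \<partial>lborel)"
   using C by (intro nn_integral_mono) (auto simp: ennreal_mult[symmetric] mult_ac intro!: ennreal_leI)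
  also have "\<dots> = ennreal (C * jbr (of_int n) powr (-4)) * ennreal (kb 1)"
   by (subst ennreal_kb) (auto intro!: nn_integral_cmult)
  finally show ?thesis using C a0 by (simp add: ennreal_mult[symmetric] mult_ac)
 qed
 have ia: "integrable ZZ a"
 proof (rule integrableI_bounded)
  have "nns (\<lambda>n. norm (a n)) \<le>
    (\<integral>\<^sup>+n. ennreal (C * kb 1) * ennreal (jbr (of_int n) powr (-4)) \<partial>ZZ)"
   using ale a0 C by (intro nn_integral_mono) (auto simp: ennreal_mult[symmetric] intro!: ennreal_leI)
  also have "\<dots> < \<infinity>"
   using sum_jbr_finite[of 4] by (simp add: nn_integral_cmult ennreal_mult_less_top)
  finally show "nns (\<lambda>n. norm (a n)) < \<infinity>" .
 qed auto
 define A where "A = (\<integral>n. a n \<partial>ZZ)"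
 have A0: "0 \<le> A" unfolding A_def using a0 by (intro integral_nonneg_AE) auto
 have "sqi (wm 0 b) (gam F) = (\<integral>\<^sup>+n. ennreal (1 / (2 * pi)\<^sup>2) * ennreal (a n) \<partial>ZZ)"
  unfolding sqi_wm[OF gam_measurable[OF F]] rows using a0 by (simp add: ennreal_mult[symmetric])
 also have "\<dots> = ennreal (1 / (2 * pi)\<^sup>2) * ennreal A"
  unfolding A_def using a0 by (subst nn_integral_eq_integral[symmetric, OF ia]) (auto intro!: nn_integral_cmult)
 finally have sq: "sqi (wm 0 b) (gam F) = ennreal (A / (2 * pi)\<^sup>2)"
  using A0 by (simp add: ennreal_mult[symmetric])
 then show "gam F \<in> L2 (wm 0 b)"
  using gam_measurable[OF F] by (simp add: L2_def)
 have "Xsb_smooth_norm 0 b F = sqrt A"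
  unfolding Xsb_smooth_norm_def a_def[symmetric] A_def infsum_eq_integral[OF ia] ..
 moreover have "l2 (wm 0 b) (gam F) = sqrt A / (2 * pi)"
 proof -
  have "sqrt (A / (2 * pi)\<^sup>2) = sqrt A / (2 * pi)"
   by (simp only: real_sqrt_divide real_sqrt_abs) simp
  then show ?thesis using A0 by (simp only: l2_def sq) simp
 qed
 ultimately show "Xsb_smooth_norm 0 b F = 2 * pi * l2 (wm 0 b) (gam F)" by simp
qed

subsection \<open>Density of smooth functions\<close>

definition rw :: "real => real measure" where
 "rw b = density lborel (\<lambda>y. ennreal (jbr y powr (2 * b)))"

lemma measurable_rw [simp]: "borel_measurable (rw b) = bor"
 unfolding rw_def by (intro measurable_cong_sets) auto

lemma sqi_rw:
 assumes [measurable]: "f \<in> bor"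
 shows "sqi (rw b) f = nnl (\<lambda>y. jbr y powr (2 * b) * (norm (f y))\<^sup>2)"
 unfolding sqi_def rw_def by (subst nn_integral_density) (auto simp: ennreal_mult)

lemma AE_rw: "(AE x in rw b. P x) \<longleftrightarrow> (AE x in lborel. P x)"
 unfolding rw_def by (subst AE_density) (auto simp: less_le)

lemma L2_rw_bounded_support:
 "(\<lambda>y. of_real (C * indicator {-M..M} y)) \<in> L2 (rw b)"
proof -
 have [measurable]: "(\<lambda>y. complex_of_real (C * indicator {-M..M} y)) \<in> bor" by measurable
 have "sqi (rw b) (\<lambda>y. of_real (C * indicator {-M..M} y)) \<le>
   (\<integral>\<^sup>+y. ennreal (jbr M powr (2 * \<bar>b\<bar>) * C\<^sup>2) * indicator {-M..M} y \<partial>lborel)"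
 proof (subst sqi_rw, measurable, intro nn_integral_mono)
  fix y
  have "jbr y powr (2 * b) \<le> jbr M powr (2 * \<bar>b\<bar>)" if "\<bar>y\<bar> \<le> M"
  proof -
   have "jbr y powr (2 * b) \<le> jbr y powr (2 * \<bar>b\<bar>)" by (intro jbr_powr_mono) auto
   also have "\<dots> \<le> jbr M powr (2 * \<bar>b\<bar>)" using that by (intro powr_mono2 jbr_mono) auto
   finally show ?thesis .
  qed
  then show "ennreal (jbr y powr (2 * b) * (norm (complex_of_real (C * indicator {-M..M} y)))\<^sup>2) \<le>
    ennreal (jbr M powr (2 * \<bar>b\<bar>) * C\<^sup>2) * indicator {-M..M} y"
   by (auto simp: indicator_def intro!: ennreal_leI mult_right_mono)
 qed
 also have "\<dots> < \<infinity>"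
  by (subst nn_integral_cmult_indicator) (auto simp: ennreal_mult_less_top emeasure_lborel_Icc_eq)
 finally show ?thesis by (simp add: L2_def)
qed

lemma L2_rw_jbr:
 assumes "b \<le> 1"
 shows "(\<lambda>y. of_real (C * jbr y powr (-2))) \<in> L2 (rw b)"
proof -
 have "sqi (rw b) (\<lambda>y. of_real (C * jbr y powr (-2))) =
   (\<integral>\<^sup>+y. ennreal (C\<^sup>2) * ennreal (jbr y powr (- (4 - 2 * b))) \<partial>lborel)"
 proof (subst sqi_rw, measurable, intro nn_integral_cong)
  fix y
  have "jbr y powr (2 * b) * (C * jbr y powr (-2))\<^sup>2 = C\<^sup>2 * (jbr y powr (2 * b) * (jbr y powr (-2) * jbr y powr (-2)))"
   by (simp add: power2_eq_square mult_ac)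
  also have "\<dots> = C\<^sup>2 * jbr y powr (- (4 - 2 * b))"
   by (simp only: powr_add[symmetric]) simp
  finally show "ennreal (jbr y powr (2 * b) * (norm (complex_of_real (C * jbr y powr (-2))))\<^sup>2) =
    ennreal (C\<^sup>2) * ennreal (jbr y powr (- (4 - 2 * b)))"
   by (simp only: norm_of_real power2_abs ennreal_mult[symmetric] zero_le_power2 powr_ge_zero)
 qed
 also have "\<dots> < \<infinity>"
  using nn_integral_jbr_finite[of "4 - 2 * b"] assms by (simp add: nn_integral_cmult ennreal_mult_less_top)
 finally show ?thesis by (simp add: L2_def)
qed

lemma approx_bounded_support:
 assumes "g \<in> L2 (rw b)" "0 < e"
 obtains h C where "h \<in> bor" "0 < C" "\<And>x. norm (h x) \<le> C * indicator {-C..C} x"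
  "l2 (rw b) (\<lambda>x. h x - g x) < e" "h \<in> L2 (rw b)"
proof -
 have [measurable]: "g \<in> bor" using assms L2_measurable by fastforce
 define h where "h k x = (if \<bar>x\<bar> \<le> real (Suc k) \<and> norm (g x) \<le> real (Suc k) then g x else 0)" for k x
 have [measurable]: "h k \<in> bor" for k unfolding h_def by measurable
 have "null (\<lambda>k. l2 (rw b) (\<lambda>x. h k x - g x))"
 proof (rule L2_dominated_convergence(2)[OF _ _ assms(1)])
  show "AE x in rw b. (\<lambda>k. h k x) \<longlonglongrightarrow> g x"
  proof (intro AE_I2 tendsto_eventually)
   fix x
   obtain K where "\<bar>x\<bar> + norm (g x) \<le> real K" using real_arch_simple by blast
   then have "h k x = g x" if "K \<le> k" for k
    using that by (auto simp: h_def) (smt (verit) norm_ge_zero of_nat_le_iff)+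
   then show "\<forall>\<^sub>F k in sequentially. h k x = g x"
    by (rule eventually_sequentiallyI)
  qed
 qed (auto simp: h_def)
 then obtain k where k: "l2 (rw b) (\<lambda>x. h k x - g x) < e"
  using assms(2) by (metis (no_types, lifting) LIMSEQ_iff diff_zero l2_nonneg real_norm_def abs_of_nonneg order_refl)
 show ?thesis
 proof (rule that[of "h k" "real (Suc k)"])
  show "h k \<in> L2 (rw b)"
   by (rule L2_mono_AE(1)[OF _ _ assms(1)]) (auto simp: h_def)
 qed (use k in \<open>auto simp: h_def indicator_def\<close>)
qed

text \<open>A Borel function is an almost everywhere limit of continuous ones. Clamping their values
  and cutting off their supports leaves the limit unchanged, because \<open>h\<close> obeys the same
  bounds, and supplies a common majorant.\<close>

lemma approx_continuous:
 assumes h: "h \<in> bor" "0 < C" "\<And>x. norm (h x) \<le> C * indicator {-C..C} x"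
  and e: "0 < e"
 obtains f M where "continuous_on UNIV f" "0 < M" "\<And>x. norm (f x) \<le> M * indicator {-M..M} x"
  "l2 (rw b) (\<lambda>x. f x - h x) < e"
proof -
 have "h measurable_on UNIV"
  using h(1) by (intro lebesgue_measurable_imp_measurable_on) (simp_all add: measurable_completion)
 then obtain N f where N: "negligible N" "\<And>n. continuous_on UNIV (f n)" "\<And>x. x \<notin> N ==> (\<lambda>n. f n x) \<longlonglongrightarrow> h x"
  unfolding measurable_on_def by auto
 have AE: "AE x in lborel. x \<notin> N"
 proof -
  have "AE x in lebesgue. x \<notin> N"
   using N(1) by (intro AE_not_in) (simp add: negligible_iff_null_sets)
  then show ?thesis by (simp add: AE_completion_iff)
 qed
 define clamp where "clamp z = z * of_real (C / max C (norm z))" for z :: complex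
 have clamp_cont: "continuous_on UNIV clamp"
  unfolding clamp_def using h(2) by (intro continuous_intros) (auto simp: max_def)
 have clamp_le: "norm (clamp z) \<le> C" for z
  using h(2) by (auto simp: clamp_def norm_mult norm_divide max_def field_simps)
 have clamp_id: "clamp z = z" if "norm z \<le> C" for z
  using that h(2) by (simp add: clamp_def max_def)
 define cutoff where "cutoff x = max 0 (min 1 (C + 1 - \<bar>x\<bar>))" for x :: real
 define F where "F n x = clamp (f n x) * of_real (cutoff x)" for n x
 have cF: "continuous_on UNIV (F n)" for n
  unfolding F_def cutoff_def
  by (intro continuous_intros continuous_on_compose2[OF clamp_cont N(2)]) auto
 have bF: "norm (F n x) \<le> (C + 1) * indicator {-(C + 1)..C + 1} x" for n x
 proof -
  have "norm (F n x) \<le> C * cutoff x"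
   unfolding F_def norm_mult using clamp_le[of "f n x"] h(2) by (auto simp: cutoff_def intro!: mult_mono)
  also have "\<dots> \<le> (C + 1) * indicator {-(C + 1)..C + 1} x"
   using h(2) by (auto simp: cutoff_def indicator_def max_def min_def mult_left_le intro: order_trans[of _ C])
  finally show ?thesis .
 qed
 have "null (\<lambda>n. l2 (rw b) (\<lambda>x. F n x - h x))"
 proof (rule L2_dominated_convergence(2)[OF _ _ L2_rw_bounded_support[of "C + 1" "C + 1" b]])
  show "AE x in rw b. (\<lambda>n. F n x) \<longlonglongrightarrow> h x"
   unfolding AE_rw using AE
  proof eventually_elim
   case (elim x)
   have nh: "norm (h x) \<le> C"
    by (rule order_trans[OF h(3)]) (use h(2) in \<open>auto simp: indicator_def\<close>)
   have "(\<lambda>n. F n x) \<longlonglongrightarrow> clamp (h x) * of_real (cutoff x)"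
    unfolding F_def using N(3)[OF elim] clamp_cont
    by (intro tendsto_mult tendsto_const isCont_tendsto_compose[where g=clamp]) (auto simp: continuous_on_eq_continuous_at)
   also have "clamp (h x) * of_real (cutoff x) = h x"
   proof (cases "\<bar>x\<bar> \<le> C")
    case True
    then show ?thesis using nh by (simp add: clamp_id cutoff_def)
   next
    case False
    then have "h x = 0" using h(3)[of x] by (auto simp: indicator_def abs_le_iff split: if_splits)
    then show ?thesis by (simp add: clamp_def)
   qed
   finally show ?case .
  qed
  show "AE x in rw b. norm (F k x) \<le> norm (complex_of_real ((C + 1) * indicator {-(C + 1)..C + 1} x))" for k
   using bF h(2) by (auto simp: abs_mult indicator_def norm_mult split: if_splits)
 qed (use h cF in \<open>auto intro!: borel_measurable_continuous_onI\<close>)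
 then obtain k where "l2 (rw b) (\<lambda>x. F k x - h x) < e"
  using e by (metis (no_types, lifting) LIMSEQ_iff diff_zero l2_nonneg real_norm_def abs_of_nonneg order_refl)
 then show ?thesis
  using cF bF h(2) by (intro that[of "F k" "C + 1"]) auto
qed

lemma fourier_param_deriv:
 assumes h: "integrable lborel h" "integrable lborel (\<lambda>\<sigma>. of_real \<sigma> * h \<sigma>)" "integrable lborel (\<lambda>\<sigma>. of_real (\<sigma>\<^sup>2) * h \<sigma>)"
 shows "((\<lambda>t. LBINT \<sigma>. cis (t * \<sigma>) * h \<sigma>) has_vector_derivative (LBINT \<sigma>. cis (t * \<sigma>) * (\<i> * of_real \<sigma> * h \<sigma>))) (at t)"
proof (rule has_vector_derivative_quadratic)
 fix s
 have i: "integrable lborel (\<lambda>\<sigma>. \<i> * of_real \<sigma> * h \<sigma>)"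
  using integrable_mult_right[OF h(2), of \<i>] by (simp add: mult.assoc)
 have e: "cis y = 1 + \<i> * of_real y + (cis y - (1 + \<i> * of_real y))" "norm (cis y - (1 + \<i> * of_real y)) \<le> y\<^sup>2" for y
 proof -
  have "2 * norm (cis y - (1 + \<i> * of_real y)) \<le> y\<^sup>2"
   using iexp_approx1[of y 1] by (simp add: cis_conv_exp power2_eq_square)
  then show "norm (cis y - (1 + \<i> * of_real y)) \<le> y\<^sup>2"
   using norm_ge_zero[of "cis y - (1 + \<i> * of_real y)"] by linarith
 qed simp
 have eq: "(LBINT \<sigma>. cis (s * \<sigma>) * h \<sigma>) - (LBINT \<sigma>. cis (t * \<sigma>) * h \<sigma>) - (s - t) *\<^sub>R (LBINT \<sigma>. cis (t * \<sigma>) * (\<i> * of_real \<sigma> * h \<sigma>)) =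
   (LBINT \<sigma>. cis (s * \<sigma>) * h \<sigma> - cis (t * \<sigma>) * h \<sigma> - (s - t) *\<^sub>R (cis (t * \<sigma>) * (\<i> * of_real \<sigma> * h \<sigma>)))"
  by (simp add: Bochner_Integration.integral_diff integrable_cis_mult h i Bochner_Integration.integrable_diff)
 have "norm (LBINT \<sigma>. cis (s * \<sigma>) * h \<sigma> - cis (t * \<sigma>) * h \<sigma> - (s - t) *\<^sub>R (cis (t * \<sigma>) * (\<i> * of_real \<sigma> * h \<sigma>))) \<le> (LBINT \<sigma>. norm (cis (s * \<sigma>) * h \<sigma> - cis (t * \<sigma>) * h \<sigma> - (s - t) *\<^sub>R (cis (t * \<sigma>) * (\<i> * of_real \<sigma> * h \<sigma>))))"
  by (rule integral_norm_bound)
 also have "\<dots> \<le> (LBINT \<sigma>. (s - t)\<^sup>2 * norm (of_real (\<sigma>\<^sup>2) * h \<sigma>))"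
 proof (rule integral_mono')
  show "integrable lborel (\<lambda>\<sigma>. (s - t)\<^sup>2 * norm (of_real (\<sigma>\<^sup>2) * h \<sigma>))"
   by (intro integrable_mult_right integrable_norm h)
  fix \<sigma> :: real
  have "cis (s * \<sigma>) = cis (t * \<sigma>) * cis ((s - t) * \<sigma>)" by (simp add: cis_mult algebra_simps)
  then have e2: "cis (s * \<sigma>) * h \<sigma> - cis (t * \<sigma>) * h \<sigma> - (s - t) *\<^sub>R (cis (t * \<sigma>) * (\<i> * of_real \<sigma> * h \<sigma>)) =
    cis (t * \<sigma>) * h \<sigma> * (cis ((s - t) * \<sigma>) - (1 + \<i> * of_real ((s - t) * \<sigma>)))"
   by (simp add: scaleR_conv_of_real algebra_simps)
  have "norm (cis (t * \<sigma>) * h \<sigma> * (cis ((s - t) * \<sigma>) - (1 + \<i> * of_real ((s - t) * \<sigma>)))) \<le> norm (h \<sigma>) * ((s - t) * \<sigma>)\<^sup>2"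
   unfolding norm_mult norm_cis using e(2)[of "(s - t) * \<sigma>"] by (simp add: mult_left_mono)
  then show "norm (cis (s * \<sigma>) * h \<sigma> - cis (t * \<sigma>) * h \<sigma> - (s - t) *\<^sub>R (cis (t * \<sigma>) * (\<i> * of_real \<sigma> * h \<sigma>)))
    \<le> (s - t)\<^sup>2 * norm (of_real (\<sigma>\<^sup>2) * h \<sigma>)"
   unfolding e2 by (simp add: norm_mult norm_power power_mult_distrib mult_ac)
 qed auto
 finally show "norm ((LBINT \<sigma>. cis (s * \<sigma>) * h \<sigma>) - (LBINT \<sigma>. cis (t * \<sigma>) * h \<sigma>) -
   (s - t) *\<^sub>R (LBINT \<sigma>. cis (t * \<sigma>) * (\<i> * of_real \<sigma> * h \<sigma>))) \<le>
   (LBINT \<sigma>. norm (of_real (\<sigma>\<^sup>2) * h \<sigma>)) * (s - t)\<^sup>2"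
  unfolding eq by (simp only: integral_mult_right_zero mult.commute)
qed

lemma jet_slow_cis: "jet slow (\<lambda>t. cis (a * t))"
proof (rule jet_coinduct[where S="range (\<lambda>c t. c * cis (a * t))"])
 fix g assume "g \<in> range (\<lambda>c t. c * cis (a * t))"
 then obtain c where g: "g = (\<lambda>t. c * cis (a * t))" by auto
 have "(g has_vector_derivative (c * (\<i> * of_real a)) * cis (a * t)) (at t)" for t
  unfolding g using has_vector_derivative_mult_right[OF cis_has_vector_derivative, of c] by (simp add: mult.assoc)
 moreover have "slow g" unfolding g by (rule slowI[of _ "norm c" 0]) (simp add: norm_mult)
 ultimately show "slow g \<and> (\<exists>g'\<in>range (\<lambda>c t. c * cis (a * t)). \<forall>t. (g has_vector_derivative g' t) (at t))"
  by (intro conjI bexI[where x="\<lambda>t. (c * (\<i> * of_real a)) * cis (a * t)"]) auto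
qed (auto intro!: image_eqI[of _ _ 1])

text \<open>Differentiation multiplies the integrand by \<open>\<i> * r\<close>; the compact support
  keeps the result in the same class.\<close>

lemma jet_slow_fourier:
 assumes f: "f \<in> bor" "\<And>x. norm (f x) \<le> M * indicator {-M..M} x"
 shows "jet slow (\<lambda>t. LBINT r. cis (t * r) * f r)"
proof (rule jet_coinduct[where S="{\<lambda>t. LBINT r. cis (t * r) * h r | h. \<exists>B. h \<in> bor \<and> (\<forall>x. norm (h x) \<le> B * indicator {-M..M} x)}"])
 let ?S = "{\<lambda>t. LBINT r. cis (t * r) * h r | h. \<exists>B. h \<in> bor \<and> (\<forall>x. norm (h x) \<le> B * indicator {-M..M} x)}"
 fix g assume "g \<in> ?S"
 then obtain h B where g: "g = (\<lambda>t. LBINT r. cis (t * r) * h r)" and h: "h \<in> bor" "\<And>x. norm (h x) \<le> B * indicator {-M..M} x"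
  by auto
 have i: "integrable lborel k" if "k \<in> bor" "\<And>x. norm (k x) \<le> A * indicator {-M..M} x" for k :: "real => complex" and A
 proof (rule Bochner_Integration.integrable_bound)
  show "integrable lborel (\<lambda>x. A * indicator {-M..M} x :: real)"
   by (intro integrable_mult_right integrable_real_indicator) (auto simp: emeasure_lborel_Icc_eq)
  show "AE x in lborel. norm (k x) \<le> norm (A * indicator {-M..M} x)"
   using that(2) by (auto intro: order_trans[OF _ abs_ge_self])
 qed (use that in auto)
 have b1: "norm (of_real (r ^ j) * h r) \<le> (\<bar>M\<bar> ^ j * B) * indicator {-M..M} r" for j r
 proof (cases "r \<in> {-M..M}")
  case True
  then have "\<bar>r\<bar> ^ j * norm (h r) \<le> \<bar>M\<bar> ^ j * B" using h(2)[of r] by (intro mult_mono power_mono) auto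
  then show ?thesis using True by (simp add: norm_mult norm_power)
 next
  case False then show ?thesis using h(2)[of r] by simp
 qed
 have m: "(\<lambda>r. of_real (r ^ j) * h r) \<in> bor" for j using h(1) by measurable
 have mi: "(\<lambda>r. \<i> * of_real r * h r) \<in> bor" using h(1) by measurable
 have ih: "integrable lborel (\<lambda>r. of_real (r ^ j) * h r)" for j by (rule i[OF m b1])
 have "(g has_vector_derivative (LBINT r. cis (t * r) * (\<i> * of_real r * h r))) (at t)" for t
  unfolding g using ih[of 0] ih[of 1] ih[of 2] by (intro fourier_param_deriv) auto
 moreover have "norm (g t) \<le> (LBINT r. norm (h r))" for t
  unfolding g using integral_norm_bound[of lborel "\<lambda>r. cis (t * r) * h r"] by (simp add: norm_mult)
 then have "slow g" by (intro slowI[of _ "LBINT r. norm (h r)" 0]) simp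
 moreover have "(\<lambda>t. LBINT r. cis (t * r) * (\<i> * of_real r * h r)) \<in> ?S"
  using b1[of _ 1] mi by (auto intro!: exI[of _ "\<lambda>r. \<i> * of_real r * h r"] exI[of _ "\<bar>M\<bar> ^ 1 * B"] simp: norm_mult)
 ultimately show "slow g \<and> (\<exists>g'\<in>?S. \<forall>t. (g has_vector_derivative g' t) (at t))"
  by (intro conjI bexI[where x="\<lambda>t. LBINT r. cis (t * r) * (\<i> * of_real r * h r)"] allI)
qed (use f in auto)

lemma integrable_normal_jbr: "integrable lborel (\<lambda>r. std_normal_density r * (jbr r)\<^sup>2)"
 unfolding jbr_square distrib_left
 using integrable_std_normal_moment[of 2] integrable_normal_density[of 1 0] by (intro Bochner_Integration.integrable_add) auto

text \<open>The bound is uniform in the width \<open>d\<close>, so it serves as the majorant when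
  the width tends to 0. A far \<open>y\<close> reaches the support only through a large
  \<open>r\<close>, which the Gaussian penalises.\<close>

lemma mollifier_bound:
 fixes f :: "real => complex"
 assumes f: "f \<in> bor" "\<And>x. norm (f x) \<le> M * indicator {-M..M} x" "0 < M" and d: "\<bar>d\<bar> \<le> 1"
 shows "norm (LBINT r. of_real (std_normal_density r) * f (y + d * r)) \<le>
  (4 * M * (jbr M)\<^sup>2 * (LBINT r. std_normal_density r * (jbr r)\<^sup>2)) * jbr y powr (-2)"
proof -
 have pt: "norm (f (y + d * r)) \<le> (4 * M * (jbr M)\<^sup>2 * jbr y powr (-2)) * (jbr r)\<^sup>2" for r
 proof (cases "y + d * r \<in> {-M..M}")
  case True
  have "\<bar>d * r\<bar> \<le> \<bar>r\<bar>" using d by (simp add: abs_mult mult_left_le_one_le)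
  then have "jbr (d * r) \<le> jbr r" by (rule jbr_mono)
  have "jbr y \<le> 2 * (jbr (y + d * r) * jbr (- (d * r)))"
   using jbr_add[of "y + d * r" "- (d * r)"] by simp
  also have "\<dots> \<le> 2 * (jbr M * jbr r)"
  proof -
   have "jbr (y + d * r) \<le> jbr M" using True by (intro jbr_mono) auto
   then show ?thesis using \<open>jbr (d * r) \<le> jbr r\<close> by (intro mult_left_mono mult_mono) auto
  qed
  finally have "(jbr y)\<^sup>2 \<le> (2 * (jbr M * jbr r))\<^sup>2" by (intro power_mono) auto
  then have "1 \<le> 4 * (jbr M)\<^sup>2 * (jbr r)\<^sup>2 / (jbr y)\<^sup>2" by (simp add: power_mult_distrib)
  then have "M * 1 \<le> M * (4 * (jbr M)\<^sup>2 * (jbr r)\<^sup>2 / (jbr y)\<^sup>2)" using f(3) by (intro mult_left_mono) auto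
  moreover have "norm (f (y + d * r)) \<le> M" using f(2)[of "y + d * r"] True by simp
  moreover have "jbr y powr (-2) = inverse ((jbr y)\<^sup>2)" by (simp add: powr_minus)
  ultimately show ?thesis by (simp add: divide_inverse mult_ac)
 next
  case False
  then have "f (y + d * r) = 0" using f(2)[of "y + d * r"] by simp
  then show ?thesis using f(3) by simp
 qed
 have "norm (LBINT r. of_real (std_normal_density r) * f (y + d * r)) \<le>
   (LBINT r. norm (of_real (std_normal_density r) * f (y + d * r)))"
  by (rule integral_norm_bound)
 also have "\<dots> \<le> (LBINT r. (4 * M * (jbr M)\<^sup>2 * jbr y powr (-2)) * (std_normal_density r * (jbr r)\<^sup>2))"
 proof (rule integral_mono')
  fix r
  have "std_normal_density r * norm (f (y + d * r)) \<le> std_normal_density r * ((4 * M * (jbr M)\<^sup>2 * jbr y powr (-2)) * (jbr r)\<^sup>2)"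
   by (intro mult_left_mono pt normal_density_nonneg)
  then show "norm (of_real (std_normal_density r) * f (y + d * r)) \<le>
    (4 * M * (jbr M)\<^sup>2 * jbr y powr (-2)) * (std_normal_density r * (jbr r)\<^sup>2)"
   by (simp add: norm_mult normal_density_nonneg mult_ac)
 qed (use f(3) in \<open>auto intro!: integrable_mult_right integrable_normal_jbr simp: normal_density_nonneg\<close>)
 finally show ?thesis unfolding integral_mult_right_zero by (simp only: mult_ac)
qed

text \<open>The approximant is the inverse transform of \<open>f\<close>, damped by a Gaussian, so
  its transform is a Gaussian average of \<open>f\<close>. The shift \<open>a\<close> will be
  \<open>n\<^sup>2\<close>, the difference between modulation and time frequency; the phase
  \<open>cis (- a * t)\<close> produces it.\<close>

lemma approx_schwartz:
 assumes f: "continuous_on UNIV f" "0 < M" "\<And>x. norm (f x) \<le> M * indicator {-M..M} x"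
  and e: "0 < e" and b: "b \<le> 1"
 obtains c where "c \<in> schwartz" "l2 (rw b) (\<lambda>y. ft c (y - a) / (2 * of_real pi) - f y) < e"
proof -
 have [measurable]: "f \<in> bor" using f by (intro borel_measurable_continuous_onI)
 have fb: "norm (f x) \<le> M" for x
  by (rule order_trans[OF f(3)]) (use f(2) in \<open>auto simp: indicator_def\<close>)
 define \<delta> :: "nat => real" where "\<delta> n = inverse (real (Suc n))" for n
 have \<delta>: "0 < \<delta> n" "\<bar>\<delta> n\<bar> \<le> 1" "\<delta> \<longlonglongrightarrow> 0" for n
  unfolding \<delta>_def by (simp, simp add: inverse_le_1_iff, rule LIMSEQ_inverse_real_of_nat)
 define G where "G t = (LBINT u. cis (t * u) * f u)" for t
 define c where "c n t = (cis (- a * t) * G t) * exp (- (of_real ((\<delta> n * t)\<^sup>2 / 2)))" for n t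
 have c: "c n \<in> schwartz" for n
  unfolding c_def
 proof (rule schwartz_gaussian_type[where c="(\<delta> n)\<^sup>2 / 2" and C=1])
  show "jet slow (\<lambda>t. cis (- a * t) * G t)"
   unfolding G_def by (intro jet_slow_mult jet_slow_cis jet_slow_fourier[OF _ f(3)]) measurable
  have "jet slow (\<lambda>t. of_real ((\<delta> n)\<^sup>2 / 2) * (complex_of_real t * complex_of_real t))"
   by (intro jet_slow_mult jet_slow_const jet_slow_ident)
  then show "jet slow (\<lambda>t. of_real ((\<delta> n * t)\<^sup>2 / 2))"
   by (simp add: power2_eq_square mult_ac)
  show "norm (exp (- complex_of_real ((\<delta> n * t)\<^sup>2 / 2))) \<le> 1 * exp (- ((\<delta> n)\<^sup>2 / 2 * t\<^sup>2))" for t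
  proof -
   have "norm (exp (- complex_of_real x)) = exp (- x)" for x by simp
   then show ?thesis by (simp only: power_mult_distrib) simp
  qed
 qed (use \<delta>(1)[of n] in simp)
 have fi: "integrable lborel (\<lambda>s. f (- s))"
 proof (rule Bochner_Integration.integrable_bound)
  show "integrable lborel (\<lambda>x. M * indicator {-M..M} x :: real)"
   by (intro integrable_mult_right integrable_real_indicator) (auto simp: emeasure_lborel_Icc_eq)
  show "AE x in lborel. norm (f (- x)) \<le> norm (M * indicator {-M..M} x)"
  proof (intro AE_I2)
   fix x
   have "norm (f (- x)) \<le> M * indicator {-M..M} (- x)" by (rule f(3))
   also have "\<dots> \<le> norm (M * indicator {-M..M} x :: real)" using f(2) by (auto simp: indicator_def)
   finally show "norm (f (- x)) \<le> norm (M * indicator {-M..M} x)" .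
  qed
 qed auto
 have Gft: "G y = ft (\<lambda>s. f (- s)) y" for y
  unfolding G_def ft_def by (subst lborel_integral_real_affine[where c="-1" and t=0]) auto
 have ftc: "ft (c n) (y - a) / (2 * of_real pi) = (LBINT r. of_real (std_normal_density r) * f (y + (- \<delta> n) * r))" for n y
 proof -
  have ex: "exp (- (of_real ((\<delta> n * t)\<^sup>2 / 2))) = complex_of_real (exp (- (\<delta> n * t)\<^sup>2 / 2))" for t
   by (subst exp_of_real[symmetric]) (simp only: of_real_minus minus_divide_left[symmetric])
  have cc: "cis (- ((y - a) * t)) * (cis (- a * t) * z) = cis (- y * t) * z" for t z
   by (simp add: cis_mult mult.assoc[symmetric] algebra_simps)
  have "ft (c n) (y - a) = (LBINT t. of_real (exp (- (\<delta> n * t)\<^sup>2 / 2)) * (cis ((- y) * t) * ft (\<lambda>s. f (- s)) t))"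
   unfolding ft_def[of "c n"] c_def ex Gft[symmetric]
   by (intro Bochner_Integration.integral_cong) (simp_all only: mult.assoc cc mult.commute[of _ "of_real _"] mult.left_commute[of _ "of_real _"])
  also have "\<dots> = 2 * of_real pi * (LBINT r. of_real (std_normal_density r) * f (- (- y + \<delta> n * r)))"
   by (rule gaussian_regularisation[OF fi \<delta>(1)])
  finally show ?thesis by simp
 qed
 have "null (\<lambda>n. l2 (rw b) (\<lambda>y. ft (c n) (y - a) / (2 * of_real pi) - f y))"
 proof (rule L2_dominated_convergence(2)[OF _ _ L2_rw_jbr[OF b]])
  show "AE y in rw b. (\<lambda>n. ft (c n) (y - a) / (2 * of_real pi)) \<longlonglongrightarrow> f y"
   unfolding ftc using tendsto_minus[OF \<delta>(3)]
   by (intro AE_I2 gaussian_mollifier_tendsto[OF f(1) fb]) simp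
  show "AE y in rw b. norm (ft (c n) (y - a) / (2 * of_real pi)) \<le>
    norm (complex_of_real ((4 * M * (jbr M)\<^sup>2 * (LBINT r. std_normal_density r * (jbr r)\<^sup>2)) * jbr y powr (-2)))" for n
   unfolding ftc norm_of_real using \<delta>
   by (intro AE_I2 order_trans[OF mollifier_bound[OF _ f(3,2)] abs_ge_self]) auto
  show "(\<lambda>y. ft (c n) (y - a) / (2 * of_real pi)) \<in> borel_measurable (rw b)" for n
   using ft_measurable[OF schwartz_measurable[OF c[of n]]] by simp
 qed simp
 then obtain k where "l2 (rw b) (\<lambda>y. ft (c k) (y - a) / (2 * of_real pi) - f y) < e"
  using e by (metis (no_types, lifting) LIMSEQ_iff diff_zero l2_nonneg real_norm_def abs_of_nonneg order_refl)
 then show ?thesis using c that by blast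
qed

lemma row_density:
 assumes g: "g \<in> L2 (rw b)" and e: "0 < e" and b: "0 \<le> b" "b \<le> 1"
 obtains c where "c \<in> schwartz" "l2 (rw b) (\<lambda>y. ft c (y - a) / (2 * of_real pi) - g y) < e"
proof -
 obtain h C where h: "h \<in> bor" "0 < C" "\<And>x. norm (h x) \<le> C * indicator {-C..C} x"
  "l2 (rw b) (\<lambda>x. h x - g x) < e / 3" "h \<in> L2 (rw b)"
  using approx_bounded_support[OF g, of "e / 3"] e by auto
 obtain f M where f: "continuous_on UNIV f" "0 < M" "\<And>x. norm (f x) \<le> M * indicator {-M..M} x"
  "l2 (rw b) (\<lambda>x. f x - h x) < e / 3"
  using approx_continuous[OF h(1-3), of "e / 3" b] e by auto
 obtain c where c: "c \<in> schwartz" "l2 (rw b) (\<lambda>y. ft c (y - a) / (2 * of_real pi) - f y) < e / 3"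
  using approx_schwartz[OF f(1-3), of "e / 3" b a] e b by auto
 have fL: "f \<in> L2 (rw b)"
 proof (rule L2_mono_AE(1)[OF _ _ L2_rw_bounded_support[of M M b]])
  show "AE x in rw b. norm (f x) \<le> norm (complex_of_real (M * indicator {-M..M} x))"
   using f(3) f(2) by (auto simp: norm_mult abs_mult indicator_def split: if_splits)
 qed (use f(1) in \<open>auto intro!: borel_measurable_continuous_onI\<close>)
 have cL: "(\<lambda>y. ft c (y - a) / (2 * of_real pi)) \<in> L2 (rw b)"
 proof -
  obtain K where K: "0 \<le> K" "\<And>y. norm (ft c y) \<le> K * jbr y powr (-2)"
   using c(1) by (rule ft_schwartz_decay) auto
  have "norm (ft c (y - a) / (2 * of_real pi)) \<le> norm (complex_of_real (4 * (jbr a)\<^sup>2 * K * jbr y powr (-2)))" for y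
  proof -
   have "jbr y powr 2 \<le> 2 powr 2 * (jbr (y - a) powr 2 * jbr a powr 2)"
    using jbr_add_powr[of 2 "y - a" a] by simp
   then have "jbr (y - a) powr (-2) \<le> 4 * (jbr a)\<^sup>2 * jbr y powr (-2)"
    by (simp add: powr_minus field_simps)
   then have "norm (ft c (y - a)) \<le> K * (4 * (jbr a)\<^sup>2 * jbr y powr (-2))"
    using order_trans[OF K(2)[of "y - a"] mult_left_mono] K(1) by blast
   moreover have "norm (ft c (y - a) / (2 * of_real pi)) \<le> norm (ft c (y - a))"
    using pi_gt3 by (simp add: norm_divide divide_le_eq mult_le_cancel_left1)
   ultimately have "norm (ft c (y - a) / (2 * of_real pi)) \<le> 4 * (jbr a)\<^sup>2 * K * jbr y powr (-2)"
    by (simp add: mult_ac)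
   then show ?thesis unfolding norm_of_real by (rule order_trans[OF _ abs_ge_self])
  qed
  then show ?thesis
   using ft_measurable[OF schwartz_measurable[OF c(1)]]
   by (intro L2_mono_AE(1)[OF _ _ L2_rw_jbr[OF b(2), of "4 * (jbr a)\<^sup>2 * K"]]) auto
 qed
 have "l2 (rw b) (\<lambda>y. (ft c (y - a) / (2 * of_real pi) - f y) + ((f y - h y) + (h y - g y))) \<le>
   l2 (rw b) (\<lambda>y. ft c (y - a) / (2 * of_real pi) - f y) + (l2 (rw b) (\<lambda>y. f y - h y) + l2 (rw b) (\<lambda>y. h y - g y))"
  by (intro order_trans[OF L2_add(2)] add_left_mono L2_add L2_diff(1) cL fL h(5) g)
 then have "l2 (rw b) (\<lambda>y. ft c (y - a) / (2 * of_real pi) - g y) < e"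
  using h(4) f(4) c(2) by simp
 then show ?thesis using c(1) that by blast
qed

lemma wt_0: "wt 0 b n y = jbr y powr (2 * b)"
 by (simp add: wt_def)

lemma L2_row_rw:
 assumes f: "f \<in> L2 (wm 0 b)"
 shows "(\<lambda>y. f (n, y)) \<in> L2 (rw b)" "l2 (rw b) (\<lambda>y. f (n, y)) \<le> l2 (wm 0 b) f"
proof -
 note m = L2_wm_measurable[OF f]
 have "sqi (rw b) (\<lambda>y. f (n, y)) \<le> sqi (wm 0 b) f"
  using sqi_wm_row_le[OF m, of 0 b n] by (simp add: sqi_rw measurable_row[OF m] wt_0)
 then have le: "sqi (rw b) (\<lambda>y. f (n, y)) \<le> ennreal ((l2 (wm 0 b) f)\<^sup>2)"
  by (simp add: sqi_l2[OF f])
 show "(\<lambda>y. f (n, y)) \<in> L2 (rw b)" "l2 (rw b) (\<lambda>y. f (n, y)) \<le> l2 (wm 0 b) f"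
  using l2_leI[OF _ le] measurable_row[OF m] by auto
qed

lemma sqi_wm_finite_rows:
 assumes f: "f \<in> bPM" and I: "finite I" "\<And>n y. n \<notin> I ==> f (n, y) = 0"
 shows "sqi (wm 0 b) f = (\<Sum>n\<in>I. sqi (rw b) (\<lambda>y. f (n, y)))"
proof -
 have "sqi (wm 0 b) f = (\<integral>\<^sup>+n. sqi (rw b) (\<lambda>y. f (n, y)) \<partial>ZZ)"
  by (simp add: sqi_wm[OF f] sqi_rw measurable_row[OF f] wt_0)
 also have "\<dots> = (\<integral>\<^sup>+n\<in>I. sqi (rw b) (\<lambda>y. f (n, y)) \<partial>ZZ)"
  using I(2) by (intro nn_integral_cong) (auto simp: indicator_def sqi_def)
 also have "\<dots> = (\<Sum>n\<in>I. sqi (rw b) (\<lambda>y. f (n, y)))"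
  using I(1) by (simp add: nn_integral_count_space_indicator[symmetric] nn_integral_count_space_finite)
 finally show ?thesis .
qed

text \<open>After a cut to finitely many rows, each row is approximated by the transform of a
  Schwartz function. The resulting trigonometric sum in \<open>x\<close> is smooth, and its
  transform is known row by row.\<close>

theorem smooth_density:
 assumes g: "g \<in> L2 (wm 0 b)" and e: "0 < e" and b: "0 \<le> b" "b \<le> 1"
 obtains F where "F \<in> smooth_schwartz" "l2 (wm 0 b) (\<lambda>z. gam F z - g z) < e"
proof -
 note m = L2_wm_measurable[OF g]
 define h where "h k z = (if \<bar>fst z\<bar> \<le> int k then g z else 0)" for k z
 have mh: "h k \<in> bPM" for k
  unfolding measurable_PM_iff h_def using measurable_row[OF m] by auto
 have "null (\<lambda>k. l2 (wm 0 b) (\<lambda>z. h k z - g z))"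
 proof (rule L2_dominated_convergence(2)[OF _ _ g])
  show "AE z in wm 0 b. (\<lambda>k. h k z) \<longlonglongrightarrow> g z"
  proof (intro AE_I2 tendsto_eventually)
   fix z :: "int \<times> real"
   show "\<forall>\<^sub>F k in sequentially. h k z = g z"
    by (rule eventually_sequentiallyI[of "nat \<bar>fst z\<bar>"]) (auto simp: h_def)
  qed
 qed (use mh m in \<open>auto simp: h_def\<close>)
 then obtain k where k: "l2 (wm 0 b) (\<lambda>z. h k z - g z) < e / 2"
  using e by (metis (no_types, lifting) LIMSEQ_iff diff_zero l2_nonneg real_norm_def abs_of_nonneg order_refl half_gt_zero)
 have hL: "h k \<in> L2 (wm 0 b)"
  by (rule L2_mono_AE(1)[OF _ _ g]) (use mh in \<open>auto simp: h_def\<close>)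
 define I where "I = {n. \<bar>n\<bar> \<le> int k}"
 have fI: "finite I"
 proof -
  have "I \<subseteq> {- int k..int k}" by (auto simp: I_def)
  then show ?thesis by (rule finite_subset) simp
 qed
 \<comment> \<open>\<open>card I\<close> rows with squared error \<open>e'\<^sup>2\<close> each stay
   within \<open>(e / 2)\<^sup>2\<close>; the \<open>+ 1\<close> keeps the denominator
   positive.\<close>
 define e' where "e' = e / (2 * sqrt (real (card I) + 1))"
 have e': "0 < e'" using e by (simp add: e'_def)
 have "\<exists>c\<in>schwartz. l2 (rw b) (\<lambda>y. ft c (y - (of_int n)\<^sup>2) / (2 * of_real pi) - g (n, y)) < e'" for n
  by (rule row_density[OF L2_row_rw(1)[OF g, of n] e' b, where a="(of_int n)\<^sup>2"]) (rule bexI)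
 then obtain c where c: "\<And>n. c n \<in> schwartz"
  "\<And>n. l2 (rw b) (\<lambda>y. ft (c n) (y - (of_int n)\<^sup>2) / (2 * of_real pi) - g (n, y)) < e'"
  by metis
 define F where "F t x = (\<Sum>n\<in>I. c n t * cis (of_int n * x))" for t x
 have F: "F \<in> smooth_schwartz"
  unfolding F_def by (rule trig_sum_smooth_schwartz[OF fI c(1)])
 have cF: "fcoeff (F t) n = (if n \<in> I then c n t else 0)" for t n
  unfolding F_def by (rule fcoeff_trig_sum[OF fI])
 have gF: "gam F (n, y) = (if n \<in> I then ft (c n) (y - (of_int n)\<^sup>2) / (2 * of_real pi) else 0)" for n y
  by (cases "n \<in> I") (simp_all add: gam_def st_fourier_eq_ft cF ft_def)
 have hI: "h k (n, y) = (if n \<in> I then g (n, y) else 0)" for n y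
  by (simp add: h_def I_def)
 define d where "d z = gam F z - h k z" for z
 have dm: "d \<in> bPM"
  unfolding d_def using gam_measurable[OF F] mh[of k] by (intro borel_measurable_diff)
 have "sqi (wm 0 b) d = (\<Sum>n\<in>I. sqi (rw b) (\<lambda>y. d (n, y)))"
  by (rule sqi_wm_finite_rows[OF dm fI]) (simp add: d_def gF hI)
 also have "\<dots> \<le> (\<Sum>n\<in>I. ennreal (e'\<^sup>2))"
 proof (rule sum_mono)
  fix n assume n: "n \<in> I"
  have eq: "(\<lambda>y. d (n, y)) = (\<lambda>y. ft (c n) (y - (of_int n)\<^sup>2) / (2 * of_real pi) - g (n, y))"
   using n by (simp add: d_def gF hI)
  have "(\<lambda>y. d (n, y)) \<in> L2 (rw b)"
   unfolding d_def by (intro L2_diff(1) L2_row_rw(1) hL gam_L2(1)[OF F b])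
  then show "sqi (rw b) (\<lambda>y. d (n, y)) \<le> ennreal (e'\<^sup>2)"
   using c(2)[of n] unfolding eq by (simp add: sqi_l2 power_mono)
 qed
 also have "\<dots> = ennreal (real (card I) * e'\<^sup>2)"
  by (simp add: ennreal_mult ennreal_of_nat_eq_real_of_nat)
 also have "\<dots> \<le> ennreal ((e / 2)\<^sup>2)"
 proof (rule ennreal_leI)
  have "real (card I) * e'\<^sup>2 \<le> (real (card I) + 1) * e'\<^sup>2" by (simp add: mult_right_mono)
  also have "\<dots> = (e / 2)\<^sup>2"
  proof -
   define p where "p = real (card I) + 1"
   have "0 < p" by (simp add: p_def)
   then show ?thesis unfolding e'_def p_def[symmetric] by (simp add: power_divide power_mult_distrib)
  qed
  finally show "real (card I) * e'\<^sup>2 \<le> (e / 2)\<^sup>2" .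
 qed
 finally have dl: "d \<in> L2 (wm 0 b)" "l2 (wm 0 b) d \<le> e / 2"
  using l2_leI[of d "wm 0 b" "e / 2"] dm e by auto
 have "l2 (wm 0 b) (\<lambda>z. d z + (h k z - g z)) \<le> l2 (wm 0 b) d + l2 (wm 0 b) (\<lambda>z. h k z - g z)"
  by (intro L2_add(2) dl L2_diff(1) hL g)
 then have "l2 (wm 0 b) (\<lambda>z. gam F z - g z) < e"
  using dl(2) k by (simp add: d_def)
 then show ?thesis using F that by blast
qed

lemma smooth_density_sequence:
 assumes g: "g \<in> L2 (wm 0 b)" and b: "0 \<le> b" "b \<le> 1"
 obtains F where "\<And>k. F k \<in> smooth_schwartz" "null (\<lambda>k. l2 (wm 0 b) (\<lambda>z. gam (F k) z - g z))"
proof -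
 have "\<exists>F. F \<in> smooth_schwartz \<and> l2 (wm 0 b) (\<lambda>z. gam F z - g z) < inverse (real (Suc k))" for k
  using smooth_density[OF g _ b, of "inverse (real (Suc k))"] by (metis inverse_positive_iff_positive of_nat_0_less_iff zero_less_Suc)
 then obtain F where F: "\<And>k. F k \<in> smooth_schwartz" "\<And>k. l2 (wm 0 b) (\<lambda>z. gam (F k) z - g z) < inverse (real (Suc k))"
  by metis
 have "null (\<lambda>k. l2 (wm 0 b) (\<lambda>z. gam (F k) z - g z))"
  by (rule Lim_null_comparison[OF _ LIMSEQ_inverse_real_of_nat])
   (use F(2) in \<open>auto intro!: always_eventually less_imp_le\<close>)
 then show ?thesis using F(1) that by blast
qed

subsection \<open>The curve determines the element\<close>

lemma L2_rw_lborel: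
 assumes f: "f \<in> L2 (rw b)" and b: "0 \<le> b"
 shows "f \<in> L2 lborel" "l2 lborel f \<le> l2 (rw b) f"
proof -
 have [measurable]: "f \<in> bor" using f L2_measurable by fastforce
 have "sqi lborel f \<le> sqi (rw b) f"
  unfolding sqi_rw[OF \<open>f \<in> bor\<close>] unfolding sqi_def
  using b by (intro nn_integral_mono ennreal_leI) (simp add: jbr_powr_ge1 mult_le_cancel_right1)
 then have le: "sqi lborel f \<le> ennreal ((l2 (rw b) f)\<^sup>2)" by (simp add: sqi_l2[OF f])
 show "f \<in> L2 lborel" "l2 lborel f \<le> l2 (rw b) f"
  using l2_leI[OF _ le] by auto
qed

lemma measurable_cnj [measurable]: "cnj \<in> bor"
 by (intro borel_measurable_continuous_onI continuous_intros)

text \<open>Parseval: the pairing in frequency is an integral in time of the curve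
  \<open>ic d\<close> against the conjugate coefficient of \<open>F\<close>, up to a phase.\<close>

lemma pairing_gam_eq_0:
 assumes d: "d \<in> L2 (wm 0 b)" "1/2 < b" and zero: "\<And>t. ic d t n = 0" and F: "F \<in> smooth_schwartz"
 shows "(LBINT y. d (n, y) * cnj (gam F (n, y))) = 0"
proof -
 define c where "c t = fcoeff (F t) n" for t
 have c: "c \<in> schwartz" unfolding c_def by (rule smooth_schwartz_fcoeff[OF F])
 have [measurable]: "c \<in> bor" using c by (rule schwartz_measurable)
 have [measurable]: "(\<lambda>y. d (n, y)) \<in> bor" by (rule L2_row_measurable[OF d(1)])
 define m where "m = (real_of_int n)\<^sup>2"
 define k where "k y t = d (n, y) * (cis ((y - m) * t) * cnj (c t))" for y t
 have int: "integrable (lborel \<Otimes>\<^sub>M lborel) (\<lambda>(y, t). k y t)"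
  unfolding k_def
  by (rule lborel_pair.integrable_mult_prod[OF L2_row_integrable[OF d, of n] schwartz_integrable[OF c]])
   (auto simp: norm_mult)
 have "d (n, y) * cnj (gam F (n, y)) = (LBINT t. k y t) / (2 * of_real pi)" for y
 proof -
  have "cnj (ft c (y - m)) = (LBINT t. cnj (cis (- ((y - m) * t)) * c t))"
   unfolding ft_def by (rule Bochner_Integration.integral_cnj[symmetric])
  then show ?thesis
   by (simp add: gam_def st_fourier_eq_ft c_def[abs_def] m_def k_def cis_cnj)
 qed
 then have "(LBINT y. d (n, y) * cnj (gam F (n, y))) = (LBINT y. LBINT t. k y t) / (2 * of_real pi)"
  by simp
 also have "(LBINT y. LBINT t. k y t) = (LBINT t. LBINT y. k y t)"
  using lborel_pair.Fubini_integral[OF int] by simp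
 also have "\<dots> = (LBINT t. cis (- (m * t)) * cnj (c t) * ic d t n)"
 proof (rule Bochner_Integration.integral_cong[OF refl])
  fix t
  have "k y t = cis (- (m * t)) * cnj (c t) * (cis (t * y) * d (n, y))" for y
  proof -
   have "cis ((y - m) * t) = cis (- (m * t)) * cis (t * y)" by (simp add: cis_mult algebra_simps)
   then show ?thesis by (simp add: k_def mult_ac)
  qed
  then show "(LBINT y. k y t) = cis (- (m * t)) * cnj (c t) * ic d t n"
   by (simp only: ic_def integral_mult_right_zero)
 qed
 finally show ?thesis by (simp add: zero)
qed

text \<open>A vanishing curve is orthogonal to all smooth functions, and these are dense, so
  \<open>d\<close> is orthogonal to itself, row by row. Thus a curve determines its element and its
  norm.\<close>

lemma ic_injective:
 assumes d: "d \<in> L2 (wm 0 b)" "1/2 < b" "b \<le> 1" and zero: "\<And>t n. ic d t n = 0"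
 shows "l2 (wm 0 b) d = 0"
proof -
 have b0: "0 \<le> b" using d by simp
 obtain F where F: "\<And>k. F k \<in> smooth_schwartz" "null (\<lambda>k. l2 (wm 0 b) (\<lambda>z. gam (F k) z - d z))"
  by (rule smooth_density_sequence[OF d(1) b0 d(3)]) blast
 have row0: "l2 lborel (\<lambda>y. d (n, y)) = 0" for n
 proof -
  have dL: "(\<lambda>y. d (n, y)) \<in> L2 lborel"
   by (rule L2_rw_lborel(1)[OF L2_row_rw(1)[OF d(1)] b0])
  have FL: "(\<lambda>y. gam (F k) (n, y)) \<in> L2 lborel" for k
   by (rule L2_rw_lborel(1)[OF L2_row_rw(1)[OF gam_L2(1)[OF F(1) b0 d(3)]] b0])
  have cnjL: "(\<lambda>x. cnj (f x)) \<in> L2 lborel \<and> l2 lborel (\<lambda>x. cnj (f x)) = l2 lborel f" if "f \<in> L2 lborel" for f :: "real => complex"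
   using that by (auto simp: L2_def l2_def sqi_def)
  have "(l2 lborel (\<lambda>y. d (n, y)))\<^sup>2 \<le> l2 lborel (\<lambda>y. d (n, y)) * l2 (wm 0 b) (\<lambda>z. gam (F k) z - d z)" for k
  proof -
   let ?D = "\<lambda>y. d (n, y)" and ?G = "\<lambda>y. gam (F k) (n, y)"
   have sq: "ennreal ((l2 lborel ?D)\<^sup>2) = nnl (\<lambda>y. norm (?D y * cnj (?D y)))"
    unfolding sqi_l2[OF dL, symmetric] sqi_def by (simp add: norm_mult power2_eq_square)
   have i1: "integrable lborel (\<lambda>y. ?D y * cnj (?D y))"
    using integrable_L2_mult(2)[OF dL conjunct1[OF cnjL[OF dL]]] .
   have i2: "integrable lborel (\<lambda>y. ?D y * cnj (?G y))"
    using integrable_L2_mult(2)[OF dL conjunct1[OF cnjL[OF FL]]] .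
   have DG: "(\<lambda>y. ?D y - ?G y) \<in> L2 lborel" by (rule L2_diff(1)[OF dL FL])
   have eqR: "?D y * cnj (?D y) = complex_of_real (norm (?D y * cnj (?D y)))" for y
    by (simp only: complex_norm_square[symmetric]) (simp add: norm_power)
   have "(l2 lborel ?D)\<^sup>2 = (LBINT y. norm (?D y * cnj (?D y)))"
    using sq nn_integral_eq_integral[OF integrable_norm[OF i1]] by (simp add: integral_nonneg_AE)
   then have "complex_of_real ((l2 lborel ?D)\<^sup>2) = (LBINT y. ?D y * cnj (?D y))"
    by (subst eqR) (simp only: integral_complex_of_real)
   also have "\<dots> = (LBINT y. ?D y * cnj (?D y)) - (LBINT y. ?D y * cnj (?G y))"
    using pairing_gam_eq_0[OF d(1,2) zero F(1)] by simp
   also have "\<dots> = (LBINT y. ?D y * cnj (?D y - ?G y))"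
    by (subst Bochner_Integration.integral_diff[OF i1 i2, symmetric]) (simp add: right_diff_distrib)
   finally have eq: "complex_of_real ((l2 lborel ?D)\<^sup>2) = (LBINT y. ?D y * cnj (?D y - ?G y))" .
   have "(l2 lborel ?D)\<^sup>2 = norm (LBINT y. ?D y * cnj (?D y - ?G y))"
    unfolding eq[symmetric] norm_of_real by simp
   also have "\<dots> \<le> (LBINT y. norm (?D y * cnj (?D y - ?G y)))" by (rule integral_norm_bound)
   also have "\<dots> \<le> l2 lborel ?D * l2 lborel (\<lambda>y. cnj (?D y - ?G y))"
    by (rule integrable_L2_mult(3)[OF dL conjunct1[OF cnjL[OF DG]]])
   also have "l2 lborel (\<lambda>y. cnj (?D y - ?G y)) = l2 lborel (\<lambda>y. ?G y - ?D y)"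
    using conjunct2[OF cnjL[OF DG]] l2_diff_commute by metis
   also have "\<dots> \<le> l2 (wm 0 b) (\<lambda>z. gam (F k) z - d z)"
   proof -
    have L: "(\<lambda>z. gam (F k) z - d z) \<in> L2 (wm 0 b)"
     by (intro L2_diff(1) gam_L2(1) F d b0)
    show ?thesis
     using L2_rw_lborel(2)[OF L2_row_rw(1)[OF L] b0] L2_row_rw(2)[OF L, of n] by (meson order_trans)
   qed
   finally show ?thesis by (simp add: mult_left_mono)
  qed
  then have "(l2 lborel (\<lambda>y. d (n, y)))\<^sup>2 \<le> l2 lborel (\<lambda>y. d (n, y)) * 0"
   by (intro LIMSEQ_le_const[OF tendsto_mult[OF tendsto_const F(2)]]) auto
  then show ?thesis by simp
 qed
 have z: "AE y in lborel. d (n, y) = 0" for n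
  by (rule l2_eq_0_AE[OF L2_rw_lborel(1)[OF L2_row_rw(1)[OF d(1)] b0] row0])
 have "AE y in lborel. ennreal (wt 0 b n y * (norm (d (n, y)))\<^sup>2) = 0" for n
  using z[of n] by (rule eventually_mono) simp
 then have "nnl (\<lambda>y. wt 0 b n y * (norm (d (n, y)))\<^sup>2) = (\<integral>\<^sup>+y. 0 \<partial>(lborel :: real measure))" for n
  by (rule nn_integral_cong_AE)
 then show ?thesis by (simp add: l2_def sqi_wm[OF L2_wm_measurable[OF d(1)]])
qed

lemma cv_injective:
 assumes f: "f \<in> L2 (wm 0 b)" "g \<in> L2 (wm 0 b)" "1/2 < b" "b \<le> 1" and eq: "\<And>t n. cv f t n = cv g t n"
 shows "l2 (wm 0 b) (\<lambda>z. f z - g z) = 0"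
proof (rule ic_injective[OF L2_diff(1)[OF f(1,2)] f(3,4)])
 fix t n
 show "ic (\<lambda>z. f z - g z) t n = 0"
  using eq[of t n] by (simp add: ic_diff[OF f(1,2,3)] ic_cv)
qed

subsection \<open>The completion as a weighted space\<close>

lemma Xsb_smooth_norm_diff:
 assumes "F \<in> smooth_schwartz" "G \<in> smooth_schwartz" "0 \<le> b" "b \<le> 1"
 shows "Xsb_smooth_norm 0 b (\<lambda>t x. F t x - G t x) = 2 * pi * l2 (wm 0 b) (\<lambda>z. gam F z - gam G z)"
 using gam_L2(2)[OF smooth_schwartz_diff[OF assms(1,2)] assms(3,4)] by (simp add: gam_diff[OF assms(1,2)])

lemma represents_limit:
 assumes b: "1/2 < b" "b \<le> 1" and rep: "Xsb_represents 0 b \<Phi> F"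
 obtains g where "g \<in> L2 (wm 0 b)" "null (\<lambda>k. l2 (wm 0 b) (\<lambda>z. gam (\<Phi> k) z - g z))" "F = cv g"
proof -
 have b0: "0 \<le> b" using b by simp
 have \<Phi>: "\<Phi> k \<in> smooth_schwartz" for k using rep by (simp add: Xsb_represents_def)
 have L: "gam (\<Phi> k) \<in> L2 (wm 0 b)" for k by (rule gam_L2(1)[OF \<Phi> b0 b(2)])
 obtain g where g: "g \<in> L2 (wm 0 b)" "null (\<lambda>k. l2 (wm 0 b) (\<lambda>z. gam (\<Phi> k) z - g z))"
 proof (rule L2_complete[OF L])
  fix e :: real assume "0 < e"
  then have "0 < 2 * pi * e" by simp
  then obtain K where "\<forall>k\<ge>K. \<forall>m\<ge>K. Xsb_smooth_norm 0 b (\<lambda>t x. \<Phi> k t x - \<Phi> m t x) < 2 * pi * e"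
   using rep unfolding Xsb_represents_def by blast
  then show "\<exists>K. \<forall>k\<ge>K. \<forall>m\<ge>K. l2 (wm 0 b) (\<lambda>z. gam (\<Phi> k) z - gam (\<Phi> m) z) < e"
   by (auto simp: Xsb_smooth_norm_diff[OF \<Phi> \<Phi> b0 b(2)])
 qed blast
 have "F t n = cv g t n" for t n
 proof (rule LIMSEQ_unique)
  show "(\<lambda>k. fcoeff (\<Phi> k t) n) \<longlonglongrightarrow> F t n" using rep by (simp add: Xsb_represents_def)
  show "(\<lambda>k. fcoeff (\<Phi> k t) n) \<longlonglongrightarrow> cv g t n"
   using cv_tendsto[OF L g(1) b(1) g(2), of t n] by (simp add: cv_gam[OF \<Phi>])
 qed
 then have "F = cv g" by auto
 then show ?thesis using g that by blast
qed

lemma cv_represented: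
 assumes b: "1/2 < b" "b \<le> 1" and g: "g \<in> L2 (wm 0 b)"
 obtains \<Phi> where "Xsb_represents 0 b \<Phi> (cv g)" "null (\<lambda>k. l2 (wm 0 b) (\<lambda>z. gam (\<Phi> k) z - g z))"
proof -
 have b0: "0 \<le> b" using b by simp
 obtain \<Phi> where \<Phi>: "\<And>k. \<Phi> k \<in> smooth_schwartz" "null (\<lambda>k. l2 (wm 0 b) (\<lambda>z. gam (\<Phi> k) z - g z))"
  by (rule smooth_density_sequence[OF g b0 b(2)]) blast
 have L: "gam (\<Phi> k) \<in> L2 (wm 0 b)" for k by (rule gam_L2(1)[OF \<Phi>(1) b0 b(2)])
 have "\<exists>K. \<forall>k\<ge>K. \<forall>m\<ge>K. Xsb_smooth_norm 0 b (\<lambda>t x. \<Phi> k t x - \<Phi> m t x) < e" if "0 < e" for e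
 proof -
  have "0 < e / (4 * pi)" using that by simp
  then obtain K where K: "\<And>k. K \<le> k ==> l2 (wm 0 b) (\<lambda>z. gam (\<Phi> k) z - g z) < e / (4 * pi)"
   using LIMSEQ_D[OF \<Phi>(2), of "e / (4 * pi)"] by auto
  have "Xsb_smooth_norm 0 b (\<lambda>t x. \<Phi> k t x - \<Phi> m t x) < e" if "K \<le> k" "K \<le> m" for k m
  proof -
   have "l2 (wm 0 b) (\<lambda>z. gam (\<Phi> k) z - gam (\<Phi> m) z) \<le>
     l2 (wm 0 b) (\<lambda>z. gam (\<Phi> k) z - g z) + l2 (wm 0 b) (\<lambda>z. gam (\<Phi> m) z - g z)"
    using L2_diff(2)[OF L2_diff(1)[OF L[of k] g] L2_diff(1)[OF L[of m] g]] by simp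
   also have "\<dots> < e / (2 * pi)" using K[OF that(1)] K[OF that(2)] by (simp add: field_simps)
   finally show ?thesis by (simp add: Xsb_smooth_norm_diff[OF \<Phi>(1) \<Phi>(1) b0 b(2)] field_simps)
  qed
  then show ?thesis by blast
 qed
 moreover have "(\<lambda>k. fcoeff (\<Phi> k t) n) \<longlonglongrightarrow> cv g t n" for t n
  using cv_tendsto[OF L g(1) b(1) \<Phi>(2), of t n] by (simp add: cv_gam[OF \<Phi>(1)])
 ultimately have "Xsb_represents 0 b \<Phi> (cv g)"
  using \<Phi>(1) by (simp add: Xsb_represents_def)
 then show ?thesis using \<Phi>(2) that by blast
qed

theorem Xsb_eq:
 assumes b: "1/2 < b" "b \<le> 1"
 shows "Xsb 0 b = cv ` L2 (wm 0 b)"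
proof (intro set_eqI iffI)
 fix F assume "F \<in> Xsb 0 b"
 then obtain \<Phi> where "Xsb_represents 0 b \<Phi> F" by (auto simp: Xsb_def)
 from represents_limit[OF b this] show "F \<in> cv ` L2 (wm 0 b)" by blast
next
 fix F assume "F \<in> cv ` L2 (wm 0 b)"
 then obtain g where "F = cv g" "g \<in> L2 (wm 0 b)" by blast
 with cv_represented[OF b this(2)] show "F \<in> Xsb 0 b" by (auto simp: Xsb_def)
qed

text \<open>The definite description in \<open>Xsb_norm\<close> requires that the limit of the norms
  be the same for all sequences that represent one curve. Their limits in \<open>wm 0 b\<close> have
  the same curve, so \<open>cv_injective\<close> applies.\<close>

theorem Xsb_norm_cv:
 assumes b: "1/2 < b" "b \<le> 1" and g: "g \<in> L2 (wm 0 b)"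
 shows "Xsb_norm 0 b (cv g) = 2 * pi * l2 (wm 0 b) g"
 unfolding Xsb_norm_def
proof (rule the_equality)
 have b0: "0 \<le> b" using b by simp
 have conv: "(\<lambda>k. Xsb_smooth_norm 0 b (\<Phi> k)) \<longlonglongrightarrow> 2 * pi * l2 (wm 0 b) h"
  if "\<And>k. \<Phi> k \<in> smooth_schwartz" "h \<in> L2 (wm 0 b)" "null (\<lambda>k. l2 (wm 0 b) (\<lambda>z. gam (\<Phi> k) z - h z))" for \<Phi> h
  unfolding gam_L2(2)[OF that(1) b0 b(2)]
  by (intro tendsto_mult tendsto_const l2_tendsto[OF gam_L2(1)[OF that(1) b0 b(2)] that(2,3)])
 obtain \<Phi> where "Xsb_represents 0 b \<Phi> (cv g)" "null (\<lambda>k. l2 (wm 0 b) (\<lambda>z. gam (\<Phi> k) z - g z))"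
  using cv_represented[OF b g] by blast
 then show "\<exists>\<Phi>. Xsb_represents 0 b \<Phi> (cv g) \<and> (\<lambda>k. Xsb_smooth_norm 0 b (\<Phi> k)) \<longlonglongrightarrow> 2 * pi * l2 (wm 0 b) g"
  using conv[of \<Phi> g] g by (auto simp: Xsb_represents_def)
 fix L assume "\<exists>\<Phi>. Xsb_represents 0 b \<Phi> (cv g) \<and> (\<lambda>k. Xsb_smooth_norm 0 b (\<Phi> k)) \<longlonglongrightarrow> L"
 then obtain \<Phi> where \<Phi>: "Xsb_represents 0 b \<Phi> (cv g)" "(\<lambda>k. Xsb_smooth_norm 0 b (\<Phi> k)) \<longlonglongrightarrow> L" by blast
 obtain h where h: "h \<in> L2 (wm 0 b)" "null (\<lambda>k. l2 (wm 0 b) (\<lambda>z. gam (\<Phi> k) z - h z))" "cv g = cv h"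
  using represents_limit[OF b \<Phi>(1)] by blast
 have "l2 (wm 0 b) (\<lambda>z. g z - h z) = 0"
  by (rule cv_injective[OF g h(1) b]) (simp add: h(3))
 then have "l2 (wm 0 b) g = l2 (wm 0 b) h"
  using l2_diff_ge[OF g h(1)] by simp
 moreover have "(\<lambda>k. Xsb_smooth_norm 0 b (\<Phi> k)) \<longlonglongrightarrow> 2 * pi * l2 (wm 0 b) h"
  using conv[of \<Phi> h] h \<Phi>(1) by (auto simp: Xsb_represents_def)
 ultimately show "L = 2 * pi * l2 (wm 0 b) g" using \<Phi>(2) LIMSEQ_unique by metis
qed

subsection \<open>Integral operators in the time frequency\<close>

lemma ennreal_square_add_le: "(x + y)\<^sup>2 \<le> 2 * x\<^sup>2 + 2 * (y\<^sup>2 :: ennreal)"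
proof -
 have "(x + y)\<^sup>2 = x\<^sup>2 + (2 * x * y + y\<^sup>2)" by (simp add: power2_sum add_ac)
 also have "\<dots> \<le> x\<^sup>2 + ((x\<^sup>2 + y\<^sup>2) + y\<^sup>2)" by (intro add_mono sum_of_squares_ge_ennreal) auto
 finally show ?thesis by (simp add: mult_2 add_ac)
qed

lemma nn_integral_minus_shift:
 assumes [measurable]: "f \<in> bor"
 shows "(\<integral>\<^sup>+y. f (a - y) \<partial>lborel) = (\<integral>\<^sup>+y. f y \<partial>(lborel :: real measure))"
 using nn_integral_real_affine[of f "-1" a] by simp

lemma nn_integral_plus_shift:
 assumes [measurable]: "f \<in> bor"
 shows "(\<integral>\<^sup>+y. f (y + a) \<partial>lborel) = (\<integral>\<^sup>+y. f y \<partial>(lborel :: real measure))"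
 using nn_integral_real_affine[of f "1" a] by (simp add: add.commute)

text \<open>Cauchy-Schwarz with the kernel split into two square roots, followed by Fubini.\<close>

lemma young_row:
 fixes k :: "real => real" and g :: "real => ennreal"
 assumes [measurable]: "k \<in> bor" "g \<in> bor" and k0: "\<And>x. 0 \<le> k x"
 shows "(\<integral>\<^sup>+r. (\<integral>\<^sup>+y. ennreal (k (r - y)) * g y \<partial>lborel)\<^sup>2 \<partial>lborel) \<le>
  (nnl (\<lambda>x. k x))\<^sup>2 * (\<integral>\<^sup>+y. (g y)\<^sup>2 \<partial>lborel)"
proof -
 define A where "A = nnl (\<lambda>x. k x)"
 have "(\<integral>\<^sup>+r. (\<integral>\<^sup>+y. ennreal (k (r - y)) * g y \<partial>lborel)\<^sup>2 \<partial>lborel) \<le>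
   (\<integral>\<^sup>+r. A * (\<integral>\<^sup>+y. ennreal (k (r - y)) * (g y)\<^sup>2 \<partial>lborel) \<partial>lborel)"
 proof (intro nn_integral_mono)
  fix r
  have s: "ennreal (sqrt (k x)) * ennreal (sqrt (k x)) = ennreal (k x)" for x
   using k0[of x] by (simp add: ennreal_mult[symmetric])
  have "(\<integral>\<^sup>+y. ennreal (k (r - y)) * g y \<partial>lborel)\<^sup>2 =
    (\<integral>\<^sup>+y. ennreal (sqrt (k (r - y))) * (ennreal (sqrt (k (r - y))) * g y) \<partial>lborel)\<^sup>2"
   by (simp add: mult.assoc[symmetric] s)
  also have "\<dots> \<le> (\<integral>\<^sup>+y. (ennreal (sqrt (k (r - y))))\<^sup>2 \<partial>lborel) *
    (\<integral>\<^sup>+y. (ennreal (sqrt (k (r - y))) * g y)\<^sup>2 \<partial>lborel)"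
   by (rule Cauchy_Schwarz_nn_integral) auto
  also have "(\<integral>\<^sup>+y. (ennreal (sqrt (k (r - y))))\<^sup>2 \<partial>lborel) = A"
   unfolding A_def power2_eq_square s by (rule nn_integral_minus_shift) measurable
  also have "(\<integral>\<^sup>+y. (ennreal (sqrt (k (r - y))) * g y)\<^sup>2 \<partial>lborel) =
    (\<integral>\<^sup>+y. ennreal (k (r - y)) * (g y)\<^sup>2 \<partial>lborel)"
   by (simp add: power_mult_distrib power2_eq_square[of "ennreal (sqrt _)"] s)
  finally show "(\<integral>\<^sup>+y. ennreal (k (r - y)) * g y \<partial>lborel)\<^sup>2 \<le>
    A * (\<integral>\<^sup>+y. ennreal (k (r - y)) * (g y)\<^sup>2 \<partial>lborel)" .
 qed
 also have "\<dots> = A * (\<integral>\<^sup>+r. \<integral>\<^sup>+y. ennreal (k (r - y)) * (g y)\<^sup>2 \<partial>lborel \<partial>lborel)"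
  by (rule nn_integral_cmult) measurable
 also have "(\<integral>\<^sup>+r. \<integral>\<^sup>+y. ennreal (k (r - y)) * (g y)\<^sup>2 \<partial>lborel \<partial>lborel) =
   (\<integral>\<^sup>+y. \<integral>\<^sup>+r. ennreal (k (r - y)) * (g y)\<^sup>2 \<partial>lborel \<partial>lborel)"
  by (rule lborel_pair.Fubini') measurable
 also have "\<dots> = (\<integral>\<^sup>+y. A * (g y)\<^sup>2 \<partial>lborel)"
 proof (intro nn_integral_cong)
  fix y
  have "(\<integral>\<^sup>+r. ennreal (k (r - y)) * (g y)\<^sup>2 \<partial>lborel) = nnl (\<lambda>r. k (r - y)) * (g y)\<^sup>2"
   by (rule nn_integral_multc) measurable
  also have "nnl (\<lambda>r. k (r - y)) = A"
   unfolding A_def using nn_integral_plus_shift[of "\<lambda>x. ennreal (k x)" "- y"] by simp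
  finally show "(\<integral>\<^sup>+r. ennreal (k (r - y)) * (g y)\<^sup>2 \<partial>lborel) = A * (g y)\<^sup>2" .
 qed
 also have "A * \<dots> = A\<^sup>2 * (\<integral>\<^sup>+y. (g y)\<^sup>2 \<partial>lborel)"
  by (subst nn_integral_cmult) (auto simp: power2_eq_square mult.assoc)
 finally show ?thesis unfolding A_def .
qed

lemma rank_one_row:
 fixes a c :: "real => real" and g :: "real => ennreal"
 assumes [measurable]: "a \<in> bor" "c \<in> bor" "g \<in> bor"
  and a0: "\<And>x. 0 \<le> a x" and c0: "\<And>x. 0 \<le> c x"
 shows "(\<integral>\<^sup>+r. (\<integral>\<^sup>+y. ennreal (a r * c y) * g y \<partial>lborel)\<^sup>2 \<partial>lborel) \<le>
  nnl (\<lambda>x. (a x)\<^sup>2) * nnl (\<lambda>x. (c x)\<^sup>2) * (\<integral>\<^sup>+y. (g y)\<^sup>2 \<partial>lborel)"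
proof -
 have "(\<integral>\<^sup>+y. ennreal (a r * c y) * g y \<partial>lborel) = ennreal (a r) * (\<integral>\<^sup>+y. ennreal (c y) * g y \<partial>lborel)" for r
  by (subst nn_integral_cmult[symmetric]) (auto simp: ennreal_mult a0 c0 mult.assoc)
 then have "(\<integral>\<^sup>+r. (\<integral>\<^sup>+y. ennreal (a r * c y) * g y \<partial>lborel)\<^sup>2 \<partial>lborel) =
   (\<integral>\<^sup>+r. ennreal ((a r)\<^sup>2) * (\<integral>\<^sup>+y. ennreal (c y) * g y \<partial>lborel)\<^sup>2 \<partial>lborel)"
  by (simp add: power_mult_distrib ennreal_power a0)
 also have "\<dots> = nnl (\<lambda>x. (a x)\<^sup>2) * (\<integral>\<^sup>+y. ennreal (c y) * g y \<partial>lborel)\<^sup>2"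
  by (rule nn_integral_multc) measurable
 also have "(\<integral>\<^sup>+y. ennreal (c y) * g y \<partial>lborel)\<^sup>2 \<le> (\<integral>\<^sup>+x. (ennreal (c x))\<^sup>2 \<partial>lborel) * (\<integral>\<^sup>+y. (g y)\<^sup>2 \<partial>lborel)"
  by (rule Cauchy_Schwarz_nn_integral) measurable
 finally show ?thesis
  by (simp add: ennreal_power c0 mult.assoc mult_left_mono)
qed

definition kop :: "(real => real => complex) => (int \<times> real => complex) => int \<times> real => complex" where
 "kop M H z = (LBINT y. M (snd z) y * H (fst z, y))"

text \<open>The kernel bound splits into a convolution part and a rank one part; both are bounded on
 \<open>L\<^sup>2\<close>, by Young's inequality and by the Cauchy-Schwarz inequality.\<close>

definition kernel_bound ::
  "real => (real => real => complex) => (real => real) => real => bool" where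
 "kernel_bound b M v B \<longleftrightarrow> case_prod M \<in> borel_measurable (borel \<Otimes>\<^sub>M borel) \<and> v \<in> bor \<and> (\<forall>y. 0 \<le> v y) \<and> 0 \<le> B \<and>
  (\<exists>k a c. k \<in> bor \<and> a \<in> bor \<and> c \<in> bor \<and>
   (\<forall>x. 0 \<le> k x \<and> 0 \<le> a x \<and> 0 \<le> c x) \<and>
   (\<forall>r y. jbr r powr b * norm (M r y) \<le> (k (r - y) + a r * c y) * v y) \<and>
   2 * (nnl (\<lambda>x. k x))\<^sup>2 +
   2 * (nnl (\<lambda>x. (a x)\<^sup>2) * nnl (\<lambda>x. (c x)\<^sup>2)) \<le> ennreal (B\<^sup>2))"

lemma kernel_row:
 assumes K: "kernel_bound b M v B" and H: "H \<in> bor"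
 shows "(\<integral>\<^sup>+r. (ennreal (jbr r powr b) * nnl (\<lambda>y. norm (M r y * H y)))\<^sup>2 \<partial>lborel) \<le>
  ennreal (B\<^sup>2) * nnl (\<lambda>y. (v y * norm (H y))\<^sup>2)"
proof -
 from K have [measurable]: "case_prod M \<in> borel_measurable (borel \<Otimes>\<^sub>M borel)" "v \<in> bor"
  and v0': "\<forall>y. 0 \<le> v y"
  unfolding kernel_bound_def by - (elim conjE, assumption)+
 from K obtain k a c where [measurable]: "k \<in> bor" "a \<in> bor" "c \<in> bor"
  and pos': "\<forall>x. 0 \<le> k x \<and> 0 \<le> a x \<and> 0 \<le> c x"
  and le': "\<forall>r y. jbr r powr b * norm (M r y) \<le> (k (r - y) + a r * c y) * v y"
  and B: "2 * (nnl (\<lambda>x. k x))\<^sup>2 +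
   2 * (nnl (\<lambda>x. (a x)\<^sup>2) * nnl (\<lambda>x. (c x)\<^sup>2)) \<le> ennreal (B\<^sup>2)"
  unfolding kernel_bound_def by (elim conjE exE) (rule that; assumption)
 from v0' have v0: "\<And>x. 0 \<le> v x" by simp
 from pos' have pos: "\<And>x. 0 \<le> k x" "\<And>x. 0 \<le> a x" "\<And>x. 0 \<le> c x" by simp_all
 from le' have le: "\<And>r y. jbr r powr b * norm (M r y) \<le> (k (r - y) + a r * c y) * v y" by simp
 note [measurable] = H
 define g where "g y = ennreal (v y * norm (H y))" for y
 have [measurable]: "g \<in> bor" unfolding g_def by measurable
 have Mm [measurable]: "(\<lambda>y. M r y) \<in> bor" for r
  using measurable_compose[of "\<lambda>y. (r, y)" borel "borel \<Otimes>\<^sub>M borel" "case_prod M" borel] by simp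
 have pt: "ennreal (jbr r powr b) * nnl (\<lambda>y. norm (M r y * H y)) \<le>
   (\<integral>\<^sup>+y. ennreal (k (r - y)) * g y \<partial>lborel) + (\<integral>\<^sup>+y. ennreal (a r * c y) * g y \<partial>lborel)" for r
 proof -
  have "ennreal (jbr r powr b) * nnl (\<lambda>y. norm (M r y * H y)) =
    (\<integral>\<^sup>+y. ennreal (jbr r powr b) * ennreal (norm (M r y * H y)) \<partial>lborel)"
   by (rule nn_integral_cmult[symmetric]) measurable
  also have "\<dots> \<le> (\<integral>\<^sup>+y. ennreal (k (r - y)) * g y + ennreal (a r * c y) * g y \<partial>lborel)"
  proof (intro nn_integral_mono)
   fix y
   have "jbr r powr b * norm (M r y * H y) \<le> (k (r - y) + a r * c y) * (v y * norm (H y))"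
    using mult_right_mono[OF le[of r y], of "norm (H y)"] by (simp add: norm_mult mult.assoc)
   then have "ennreal (jbr r powr b * norm (M r y * H y)) \<le> ennreal ((k (r - y) + a r * c y) * (v y * norm (H y)))"
    by (rule ennreal_leI)
   also have "\<dots> = ennreal (k (r - y)) * g y + ennreal (a r * c y) * g y"
    unfolding g_def using pos v0 by (simp add: ennreal_mult ennreal_plus distrib_right)
   finally show "ennreal (jbr r powr b) * ennreal (norm (M r y * H y)) \<le> \<dots>"
    by (simp add: ennreal_mult)
  qed
  also have "\<dots> = (\<integral>\<^sup>+y. ennreal (k (r - y)) * g y \<partial>lborel) + (\<integral>\<^sup>+y. ennreal (a r * c y) * g y \<partial>lborel)"
   by (rule nn_integral_add) measurable
  finally show ?thesis .
 qed
 have "(\<integral>\<^sup>+r. (ennreal (jbr r powr b) * nnl (\<lambda>y. norm (M r y * H y)))\<^sup>2 \<partial>lborel) \<le>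
   (\<integral>\<^sup>+r. 2 * (\<integral>\<^sup>+y. ennreal (k (r - y)) * g y \<partial>lborel)\<^sup>2 + 2 * (\<integral>\<^sup>+y. ennreal (a r * c y) * g y \<partial>lborel)\<^sup>2 \<partial>lborel)"
  by (intro nn_integral_mono order_trans[OF power_mono_ennreal[OF pt] ennreal_square_add_le])
 also have "\<dots> = 2 * (\<integral>\<^sup>+r. (\<integral>\<^sup>+y. ennreal (k (r - y)) * g y \<partial>lborel)\<^sup>2 \<partial>lborel) +
   2 * (\<integral>\<^sup>+r. (\<integral>\<^sup>+y. ennreal (a r * c y) * g y \<partial>lborel)\<^sup>2 \<partial>lborel)"
  by (simp add: nn_integral_add nn_integral_cmult)
 also have "\<dots> \<le> 2 * ((nnl (\<lambda>x. k x))\<^sup>2 * (\<integral>\<^sup>+y. (g y)\<^sup>2 \<partial>lborel)) +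
   2 * (nnl (\<lambda>x. (a x)\<^sup>2) * nnl (\<lambda>x. (c x)\<^sup>2) * (\<integral>\<^sup>+y. (g y)\<^sup>2 \<partial>lborel))"
  by (intro add_mono mult_left_mono young_row rank_one_row pos) auto
 also have "\<dots> = (2 * (nnl (\<lambda>x. k x))\<^sup>2 +
   2 * (nnl (\<lambda>x. (a x)\<^sup>2) * nnl (\<lambda>x. (c x)\<^sup>2))) * (\<integral>\<^sup>+y. (g y)\<^sup>2 \<partial>lborel)"
  by (simp add: distrib_right mult.assoc)
 also have "\<dots> \<le> ennreal (B\<^sup>2) * (\<integral>\<^sup>+y. (g y)\<^sup>2 \<partial>lborel)"
  by (intro mult_right_mono B) simp
 also have "(\<integral>\<^sup>+y. (g y)\<^sup>2 \<partial>lborel) = nnl (\<lambda>y. (v y * norm (H y))\<^sup>2)"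
  using v0 by (simp add: g_def ennreal_power)
 finally show ?thesis .
qed

definition vsq :: "(real => real) => (int \<times> real => complex) => ennreal" where
 "vsq v H = (\<integral>\<^sup>+n. \<integral>\<^sup>+y. ennreal ((v y * norm (H (n, y)))\<^sup>2) \<partial>lborel \<partial>ZZ)"

lemma vsq_row_finite:
 assumes "vsq v H < \<infinity>"
 shows "nnl (\<lambda>y. (v y * norm (H (n, y)))\<^sup>2) < \<infinity>"
proof -
 have "nnl (\<lambda>y. (v y * norm (H (n, y)))\<^sup>2) =
   (\<integral>\<^sup>+k. (nnl (\<lambda>y. (v y * norm (H (k, y)))\<^sup>2)) * indicator {n} k \<partial>ZZ)"
  by (subst nn_integral_indicator_singleton) auto
 also have "\<dots> \<le> vsq v H"
  unfolding vsq_def by (intro nn_integral_mono) (auto split: split_indicator)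
 finally show ?thesis using assms by (rule le_less_trans)
qed

lemma kop_L2:
 assumes K: "kernel_bound b M v B" and H: "H \<in> bPM" and fin: "vsq v H < \<infinity>"
 shows "kop M H \<in> L2 (wm 0 b)" "l2 (wm 0 b) (kop M H) \<le> B * sqrt (enn2real (vsq v H))"
proof -
 have B: "0 \<le> B" using K by (simp add: kernel_bound_def)
 have [measurable]: "case_prod M \<in> borel_measurable (borel \<Otimes>\<^sub>M borel)" using K by (simp add: kernel_bound_def)
 have [measurable]: "(\<lambda>y. H (n, y)) \<in> bor" for n by (rule measurable_row[OF H])
 have m: "kop M H \<in> bPM"
  unfolding measurable_PM_iff kop_def by (auto simp: split_beta')
 have "sqi (wm 0 b) (kop M H) \<le> (\<integral>\<^sup>+n. ennreal (B\<^sup>2) * nnl (\<lambda>y. (v y * norm (H (n, y)))\<^sup>2) \<partial>ZZ)"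
  unfolding sqi_wm[OF m]
 proof (intro nn_integral_mono)
  fix n
  have "nnl (\<lambda>x. wt 0 b n x * (norm (kop M H (n, x)))\<^sup>2) \<le>
    (\<integral>\<^sup>+x. (ennreal (jbr x powr b) * nnl (\<lambda>y. norm (M x y * H (n, y))))\<^sup>2 \<partial>lborel)"
  proof (intro nn_integral_mono)
   fix x
   have "wt 0 b n x * (norm (kop M H (n, x)))\<^sup>2 = (jbr x powr b * norm (kop M H (n, x)))\<^sup>2"
    by (simp add: wt_0 power_mult_distrib power2_eq_square[of "_ powr _"] powr_add[symmetric])
   then have "ennreal (wt 0 b n x * (norm (kop M H (n, x)))\<^sup>2) = (ennreal (jbr x powr b) * ennreal (norm (kop M H (n, x))))\<^sup>2"
    by (simp add: ennreal_mult[symmetric] ennreal_power)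
   also have "\<dots> \<le> (ennreal (jbr x powr b) * nnl (\<lambda>y. norm (M x y * H (n, y))))\<^sup>2"
   proof (intro power_mono_ennreal mult_left_mono)
    show "ennreal (norm (kop M H (n, x))) \<le> nnl (\<lambda>y. norm (M x y * H (n, y)))"
    proof (cases "integrable lborel (\<lambda>y. M x y * H (n, y))")
     case True
     then show ?thesis using integral_norm_bound_ennreal[OF True] by (simp add: kop_def)
    next
     \<comment> \<open>A divergent integral has the default value 0, for which the bound is
       trivial.\<close>
     case False
     then show ?thesis by (simp add: kop_def not_integrable_integral_eq)
    qed
   qed simp
   finally show "ennreal (wt 0 b n x * (norm (kop M H (n, x)))\<^sup>2) \<le> \<dots>" .
  qed
  also have "\<dots> \<le> ennreal (B\<^sup>2) * nnl (\<lambda>y. (v y * norm (H (n, y)))\<^sup>2)"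
   by (rule kernel_row[OF K]) measurable
  finally show "nnl (\<lambda>x. wt 0 b n x * (norm (kop M H (n, x)))\<^sup>2) \<le> \<dots>" .
 qed
 also have "\<dots> = ennreal (B\<^sup>2) * vsq v H"
  by (simp add: nn_integral_cmult vsq_def)
 also have "\<dots> = ennreal ((B * sqrt (enn2real (vsq v H)))\<^sup>2)"
  using fin by (simp add: power_mult_distrib ennreal_mult)
 finally have le: "sqi (wm 0 b) (kop M H) \<le> ennreal ((B * sqrt (enn2real (vsq v H)))\<^sup>2)" .
 show "kop M H \<in> L2 (wm 0 b)" "l2 (wm 0 b) (kop M H) \<le> B * sqrt (enn2real (vsq v H))"
  using l2_leI[OF _ le] m B by auto
qed

text \<open>Fubini is justified by the kernel bound itself: \<open>jbr x powr (- b)\<close> is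
  square integrable for \<open>1/2 < b\<close>, and \<open>kernel_row\<close> controls the remaining
  factor.\<close>

lemma ic_kop:
 assumes K: "kernel_bound b M v B" and b: "1/2 < b" and H: "H \<in> bPM" and fin: "vsq v H < \<infinity>"
 shows "ic (kop M H) t n = (LBINT y. H (n, y) * (LBINT x. cis (t * x) * M x y))"
proof -
 have [measurable]: "case_prod M \<in> borel_measurable (borel \<Otimes>\<^sub>M borel)" using K by (simp add: kernel_bound_def)
 have [measurable]: "(\<lambda>y. H (n, y)) \<in> bor" by (rule measurable_row[OF H])
 define F where "F x y = cis (t * x) * (M x y * H (n, y))" for x y
 define R where "R x = nnl (\<lambda>y. norm (M x y * H (n, y)))" for x
 have [measurable]: "R \<in> bor" unfolding R_def by (auto simp: split_beta')
 have int: "integrable (lborel \<Otimes>\<^sub>M lborel) (\<lambda>(x, y). F x y)"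
 proof (rule integrableI_bounded)
  show Fm: "(\<lambda>(x, y). F x y) \<in> borel_measurable (lborel \<Otimes>\<^sub>M lborel)"
   unfolding F_def by (auto simp: split_beta')
  have nF: "norm (F x y) = norm (M x y * H (n, y))" for x y
   by (simp add: F_def norm_mult)
  have "(\<integral>\<^sup>+z. ennreal (norm (case z of (x, y) => F x y)) \<partial>(lborel \<Otimes>\<^sub>M lborel)) =
    (\<integral>\<^sup>+x. \<integral>\<^sup>+y. ennreal (norm (F x y)) \<partial>lborel \<partial>lborel)"
   using lborel.nn_integral_fst[of "\<lambda>z. ennreal (norm (case z of (x, y) => F x y))" lborel]
    measurable_compose[OF measurable_compose[OF Fm borel_measurable_norm] measurable_ennreal] by simp
  also have "\<dots> = (\<integral>\<^sup>+x. R x \<partial>lborel)"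
   unfolding R_def nF ..
  also have "\<dots> = (\<integral>\<^sup>+x. ennreal (jbr x powr (- b)) * (ennreal (jbr x powr b) * R x) \<partial>lborel)"
   by (simp add: mult.assoc[symmetric] ennreal_mult[symmetric] powr_add[symmetric])
  finally have eq: "(\<integral>\<^sup>+z. ennreal (norm (case z of (x, y) => F x y)) \<partial>(lborel \<Otimes>\<^sub>M lborel)) =
    (\<integral>\<^sup>+x. ennreal (jbr x powr (- b)) * (ennreal (jbr x powr b) * R x) \<partial>lborel)" .
  have "(\<integral>\<^sup>+x. ennreal (jbr x powr (- b)) * (ennreal (jbr x powr b) * R x) \<partial>lborel)\<^sup>2 \<le>
    (\<integral>\<^sup>+x. (ennreal (jbr x powr (- b)))\<^sup>2 \<partial>lborel) * (\<integral>\<^sup>+x. (ennreal (jbr x powr b) * R x)\<^sup>2 \<partial>lborel)"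
   by (rule Cauchy_Schwarz_nn_integral) measurable
  also have "\<dots> \<le> ennreal (kb b) * (ennreal (B\<^sup>2) * nnl (\<lambda>y. (v y * norm (H (n, y)))\<^sup>2))"
   unfolding R_def
   by (intro mult_mono kernel_row[OF K])
    (auto simp: ennreal_kb[OF b] power2_eq_square ennreal_mult[symmetric] powr_add[symmetric])
  also have "\<dots> < \<infinity>"
   using vsq_row_finite[OF fin, of n] by (simp add: ennreal_mult_less_top)
  finally show "(\<integral>\<^sup>+z. ennreal (norm (case z of (x, y) => F x y)) \<partial>(lborel \<Otimes>\<^sub>M lborel)) < \<infinity>"
   unfolding eq by (simp add: power2_eq_square ennreal_mult_less_top) auto
 qed
 have "ic (kop M H) t n = (LBINT x. LBINT y. F x y)"
  by (simp add: ic_def kop_def F_def)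
 also have "\<dots> = (LBINT y. LBINT x. F x y)"
  using lborel_pair.Fubini_integral[OF int] by simp
 also have "\<dots> = (LBINT y. H (n, y) * (LBINT x. cis (t * x) * M x y))"
 proof (rule Bochner_Integration.integral_cong[OF refl])
  fix y
  have "F x y = H (n, y) * (cis (t * x) * M x y)" for x by (simp add: F_def mult_ac)
  then show "(LBINT x. F x y) = H (n, y) * (LBINT x. cis (t * x) * M x y)" by simp
 qed
 finally show ?thesis .
qed

subsection \<open>Time localisation\<close>

lemma rapid_add:
 assumes "rapid f" "rapid g" shows "rapid (\<lambda>t. f t + g t)"
 unfolding rapid_def
proof
 fix k
 obtain A where A: "\<And>t. \<bar>t\<bar> ^ k * norm (f t) \<le> A" using assms(1) unfolding rapid_def by blast
 obtain B where B: "\<And>t. \<bar>t\<bar> ^ k * norm (g t) \<le> B" using assms(2) unfolding rapid_def by blast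
 have "\<bar>t\<bar> ^ k * norm (f t + g t) \<le> A + B" for t
 proof -
  have "\<bar>t\<bar> ^ k * norm (f t + g t) \<le> \<bar>t\<bar> ^ k * (norm (f t) + norm (g t))"
   by (intro mult_left_mono norm_triangle_ineq) auto
  then show ?thesis using A[of t] B[of t] by (simp add: distrib_left)
 qed
 then show "\<exists>C. \<forall>t. \<bar>t\<bar> ^ k * norm (f t + g t) \<le> C" by blast
qed

lemma rapid_ident_mult:
 assumes "rapid f" shows "rapid (\<lambda>t. of_real \<bar>t\<bar> * f t)"
 unfolding rapid_def
proof
 fix k
 obtain A where "\<And>t. \<bar>t\<bar> ^ Suc k * norm (f t) \<le> A" using assms(1) unfolding rapid_def by blast
 then show "\<exists>C. \<forall>t. \<bar>t\<bar> ^ k * norm (of_real \<bar>t\<bar> * f t) \<le> C"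
  by (intro exI[of _ A]) (simp add: norm_mult mult_ac)
qed

lemma norm_cis_minus_1_le: "norm (cis x - 1) \<le> \<bar>x\<bar>"
 using iexp_approx1[of x 0] by (simp add: cis_conv_exp)

lemma jbr_triangle: "jbr (x + y) \<le> jbr x + jbr y"
proof -
 have "x * y \<le> \<bar>x\<bar> * \<bar>y\<bar>" by (simp add: abs_mult[symmetric])
 also have "\<dots> \<le> jbr x * jbr y" by (intro mult_mono abs_le_jbr) auto
 finally have "(jbr (x + y))\<^sup>2 \<le> (jbr x + jbr y)\<^sup>2"
  by (simp add: jbr_square power2_sum)
 then show ?thesis by (rule power2_le_imp_le) (simp add: add_nonneg_nonneg)
qed

text \<open>The derivative of the transform is, up to a factor, the transform of
  \<open>t * p t\<close> and decays as well. Over a segment of length at most 1 brackets change by a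
  factor of at most 3, whence the 9.\<close>

lemma ft_difference_small:
 assumes p: "p \<in> schwartz"
 obtains L where "0 \<le> L" "\<And>x z. \<bar>x\<bar> \<le> 1 ==> norm (ft p (z - x) - ft p z) \<le> L * \<bar>x\<bar> * jbr z powr (-2)"
proof -
 obtain p' where p': "p' \<in> schwartz" "\<And>t. (p has_vector_derivative p' t) (at t)"
  using p by (rule schwartz_deriv) auto
 obtain p'' where p'': "p'' \<in> schwartz" "\<And>t. (p' has_vector_derivative p'' t) (at t)"
  using p'(1) by (rule schwartz_deriv) auto
 note r = schwartz_rapid[OF p] schwartz_rapid[OF p'(1)] schwartz_rapid[OF p''(1)]
 note [measurable] = schwartz_measurable[OF p]
 have ri: "rapid (\<lambda>t. of_real t * f t)" if "rapid f" for f
  using rapid_ident_mult[OF that] by (simp add: rapid_def norm_mult)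
 define h h' h'' where "h t = of_real t * p t" and "h' t = of_real t * p' t + of_real 1 * p t"
  and "h'' t = of_real t * p'' t + of_real 1 * p' t + of_real 1 * p' t" for t
 have d: "(complex_of_real has_vector_derivative of_real 1) (at t)" for t
  by (rule has_vector_derivative_of_real) (rule DERIV_ident)
 have dh: "(h has_vector_derivative h' t) (at t)" "(h' has_vector_derivative h'' t) (at t)" for t
  unfolding h_def h'_def h''_def
  by (intro has_vector_derivative_add has_vector_derivative_mult has_vector_derivative_mult_right d p' p'')+
 have rh: "rapid h" "rapid h'" "rapid h''" unfolding h_def h'_def h''_def of_real_1 mult_1 by (intro rapid_add ri r)+
 have "continuous_on UNIV p'" "continuous_on UNIV p''" using p'(1) p''(1) by (auto simp: schwartz_eq intro: jet_continuous)
 then have ch: "continuous_on UNIV h''" unfolding h''_def by (intro continuous_intros)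
 define L where "L = (LBINT t. norm (h t - h'' t))"
 have L: "0 \<le> L" unfolding L_def by (intro integral_nonneg_AE) auto
 have dec: "norm (ft h z) \<le> L * jbr z powr (-2)" for z
  unfolding L_def by (rule ft_decay[OF dh(1) rh(1,2) dh(2) rh(3) ch])
 have int: "integrable lborel p" "integrable lborel (\<lambda>\<sigma>. of_real \<sigma> * p \<sigma>)" "integrable lborel (\<lambda>\<sigma>. of_real (\<sigma>\<^sup>2) * p \<sigma>)"
  using ri[OF ri[OF r(1)]] by (intro rapid_integrable r ri; simp add: power2_eq_square mult.assoc)+
 have "norm (ft p (z - x) - ft p z) \<le> (9 * L) * \<bar>x\<bar> * jbr z powr (-2)" if x: "\<bar>x\<bar> \<le> 1" for x z
 proof -
  have "norm ((LBINT \<sigma>. cis ((x - z) * \<sigma>) * p \<sigma>) - (LBINT \<sigma>. cis (- z * \<sigma>) * p \<sigma>)) \<le> (9 * L * jbr z powr (-2)) * \<bar>(x - z) - (- z)\<bar>"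
  proof (rule norm_diff_le_deriv[OF fourier_param_deriv[OF int]])
   fix w assume "w \<in> closed_segment (x - z) (- z)"
   then have "\<bar>z + w\<bar> \<le> 1" using x by (auto simp: closed_segment_eq_real_ivl split: if_splits)
   then have "(z + w)\<^sup>2 \<le> 1" by (simp add: abs_square_le_1)
   then have "(jbr (z + w))\<^sup>2 \<le> 2\<^sup>2" by (simp add: jbr_square)
   then have "jbr (z + w) \<le> 2" by (rule power2_le_imp_le) simp
   then have "jbr z \<le> 3 * jbr w"
    using jbr_triangle[of "z + w" "- w"] jbr_ge1[of w] by simp
   then have "(jbr z)\<^sup>2 \<le> (3 * jbr w)\<^sup>2" by (intro power_mono) auto
   then have "inverse ((jbr w)\<^sup>2) \<le> 9 * inverse ((jbr z)\<^sup>2)" by (simp add: field_simps power2_eq_square)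
   then have j: "jbr w powr (-2) \<le> 9 * jbr z powr (-2)" by (simp add: powr_minus)
   have "(LBINT \<sigma>. cis (w * \<sigma>) * (\<i> * of_real \<sigma> * p \<sigma>)) = \<i> * ft h (- w)"
    unfolding ft_def h_def integral_mult_right_zero[symmetric] by (simp add: mult_ac)
   then show "norm (LBINT \<sigma>. cis (w * \<sigma>) * (\<i> * of_real \<sigma> * p \<sigma>)) \<le> 9 * L * jbr z powr (-2)"
    using dec[of "- w"] mult_left_mono[OF j L] by (simp add: norm_mult)
  qed
  then show ?thesis
   unfolding ft_def minus_mult_left minus_diff_eq by (simp only: diff_minus_eq_add diff_add_cancel mult_ac)
 qed
 then show ?thesis using that[of "9 * L"] L by simp
qed

text \<open>The factor \<open>\<bar>z\<bar> * jbr z powr (-1)\<close> is comparable to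
  \<open>\<bar>z\<bar>\<close> for small \<open>z\<close> and to 1 for large \<open>z\<close>, which
  joins the mean value bound with plain decay. Its zero at \<open>z = 0\<close> will cancel the
  singular denominator of \<open>dk\<close>.\<close>

lemma ft_difference:
 assumes "p \<in> schwartz"
 obtains C where "0 \<le> C" "\<And>z u. norm (ft p (u - z) - ft p u) \<le>
   C * (\<bar>z\<bar> * jbr z powr (-1)) * (jbr (u - z) powr (-2) + jbr u powr (-2))"
proof -
 obtain L where L: "0 \<le> L" "\<And>z u. \<bar>z\<bar> \<le> 1 ==> norm (ft p (u - z) - ft p u) \<le> L * \<bar>z\<bar> * jbr u powr (-2)"
  using assms by (rule ft_difference_small) auto
 obtain K where K: "0 \<le> K" "\<And>y. norm (ft p y) \<le> K * jbr y powr (-2)"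
  using assms by (rule ft_schwartz_decay) auto
 have jb: "jbr z \<le> 1 + \<bar>z\<bar>" for z
  unfolding jbr_def by (rule real_le_lsqrt) (auto simp: power2_sum)
 have "norm (ft p (u - z) - ft p u) \<le>
   (2 * (L + K)) * (\<bar>z\<bar> * jbr z powr (-1)) * (jbr (u - z) powr (-2) + jbr u powr (-2))" for z u
 proof (cases "\<bar>z\<bar> \<le> 1")
  case True
  then have "jbr z \<le> 2" using jb[of z] by simp
  then have "1 \<le> 2 * jbr z powr (-1)" by (simp add: powr_minus field_simps)
  then have x: "\<bar>z\<bar> \<le> 2 * (\<bar>z\<bar> * jbr z powr (-1))" using mult_left_mono[of 1 "2 * jbr z powr (-1)" "\<bar>z\<bar>"] by (simp only: mult_1_right mult.left_commute abs_ge_zero)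
  have "norm (ft p (u - z) - ft p u) \<le> L * \<bar>z\<bar> * jbr u powr (-2)" by (rule L(2)[OF True])
  also have "\<dots> \<le> (L + K) * (2 * (\<bar>z\<bar> * jbr z powr (-1))) * (jbr (u - z) powr (-2) + jbr u powr (-2))"
   using L(1) K(1) x by (intro mult_mono) auto
  finally show ?thesis by (simp only: mult_ac)
 next
  case False
  then have "jbr z \<le> 2 * \<bar>z\<bar>" using jb[of z] by simp
  then have x: "1 \<le> 2 * (\<bar>z\<bar> * jbr z powr (-1))" by (simp add: powr_minus field_simps)
  have "norm (ft p (u - z) - ft p u) \<le> K * jbr (u - z) powr (-2) + K * jbr u powr (-2)"
   by (intro order_trans[OF norm_triangle_ineq4] add_mono K)
  also have "\<dots> = (K * 1) * (jbr (u - z) powr (-2) + jbr u powr (-2))" by (simp add: distrib_left)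
  also have "\<dots> \<le> ((L + K) * (2 * (\<bar>z\<bar> * jbr z powr (-1)))) * (jbr (u - z) powr (-2) + jbr u powr (-2))"
   using L(1) K(1) x by (intro mult_right_mono mult_mono) auto
  finally show ?thesis by (simp only: mult_ac)
 qed
 then show ?thesis using that[of "2 * (L + K)"] L(1) K(1) by auto
qed

text \<open>The transform of the dilated cutoff \<open>p (t / T)\<close>, normalised so that
  \<open>phat_inversion\<close> carries no factor.\<close>

definition phat :: "(real => complex) => real => real => complex" where
 "phat p T x = of_real (T / (2 * pi)) * ft p (T * x)"

lemma phat_integrable:
 assumes "p \<in> schwartz" "0 < T"
 shows "integrable lborel (phat p T)"
 using lborel_integrable_real_affine[OF schwartz_ft_integrable[OF assms(1)], of T 0] assms(2)
 unfolding phat_def by (intro integrable_mult_right) simp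

lemma phat_inversion:
 assumes "p \<in> schwartz" "0 < T"
 shows "(LBINT x. cis (t * x) * phat p T x) = p (t / T)"
proof -
 have "2 * of_real pi * p (t / T) = (LBINT z. cis (t / T * z) * ft p z)"
  by (rule schwartz_inversion[OF assms(1), symmetric])
 also have "\<dots> = T *\<^sub>R (LBINT x. cis (t / T * (0 + T * x)) * ft p (0 + T * x))"
  using assms(2) by (subst lborel_integral_real_affine[where c=T and t=0]) auto
 also have "\<dots> = of_real T * (LBINT x. cis (t * x) * ft p (T * x))"
  using assms(2) by (simp add: scaleR_conv_of_real)
 finally have "2 * of_real pi * p (t / T) = of_real T * (LBINT x. cis (t * x) * ft p (T * x))" .
 moreover have "(LBINT x. cis (t * x) * phat p T x) = of_real (T / (2 * pi)) * (LBINT x. cis (t * x) * ft p (T * x))"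
  unfolding phat_def integral_mult_right_zero[symmetric] by (simp only: mult.left_commute)
 ultimately have "(LBINT x. cis (t * x) * phat p T x) = (2 * of_real pi * p (t / T)) / (2 * of_real pi)"
  by simp
 then show ?thesis by simp
qed

lemma jbr_scale: "0 < T ==> T \<le> 1 ==> jbr x \<le> jbr (T * x) / T"
proof -
 assume T: "0 < T" "T \<le> 1"
 have "T * jbr x = sqrt (T\<^sup>2 * (1 + x\<^sup>2))" using T by (simp add: jbr_def real_sqrt_mult)
 also have "\<dots> \<le> sqrt (1 + (T * x)\<^sup>2)"
  using T by (intro real_sqrt_le_mono) (simp add: power_mult_distrib distrib_left power_le_one)
 finally show ?thesis using T by (simp add: jbr_def field_simps)
qed

lemma jbr_scale_powr: "0 < T ==> T \<le> 1 ==> 0 \<le> b ==> jbr x powr b \<le> T powr (- b) * jbr (T * x) powr b"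
 using powr_mono2[OF _ _ jbr_scale[of T x], of b] by (simp add: powr_divide powr_minus field_simps)

lemma nn_integral_jbr_scaled:
 assumes "0 < T"
 shows "nnl (\<lambda>x. C * jbr (T * x) powr (- p)) = ennreal (1 / T) * nnl (\<lambda>x. C * jbr x powr (- p))"
proof -
 have "nnl (\<lambda>x. C * jbr x powr (- p)) = ennreal T * nnl (\<lambda>x. C * jbr (T * x) powr (- p))"
  using assms by (subst nn_integral_real_affine[where c=T and t=0]) auto
 then show ?thesis
  using assms by (simp add: mult.assoc[symmetric] ennreal_mult[symmetric])
qed

lemma phat_kernel_measurable:
 assumes "p \<in> schwartz"
 shows "phat p T \<in> bor"
 unfolding phat_def using ft_measurable[OF schwartz_measurable[OF assms]] by measurable

lemma localisation_kernel:
 assumes p: "p \<in> schwartz" and b: "0 \<le> b" "b < 1" and T: "0 < T"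
 obtains B where "kernel_bound b (\<lambda>r y. phat p T (r - y)) (\<lambda>y. jbr y powr b) B"
proof -
 obtain K where K: "0 \<le> K" "\<And>y. norm (ft p y) \<le> K * jbr y powr (-2)"
  using p by (rule ft_schwartz_decay) auto
 note [measurable] = phat_kernel_measurable[OF p]
 \<comment> \<open>\<open>jbr_scale_powr\<close> handles dilations by at most 1, while
   \<open>T\<close> is an arbitrary positive number here.\<close>
 define T' where "T' = min T 1"
 have T': "0 < T'" "T' \<le> 1" "T' \<le> T" using T by (auto simp: T'_def)
 define C where "C = 2 powr b * (T / (2 * pi) * K) * T' powr (- 2)"
 have C: "0 \<le> C" using K(1) T by (simp add: C_def)
 define k where "k x = C * jbr x powr (b - 2)" for x
 have [measurable]: "k \<in> bor" unfolding k_def by measurable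
 have ph: "norm (phat p T x) \<le> (T / (2 * pi) * K) * T' powr (- 2) * jbr x powr (-2)" for x
 proof -
  have "jbr x powr 2 \<le> T' powr (- 2) * jbr (T' * x) powr 2"
   by (rule jbr_scale_powr) (use T' in auto)
  also have "\<dots> \<le> T' powr (- 2) * jbr (T * x) powr 2"
   using T' T by (intro mult_left_mono powr_mono2 jbr_mono) (auto simp: abs_mult mult_right_mono)
  finally have le2: "jbr x powr 2 \<le> T' powr (- 2) * jbr (T * x) powr 2" .
  have "inverse Y \<le> c * inverse X" if "X \<le> c * Y" "0 < X" "0 < Y" for X Y c :: real
   using that by (simp add: field_simps)
  from this[OF le2] have "jbr (T * x) powr (-2) \<le> T' powr (- 2) * jbr x powr (-2)"
   by (simp only: powr_minus powr_gt_zero jbr_neq0 simp_thms)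
  then have "norm (ft p (T * x)) \<le> K * (T' powr (- 2) * jbr x powr (-2))"
   using K by (meson mult_left_mono order_trans)
  then have "T / (2 * pi) * norm (ft p (T * x)) \<le> T / (2 * pi) * (K * (T' powr (- 2) * jbr x powr (-2)))"
   using T by (intro mult_left_mono) auto
  moreover have "norm (phat p T x) = T / (2 * pi) * norm (ft p (T * x))"
   using T by (simp add: phat_def norm_mult norm_divide)
  ultimately show ?thesis by (simp only: mult_ac)
 qed
 have le: "jbr r powr b * norm (phat p T (r - y)) \<le> (k (r - y) + 0 * 0) * jbr y powr b" for r y
 proof -
  have "jbr r powr b \<le> 2 powr b * (jbr (r - y) powr b * jbr y powr b)"
   using jbr_add_powr[OF b(1), of "r - y" y] by simp
  then have "jbr r powr b * norm (phat p T (r - y)) \<le>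
    (2 powr b * (jbr (r - y) powr b * jbr y powr b)) * ((T / (2 * pi) * K) * T' powr (- 2) * jbr (r - y) powr (-2))"
   by (intro mult_mono ph) auto
  also have "\<dots> = C * (jbr (r - y) powr b * jbr (r - y) powr (-2)) * jbr y powr b"
   by (simp only: C_def mult_ac)
  also have "jbr (r - y) powr b * jbr (r - y) powr (-2) = jbr (r - y) powr (b - 2)"
   by (simp only: powr_add[symmetric]) simp
  finally show ?thesis by (simp add: k_def)
 qed
 have fin: "nnl (\<lambda>x. k x) < \<infinity>"
 proof -
  have "nnl (\<lambda>x. k x) = ennreal C * nnl (\<lambda>x. jbr x powr (- (2 - b)))"
   using C by (simp add: k_def ennreal_mult nn_integral_cmult)
  then show ?thesis using nn_integral_jbr_finite[of "2 - b"] b by (simp add: ennreal_mult_less_top)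
 qed
 then obtain I where I: "nnl (\<lambda>x. k x) = ennreal I" "0 \<le> I"
  by (cases "\<integral>\<^sup>+x. ennreal (k x) \<partial>lborel") auto
 have "kernel_bound b (\<lambda>r y. phat p T (r - y)) (\<lambda>y. jbr y powr b) (2 * I)"
 proof -
  have "2 * (ennreal I)\<^sup>2 \<le> ennreal ((2 * I)\<^sup>2)"
  proof -
   have "2 * (ennreal I)\<^sup>2 = ennreal (2 * I\<^sup>2)" using I(2) by (simp add: ennreal_power ennreal_mult)
   also have "\<dots> \<le> ennreal ((2 * I)\<^sup>2)" by (rule ennreal_leI) (simp add: power_mult_distrib)
   finally show ?thesis .
  qed
  then have tot: "2 * (nnl (\<lambda>x. k x))\<^sup>2 +
   2 * ((\<integral>\<^sup>+x. ennreal (0\<^sup>2) \<partial>(lborel::real measure)) * (\<integral>\<^sup>+x. ennreal (0\<^sup>2) \<partial>(lborel :: real measure))) \<le> ennreal ((2 * I)\<^sup>2)"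
   by (simp add: I(1))
  have Mm: "(\<lambda>(r, y). phat p T (r - y)) \<in> borel_measurable (borel \<Otimes>\<^sub>M borel)"
   unfolding split_beta' by measurable
  have Bn: "0 \<le> 2 * I" using I(2) by simp
  show ?thesis
   unfolding kernel_bound_def
   by (intro conjI Mm Bn allI; (rule exI[of _ k], rule exI[of _ "\<lambda>_. 0"], rule exI[of _ "\<lambda>_. 0"], intro conjI allI le tot)?)
    (auto simp: k_def C)
 qed
 then show ?thesis by (rule that)
qed

text \<open>The kernel of the localised Duhamel integral: in time, the exponential of frequency
  \<open>y\<close> is integrated from \<open>0\<close> to \<open>t\<close> and multiplied by
  \<open>p (t / T)\<close>. At \<open>y = 0\<close> division by zero gives the value 0, on a null
  set.\<close>

definition dk :: "(real => complex) => real => real => real => complex" where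
 "dk p T x y = (phat p T (x - y) - phat p T x) / (\<i> * of_real y)"

lemma dk_inversion:
 assumes "w \<in> schwartz" "0 < T"
 shows "(LBINT x. cis (t * x) * dk w T x y) = w (t / T) * ((cis (t * y) - 1) / (\<i> * of_real y))"
proof -
 note p = phat_integrable[OF assms]
 have p2: "integrable lborel (\<lambda>x. phat w T (x - y))"
  using lborel_integrable_real_affine[OF p, of 1 "- y"] by (simp add: algebra_simps)
 have "(LBINT x. cis (t * x) * phat w T (x - y)) = (LBINT x. cis (t * (y + 1 * x)) * phat w T ((y + 1 * x) - y))"
  by (subst lborel_integral_real_affine[where c=1 and t=y]) auto
 also have "\<dots> = (LBINT x. cis (t * y) * (cis (t * x) * phat w T x))"
  by (intro Bochner_Integration.integral_cong) (simp_all add: distrib_left cis_mult[symmetric] mult.assoc)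
 also have "\<dots> = cis (t * y) * w (t / T)"
  by (simp only: integral_mult_right_zero phat_inversion[OF assms])
 finally have e: "(LBINT x. cis (t * x) * phat w T (x - y)) = cis (t * y) * w (t / T)" .
 have "(LBINT x. cis (t * x) * dk w T x y) =
   (LBINT x. (cis (t * x) * phat w T (x - y) - cis (t * x) * phat w T x) / (\<i> * of_real y))"
  by (simp add: dk_def right_diff_distrib)
 also have "\<dots> = ((LBINT x. cis (t * x) * phat w T (x - y)) - (LBINT x. cis (t * x) * phat w T x)) / (\<i> * of_real y)"
  by (subst integral_divide_zero, subst Bochner_Integration.integral_diff) (auto intro!: integrable_cis_mult p p2)
 also have "\<dots> = w (t / T) * ((cis (t * y) - 1) / (\<i> * of_real y))"
  by (simp only: e phat_inversion[OF assms]) (simp add: algebra_simps diff_divide_distrib)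
 finally show ?thesis .
qed

text \<open>The exponents are those for which the powers of \<open>T\<close> combine to \<open>T powr \<theta>\<close>.\<close>

lemma duhamel_kernel:
 assumes w: "w \<in> schwartz" and b: "1/2 < b" "b < 1" and \<theta>: "0 \<le> \<theta>" "b + \<theta> \<le> 1"
 obtains B where "0 \<le> B" "\<And>T. 0 < T ==> T \<le> 1 ==>
  kernel_bound b (dk w T) (\<lambda>r. jbr r powr (- (1 - b - \<theta>))) (B * T powr \<theta>)"
proof -
 obtain K where K: "0 \<le> K" "\<And>v e. norm (ft w (e - v) - ft w e) \<le>
   K * (\<bar>v\<bar> * jbr v powr (-1)) * (jbr (e - v) powr (-2) + jbr e powr (-2))"
  using w by (rule ft_difference) auto
 note [measurable] = phat_kernel_measurable[OF w]
 define C where "C = 2 powr b * K"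
 have C: "0 \<le> C" "K \<le> C" using K(1) ge_one_powr_ge_zero[of 2 b] b
  by (auto simp: C_def mult_le_cancel_right1)
 obtain I1 where I1: "nnl (\<lambda>x. jbr x powr (- (2 - b))) = ennreal I1" "0 \<le> I1"
  using nn_integral_jbr_finite[of "2 - b"] b by (cases "\<integral>\<^sup>+x. ennreal (jbr x powr (- (2 - b))) \<partial>lborel") auto
 obtain I2 where I2: "nnl (\<lambda>x. jbr x powr (- (4 - 2 * b))) = ennreal I2" "0 \<le> I2"
  using nn_integral_jbr_finite[of "4 - 2 * b"] b by (cases "\<integral>\<^sup>+x. ennreal (jbr x powr (- (4 - 2 * b))) \<partial>lborel") auto
 define B where "B = sqrt (2 * (C * I1)\<^sup>2 + 2 * (C\<^sup>2 * I2 * kb b))"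
 have B0: "0 \<le> 2 * (C * I1)\<^sup>2 + 2 * (C\<^sup>2 * I2 * kb b)" using I2 by simp
 have B2: "B\<^sup>2 = 2 * (C * I1)\<^sup>2 + 2 * (C\<^sup>2 * I2 * kb b)"
  unfolding B_def using B0 by (rule real_sqrt_pow2)
 have "kernel_bound b (dk w T) (\<lambda>r. jbr r powr (- (1 - b - \<theta>))) (B * T powr \<theta>)" if T: "0 < T" "T \<le> 1" for T
 proof -
  define A where "A = C * T powr (1 + \<theta>)"
  have A: "0 \<le> A" using C by (simp add: A_def)
  define k where "k x = A * jbr (T * x) powr (- (2 - b))" for x
  define a where "a x = A * jbr (T * x) powr (- (2 - b))" for x
  define c where "c x = jbr (T * x) powr (- b)" for x
  have [measurable]: "k \<in> bor" "a \<in> bor" "c \<in> bor"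
   unfolding k_def a_def c_def by measurable
  have le: "jbr u powr b * norm (dk w T u r) \<le> (k (u - r) + a u * c r) * jbr r powr (- (1 - b - \<theta>))" for u r
  proof (cases "r = 0")
   case True
   have "0 \<le> (k (u - r) + a u * c r) * jbr r powr (- (1 - b - \<theta>))"
    using A by (auto simp: k_def a_def c_def intro!: mult_nonneg_nonneg add_nonneg_nonneg)
   then show ?thesis using True by (simp add: dk_def)
  next
   case False
   define \<alpha> where "\<alpha> = jbr (T * u)"
   define \<beta> where "\<beta> = jbr (T * r)"
   define \<gamma> where "\<gamma> = jbr (T * u - T * r)"
   have p: "0 < \<alpha>" "0 < \<beta>" "0 < \<gamma>" "1 \<le> \<beta>" by (simp_all add: \<alpha>_def \<beta>_def \<gamma>_def jbr_ge1)
   have "norm (dk w T u r) = T / (2 * pi) * norm (ft w (T * u - T * r) - ft w (T * u)) / \<bar>r\<bar>"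
   proof -
    have "phat w T (u - r) - phat w T u = of_real (T / (2 * pi)) * (ft w (T * u - T * r) - ft w (T * u))"
     by (simp add: phat_def right_diff_distrib)
    then show ?thesis using T by (simp add: dk_def norm_divide norm_mult)
   qed
   also have "\<dots> \<le> T * norm (ft w (T * u - T * r) - ft w (T * u)) / \<bar>r\<bar>"
   proof -
    have "T / (2 * pi) \<le> T" using T pi_gt3 by (simp add: divide_le_eq mult_le_cancel_left1)
    then show ?thesis by (intro divide_right_mono mult_right_mono) auto
   qed
   also have "\<dots> \<le> T * (K * (\<bar>T * r\<bar> * \<beta> powr (-1)) * (\<gamma> powr (-2) + \<alpha> powr (-2))) / \<bar>r\<bar>"
    using T K(2)[of "T * u" "T * r"] unfolding \<alpha>_def \<beta>_def \<gamma>_def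
    by (intro divide_right_mono mult_left_mono) auto
   also have "\<dots> = T\<^sup>2 * K * \<beta> powr (-1) * (\<gamma> powr (-2) + \<alpha> powr (-2))"
    using T False by (simp add: abs_mult power2_eq_square)
   finally have n: "norm (dk w T u r) \<le> T\<^sup>2 * K * \<beta> powr (-1) * (\<gamma> powr (-2) + \<alpha> powr (-2))" .
   have s1: "jbr u powr b \<le> T powr (- b) * \<alpha> powr b"
    unfolding \<alpha>_def using T b by (intro jbr_scale_powr) auto
   \<comment> \<open>Inserting this factor, which is at least 1, creates the weight in
     \<open>r\<close> and costs \<open>T powr (- (1 - b - \<theta>))\<close>. Together with
     \<open>T powr (- b)\<close> and \<open>T\<^sup>2\<close> this makes
     \<open>T powr (1 + \<theta>)\<close>, of which the dilation in the integrals takes one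
     power.\<close>
   have s2: "1 \<le> T powr (- (1 - b - \<theta>)) * \<beta> powr (1 - b - \<theta>) * jbr r powr (- (1 - b - \<theta>))"
   proof -
    have "jbr r powr (1 - b - \<theta>) \<le> T powr (- (1 - b - \<theta>)) * \<beta> powr (1 - b - \<theta>)"
     unfolding \<beta>_def using T \<theta> by (intro jbr_scale_powr) auto
    moreover have "1 \<le> z * inverse X" if "X \<le> z" "0 < X" for X z :: real
     using that by (simp add: field_simps)
    ultimately show ?thesis by (simp only: powr_minus[of "jbr r"] powr_gt_zero jbr_neq0 simp_thms)
   qed
   have s3: "\<alpha> powr b \<le> 2 powr b * (\<gamma> powr b * \<beta> powr b)"
    using jbr_add_powr[of b "T * u - T * r" "T * r"] b by (simp add: \<alpha>_def \<beta>_def \<gamma>_def)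
   have "jbr u powr b * norm (dk w T u r) \<le>
     (T powr (- b) * \<alpha> powr b) * (T\<^sup>2 * K * \<beta> powr (-1) * (\<gamma> powr (-2) + \<alpha> powr (-2)))"
    using p by (intro mult_mono s1 n) auto
   also have "\<dots> = (T powr (- b) * T\<^sup>2 * K) * (\<alpha> powr b * \<beta> powr (-1) * (\<gamma> powr (-2) + \<alpha> powr (-2))) * 1"
    by (simp only: mult_ac mult_1_right)
   also have "\<dots> \<le> (T powr (- b) * T\<^sup>2 * K) * (\<alpha> powr b * \<beta> powr (-1) * (\<gamma> powr (-2) + \<alpha> powr (-2))) *
     (T powr (- (1 - b - \<theta>)) * \<beta> powr (1 - b - \<theta>) * jbr r powr (- (1 - b - \<theta>)))"
    using K(1) by (intro mult_left_mono s2) auto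
   also have "\<dots> = (T powr (- b) * T\<^sup>2 * T powr (- (1 - b - \<theta>))) * (K * (\<alpha> powr b * (\<beta> powr (-1) * \<beta> powr (1 - b - \<theta>)) * (\<gamma> powr (-2) + \<alpha> powr (-2)))) *
     jbr r powr (- (1 - b - \<theta>))"
    by (simp only: mult_ac)
   also have "T powr (- b) * T\<^sup>2 * T powr (- (1 - b - \<theta>)) = T powr (1 + \<theta>)"
   proof -
    have "T\<^sup>2 = T powr 2" using T by simp
    then show ?thesis by (simp only: powr_add[symmetric]) (simp add: algebra_simps)
   qed
   also have "\<beta> powr (-1) * \<beta> powr (1 - b - \<theta>) = \<beta> powr (- b - \<theta>)"
    by (simp only: powr_add[symmetric]) (rule arg_cong[where f="\<lambda>x. \<beta> powr x"], simp)
   also have "T powr (1 + \<theta>) * (K * (\<alpha> powr b * \<beta> powr (- b - \<theta>) * (\<gamma> powr (-2) + \<alpha> powr (-2)))) * jbr r powr (- (1 - b - \<theta>))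
     \<le> T powr (1 + \<theta>) * (C * \<gamma> powr (- (2 - b)) + C * (\<alpha> powr (- (2 - b)) * \<beta> powr (- b))) * jbr r powr (- (1 - b - \<theta>))"
   \<comment> \<open>The term with \<open>\<gamma>\<close> becomes the convolution part once
     \<open>\<alpha> powr b\<close> is split by \<open>s3\<close>. The term with
     \<open>\<alpha>\<close> already is a function of \<open>u\<close> times a function of
     \<open>r\<close>, the rank one part.\<close>
   proof (intro mult_left_mono mult_right_mono)
    have bb: "\<beta> powr (- b - \<theta>) \<le> \<beta> powr (- b)" using p \<theta> by (intro powr_mono) auto
    have "K * (\<alpha> powr b * \<beta> powr (- b - \<theta>) * \<gamma> powr (-2)) \<le> K * ((2 powr b * (\<gamma> powr b * \<beta> powr b)) * \<beta> powr (- b) * \<gamma> powr (-2))"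
     using K(1) by (intro mult_left_mono mult_right_mono mult_mono s3 bb) auto
    also have "\<dots> = C * ((\<gamma> powr b * \<gamma> powr (-2)) * (\<beta> powr b * \<beta> powr (- b)))"
     by (simp only: C_def mult_ac)
    also have "\<dots> = C * \<gamma> powr (- (2 - b))"
     using p by (simp add: powr_add[symmetric])
    finally have t1: "K * (\<alpha> powr b * \<beta> powr (- b - \<theta>) * \<gamma> powr (-2)) \<le> C * \<gamma> powr (- (2 - b))" .
    have "K * (\<alpha> powr b * \<beta> powr (- b - \<theta>) * \<alpha> powr (-2)) \<le> C * (\<alpha> powr b * \<beta> powr (- b) * \<alpha> powr (-2))"
     using C by (intro mult_mono mult_right_mono mult_left_mono bb) auto
    also have "\<dots> = C * ((\<alpha> powr b * \<alpha> powr (-2)) * \<beta> powr (- b))" by (simp only: mult_ac)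
    also have "\<dots> = C * (\<alpha> powr (- (2 - b)) * \<beta> powr (- b))" by (simp add: powr_add[symmetric])
    finally show "K * (\<alpha> powr b * \<beta> powr (- b - \<theta>) * (\<gamma> powr (-2) + \<alpha> powr (-2))) \<le>
      C * \<gamma> powr (- (2 - b)) + C * (\<alpha> powr (- (2 - b)) * \<beta> powr (- b))"
     using t1 by (simp add: distrib_left)
   qed auto
   also have "\<dots> = (k (u - r) + a u * c r) * jbr r powr (- (1 - b - \<theta>))"
    by (simp add: k_def a_def c_def A_def \<alpha>_def \<beta>_def \<gamma>_def right_diff_distrib distrib_left mult_ac)
   finally show ?thesis .
  qed
  have Tp: "T powr (1 + \<theta>) / T = T powr \<theta>" using T by (simp add: powr_add)
  have Ik: "nnl (\<lambda>x. k x) = ennreal (C * T powr \<theta> * I1)"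
  proof -
   have "nnl (\<lambda>x. k x) = ennreal (1 / T) * (ennreal A * ennreal I1)"
    unfolding k_def nn_integral_jbr_scaled[OF T(1)] I1(1)[symmetric] using A by (simp add: ennreal_mult nn_integral_cmult)
   also have "\<dots> = ennreal (1 / T * (A * I1))" using T A I1(2) by (simp add: ennreal_mult[symmetric])
   also have "1 / T * (A * I1) = C * (T powr (1 + \<theta>) / T) * I1" by (simp add: A_def)
   finally show ?thesis by (simp only: Tp)
  qed
  have Ia: "nnl (\<lambda>x. (a x)\<^sup>2) = ennreal (1 / T * (A\<^sup>2 * I2))"
  proof -
   have "(a x)\<^sup>2 = A\<^sup>2 * jbr (T * x) powr (- (4 - 2 * b))" for x
    by (simp add: a_def power_mult_distrib power2_eq_square[of "_ powr _"] powr_add[symmetric])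
   then have "nnl (\<lambda>x. (a x)\<^sup>2) = ennreal (1 / T) * (ennreal (A\<^sup>2) * ennreal I2)"
    by (simp only: nn_integral_jbr_scaled[OF T(1)] I2(1)[symmetric]) (simp add: ennreal_mult nn_integral_cmult)
   then show ?thesis using T A I2(2) by (simp add: ennreal_mult[symmetric])
  qed
  have Ic: "nnl (\<lambda>x. (c x)\<^sup>2) = ennreal (1 / T * kb b)"
  proof -
   have "(c x)\<^sup>2 = 1 * jbr (T * x) powr (- (2 * b))" for x
    by (simp add: c_def power2_eq_square powr_add[symmetric])
   then have "nnl (\<lambda>x. (c x)\<^sup>2) = ennreal (1 / T) * ennreal (kb b)"
    by (simp only: nn_integral_jbr_scaled[OF T(1)] ennreal_kb[OF b(1)]) simp
   then show ?thesis using T by (simp add: ennreal_mult[symmetric])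
  qed
  have "2 * (nnl (\<lambda>x. k x))\<^sup>2 +
   2 * (nnl (\<lambda>x. (a x)\<^sup>2) * nnl (\<lambda>x. (c x)\<^sup>2)) =
   ennreal (2 * (C * T powr \<theta> * I1)\<^sup>2 + 2 * ((1 / T * (A\<^sup>2 * I2)) * (1 / T * kb b)))"
  proof -
   have "2 * (ennreal x)\<^sup>2 + 2 * (ennreal y * ennreal z) = ennreal (2 * x\<^sup>2 + 2 * (y * z))"
    if "0 \<le> x" "0 \<le> y" "0 \<le> z" for x y z
    using that by (simp add: ennreal_mult ennreal_power[symmetric])
   then show ?thesis unfolding Ik Ia Ic using T A C(1) I1(2) I2(2) by simp
  qed
  also have "2 * (C * T powr \<theta> * I1)\<^sup>2 + 2 * ((1 / T * (A\<^sup>2 * I2)) * (1 / T * kb b)) =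
    (T powr \<theta>)\<^sup>2 * (2 * (C * I1)\<^sup>2) + (T powr (1 + \<theta>) / T)\<^sup>2 * (2 * (C\<^sup>2 * I2 * kb b))"
   by (simp add: A_def power_mult_distrib power_divide power2_eq_square[of T] mult_ac)
  also have "\<dots> = (B * T powr \<theta>)\<^sup>2"
   by (simp only: Tp power_mult_distrib[of B] B2) (simp add: algebra_simps)
  finally have tot: "2 * (nnl (\<lambda>x. k x))\<^sup>2 +
   2 * (nnl (\<lambda>x. (a x)\<^sup>2) * nnl (\<lambda>x. (c x)\<^sup>2)) = ennreal ((B * T powr \<theta>)\<^sup>2)" .
  have Bn: "0 \<le> B * T powr \<theta>" unfolding B_def using B0 by simp
  have Mm: "case_prod (dk w T) \<in> borel_measurable (borel \<Otimes>\<^sub>M borel)"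
   unfolding dk_def split_beta' by measurable
  show ?thesis
   unfolding kernel_bound_def
   by (intro conjI Mm Bn allI; (rule exI[of _ k], rule exI[of _ a], rule exI[of _ c], intro conjI allI le order_eq_refl[OF tot])?)
    (auto simp: k_def a_def c_def A)
 qed
 moreover have "0 \<le> B" unfolding B_def using B0 by simp
 ultimately show ?thesis using that by blast
qed

subsection \<open>The restriction space\<close>

lemma wt_square: "wt s b n y = (jbr (of_int n) powr s * jbr y powr b)\<^sup>2"
 by (simp add: wt_def power_mult_distrib power2_eq_square[of "_ powr _"] powr_add[symmetric])

lemma vsq_jbr: "f \<in> bPM ==> vsq (\<lambda>y. jbr y powr b) f = sqi (wm 0 b) f"
 by (simp add: vsq_def sqi_wm wt_square power_mult_distrib)

lemma phat_shift_inversion: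
 assumes "p \<in> schwartz" "0 < T"
 shows "(LBINT x. cis (t * x) * phat p T (x - y)) = cis (t * y) * p (t / T)"
proof -
 have "(LBINT x. cis (t * x) * phat p T (x - y)) = (LBINT x. cis (t * (y + 1 * x)) * phat p T ((y + 1 * x) - y))"
  by (subst lborel_integral_real_affine[where c=1 and t=y]) auto
 also have "\<dots> = (LBINT x. cis (t * y) * (cis (t * x) * phat p T x))"
  by (intro Bochner_Integration.integral_cong) (simp_all add: distrib_left cis_mult[symmetric] mult.assoc)
 finally show ?thesis
  by (simp only: integral_mult_right_zero phat_inversion[OF assms])
qed

text \<open>Multiplication in time is convolution in the modulation. It commutes with the free
  evolution, so one kernel serves all rows.\<close>

lemma multiply_curve:
 assumes p: "p \<in> schwartz" and b: "1/2 < b" "b < 1" and T: "0 < T"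
 obtains B where "0 \<le> B" "\<And>g. g \<in> L2 (wm 0 b) ==>
  \<exists>h\<in>L2 (wm 0 b). cv h = (\<lambda>t n. p (t / T) * cv g t n) \<and> l2 (wm 0 b) h \<le> B * l2 (wm 0 b) g"
proof -
 have b0: "0 \<le> b" using b by simp
 obtain B where B: "kernel_bound b (\<lambda>x y. phat p T (x - y)) (\<lambda>y. jbr y powr b) B"
  using localisation_kernel[OF p b0 b(2) T] by blast
 have "\<exists>h\<in>L2 (wm 0 b). cv h = (\<lambda>t n. p (t / T) * cv g t n) \<and> l2 (wm 0 b) h \<le> B * l2 (wm 0 b) g"
  if g: "g \<in> L2 (wm 0 b)" for g
 proof -
  note m = L2_wm_measurable[OF g]
  have v: "vsq (\<lambda>y. jbr y powr b) g = ennreal ((l2 (wm 0 b) g)\<^sup>2)"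
   by (simp add: vsq_jbr[OF m] sqi_l2[OF g])
  then have fin: "vsq (\<lambda>y. jbr y powr b) g < \<infinity>" by simp
  define h where "h = kop (\<lambda>x y. phat p T (x - y)) g"
  have "ic h t n = p (t / T) * ic g t n" for t n
  proof -
   have "ic h t n = (LBINT y. g (n, y) * (cis (t * y) * p (t / T)))"
    unfolding h_def ic_kop[OF B b(1) m fin] phat_shift_inversion[OF p T] ..
   also have "\<dots> = (LBINT y. p (t / T) * (cis (t * y) * g (n, y)))" by (simp only: mult_ac)
   finally show ?thesis by (simp only: integral_mult_right_zero ic_def)
  qed
  then have "cv h = (\<lambda>t n. p (t / T) * cv g t n)" by (simp add: cv_def fun_eq_iff)
  then show ?thesis
   using kop_L2[OF B m fin] by (intro bexI[of _ h]) (auto simp: h_def v)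
 qed
 moreover have "0 \<le> B" using B by (simp add: kernel_bound_def)
 ultimately show ?thesis using that by blast
qed

lemma XT_iff:
 assumes "1/2 < b" "b \<le> 1"
 shows "F \<in> XT 0 b T \<longleftrightarrow> (\<exists>g\<in>L2 (wm 0 b). F = restrict (cv g) {-T..T})"
 by (auto simp: XT_def Xsb_eq[OF assms])

text \<open>The cutoff \<open>bump\<close> is one competitor in the infimum. That all competitors
  are nonnegative has to be known before \<open>Inf\<close> can be bounded by one of them.\<close>

lemma XT_norm_le:
 assumes b: "1/2 < b" "b < 1" and T: "0 < T"
 obtains B where "0 \<le> B" "\<And>g F. g \<in> L2 (wm 0 b) ==> (\<And>t. t \<in> {-T..T} ==> cv g t = F t) ==>
  XT_norm 0 b T F \<le> B * l2 (wm 0 b) g"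
proof -
 have b1: "b \<le> 1" using b by simp
 have Xm: "0 \<le> Xsb_norm 0 b (\<lambda>t n. p (t / T) * G t n)" if G: "G \<in> Xsb 0 b" and p: "p \<in> schwartz" for G p
 proof -
  obtain g where g: "g \<in> L2 (wm 0 b)" "G = cv g" using G by (auto simp: Xsb_eq[OF b(1) b1])
  obtain h where "h \<in> L2 (wm 0 b)" "cv h = (\<lambda>t n. p (t / T) * cv g t n)"
   using multiply_curve[OF p b T] g(1) by metis
  then show ?thesis using Xsb_norm_cv[OF b(1) b1, of h] g(2) by simp
 qed
 obtain B where B: "0 \<le> B" "\<And>g. g \<in> L2 (wm 0 b) ==>
  \<exists>h\<in>L2 (wm 0 b). cv h = (\<lambda>t n. bump (t / T) * cv g t n) \<and> l2 (wm 0 b) h \<le> B * l2 (wm 0 b) g"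
  by (rule multiply_curve[OF bump_schwartz b T]) blast
 have "XT_norm 0 b T F \<le> (2 * pi * B) * l2 (wm 0 b) g"
  if g: "g \<in> L2 (wm 0 b)" and eq: "\<And>t. t \<in> {-T..T} ==> cv g t = F t" for g F
 proof -
  obtain h where h: "h \<in> L2 (wm 0 b)" "cv h = (\<lambda>t n. bump (t / T) * cv g t n)" "l2 (wm 0 b) h \<le> B * l2 (wm 0 b) g"
   using B(2)[OF g] by blast
  have "XT_norm 0 b T F \<le> Xsb_norm 0 b (\<lambda>t n. bump (t / T) * cv g t n)"
   unfolding XT_norm_def
  proof (rule cInf_lower)
   show "Xsb_norm 0 b (\<lambda>t n. bump (t / T) * cv g t n) \<in> {Xsb_norm 0 b (\<lambda>t n. p (t / T) * G t n) | p G.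
     G \<in> Xsb 0 b \<and> (\<forall>t\<in>{-T..T}. G t = F t) \<and> p \<in> schwartz \<and> (\<forall>r\<in>{-1..1}. p r = 1)}"
    using g eq bump_schwartz bump_eq_1
    by (intro CollectI exI[of _ bump] exI[of _ "cv g"]) (auto simp: Xsb_eq[OF b(1) b1] abs_le_iff)
   show "bdd_below {Xsb_norm 0 b (\<lambda>t n. p (t / T) * G t n) | p G.
     G \<in> Xsb 0 b \<and> (\<forall>t\<in>{-T..T}. G t = F t) \<and> p \<in> schwartz \<and> (\<forall>r\<in>{-1..1}. p r = 1)}"
    using Xm by (intro bdd_belowI[of _ 0]) auto
  qed
  also have "\<dots> = 2 * pi * l2 (wm 0 b) h" unfolding h(2)[symmetric] by (rule Xsb_norm_cv[OF b(1) b1 h(1)])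
  also have "\<dots> \<le> 2 * pi * (B * l2 (wm 0 b) g)" by (intro mult_left_mono h) auto
  finally show ?thesis by (simp only: mult.assoc)
 qed
 then show ?thesis using that[of "2 * pi * B"] B(1) by auto
qed

text \<open>A nearly optimal pair of cutoff and extension is merged into one representative, their
  product, which still agrees with \<open>F\<close> because the cutoff is 1 on
  \<open>[-T, T]\<close> after rescaling. The given \<open>g0\<close> makes the set of competitors
  nonempty.\<close>

lemma XT_norm_witness:
 assumes b: "1/2 < b" "b < 1" and T: "0 < T" and g0: "g0 \<in> L2 (wm 0 b)" "\<And>t. t \<in> {-T..T} ==> cv g0 t = F t" and e: "0 < e"
 obtains g where "g \<in> L2 (wm 0 b)" "\<And>t. t \<in> {-T..T} ==> cv g t = F t" "l2 (wm 0 b) g \<le> XT_norm 0 b T F + e"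
proof -
 have b1: "b \<le> 1" using b by simp
 let ?S = "{Xsb_norm 0 b (\<lambda>t n. p (t / T) * G t n) | p G.
     G \<in> Xsb 0 b \<and> (\<forall>t\<in>{-T..T}. G t = F t) \<and> p \<in> schwartz \<and> (\<forall>r\<in>{-1..1}. p r = 1)}"
 have "Xsb_norm 0 b (\<lambda>t n. bump (t / T) * cv g0 t n) \<in> ?S"
  using g0 bump_schwartz bump_eq_1
  by (intro CollectI exI[of _ bump] exI[of _ "cv g0"]) (auto simp: Xsb_eq[OF b(1) b1] abs_le_iff)
 then have "?S \<noteq> {}" by blast
 moreover have "Inf ?S < XT_norm 0 b T F + e" using e by (simp add: XT_norm_def)
 ultimately have "\<exists>x\<in>?S. x < XT_norm 0 b T F + e" by (rule cInf_lessD)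
 then obtain x where "x \<in> ?S" "x < XT_norm 0 b T F + e" by (elim bexE)
 then obtain p G where G: "x = Xsb_norm 0 b (\<lambda>t n. p (t / T) * G t n)" "G \<in> Xsb 0 b" "\<forall>t\<in>{-T..T}. G t = F t"
  "p \<in> schwartz" "\<forall>r\<in>{-1..1}. p r = 1"
  unfolding mem_Collect_eq by (elim exE conjE) (rule that; assumption)
 obtain g where g: "g \<in> L2 (wm 0 b)" "G = cv g" using G(2) by (auto simp: Xsb_eq[OF b(1) b1])
 obtain h where h: "h \<in> L2 (wm 0 b)" "cv h = (\<lambda>t n. p (t / T) * cv g t n)"
  using multiply_curve[OF G(4) b T] g(1) by metis
 have "cv h t = F t" if "t \<in> {-T..T}" for t
 proof -
  have "p (t / T) = 1" using G(5) that T by (auto simp: field_simps)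
  then show ?thesis using G(3) that by (auto simp: h(2) g(2))
 qed
 moreover have "l2 (wm 0 b) h \<le> XT_norm 0 b T F + e"
 proof -
  have "2 * pi * l2 (wm 0 b) h < XT_norm 0 b T F + e"
   using \<open>x < _\<close> Xsb_norm_cv[OF b(1) b1 h(1)] by (simp add: G(1) g(2) h(2))
  moreover have "1 * l2 (wm 0 b) h \<le> 2 * pi * l2 (wm 0 b) h" using pi_gt3 by (intro mult_right_mono) auto
  ultimately show ?thesis by linarith
 qed
 ultimately show ?thesis using h(1) that by blast
qed

subsection \<open>Counting in the resonance function\<close>

definition om :: "int => int => real" where
 "om n k = (of_int n)\<^sup>2 + (of_int k)\<^sup>2 + (of_int n + of_int k)\<^sup>2"

lemma om_nonneg [simp]: "0 \<le> om n k"
 by (simp add: om_def)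

lemma jbr_sq_le_om: "(jbr (of_int k))\<^sup>2 \<le> 2 * jbr (om n k)" "(jbr (of_int (- n - k)))\<^sup>2 \<le> 2 * jbr (om n k)"
proof -
 have "1 + om n k \<le> 2 * jbr (om n k)"
  using jbr_ge1[of "om n k"] abs_le_jbr[of "om n k"] by simp
 moreover have "(of_int (- n - k))\<^sup>2 = (real_of_int n + of_int k)\<^sup>2"
  by (simp add: power2_eq_square algebra_simps)
 then have "(jbr (of_int k))\<^sup>2 \<le> 1 + om n k" "(jbr (of_int (- n - k)))\<^sup>2 \<le> 1 + om n k"
  unfolding jbr_square om_def by simp_all
 ultimately show "(jbr (of_int k))\<^sup>2 \<le> 2 * jbr (om n k)" "(jbr (of_int (- n - k)))\<^sup>2 \<le> 2 * jbr (om n k)"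
  by linarith+
qed

text \<open>Writing \<open>om n k = 2 (k + n / 2)\<^sup>2 + 3 n\<^sup>2 / 2\<close>, only boundedly many \<open>k\<close> put \<open>om n k\<close> within distance \<open>1\<close>
 of a given number, uniformly in that number.\<close>

lemma sum_om_le:
 assumes r: "1/2 < r"
 obtains C where "0 \<le> C" "\<And>y n. (nns (\<lambda>k. jbr (y + om n k) powr (- r))) \<le> ennreal C"
proof -
 define S where "S = nnl (\<lambda>x. jbr x powr (- (2 * r)))"
 have S: "S = ennreal (kb r)" unfolding S_def using ennreal_kb[OF r] by simp
 define C where "C = 2 powr r * (2 * (4 powr (2 * r) * kb r))"
 have "nns (\<lambda>k. jbr (y + om n k) powr (- r)) \<le> ennreal C" for y n
 proof -
  define m where "m = real_of_int n / 2"
  define z where "z = y + 3 / 2 * (of_int n)\<^sup>2"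
  \<comment> \<open>The nonnegative zero of \<open>z + 2 * x\<^sup>2\<close> when there is one, and
    \<open>0\<close> otherwise.\<close>
  define A where "A = sqrt (max 0 (- z / 2))"
  have omz: "y + om n k = z + 2 * (of_int k + m)\<^sup>2" for k
   by (simp add: om_def z_def m_def power2_eq_square algebra_simps)
  have lower: "2 * (\<bar>x\<bar> - A)\<^sup>2 \<le> \<bar>z + 2 * x\<^sup>2\<bar>" for x
  proof (cases "0 \<le> z")
   case True
   then have "A = 0" by (simp add: A_def)
   then show ?thesis using True by simp
  next
   case False
   then have z: "z = - 2 * A\<^sup>2" by (simp add: A_def)
   have A0: "0 \<le> A" by (simp add: A_def)
   have "\<bar>\<bar>x\<bar> - A\<bar> \<le> \<bar>x\<bar> + A" using A0 by linarith
   then have "\<bar>\<bar>x\<bar> - A\<bar> * \<bar>\<bar>x\<bar> - A\<bar> \<le> (\<bar>x\<bar> + A) * \<bar>\<bar>x\<bar> - A\<bar>" by (intro mult_right_mono) auto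
   also have "\<dots> = \<bar>(\<bar>x\<bar> + A) * (\<bar>x\<bar> - A)\<bar>" using A0 by (simp add: abs_mult)
   also have "(\<bar>x\<bar> + A) * (\<bar>x\<bar> - A) = x\<^sup>2 - A\<^sup>2" by (simp add: power2_eq_square algebra_simps)
   finally have "(\<bar>x\<bar> - A)\<^sup>2 \<le> \<bar>x\<^sup>2 - A\<^sup>2\<bar>" by (simp add: power2_eq_square)
   moreover have "\<bar>z + 2 * x\<^sup>2\<bar> = 2 * \<bar>x\<^sup>2 - A\<^sup>2\<bar>" unfolding z by (simp add: abs_if)
   ultimately show ?thesis by simp
  qed
  have pt: "jbr (y + om n k) powr (- r) \<le>
    2 powr r * (jbr (of_int k + (m - A)) powr (- (2 * r)) + jbr (of_int k + (m + A)) powr (- (2 * r)))" for k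
  proof -
   define x where "x = of_int k + m"
   define w where "w = \<bar>x\<bar> - A"
   \<comment> \<open>The phase grows at least quadratically in the distance \<open>w\<close> to its
     zeros, so the exponent \<open>r\<close> becomes \<open>2 * r\<close>, which exceeds 1 and is
     summable over the integers.\<close>
   have "(jbr w)\<^sup>2 \<le> 2 * jbr (2 * w\<^sup>2)"
   proof (rule power2_le_imp_le)
    have "0 \<le> 3 + 15 * w ^ 4 - 2 * w\<^sup>2"
    proof -
     have "0 \<le> (w\<^sup>2 - 1)\<^sup>2 + 14 * w ^ 4 + 2" by simp
     then show ?thesis by (simp add: power2_eq_square power4_eq_xxxx algebra_simps)
    qed
    then have "(1 + w\<^sup>2)\<^sup>2 \<le> 2\<^sup>2 * (1 + (2 * w\<^sup>2)\<^sup>2)"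
     by (simp add: power2_eq_square power4_eq_xxxx algebra_simps)
    then show "((jbr w)\<^sup>2)\<^sup>2 \<le> (2 * jbr (2 * w\<^sup>2))\<^sup>2"
     by (simp only: jbr_square power_mult_distrib[of 2 "jbr _"])
   qed simp
   also have "jbr (2 * w\<^sup>2) \<le> jbr (y + om n k)"
    unfolding omz using lower[of x] by (intro jbr_mono) (auto simp: w_def x_def)
   finally have "((jbr w)\<^sup>2) powr r \<le> (2 * jbr (y + om n k)) powr r"
    using r by (intro powr_mono2) auto
   then have "jbr w powr (2 * r) \<le> 2 powr r * jbr (y + om n k) powr r"
    by (simp add: powr_mult jbr_powr_double jbr_square)
   moreover have "inverse Y \<le> c * inverse X" if "X \<le> c * Y" "0 < X" "0 < Y" for X Y c :: real
    using that by (simp add: field_simps)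
   ultimately have "jbr (y + om n k) powr (- r) \<le> 2 powr r * jbr w powr (- (2 * r))"
    by (simp only: powr_minus powr_gt_zero jbr_neq0 simp_thms)
   \<comment> \<open>\<open>\<bar>x\<bar>\<close> is \<open>x\<close> or \<open>- x\<close>, so one
     of two shifted series applies; their sum covers both cases.\<close>
   moreover have "jbr w powr (- (2 * r)) \<le> jbr (x - A) powr (- (2 * r)) + jbr (x + A) powr (- (2 * r))"
   proof (cases "0 \<le> x")
    case True then show ?thesis by (simp add: w_def)
   next
    case False
    then have "jbr w = jbr (x + A)" using jbr_minus[of "x + A"] by (simp add: w_def)
    then show ?thesis by simp
   qed
   ultimately have "jbr (y + om n k) powr (- r) \<le> 2 powr r * (jbr (x - A) powr (- (2 * r)) + jbr (x + A) powr (- (2 * r)))"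
    by (meson mult_left_mono order_trans powr_ge_zero)
   then show ?thesis by (simp add: x_def algebra_simps)
  qed
  have "nns (\<lambda>k. jbr (y + om n k) powr (- r)) \<le>
    (\<integral>\<^sup>+k. ennreal (2 powr r) * (ennreal (jbr (of_int k + (m - A)) powr (- (2 * r))) + ennreal (jbr (of_int k + (m + A)) powr (- (2 * r)))) \<partial>ZZ)"
   by (intro nn_integral_mono) (simp add: ennreal_mult[symmetric] ennreal_plus[symmetric] ennreal_leI pt del: ennreal_plus)
  also have "\<dots> = ennreal (2 powr r) * (nns (\<lambda>k. jbr (of_int k + (m - A)) powr (- (2 * r))) +
    nns (\<lambda>k. jbr (of_int k + (m + A)) powr (- (2 * r))))"
   by (simp add: nn_integral_cmult nn_integral_add)
  also have "\<dots> \<le> ennreal (2 powr r) * (ennreal (4 powr (2 * r)) * S + ennreal (4 powr (2 * r)) * S)"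
   unfolding S_def using r by (intro mult_left_mono add_mono sum_jbr_shift_le) auto
  also have "\<dots> = ennreal C"
  proof -
   have "ennreal x * (ennreal d * ennreal a + ennreal d * ennreal a) = ennreal (x * (2 * (d * a)))"
    if "0 \<le> x" "0 \<le> d" "0 \<le> a" for x d a
    using that by (simp add: ennreal_plus[symmetric] ennreal_mult[symmetric] del: ennreal_plus)
   then show ?thesis unfolding S C_def by simp
  qed
  finally show ?thesis .
 qed
 moreover have "0 \<le> C" by (simp add: C_def)
 ultimately show ?thesis using that by blast
qed

text \<open>One of \<open>jbr r\<close> and \<open>jbr (y - r)\<close> is at least half of
  \<open>jbr y\<close>; that factor leaves the integral and the other one is integrated.\<close>

lemma convolution_jbr:
 assumes p: "1/2 < b"
 shows "nnl (\<lambda>r. jbr r powr (- (2 * b)) * jbr (y - r) powr (- (2 * b))) \<le>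
  ennreal (2 powr (2 * b) * (2 * kb b) * jbr y powr (- (2 * b)))"
proof -
 define p where "p = 2 * b"
 have p0: "0 \<le> p" using assms by (simp add: p_def)
 have half: "x powr (- p) \<le> 2 powr p * jbr y powr (- p)" if "jbr y \<le> 2 * x" "0 < x" for x
 proof -
  have "jbr y powr p \<le> (2 * x) powr p" using p0 that by (intro powr_mono2) auto
  then have "jbr y powr p \<le> 2 powr p * x powr p" using that by (simp add: powr_mult)
  moreover have "inverse Y \<le> c * inverse X" if "X \<le> c * Y" "0 < X" "0 < Y" for X Y c :: real
   using that by (simp add: field_simps)
  ultimately show ?thesis using that by (simp add: powr_minus)
 qed
 have pt: "jbr r powr (- p) * jbr (y - r) powr (- p) \<le> 2 powr p * jbr y powr (- p) * (jbr r powr (- p) + jbr (y - r) powr (- p))" for r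
 proof -
  define X where "X = jbr r powr (- p)"
  define Y where "Y = jbr (y - r) powr (- p)"
  define Z where "Z = 2 powr p * jbr y powr (- p)"
  have pos: "0 \<le> X" "0 \<le> Y" "0 \<le> Z" by (simp_all add: X_def Y_def Z_def)
  have "jbr y \<le> jbr r + jbr (y - r)" using jbr_triangle[of r "y - r"] by simp
  then consider "jbr y \<le> 2 * jbr r" | "jbr y \<le> 2 * jbr (y - r)" by linarith
  then have "X \<le> Z \<or> Y \<le> Z"
   using half[of "jbr r"] half[of "jbr (y - r)"] by (cases) (auto simp: X_def Y_def Z_def)
  then have "X * Y \<le> Z * (X + Y)"
  proof
   assume "X \<le> Z"
   then have "X * Y \<le> Z * Y" using pos by (intro mult_right_mono) auto
   then show ?thesis using pos by (simp add: distrib_left add_increasing)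
  next
   assume "Y \<le> Z"
   then have "X * Y \<le> X * Z" using pos by (intro mult_left_mono) auto
   then show ?thesis using pos by (simp add: distrib_left add_increasing2 mult.commute)
  qed
  then show ?thesis by (simp add: X_def Y_def Z_def)
 qed
 have "nnl (\<lambda>r. jbr r powr (- p) * jbr (y - r) powr (- p)) \<le>
   (\<integral>\<^sup>+r. ennreal (2 powr p * jbr y powr (- p)) * (ennreal (jbr r powr (- p)) + ennreal (jbr (y - r) powr (- p))) \<partial>lborel)"
  by (intro nn_integral_mono) (simp add: ennreal_mult[symmetric] ennreal_plus[symmetric] ennreal_leI pt del: ennreal_plus)
 also have "\<dots> = ennreal (2 powr p * jbr y powr (- p)) * (nnl (\<lambda>r. jbr r powr (- p)) + nnl (\<lambda>r. jbr (y - r) powr (- p)))"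
  by (simp add: nn_integral_cmult nn_integral_add)
 also have "nnl (\<lambda>r. jbr (y - r) powr (- p)) = nnl (\<lambda>r. jbr r powr (- p))"
  by (rule nn_integral_minus_shift) measurable
 also have "nnl (\<lambda>r. jbr r powr (- p)) = ennreal (kb b)"
  unfolding p_def by (rule ennreal_kb[OF assms, symmetric])
 also have "ennreal (2 powr p * jbr y powr (- p)) * (ennreal (kb b) + ennreal (kb b)) = ennreal (2 powr p * (2 * kb b) * jbr y powr (- p))"
  by (simp add: ennreal_mult[symmetric] ennreal_plus[symmetric] mult_ac del: ennreal_plus)
 finally show ?thesis by (simp only: p_def)
qed

section \<open>Multiplier bounds for the bilinear terms\<close>

definition bw :: "real => real => real => int => int => real => real" where
 "bw s1 s2 q n k r = jbr r powr (- q) * (jbr (of_int k) powr (- (2 * s1)) * jbr (of_int (- n - k)) powr (- (2 * s2)))"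

lemma bw_nonneg [simp]: "0 \<le> bw s1 s2 q n k r"
 by (simp add: bw_def)

text \<open>Cauchy-Schwarz over the inputs leaves the integral of the reciprocal input weights times
  the output weight \<open>jbr y powr (- q)\<close>; it must be bounded uniformly over all outputs
  \<open>(n, y)\<close>. The exponent \<open>b'\<close> belongs to the modulations of both
  inputs.\<close>

definition bil :: "real => real => real => real => real => bool" where
 "bil s1 s2 b' q A \<longleftrightarrow> 0 \<le> A \<and> (\<forall>n y. (\<integral>\<^sup>+k. \<integral>\<^sup>+x. ennreal (bw s1 s2 q n k y *
    (jbr x powr (- (2 * b')) * jbr (y + om n k - x) powr (- (2 * b')))) \<partial>lborel \<partial>ZZ) \<le> ennreal A)"

text \<open>Integrating the input modulation by \<open>convolution_jbr\<close> leaves a power of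
  \<open>jbr (r + om n k)\<close>, and the sum over \<open>k\<close> is the lattice count of
  \<open>sum_om_le\<close>. The majorant has two terms, at the levels \<open>0\<close> and
  \<open>r\<close>, because either bracket may be the smaller one.\<close>

lemma bilI:
 assumes b': "1/2 < b'" and D: "0 \<le> D" and \<rho>: "1/2 < \<rho>"
  and pt: "\<And>n k r. bw s1 s2 q n k r * jbr (r + om n k) powr (- (2 * b')) \<le>
   D * (jbr (0 + om n k) powr (- \<rho>) + jbr (r + om n k) powr (- \<rho>))"
 obtains A where "bil s1 s2 b' q A"
proof -
 obtain C where C: "0 \<le> C" "\<And>y n. nns (\<lambda>k. jbr (y + om n k) powr (- \<rho>)) \<le> ennreal C"
  using sum_om_le[OF \<rho>] by metis
 define c where "c = 2 powr (2 * b') * (2 * kb b')"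
 have c: "0 \<le> c" by (simp add: c_def)
 have "(\<integral>\<^sup>+k. \<integral>\<^sup>+x. ennreal (bw s1 s2 q n k r * (jbr x powr (- (2 * b')) * jbr (r + om n k - x) powr (- (2 * b')))) \<partial>lborel \<partial>ZZ)
   \<le> ennreal (c * D * (2 * C))" for n r
 proof -
  have "(\<integral>\<^sup>+k. \<integral>\<^sup>+x. ennreal (bw s1 s2 q n k r * (jbr x powr (- (2 * b')) * jbr (r + om n k - x) powr (- (2 * b')))) \<partial>lborel \<partial>ZZ)
   \<le> (\<integral>\<^sup>+k. ennreal (c * D) * (ennreal (jbr (0 + om n k) powr (- \<rho>)) + ennreal (jbr (r + om n k) powr (- \<rho>))) \<partial>ZZ)"
  proof (intro nn_integral_mono)
   fix k
   have "nnl (\<lambda>x. bw s1 s2 q n k r * (jbr x powr (- (2 * b')) * jbr (r + om n k - x) powr (- (2 * b')))) =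
     ennreal (bw s1 s2 q n k r) * nnl (\<lambda>x. jbr x powr (- (2 * b')) * jbr (r + om n k - x) powr (- (2 * b')))"
    by (simp add: ennreal_mult'' nn_integral_cmult ennreal_mult[of "bw s1 s2 q n k r"])
   also have "\<dots> \<le> ennreal (bw s1 s2 q n k r) * ennreal (c * jbr (r + om n k) powr (- (2 * b')))"
    unfolding c_def by (intro mult_left_mono convolution_jbr b') auto
   also have "\<dots> = ennreal (c * (bw s1 s2 q n k r * jbr (r + om n k) powr (- (2 * b'))))"
    using c by (simp add: ennreal_mult[symmetric] mult_ac)
   also have "\<dots> \<le> ennreal (c * (D * (jbr (0 + om n k) powr (- \<rho>) + jbr (r + om n k) powr (- \<rho>))))"
    by (intro ennreal_leI mult_left_mono pt c)
   also have "\<dots> = ennreal (c * D) * (ennreal (jbr (0 + om n k) powr (- \<rho>)) + ennreal (jbr (r + om n k) powr (- \<rho>)))"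
    using c D by (simp add: ennreal_mult[symmetric] ennreal_plus[symmetric] mult.assoc del: ennreal_plus)
   finally show "nnl (\<lambda>x. bw s1 s2 q n k r * (jbr x powr (- (2 * b')) * jbr (r + om n k - x) powr (- (2 * b')))) \<le> \<dots>" .
  qed
  also have "\<dots> = ennreal (c * D) * (nns (\<lambda>k. jbr (0 + om n k) powr (- \<rho>)) + nns (\<lambda>k. jbr (r + om n k) powr (- \<rho>)))"
   by (simp only: nn_integral_cmult nn_integral_add borel_measurable_count_space)
  also have "\<dots> \<le> ennreal (c * D) * (ennreal C + ennreal C)" by (intro mult_left_mono add_mono C) simp
  also have "\<dots> = ennreal (c * D * (2 * C))"
   using c C D by (simp add: ennreal_mult[symmetric] ennreal_plus[symmetric] del: ennreal_plus)
  finally show ?thesis .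
 qed
 then show ?thesis using c C D that[of "c * D * (2 * C)"] by (simp add: bil_def)
qed

text \<open>Nonresonance: \<open>om = (y + om) - y\<close>, so \<open>y\<close> or \<open>y + om\<close> is as large as \<open>om\<close>.\<close>

lemma jbr_nonresonance:
 assumes "0 \<le> q"
 shows "jbr r powr (- q) \<le> 2 powr q * (jbr (om n k) powr (- q) * jbr (r + om n k) powr q)"
proof -
 have "jbr (om n k) powr q \<le> 2 powr q * (jbr (r + om n k) powr q * jbr r powr q)"
  using jbr_add_powr[OF assms, of "r + om n k" "- r"] by simp
 moreover have "inverse t \<le> c * (inverse o' * y)" if "o' \<le> c * (y * t)" "0 < t" "0 < o'" for t o' y c :: real
  using that by (simp add: field_simps)
 ultimately show ?thesis by (simp add: powr_minus)
qed

text \<open>Any exponent \<open>e\<close> from \<open>- a\<close> upwards may be spent on one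
  frequency weight, since the bracket of \<open>w\<close> is at least 1.\<close>

lemma weight_le_om:
 assumes "a \<le> 0" "- a \<le> e" "(jbr x)\<^sup>2 \<le> 2 * jbr w"
 shows "jbr x powr (- (2 * a)) \<le> 2 powr e * jbr w powr e"
proof -
 have "jbr x powr (2 * (- a)) = ((jbr x)\<^sup>2) powr (- a)" by (simp only: jbr_powr_double jbr_square)
 also have "\<dots> \<le> (2 * jbr w) powr (- a)" using assms by (intro powr_mono2) auto
 also have "\<dots> \<le> (2 * jbr w) powr e" using assms jbr_ge1[of w] by (intro powr_mono) auto
 finally show ?thesis by (simp add: powr_mult)
qed

text \<open>The weights of the two data use up \<open>jbr (om n k) powr (- q)\<close>, half each.
  What remains is \<open>jbr (r + om n k) powr (- (2 - q))\<close>, summable over \<open>k\<close>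
  because \<open>2 - q > 1/2\<close>.\<close>

lemma bil_free_free:
 assumes s: "s \<le> 0" and q: "- 2 * s \<le> q" "q < 1"
 obtains A where "bil s s 1 q A"
proof (rule bilI[of 1 "2 powr q * (2 powr (q/2) * 2 powr (q/2))" "2 - q" s s q])
 fix n k r
 define w y where "w = jbr (om n k)" and "y = jbr (r + om n k)"
 have w: "0 < w" "0 < y" by (simp_all add: w_def y_def)
 have e: "jbr x powr (- (2 * s)) \<le> 2 powr (q/2) * w powr (q/2)" if "(jbr x)\<^sup>2 \<le> 2 * w" for x
  using weight_le_om[OF s _ that[unfolded w_def], of "q/2"] q by (simp add: w_def)
 have "bw s s q n k r \<le> (2 powr q * (w powr (- q) * y powr q)) * ((2 powr (q/2) * w powr (q/2)) * (2 powr (q/2) * w powr (q/2)))"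
  unfolding bw_def using jbr_nonresonance[of q r n k] jbr_sq_le_om[where n=n and k=k] s q
  by (intro mult_mono e) (auto simp: w_def y_def)
 also have "\<dots> = (2 powr q * (2 powr (q/2) * 2 powr (q/2))) * ((w powr (- q) * (w powr (q/2) * w powr (q/2))) * y powr q)"
  by (simp only: mult_ac)
 also have "w powr (- q) * (w powr (q/2) * w powr (q/2)) = 1" using w by (simp add: powr_add[symmetric])
 finally have "bw s s q n k r * y powr (- (2 * 1)) \<le> (2 powr q * (2 powr (q/2) * 2 powr (q/2))) * (1 * y powr q) * y powr (- (2 * 1))"
  by (rule mult_right_mono) simp
 also have "\<dots> = (2 powr q * (2 powr (q/2) * 2 powr (q/2))) * (y powr q * y powr (- (2 * 1)))"
  by (simp only: mult_1_left mult.assoc)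
 also have "y powr q * y powr (- (2 * 1)) = y powr (- (2 - q))" by (simp only: powr_add[symmetric]) simp
 also have "2 powr q * (2 powr (q/2) * 2 powr (q/2)) * y powr (- (2 - q)) \<le> 2 powr q * (2 powr (q/2) * 2 powr (q/2)) *
   (jbr (0 + om n k) powr (- (2 - q)) + y powr (- (2 - q)))"
  by (intro mult_left_mono) simp_all
 finally show "bw s s q n k r * jbr (r + om n k) powr (- (2 * 1)) \<le> 2 powr q * (2 powr (q/2) * 2 powr (q/2)) *
   (jbr (0 + om n k) powr (- (2 - q)) + jbr (r + om n k) powr (- (2 - q)))" by (simp only: y_def)
qed (use q that in auto)

text \<open>The exponent \<open>2 * b - q\<close> left on \<open>jbr (u + om n k)\<close> is only
  known to be positive, too little for the sum over \<open>k\<close>. But a single weight spends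
  just half of the power of \<open>om\<close>; the other half,
  \<open>jbr (om n k) powr (- (q/2))\<close>, is added to it by passing to the smaller of the two
  brackets, and \<open>2 * b - q/2 > 1/2\<close>.\<close>

lemma bil_free_rest:
 assumes s: "s \<le> 0" and q: "- 2 * s \<le> q" "q < 1" and b: "1/2 < b"
 obtains A where "bil s 0 b q A"
proof (rule bilI[of b "2 powr q * 2 powr (q/2)" "2 * b - q/2" s 0 q])
 fix n k u
 define w y where "w = jbr (om n k)" and "y = jbr (u + om n k)"
 have w: "0 < w" "0 < y" by (simp_all add: w_def y_def)
 have q0: "0 \<le> q" using s q by simp
 have "jbr (of_int k) powr (- (2 * s)) \<le> 2 powr (q/2) * w powr (q/2)"
  unfolding w_def by (rule weight_le_om[OF s _ jbr_sq_le_om(1)]) (use q in simp)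
 then have F: "jbr (of_int k) powr (- (2 * s)) * jbr (of_int (- n - k)) powr (- (2 * 0)) \<le> 2 powr (q/2) * w powr (q/2)" by simp
 have "bw s 0 q n k u \<le> (2 powr q * (w powr (- q) * y powr q)) * (2 powr (q/2) * w powr (q/2))"
  unfolding bw_def using jbr_nonresonance[OF q0, of u n k] by (intro mult_mono[OF _ F]) (auto simp: w_def y_def)
 then have "bw s 0 q n k u * y powr (- (2 * b)) \<le> (2 powr q * (w powr (- q) * y powr q)) * (2 powr (q/2) * w powr (q/2)) * y powr (- (2 * b))"
  by (rule mult_right_mono) simp
 also have "\<dots> = (2 powr q * 2 powr (q/2)) * ((w powr (- q) * w powr (q/2)) * (y powr q * y powr (- (2 * b))))"
  by (simp only: mult_ac)
 also have "(w powr (- q) * w powr (q/2)) * (y powr q * y powr (- (2 * b))) = w powr (- (q/2)) * y powr (- (2 * b - q))"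
  by (simp only: powr_add[symmetric]) simp
 also have "(2 powr q * 2 powr (q/2)) * (w powr (- (q/2)) * y powr (- (2 * b - q))) \<le> (2 powr q * 2 powr (q/2)) * (w powr (- (2 * b - q/2)) + y powr (- (2 * b - q/2)))"
 proof (rule mult_left_mono)
  have "- (q/2) + - (2 * b - q) = - (2 * b - q/2)" by simp
  then have e: "x powr (- (q/2)) * x powr (- (2 * b - q)) = x powr (- (2 * b - q/2))" for x
   by (simp only: powr_add[symmetric])
  show "w powr (- (q/2)) * y powr (- (2 * b - q)) \<le> w powr (- (2 * b - q/2)) + y powr (- (2 * b - q/2))"
  proof (cases "w \<le> y")
   case True
   then have "y powr (- (2 * b - q)) \<le> w powr (- (2 * b - q))" using w b q by (intro powr_mono2') auto
   then have "w powr (- (q/2)) * y powr (- (2 * b - q)) \<le> w powr (- (2 * b - q/2))" unfolding e[of w, symmetric] by (intro mult_left_mono) auto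
   then show ?thesis by (simp add: add_increasing2)
  next
   case False
   then have "w powr (- (q/2)) \<le> y powr (- (q/2))" using w q0 by (intro powr_mono2') auto
   then have "w powr (- (q/2)) * y powr (- (2 * b - q)) \<le> y powr (- (2 * b - q/2))" unfolding e[of y, symmetric] by (intro mult_right_mono) auto
   then show ?thesis by (simp add: add_increasing)
  qed
 qed simp
 finally show "bw s 0 q n k u * jbr (u + om n k) powr (- (2 * b)) \<le> 2 powr q * 2 powr (q/2) *
   (jbr (0 + om n k) powr (- (2 * b - q/2)) + jbr (u + om n k) powr (- (2 * b - q/2)))" by (simp add: w_def y_def)
qed (use q b that in auto)

subsection \<open>The bilinear operator\<close>

interpretation PP: pair_sigma_finite PM PM
 unfolding pair_sigma_finite_def using P.sigma_finite_measure_axioms by simp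

text \<open>The argument of the second factor when the output is \<open>w\<close> and the first
  factor is taken at \<open>z\<close>. Before the outer conjugation the product is read off at
  frequency \<open>- n\<close>, so the two input frequencies add up to \<open>- n\<close>, and the
  modulations balance up to \<open>om\<close>.\<close>

definition sh :: "int \<times> real => int \<times> real => int \<times> real" where
 "sh w z = (- fst w - fst z, snd w + om (fst w) (fst z) - snd z)"

lemma sh_measurable:
 assumes "f \<in> bPM"
 shows "(\<lambda>p. f (sh (fst p) (snd p))) \<in> borel_measurable (PM \<Otimes>\<^sub>M PM)"
proof -
 have *: "(\<lambda>p. f (- n - k, snd (fst p) + om n k - snd (snd p))) \<in> borel_measurable (PM \<Otimes>\<^sub>M PM)" for n k
 proof (rule measurable_compose[OF _ measurable_row[OF assms]])
  show "(\<lambda>p. snd (fst p) + om n k - snd (snd p)) \<in> borel_measurable (PM \<Otimes>\<^sub>M PM)" by measurable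
 qed
 have "(\<lambda>p. (\<lambda>n p. (\<lambda>k p. f (- n - k, snd (fst p) + om n k - snd (snd p))) (fst (snd p)) p) (fst (fst p)) p) \<in> borel_measurable (PM \<Otimes>\<^sub>M PM)"
  by (rule measurable_compose_countable, rule measurable_compose_countable, rule *) measurable
 then show ?thesis by (simp add: sh_def)
qed

lemma sh_measurable_row:
 assumes "f \<in> bPM"
 shows "(\<lambda>z. f (sh w z)) \<in> bPM"
 unfolding measurable_PM_iff sh_def fst_conv snd_conv
 by (intro allI, rule measurable_compose[OF _ measurable_row[OF assms]]) measurable

definition habs :: "(int \<times> real => complex) => (int \<times> real => complex) => int \<times> real => ennreal" where
 "habs f g w = (\<integral>\<^sup>+z. ennreal (norm (f z * g (sh w z))) \<partial>PM)"

definition H :: "(int \<times> real => complex) => (int \<times> real => complex) => int \<times> real => complex" where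
 "H f g w = (\<integral>z. f z * g (sh w z) \<partial>PM)"

lemma bil_integrand_measurable:
 fixes f g :: "int \<times> real => complex"
 assumes "f \<in> bPM" "g \<in> bPM"
 shows "(\<lambda>p. f (snd p) * g (sh (fst p) (snd p))) \<in> borel_measurable (PM \<Otimes>\<^sub>M PM)"
 by (rule borel_measurable_times[OF measurable_compose[OF measurable_snd assms(1)] sh_measurable[OF assms(2)]])

lemma H_measurable:
 assumes "f \<in> bPM" "g \<in> bPM"
 shows "H f g \<in> bPM" "habs f g \<in> bPM"
proof -
 have m: "(\<lambda>(w, z). f z * g (sh w z)) \<in> borel_measurable (PM \<Otimes>\<^sub>M PM)"
  using bil_integrand_measurable[OF assms] by (simp add: split_beta')
 show "H f g \<in> bPM"
  unfolding H_def by (rule P.borel_measurable_lebesgue_integral[OF m])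
 have "(\<lambda>(w, z). ennreal (norm (f z * g (sh w z)))) \<in> borel_measurable (PM \<Otimes>\<^sub>M PM)"
  using measurable_compose[OF measurable_compose[OF m borel_measurable_norm] measurable_ennreal] by (simp add: split_beta')
 then show "habs f g \<in> bPM"
  unfolding habs_def by (rule P.borel_measurable_nn_integral)
qed

lemma norm_H_le: "ennreal (norm (H f g w)) \<le> habs f g w"
proof (cases "integrable PM (\<lambda>z. f z * g (sh w z))")
 case True
 then show ?thesis unfolding H_def habs_def by (rule integral_norm_bound_ennreal)
qed (simp add: H_def not_integrable_integral_eq)

definition wgt :: "real => real => int \<times> real => real" where
 "wgt s b z = wt s b (fst z) (snd z)"

lemma wgt_pos [simp]: "0 < wgt s b z" and wgt_nonneg [simp]: "0 \<le> wgt s b z"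
 by (simp_all add: wgt_def wt_def zero_less_mult_iff)

lemma wgt_measurable: "wgt s b \<in> bPM"
 unfolding measurable_PM_iff wgt_def by simp

lemma sqi_wgt:
 assumes "f \<in> bPM"
 shows "(\<integral>\<^sup>+z. ennreal (wgt s b z * (norm (f z))\<^sup>2) \<partial>PM) = sqi (wm s b) f"
proof -
 have [measurable]: "wgt s b \<in> bPM" "f \<in> bPM" by (rule wgt_measurable, rule assms)
 show ?thesis unfolding sqi_wm[OF assms] by (subst nn_integral_PM) (measurable, simp add: wgt_def)
qed

text \<open>For fixed \<open>z\<close> the map reflects and shifts \<open>n\<close> and shifts
  \<open>y\<close> by an amount depending on \<open>n\<close>; both operations preserve the
  measure.\<close>

lemma nn_integral_sh:
 assumes G: "G \<in> bPM"
 shows "(\<integral>\<^sup>+w. G (sh w z) \<partial>PM) = (\<integral>\<^sup>+w. G w \<partial>PM)"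
proof -
 have Gr: "(\<lambda>y. G (m, y)) \<in> bor" for m by (rule measurable_row[OF G])
 have m: "(\<lambda>w. G (sh w z)) \<in> bPM"
  unfolding measurable_PM_iff sh_def fst_conv snd_conv
  by (intro allI, rule measurable_compose[OF _ Gr]) measurable
 have "(\<integral>\<^sup>+w. G (sh w z) \<partial>PM) = (\<integral>\<^sup>+n. \<integral>\<^sup>+y. G (- n - fst z, y + (om n (fst z) - snd z)) \<partial>lborel \<partial>ZZ)"
  by (subst nn_integral_PM[OF m]) (simp add: sh_def algebra_simps)
 also have "\<dots> = (\<integral>\<^sup>+n. \<integral>\<^sup>+y. G (- n - fst z, y) \<partial>lborel \<partial>ZZ)"
  by (simp only: nn_integral_plus_shift[OF Gr])
 also have "\<dots> = (\<integral>\<^sup>+n. \<integral>\<^sup>+y. G (n, y) \<partial>lborel \<partial>ZZ)"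
  by (rule nn_integral_bij_count_space[where g="\<lambda>n. - n - fst z"])
   (auto intro!: bij_betwI[where g="\<lambda>n. - n - fst z"])
 finally show ?thesis by (simp add: nn_integral_PM[OF G])
qed

text \<open>Cauchy-Schwarz in \<open>z\<close> against the product of the two input weights. The
  first factor is at most \<open>A\<close> for every output; the second integrates to the product of
  the norms, by Fubini and the invariance of the measure under \<open>sh\<close>.\<close>

lemma bil_estimate:
 assumes bil: "bil s1 s2 b' q A" and f: "f \<in> L2 (wm s1 b')" and g: "g \<in> L2 (wm s2 b')"
 shows "(\<integral>\<^sup>+w. ennreal (jbr (snd w) powr (- q)) * (habs f g w)\<^sup>2 \<partial>PM) \<le>
  ennreal (A * (l2 (wm s1 b') f)\<^sup>2 * (l2 (wm s2 b') g)\<^sup>2)"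
proof -
 have A: "0 \<le> A" using bil by (simp add: bil_def)
 note m = L2_wm_measurable[OF f] L2_wm_measurable[OF g]
 define X where "X z = ennreal (wgt s1 b' z * (norm (f z))\<^sup>2)" for z
 define Y where "Y z = ennreal (wgt s2 b' z * (norm (g z))\<^sup>2)" for z
 have Xm: "X \<in> bPM" and Ym: "Y \<in> bPM"
  unfolding X_def Y_def using wgt_measurable m
  by (auto intro!: borel_measurable_times borel_measurable_power)
 have pt: "ennreal (jbr (snd w) powr (- q)) * (habs f g w)\<^sup>2 \<le> ennreal A * (\<integral>\<^sup>+z. X z * Y (sh w z) \<partial>PM)" for w
 proof -
  define u where "u z = wgt s1 b' z * wgt s2 b' (sh w z)" for z
  have u: "0 < u z" for z by (simp add: u_def)
  have um: "u \<in> bPM"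
   unfolding u_def by (intro borel_measurable_times wgt_measurable sh_measurable_row)
  have am: "(\<lambda>z. norm (f z * g (sh w z))) \<in> bPM"
   by (rule measurable_compose[OF borel_measurable_times[OF m(1) sh_measurable_row[OF m(2)]] borel_measurable_norm])
  have "(habs f g w)\<^sup>2 = (\<integral>\<^sup>+z. ennreal (1 / sqrt (u z)) * ennreal (sqrt (u z) * norm (f z * g (sh w z))) \<partial>PM)\<^sup>2"
   unfolding habs_def using u by (simp add: ennreal_mult[symmetric] less_imp_le less_imp_neq[symmetric])
  also have "\<dots> \<le> (\<integral>\<^sup>+z. (ennreal (1 / sqrt (u z)))\<^sup>2 \<partial>PM) * (\<integral>\<^sup>+z. (ennreal (sqrt (u z) * norm (f z * g (sh w z))))\<^sup>2 \<partial>PM)"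
   using um am by (intro Cauchy_Schwarz_nn_integral) auto
  also have "(\<integral>\<^sup>+z. (ennreal (sqrt (u z) * norm (f z * g (sh w z))))\<^sup>2 \<partial>PM) = (\<integral>\<^sup>+z. X z * Y (sh w z) \<partial>PM)"
   using u by (intro nn_integral_cong)
    (simp add: X_def Y_def u_def ennreal_power power_mult_distrib norm_mult ennreal_mult[symmetric] less_imp_le mult_ac)
  finally have 1: "(habs f g w)\<^sup>2 \<le> (\<integral>\<^sup>+z. (ennreal (1 / sqrt (u z)))\<^sup>2 \<partial>PM) * (\<integral>\<^sup>+z. X z * Y (sh w z) \<partial>PM)" .
  obtain n y where w: "w = (n, y)" by (cases w)
  have "ennreal (jbr (snd w) powr (- q)) * (\<integral>\<^sup>+z. (ennreal (1 / sqrt (u z)))\<^sup>2 \<partial>PM) =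
    (\<integral>\<^sup>+z. ennreal (jbr y powr (- q)) * (ennreal (1 / sqrt (u z)))\<^sup>2 \<partial>PM)"
   unfolding w using um by (subst nn_integral_cmult) auto
  also have "\<dots> = (\<integral>\<^sup>+k. \<integral>\<^sup>+x. ennreal (jbr y powr (- q)) * (ennreal (1 / sqrt (u (k, x))))\<^sup>2 \<partial>lborel \<partial>ZZ)"
   using um by (intro nn_integral_PM) auto
  also have "\<dots> = (\<integral>\<^sup>+k. \<integral>\<^sup>+x. ennreal (bw s1 s2 q n k y *
    (jbr x powr (- (2 * b')) * jbr (y + om n k - x) powr (- (2 * b')))) \<partial>lborel \<partial>ZZ)"
  proof (intro nn_integral_cong)
   fix k x
   have "(ennreal (1 / sqrt (u (k, x))))\<^sup>2 = ennreal (1 / u (k, x))"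
    using u[of "(k, x)"] by (simp add: ennreal_power power_divide less_imp_le)
   also have "1 / u (k, x) = (jbr (of_int k) powr (- (2 * s1)) * jbr (of_int (- n - k)) powr (- (2 * s2))) *
    (jbr x powr (- (2 * b')) * jbr (y + om n k - x) powr (- (2 * b')))"
    by (simp add: u_def wgt_def wt_def sh_def w powr_minus divide_inverse mult_ac)
   finally show "ennreal (jbr y powr (- q)) * (ennreal (1 / sqrt (u (k, x))))\<^sup>2 =
    ennreal (bw s1 s2 q n k y *
    (jbr x powr (- (2 * b')) * jbr (y + om n k - x) powr (- (2 * b'))))"
    by (simp add: ennreal_mult[symmetric] mult.assoc bw_def)
  qed
  also have "\<dots> \<le> ennreal A" using bil by (simp add: bil_def)
  finally have 2: "ennreal (jbr (snd w) powr (- q)) * (\<integral>\<^sup>+z. (ennreal (1 / sqrt (u z)))\<^sup>2 \<partial>PM) \<le> ennreal A" .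
  have "ennreal (jbr (snd w) powr (- q)) * (habs f g w)\<^sup>2 \<le>
    ennreal (jbr (snd w) powr (- q)) * ((\<integral>\<^sup>+z. (ennreal (1 / sqrt (u z)))\<^sup>2 \<partial>PM) * (\<integral>\<^sup>+z. X z * Y (sh w z) \<partial>PM))"
   by (rule mult_left_mono[OF 1]) simp
  also have "\<dots> \<le> ennreal A * (\<integral>\<^sup>+z. X z * Y (sh w z) \<partial>PM)"
   unfolding mult.assoc[symmetric] by (rule mult_right_mono[OF 2]) simp
  finally show ?thesis .
 qed
 have XYm: "(\<lambda>(w, z). X z * Y (sh w z)) \<in> borel_measurable (PM \<Otimes>\<^sub>M PM)"
  unfolding split_beta' by (intro borel_measurable_times_ennreal sh_measurable Ym measurable_compose[OF measurable_snd Xm])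
 have XYr: "(\<lambda>w. \<integral>\<^sup>+z. X z * Y (sh w z) \<partial>PM) \<in> bPM"
  by (rule P.borel_measurable_nn_integral[OF XYm])
 have "(\<integral>\<^sup>+w. ennreal (jbr (snd w) powr (- q)) * (habs f g w)\<^sup>2 \<partial>PM) \<le> (\<integral>\<^sup>+w. ennreal A * (\<integral>\<^sup>+z. X z * Y (sh w z) \<partial>PM) \<partial>PM)"
  by (intro nn_integral_mono pt)
 also have "\<dots> = ennreal A * (\<integral>\<^sup>+w. \<integral>\<^sup>+z. X z * Y (sh w z) \<partial>PM \<partial>PM)"
  by (rule nn_integral_cmult[OF XYr])
 also have "(\<integral>\<^sup>+w. \<integral>\<^sup>+z. X z * Y (sh w z) \<partial>PM \<partial>PM) = (\<integral>\<^sup>+z. \<integral>\<^sup>+w. X z * Y (sh w z) \<partial>PM \<partial>PM)"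
  by (rule PP.Fubini'[OF XYm, symmetric])
 also have "\<dots> = (\<integral>\<^sup>+z. X z * (\<integral>\<^sup>+w. Y w \<partial>PM) \<partial>PM)"
 proof (intro nn_integral_cong)
  fix z
  have "(\<lambda>w. Y (sh w z)) \<in> bPM"
   unfolding measurable_PM_iff sh_def fst_conv snd_conv
   by (intro allI, rule measurable_compose[OF _ measurable_row[OF Ym]]) measurable
  then have "(\<integral>\<^sup>+w. X z * Y (sh w z) \<partial>PM) = X z * (\<integral>\<^sup>+w. Y (sh w z) \<partial>PM)" by (rule nn_integral_cmult)
  then show "(\<integral>\<^sup>+w. X z * Y (sh w z) \<partial>PM) = X z * (\<integral>\<^sup>+w. Y w \<partial>PM)" by (simp only: nn_integral_sh[OF Ym])
 qed
 also have "\<dots> = sqi (wm s1 b') f * sqi (wm s2 b') g"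
  using Xm by (simp add: nn_integral_multc X_def[abs_def] Y_def[abs_def] sqi_wgt[OF m(1)] sqi_wgt[OF m(2)])
 also have "ennreal A * \<dots> = ennreal (A * (l2 (wm s1 b') f)\<^sup>2 * (l2 (wm s2 b') g)\<^sup>2)"
  using A by (simp add: sqi_l2[OF f] sqi_l2[OF g] ennreal_mult mult.assoc)
 finally show ?thesis .
qed

lemma vsq_H:
 assumes bil: "bil s1 s2 b' q A" and f: "f \<in> L2 (wm s1 b')" and g: "g \<in> L2 (wm s2 b')"
 shows "vsq (\<lambda>y. jbr y powr (- (q / 2))) (H f g) \<le> ennreal (A * (l2 (wm s1 b') f)\<^sup>2 * (l2 (wm s2 b') g)\<^sup>2)"
proof -
 note Hm = H_measurable[OF L2_wm_measurable[OF f] L2_wm_measurable[OF g]]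
 have jm: "(\<lambda>w. ennreal (jbr (snd w) powr (- q))) \<in> bPM"
  unfolding measurable_PM_iff by simp
 have "vsq (\<lambda>y. jbr y powr (- (q / 2))) (H f g) \<le>
   (\<integral>\<^sup>+n. \<integral>\<^sup>+y. ennreal (jbr (snd (n, y)) powr (- q)) * (habs f g (n, y))\<^sup>2 \<partial>lborel \<partial>ZZ)"
  unfolding vsq_def
 proof (intro nn_integral_mono)
  fix n y
  have "(jbr y powr (- (q / 2)) * norm (H f g (n, y)))\<^sup>2 = jbr y powr (- q) * (norm (H f g (n, y)))\<^sup>2"
   by (simp add: power_mult_distrib power2_eq_square[of "_ powr _"] powr_add[symmetric])
  then have "ennreal ((jbr y powr (- (q / 2)) * norm (H f g (n, y)))\<^sup>2) = ennreal (jbr y powr (- q)) * (ennreal (norm (H f g (n, y))))\<^sup>2"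
   by (simp add: ennreal_mult ennreal_power)
  also have "\<dots> \<le> ennreal (jbr y powr (- q)) * (habs f g (n, y))\<^sup>2"
   by (intro mult_left_mono power_mono_ennreal norm_H_le) simp
  finally show "ennreal ((jbr y powr (- (q / 2)) * norm (H f g (n, y)))\<^sup>2) \<le> ennreal (jbr (snd (n, y)) powr (- q)) * (habs f g (n, y))\<^sup>2"
   by simp
 qed
 also have "\<dots> = (\<integral>\<^sup>+w. ennreal (jbr (snd w) powr (- q)) * (habs f g w)\<^sup>2 \<partial>PM)"
  unfolding power2_eq_square by (rule nn_integral_PM[symmetric]) (intro borel_measurable_times_ennreal jm Hm(2))
 also have "\<dots> \<le> ennreal (A * (l2 (wm s1 b') f)\<^sup>2 * (l2 (wm s2 b') g)\<^sup>2)" by (rule bil_estimate[OF assms])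
 finally show ?thesis .
qed

text \<open>The integral defining \<open>H\<close> may diverge on a null set, where its value is the
  default 0. Bilinearity of \<open>H\<close> therefore holds almost everywhere, which suffices for
  \<open>J\<close>.\<close>

lemma H_integrable_AE:
 assumes bil: "bil s1 s2 b' q A" and f: "f \<in> L2 (wm s1 b')" and g: "g \<in> L2 (wm s2 b')"
 shows "AE y in lborel. integrable PM (\<lambda>z. f z * g (sh (n, y) z))"
proof -
 note m = L2_wm_measurable[OF f] L2_wm_measurable[OF g]
 note Hm = H_measurable[OF m]
 have jm: "(\<lambda>w. ennreal (jbr (snd w) powr (- q))) \<in> bPM"
  unfolding measurable_PM_iff by simp
 have "(\<integral>\<^sup>+w. ennreal (jbr (snd w) powr (- q)) * (habs f g w)\<^sup>2 \<partial>PM) \<noteq> \<infinity>"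
  using bil_estimate[OF assms] by (auto simp: top_unique)
 then have "AE w in PM. ennreal (jbr (snd w) powr (- q)) * (habs f g w)\<^sup>2 \<noteq> \<infinity>"
  unfolding power2_eq_square by (rule nn_integral_noteq_infinite[rotated]) (intro borel_measurable_times_ennreal jm Hm(2))
 then have "AE w in PM. habs f g w < \<infinity>"
 proof eventually_elim
  case (elim w)
  have "habs f g w \<noteq> \<infinity>"
  proof
   assume "habs f g w = \<infinity>"
   then show False using elim by (simp add: power2_eq_square ennreal_mult_top)
  qed
  then show ?case by (simp add: less_top)
 qed
 then have "AE w in PM. integrable PM (\<lambda>z. f z * g (sh w z))"
 proof eventually_elim
  case (elim w)
  have "(\<lambda>z. f z * g (sh w z)) \<in> bPM"
   by (intro borel_measurable_times m sh_measurable_row)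
  then show ?case using elim unfolding habs_def by (rule integrableI_bounded)
 qed
 then have "AE n in count_space UNIV. AE y in lborel. integrable PM (\<lambda>z. f z * g (sh (n, y) z))"
  by (rule P.AE_pair)
 then show ?thesis by (simp add: AE_count_space)
qed

section \<open>The Duhamel integral on the frequency side\<close>

definition tker :: "real => real => complex" where
 "tker t y = (cis (t * y) - 1) / (\<i> * of_real y)"

text \<open>For \<open>u = cv f\<close> and \<open>v = cv g\<close> the Duhamel integral of \<open>cnj u * cnj v\<close> is \<open>cis (- n\<^sup>2 t) * J f g t n\<close>. The conjugation
 makes the phases add up, hence the nonnegative \<^const>\<open>om\<close>. The value of \<^const>\<open>tker\<close> at \<open>0\<close> is junk.\<close>

definition J :: "(int \<times> real => complex) => (int \<times> real => complex) => real => int => complex" where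
 "J f g t n = cnj (LBINT y. H f g (n, y) * tker t y)"

lemma tker_measurable [measurable]: "tker t \<in> bor"
 unfolding tker_def by measurable

lemma norm_tker_le: "norm (tker t y) \<le> (4 + 2 * \<bar>t\<bar>) * jbr y powr (-1)"
proof -
 have jb: "jbr y \<le> 1 + \<bar>y\<bar>" unfolding jbr_def by (rule real_le_lsqrt) (auto simp: power2_sum)
 have inv: "jbr y powr (-1) = inverse (jbr y)" by (simp add: powr_minus)
 consider "y = 0" | "y \<noteq> 0" "\<bar>y\<bar> \<le> 1" | "1 < \<bar>y\<bar>" by linarith
 then show ?thesis
 proof cases
  case 1 then show ?thesis by (simp add: tker_def)
 next
  case 2
  have "norm (tker t y) \<le> \<bar>t * y\<bar> / \<bar>y\<bar>"
   unfolding tker_def norm_divide using norm_cis_minus_1_le[of "t * y"] by (simp add: norm_mult divide_right_mono)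
  also have "\<dots> = \<bar>t\<bar>" using 2 by (simp add: abs_mult)
  finally have n: "norm (tker t y) \<le> \<bar>t\<bar>" .
  have "jbr y \<le> 2" using jb 2 by simp
  then have "norm (tker t y) * jbr y \<le> \<bar>t\<bar> * 2" using n by (intro mult_mono) auto
  then show ?thesis unfolding inv by (simp add: divide_inverse[symmetric] pos_le_divide_eq)
 next
  case 3
  have "norm (tker t y) \<le> 2 / \<bar>y\<bar>"
   unfolding tker_def norm_divide using norm_triangle_ineq4[of "cis (t * y)" 1] by (simp add: norm_mult divide_right_mono)
  moreover have "jbr y \<le> 2 * \<bar>y\<bar>" using jb 3 by simp
  ultimately have "norm (tker t y) * jbr y \<le> (2 / \<bar>y\<bar>) * (2 * \<bar>y\<bar>)" by (intro mult_mono) auto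
  also have "\<dots> = 4" using 3 by auto
  finally have "norm (tker t y) * jbr y \<le> 4 + 2 * \<bar>t\<bar>" by simp
  then show ?thesis unfolding inv by (simp add: divide_inverse[symmetric] pos_le_divide_eq)
 qed
qed

text \<open>\<open>tker\<close> decays like \<open>jbr y powr (-1)\<close>; multiplied by
  \<open>jbr y powr (q / 2)\<close> it is still square integrable, precisely because
  \<open>q < 1\<close>.\<close>

lemma J_integrable:
 assumes Hm: "h \<in> bPM" and fin: "vsq (\<lambda>y. jbr y powr (- (q / 2))) h < \<infinity>" and q: "q < 1"
 shows "integrable lborel (\<lambda>y. h (n, y) * tker t y)"
proof -
 have [measurable]: "(\<lambda>y. h (n, y)) \<in> bor" by (rule measurable_row[OF Hm])
 have a: "(\<lambda>y. of_real (jbr y powr (- (q / 2))) * h (n, y)) \<in> L2 lborel"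
  using vsq_row_finite[OF fin, of n] by (simp add: L2_def sqi_def norm_mult)
 have "nnl (\<lambda>y. (norm (of_real (jbr y powr (q / 2)) * tker t y))\<^sup>2) \<le>
   (\<integral>\<^sup>+y. ennreal ((4 + 2 * \<bar>t\<bar>)\<^sup>2) * ennreal (jbr y powr (- (2 - q))) \<partial>lborel)"
 proof (intro nn_integral_mono)
  fix y
  have "norm (of_real (jbr y powr (q / 2)) * tker t y) \<le> jbr y powr (q / 2) * ((4 + 2 * \<bar>t\<bar>) * jbr y powr (-1))"
   unfolding norm_mult norm_of_real abs_of_nonneg[OF powr_ge_zero] by (rule mult_left_mono[OF norm_tker_le powr_ge_zero])
  also have "\<dots> = (4 + 2 * \<bar>t\<bar>) * jbr y powr (q / 2 - 1)"
   by (simp only: diff_conv_add_uminus powr_add mult_ac)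
  finally have "(norm (of_real (jbr y powr (q / 2)) * tker t y))\<^sup>2 \<le> ((4 + 2 * \<bar>t\<bar>) * jbr y powr (q / 2 - 1))\<^sup>2"
   by (intro power_mono) auto
  also have "\<dots> = (4 + 2 * \<bar>t\<bar>)\<^sup>2 * jbr y powr (- (2 - q))"
   by (simp add: power_mult_distrib power2_eq_square[of "_ powr _"] powr_add[symmetric])
  finally show "ennreal ((norm (of_real (jbr y powr (q / 2)) * tker t y))\<^sup>2) \<le> ennreal ((4 + 2 * \<bar>t\<bar>)\<^sup>2) * ennreal (jbr y powr (- (2 - q)))"
   by (simp only: ennreal_mult[symmetric] zero_le_power2 powr_ge_zero ennreal_leI)
 qed
 also have "\<dots> < \<infinity>"
  using nn_integral_jbr_finite[of "2 - q"] q by (simp add: nn_integral_cmult ennreal_mult_less_top)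
 finally have b: "(\<lambda>y. of_real (jbr y powr (q / 2)) * tker t y) \<in> L2 lborel"
  by (simp add: L2_def sqi_def)
 have "of_real (jbr y powr (- (q / 2))) * h (n, y) * (of_real (jbr y powr (q / 2)) * tker t y) = h (n, y) * tker t y" for y
 proof -
  have "jbr y powr (- (q / 2)) * jbr y powr (q / 2) = 1" by (simp add: powr_add[symmetric])
  then have "complex_of_real (jbr y powr (- (q / 2))) * of_real (jbr y powr (q / 2)) = 1"
   by (simp only: of_real_mult[symmetric] of_real_1)
  then show ?thesis by (simp add: mult_ac)
 qed
 then show ?thesis using integrable_L2_mult(2)[OF a b] by (simp only:)
qed

lemma H_cong_AE:
 assumes "\<And>n. AE y in lborel. H u g (n, y) = h (n, y)" "u \<in> bPM" "g \<in> bPM" "h \<in> bPM"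
 shows "J u g t n = cnj (LBINT y. h (n, y) * tker t y)"
proof -
 have [measurable]: "(\<lambda>y. H u g (n, y)) \<in> bor" "(\<lambda>y. h (n, y)) \<in> bor"
  by (intro measurable_row H_measurable assms)+
 show ?thesis
  unfolding J_def using assms(1)[of n]
  by (intro arg_cong[where f=cnj] integral_cong_AE) (auto elim: eventually_mono)
qed

lemma J_diff_left:
 assumes bil: "bil s1 s2 b' q A" "q < 1" and f: "f \<in> L2 (wm s1 b')" "f' \<in> L2 (wm s1 b')" and g: "g \<in> L2 (wm s2 b')"
 shows "J (\<lambda>z. f z - f' z) g t n = J f g t n - J f' g t n"
proof -
 note m = L2_wm_measurable[OF f(1)] L2_wm_measurable[OF f(2)] L2_wm_measurable[OF g]
 have fin: "vsq (\<lambda>y. jbr y powr (- (q / 2))) (H v g) < \<infinity>" if "v \<in> L2 (wm s1 b')" for v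
  using vsq_H[OF bil(1) that g] by (auto elim: le_less_trans)
 have ae: "AE y in lborel. H (\<lambda>z. f z - f' z) g (n, y) = H f g (n, y) - H f' g (n, y)" for n
  using H_integrable_AE[OF bil(1) f(1) g, of n] H_integrable_AE[OF bil(1) f(2) g, of n]
  by eventually_elim (simp add: H_def left_diff_distrib)
 have "J (\<lambda>z. f z - f' z) g t n = cnj (LBINT y. (H f g (n, y) - H f' g (n, y)) * tker t y)"
  using H_cong_AE[of "\<lambda>z. f z - f' z" g "\<lambda>w. H f g w - H f' g w" t n] ae m
  by (simp add: H_measurable borel_measurable_diff)
 also have "(LBINT y. (H f g (n, y) - H f' g (n, y)) * tker t y) =
   (LBINT y. H f g (n, y) * tker t y) - (LBINT y. H f' g (n, y) * tker t y)"
  unfolding left_diff_distrib using m f bil(2)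
  by (intro Bochner_Integration.integral_diff J_integrable[OF H_measurable(1) fin bil(2)])
 finally show ?thesis by (simp add: J_def)
qed

lemma J_diff_right:
 assumes bil: "bil s1 s2 b' q A" "q < 1" and f: "f \<in> L2 (wm s1 b')" and g: "g \<in> L2 (wm s2 b')" "g' \<in> L2 (wm s2 b')"
 shows "J f (\<lambda>z. g z - g' z) t n = J f g t n - J f g' t n"
proof -
 note m = L2_wm_measurable[OF g(1)] L2_wm_measurable[OF g(2)] L2_wm_measurable[OF f]
 have fin: "vsq (\<lambda>y. jbr y powr (- (q / 2))) (H f v) < \<infinity>" if "v \<in> L2 (wm s2 b')" for v
  using vsq_H[OF bil(1) f that] by (auto elim: le_less_trans)
 have ae: "AE y in lborel. H f (\<lambda>z. g z - g' z) (n, y) = H f g (n, y) - H f g' (n, y)" for n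
  using H_integrable_AE[OF bil(1) f g(1), of n] H_integrable_AE[OF bil(1) f g(2), of n]
  by eventually_elim (simp add: H_def right_diff_distrib)
 have "J f (\<lambda>z. g z - g' z) t n = cnj (LBINT y. (H f g (n, y) - H f g' (n, y)) * tker t y)"
  using H_cong_AE[of f "\<lambda>z. g z - g' z" "\<lambda>w. H f g w - H f g' w" t n] ae m
  by (simp add: H_measurable borel_measurable_diff)
 also have "(LBINT y. (H f g (n, y) - H f g' (n, y)) * tker t y) =
   (LBINT y. H f g (n, y) * tker t y) - (LBINT y. H f g' (n, y) * tker t y)"
  unfolding left_diff_distrib using m g bil(2)
  by (intro Bochner_Integration.integral_diff J_integrable[OF H_measurable(1) fin bil(2)])
 finally show ?thesis by (simp add: J_def)
qed

text \<open>Conjugating a curve conjugates and reflects its transform. This is needed because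
  \<open>J\<close> carries an outer conjugation.\<close>

lemma conj_reflect:
 assumes g: "g \<in> L2 (wm 0 b)"
 shows "(\<lambda>z. cnj (g (fst z, - snd z))) \<in> L2 (wm 0 b)" "l2 (wm 0 b) (\<lambda>z. cnj (g (fst z, - snd z))) = l2 (wm 0 b) g"
  "ic (\<lambda>z. cnj (g (fst z, - snd z))) t n = cnj (ic g t n)"
proof -
 have [measurable]: "(\<lambda>y. g (n, y)) \<in> bor" for n by (rule L2_row_measurable[OF g])
 have m: "(\<lambda>z. cnj (g (fst z, - snd z))) \<in> bPM"
  unfolding measurable_PM_iff using measurable_compose[of uminus borel borel "\<lambda>y. g (_, y)" borel] by simp
 have r: "nnl (\<lambda>y. wt 0 b n y * (norm (g (n, - y)))\<^sup>2) = nnl (\<lambda>y. wt 0 b n y * (norm (g (n, y)))\<^sup>2)" for n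
  using nn_integral_minus_shift[of "\<lambda>y. ennreal (wt 0 b n y * (norm (g (n, y)))\<^sup>2)" 0] by (simp add: wt_def)
 have s: "sqi (wm 0 b) (\<lambda>z. cnj (g (fst z, - snd z))) = sqi (wm 0 b) g"
  by (simp add: sqi_wm[OF m] sqi_wm[OF L2_wm_measurable[OF g]] r)
 show "(\<lambda>z. cnj (g (fst z, - snd z))) \<in> L2 (wm 0 b)" using g m s by (simp add: L2_def)
 show "l2 (wm 0 b) (\<lambda>z. cnj (g (fst z, - snd z))) = l2 (wm 0 b) g" by (simp add: l2_def s)
 have "ic (\<lambda>z. cnj (g (fst z, - snd z))) t n = (LBINT y. cis (t * y) * cnj (g (n, - y)))" by (simp add: ic_def)
 also have "\<dots> = (LBINT y. cnj (cis (t * y) * g (n, y)))"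
  by (subst lborel_integral_real_affine[where c="-1" and t=0]) (simp_all add: cis_cnj)
 also have "\<dots> = cnj (ic g t n)" unfolding ic_def by (rule Bochner_Integration.integral_cnj)
 finally show "ic (\<lambda>z. cnj (g (fst z, - snd z))) t n = cnj (ic g t n)" .
qed

text \<open>The kernel \<open>dk bump T\<close> asks of its input the weight
  \<open>jbr y powr (- (1 - b - \<theta>))\<close>, that is \<open>- q / 2\<close>, exactly what
  \<open>vsq_H\<close> provides. The cutoff appears conjugated because the conjugation of
  \<open>J\<close> is applied to the localised integral.\<close>

theorem bilinear_estimate:
 assumes b: "1/2 < b" "b < 1" and \<theta>: "0 \<le> \<theta>" "b + \<theta> \<le> 1" and bil: "bil s1 s2 b' (2 * (1 - b - \<theta>)) A"
 obtains C where "0 \<le> C" "\<And>T f c. 0 < T ==> T \<le> 1 ==> f \<in> L2 (wm s1 b') ==> c \<in> L2 (wm s2 b') ==>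
  \<exists>g\<in>L2 (wm 0 b). l2 (wm 0 b) g \<le> C * T powr \<theta> * l2 (wm s1 b') f * l2 (wm s2 b') c \<and>
   (\<forall>t n. ic g t n = cnj (bump (t / T)) * J f c t n)"
proof -
 have A: "0 \<le> A" using bil by (simp add: bil_def)
 obtain B where B: "0 \<le> B" "\<And>T. 0 < T ==> T \<le> 1 ==>
  kernel_bound b (dk bump T) (\<lambda>y. jbr y powr (- (1 - b - \<theta>))) (B * T powr \<theta>)"
  using duhamel_kernel[OF bump_schwartz b \<theta>] by blast
 have "\<exists>g\<in>L2 (wm 0 b). l2 (wm 0 b) g \<le> (B * sqrt A) * T powr \<theta> * l2 (wm s1 b') f * l2 (wm s2 b') c \<and>
   (\<forall>t n. ic g t n = cnj (bump (t / T)) * J f c t n)"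
  if T: "0 < T" "T \<le> 1" and f: "f \<in> L2 (wm s1 b')" and c: "c \<in> L2 (wm s2 b')" for T f c
 proof -
  note Hm = H_measurable(1)[OF L2_wm_measurable[OF f] L2_wm_measurable[OF c]]
  define V where "V = A * (l2 (wm s1 b') f)\<^sup>2 * (l2 (wm s2 b') c)\<^sup>2"
  have V: "0 \<le> V" using A by (simp add: V_def)
  have v: "vsq (\<lambda>y. jbr y powr (- (1 - b - \<theta>))) (H f c) \<le> ennreal V"
  proof -
   have e: "2 * (1 - b - \<theta>) / 2 = 1 - b - \<theta>" by simp
   show ?thesis using vsq_H[OF bil f c] unfolding e V_def .
  qed
  then have fin: "vsq (\<lambda>y. jbr y powr (- (1 - b - \<theta>))) (H f c) < \<infinity>" by (auto elim: le_less_trans)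
  define k where "k = kop (dk bump T) (H f c)"
  have k: "k \<in> L2 (wm 0 b)" "l2 (wm 0 b) k \<le> B * T powr \<theta> * sqrt (enn2real (vsq (\<lambda>y. jbr y powr (- (1 - b - \<theta>))) (H f c)))"
   using kop_L2[OF B(2)[OF T] Hm fin] by (simp_all add: k_def)
  have "enn2real (vsq (\<lambda>y. jbr y powr (- (1 - b - \<theta>))) (H f c)) \<le> V" using v V by (intro enn2real_leI)
  then have "B * T powr \<theta> * sqrt (enn2real (vsq (\<lambda>y. jbr y powr (- (1 - b - \<theta>))) (H f c))) \<le> B * T powr \<theta> * sqrt V"
   using B(1) by (intro mult_left_mono real_sqrt_le_mono) auto
  also have "sqrt V = sqrt A * l2 (wm s1 b') f * l2 (wm s2 b') c" by (simp add: V_def real_sqrt_mult)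
  finally have kn: "l2 (wm 0 b) k \<le> (B * sqrt A) * T powr \<theta> * l2 (wm s1 b') f * l2 (wm s2 b') c"
   using k(2) by (simp add: mult_ac)
  have ick: "ic k t n = bump (t / T) * (LBINT y. H f c (n, y) * tker t y)" for t n
  proof -
   have "ic k t n = (LBINT y. bump (t / T) * (H f c (n, y) * tker t y))"
    unfolding k_def ic_kop[OF B(2)[OF T] b(1) Hm fin] dk_inversion[OF bump_schwartz T(1)] tker_def
    by (simp only: mult.left_commute)
   then show ?thesis by (simp only: integral_mult_right_zero)
  qed
  show ?thesis
  proof (intro bexI[of _ "\<lambda>z. cnj (k (fst z, - snd z))"] conjI allI)
   fix t n
   show "ic (\<lambda>z. cnj (k (fst z, - snd z))) t n = cnj (bump (t / T)) * J f c t n"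
    by (simp add: conj_reflect(3)[OF k(1)] ick J_def)
  qed (use conj_reflect[OF k(1)] kn in auto)
 qed
 then show ?thesis using that[of "B * sqrt A"] A B(1) by auto
qed

subsection \<open>The bilinear operator in physical time\<close>

interpretation LP: pair_sigma_finite lborel PM
 unfolding pair_sigma_finite_def using P.sigma_finite_measure_axioms lborel.sigma_finite_measure_axioms by simp

lemma cis_mult_left: "cis x * (cis y * z) = cis (x + y) * z"
 by (simp add: cis_mult[symmetric] mult.assoc)

text \<open>The signed indicator of the oriented interval from \<open>0\<close> to \<open>t\<close>,
  so that both signs of \<open>t\<close> share one Fubini argument.\<close>

definition seg :: "real => real => real" where
 "seg t r = indicator {0<..<t} r - indicator {t<..<0} r"

lemma seg_measurable [measurable]: "seg t \<in> bor"
 unfolding seg_def by measurable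

lemma seg_eq_0: "\<bar>t\<bar> < \<bar>r\<bar> ==> seg t r = 0"
 by (auto simp: seg_def indicator_def)

lemma seg_integrable: "integrable lborel (\<lambda>r. complex_of_real (seg t r))"
 unfolding seg_def of_real_diff
 by (cases "0 \<le> t"; intro Bochner_Integration.integrable_diff integrable_of_real) (simp_all add: integrable_indicator_iff)

lemma interval_integral_seg:
 "(LBINT r=ereal 0..ereal t. (f r :: complex)) = (LBINT r. of_real (seg t r) * f r)"
proof (cases "0 \<le> t")
 case True
 then have "of_real (seg t r) * f r = indicator {0<..<t} r *\<^sub>R f r" for r
  by (auto simp: seg_def indicator_def)
 then show ?thesis using True
  by (simp add: interval_lebesgue_integral_def set_lebesgue_integral_def)
next
 case False
 then have "of_real (seg t r) * f r = - (indicator {t<..<0} r *\<^sub>R f r)" for r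
  by (auto simp: seg_def indicator_def)
 then show ?thesis using False
  by (simp add: interval_lebesgue_integral_def set_lebesgue_integral_def)
qed

lemma tker_eq:
 assumes "y \<noteq> 0"
 shows "tker t y = (LBINT r. of_real (seg t r) * cis (r * y))"
proof -
 have d: "((\<lambda>r. cis (r * y) / (\<i> * of_real y)) has_vector_derivative cis (r * y)) (at r within S)" for r S
  using has_vector_derivative_divide[OF cis_has_vector_derivative[of y r], of "\<i> * of_real y"] assms
  by (simp add: mult.commute[of y] has_vector_derivative_at_within)
 have "(LBINT r=ereal 0..ereal t. cis (r * y)) = cis (t * y) / (\<i> * of_real y) - cis (0 * y) / (\<i> * of_real y)"
  by (rule interval_integral_FTC_finite) (auto intro!: continuous_intros d)
 then show ?thesis by (simp add: interval_integral_seg tker_def diff_divide_distrib)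
qed

text \<open>Up to a phase, the coefficient at \<open>- n\<close> of the product of the two curves at
  physical time \<open>r\<close>.\<close>

definition phys :: "(int \<times> real => complex) => (int \<times> real => complex) => int => real => complex" where
 "phys f g n r = (\<integral>k. cis (- (om n k * r)) * (ic f r k * ic g r (- n - k)) \<partial>ZZ)"

text \<open>At regularity 0 absolute convergence is elementary: rows are integrable, and their
  integrals form square summable sequences in \<open>k\<close>.\<close>

lemma bil_integrable:
 assumes f: "f \<in> L2 (wm 0 b)" and g: "g \<in> L2 (wm 0 b)" and b: "1/2 < b"
 shows "integrable (lborel \<Otimes>\<^sub>M PM) (\<lambda>p. f (snd p) * g (sh (n, fst p) (snd p)))"
proof (rule integrableI_bounded)
 note m = L2_wm_measurable[OF f] L2_wm_measurable[OF g]
 have pm: "(\<lambda>p. ((n, fst p), snd p)) \<in> (lborel \<Otimes>\<^sub>M PM) \<rightarrow>\<^sub>M (PM \<Otimes>\<^sub>M PM)" by measurable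
 show fm: "(\<lambda>p. f (snd p) * g (sh (n, fst p) (snd p))) \<in> borel_measurable (lborel \<Otimes>\<^sub>M PM)"
  using measurable_compose[OF pm bil_integrand_measurable[OF m]] by simp
 have gr: "(\<lambda>y. norm (g (k, y))) \<in> bor" for k
  by (rule measurable_compose[OF L2_row_measurable[OF g] borel_measurable_norm])
 have fr: "(\<lambda>y. norm (f (k, y))) \<in> bor" for k
  by (rule measurable_compose[OF L2_row_measurable[OF f] borel_measurable_norm])
 have in1: "nnl (\<lambda>y. norm (f z * g (sh (n, y) z))) = ennreal (norm (f z)) * ennreal (rowL1 g (- n - fst z))" for z
 proof -
  have "nnl (\<lambda>y. norm (f z * g (sh (n, y) z))) =
    (\<integral>\<^sup>+y. ennreal (norm (f z)) * ennreal (norm (g (- n - fst z, y + (om n (fst z) - snd z)))) \<partial>lborel)"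
   by (simp add: sh_def norm_mult ennreal_mult algebra_simps)
  also have "\<dots> = ennreal (norm (f z)) * nnl (\<lambda>y. norm (g (- n - fst z, y + (om n (fst z) - snd z))))"
   by (rule nn_integral_cmult) (rule measurable_compose[OF measurable_compose[OF _ gr] measurable_ennreal], measurable)
  also have "nnl (\<lambda>y. norm (g (- n - fst z, y + (om n (fst z) - snd z)))) = ennreal (rowL1 g (- n - fst z))"
   unfolding ennreal_rowL1[OF g b] by (rule nn_integral_plus_shift) (rule measurable_compose[OF gr measurable_ennreal])
  finally show ?thesis .
 qed
 have "(\<integral>\<^sup>+p. ennreal (norm (f (snd p) * g (sh (n, fst p) (snd p)))) \<partial>(lborel \<Otimes>\<^sub>M PM)) =
   (\<integral>\<^sup>+z. \<integral>\<^sup>+y. ennreal (norm (f z * g (sh (n, y) z))) \<partial>lborel \<partial>PM)"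
  using LP.nn_integral_snd[OF measurable_compose[OF measurable_compose[OF fm borel_measurable_norm] measurable_ennreal]] by simp
 also have "\<dots> = (\<integral>\<^sup>+z. ennreal (norm (f z)) * ennreal (rowL1 g (- n - fst z)) \<partial>PM)" by (simp only: in1)
 also have "\<dots> = (\<integral>\<^sup>+k. ennreal (rowL1 f k) * ennreal (rowL1 g (- n - k)) \<partial>ZZ)"
 proof (subst nn_integral_PM)
  show "(\<lambda>z. ennreal (norm (f z)) * ennreal (rowL1 g (- n - fst z))) \<in> bPM"
   unfolding measurable_PM_iff fst_conv by (intro allI borel_measurable_times_ennreal measurable_compose[OF fr measurable_ennreal]) simp
 qed (simp add: nn_integral_multc measurable_compose[OF fr measurable_ennreal] ennreal_rowL1[OF f b])
 also have "\<dots> \<le> (\<integral>\<^sup>+k. ennreal ((rowL1 f k)\<^sup>2) + ennreal ((rowL1 g (- n - k))\<^sup>2) \<partial>ZZ)"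
 proof (intro nn_integral_mono)
  fix k
  have "rowL1 f k * rowL1 g (- n - k) \<le> (rowL1 f k)\<^sup>2 + (rowL1 g (- n - k))\<^sup>2"
   using sum_squares_bound[of "rowL1 f k" "rowL1 g (- n - k)"] mult_nonneg_nonneg[OF rowL1_nonneg[of f k] rowL1_nonneg[of g "- n - k"]] by linarith
  then show "ennreal (rowL1 f k) * ennreal (rowL1 g (- n - k)) \<le> ennreal ((rowL1 f k)\<^sup>2) + ennreal ((rowL1 g (- n - k))\<^sup>2)"
   by (simp add: ennreal_mult[symmetric] ennreal_plus[symmetric] del: ennreal_plus)
 qed
 also have "\<dots> = nns (\<lambda>k. (rowL1 f k)\<^sup>2) + nns (\<lambda>k. (rowL1 g (- n - k))\<^sup>2)"
  by (rule nn_integral_add) auto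
 also have "nns (\<lambda>k. (rowL1 g (- n - k))\<^sup>2) = nns (\<lambda>k. (rowL1 g k)\<^sup>2)"
  by (rule nn_integral_bij_count_space) (auto intro!: bij_betwI[where g="\<lambda>k. - n - k"])
 also have "nns (\<lambda>k. (rowL1 f k)\<^sup>2) + nns (\<lambda>k. (rowL1 g k)\<^sup>2) < \<infinity>"
  using rowL1_sum_le[OF f b] rowL1_sum_le[OF g b] by (simp add: ennreal_less_top le_less_trans)
 finally show "(\<integral>\<^sup>+p. ennreal (norm (f (snd p) * g (sh (n, fst p) (snd p)))) \<partial>(lborel \<Otimes>\<^sub>M PM)) < \<infinity>" .
qed

text \<open>The output modulation is the sum of the two input modulations minus \<open>om\<close>,
  so the inverse transform in \<open>y\<close> factors and a sum over \<open>k\<close>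
  remains.\<close>

lemma H_hat:
 assumes f: "f \<in> L2 (wm 0 b)" and g: "g \<in> L2 (wm 0 b)" and b: "1/2 < b"
 shows "integrable lborel (\<lambda>y. H f g (n, y))" "(LBINT y. cis (r * y) * H f g (n, y)) = phys f g n r"
proof -
 note I = bil_integrable[OF assms, of n]
 show "integrable lborel (\<lambda>y. H f g (n, y))"
  unfolding H_def using LP.integrable_fst'[OF I] by simp
 have cm: "(\<lambda>p. cis (r * fst p) * (f (snd p) * g (sh (n, fst p) (snd p)))) \<in> borel_measurable (lborel \<Otimes>\<^sub>M PM)"
  by (intro borel_measurable_times borel_measurable_integrable[OF I]) measurable
 have I2: "integrable (lborel \<Otimes>\<^sub>M PM) (\<lambda>p. cis (r * fst p) * (f (snd p) * g (sh (n, fst p) (snd p))))"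
  by (rule Bochner_Integration.integrable_bound[OF I cm]) (simp add: norm_mult)
 then have I3: "integrable (lborel \<Otimes>\<^sub>M PM) (\<lambda>(y, z). cis (r * y) * (f z * g (sh (n, y) z)))"
  by (simp add: split_beta')
 have row: "(LBINT y. cis (r * y) * (f (k, x) * g (sh (n, y) (k, x)))) =
   cis (- (om n k * r)) * ic g r (- n - k) * (cis (r * x) * f (k, x))" for k x
 proof -
  have "(LBINT y. cis (r * y) * (f (k, x) * g (sh (n, y) (k, x)))) =
    (LBINT y. cis (r * (y + (x - om n k))) * (f (k, x) * g (- n - k, y)))"
   by (subst lborel_integral_real_affine[where c=1 and t="x - om n k"]) (simp_all add: sh_def add.commute)
  also have "\<dots> = (LBINT y. cis (- (om n k * r)) * (cis (r * x) * f (k, x)) * (cis (r * y) * g (- n - k, y)))"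
  proof (rule Bochner_Integration.integral_cong[OF refl])
   fix y
   have "r * (y + (x - om n k)) = - (om n k * r) + r * x + r * y" by (simp add: algebra_simps)
   then show "cis (r * (y + (x - om n k))) * (f (k, x) * g (- n - k, y)) =
     cis (- (om n k * r)) * (cis (r * x) * f (k, x)) * (cis (r * y) * g (- n - k, y))"
    by (simp only: cis_mult[symmetric] mult_ac)
  qed
  also have "\<dots> = cis (- (om n k * r)) * (cis (r * x) * f (k, x)) * ic g r (- n - k)"
   by (simp only: integral_mult_right_zero ic_def)
  finally show ?thesis by (simp only: mult_ac)
 qed
 have row': "(LBINT y. cis (r * y) * (f z * g (sh (n, y) z))) =
   cis (- (om n (fst z) * r)) * ic g r (- n - fst z) * (cis (r * snd z) * f z)" for z
  by (cases z) (simp only: row fst_conv snd_conv)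
 have "(LBINT y. cis (r * y) * H f g (n, y)) = (LBINT y. (\<integral>z. cis (r * y) * (f z * g (sh (n, y) z)) \<partial>PM))"
  unfolding H_def by (simp only: integral_mult_right_zero)
 also have "\<dots> = (\<integral>z. (LBINT y. cis (r * y) * (f z * g (sh (n, y) z))) \<partial>PM)"
  by (rule LP.Fubini_integral[OF I3, symmetric])
 also have "\<dots> = (\<integral>z. cis (- (om n (fst z) * r)) * ic g r (- n - fst z) * (cis (r * snd z) * f z) \<partial>PM)"
  by (simp only: row')
 also have "\<dots> = (\<integral>k. (LBINT x. cis (- (om n k * r)) * ic g r (- n - k) * (cis (r * x) * f (k, x))) \<partial>ZZ)"
 proof -
  have "integrable PM (\<lambda>z. cis (- (om n (fst z) * r)) * ic g r (- n - fst z) * (cis (r * snd z) * f z))"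
   using LP.integrable_snd[OF I3] by (simp only: row')
  from P.integral_fst'[OF this] show ?thesis by (simp only: fst_conv snd_conv)
 qed
 also have "\<dots> = phys f g n r"
  unfolding phys_def integral_mult_right_zero ic_def[symmetric]
  by (rule Bochner_Integration.integral_cong[OF refl]) (simp only: mult_ac)
 finally show "(LBINT y. cis (r * y) * H f g (n, y)) = phys f g n r" .
qed

text \<open>Away from \<open>y = 0\<close>, a null set, \<open>tker\<close> is the transform of
  \<open>seg\<close>. Exchanging the integrals turns \<open>J\<close> into an integral over physical
  time between \<open>0\<close> and \<open>t\<close>, where locality is visible.\<close>

lemma J_phys:
 assumes f: "f \<in> L2 (wm 0 b)" and g: "g \<in> L2 (wm 0 b)" and b: "1/2 < b"
 shows "J f g t n = cnj (LBINT r. of_real (seg t r) * phys f g n r)"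
proof -
 note Hi = H_hat(1)[OF assms, of n]
 have I: "integrable (lborel \<Otimes>\<^sub>M lborel) (\<lambda>(r, y). H f g (n, y) * (complex_of_real (seg t r) * cis (r * y)))"
 proof (rule lborel_pair.integrable_mult_prod[OF seg_integrable[of t] Hi])
  have [measurable]: "(\<lambda>y. H f g (n, y)) \<in> bor" using borel_measurable_integrable[OF Hi] by simp
  show "(\<lambda>(r, y). H f g (n, y) * (complex_of_real (seg t r) * cis (r * y))) \<in> borel_measurable (lborel \<Otimes>\<^sub>M lborel)"
   by measurable
 qed (simp add: norm_mult mult.commute)
 have "(LBINT y. H f g (n, y) * tker t y) = (LBINT y. (LBINT r. H f g (n, y) * (of_real (seg t r) * cis (r * y))))"
 proof (rule integral_cong_AE)
  have [measurable]: "(\<lambda>y. H f g (n, y)) \<in> bor" using borel_measurable_integrable[OF Hi] by simp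
  show "(\<lambda>y. H f g (n, y) * tker t y) \<in> borel_measurable lborel" by measurable
  show "(\<lambda>y. (LBINT r. H f g (n, y) * (of_real (seg t r) * cis (r * y)))) \<in> borel_measurable lborel" by measurable
  show "AE y in lborel. H f g (n, y) * tker t y = (LBINT r. H f g (n, y) * (of_real (seg t r) * cis (r * y)))"
   using AE_lborel_singleton[of 0] by eventually_elim (simp only: integral_mult_right_zero tker_eq not_False_eq_True)
 qed
 also have "\<dots> = (LBINT r. (LBINT y. H f g (n, y) * (of_real (seg t r) * cis (r * y))))"
  by (rule lborel_pair.Fubini_integral[OF I])
 also have "\<dots> = (LBINT r. (LBINT y. of_real (seg t r) * (cis (r * y) * H f g (n, y))))"
  by (simp only: mult_ac)
 also have "\<dots> = (LBINT r. of_real (seg t r) * phys f g n r)"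
  by (simp only: integral_mult_right_zero H_hat(2)[OF assms])
 finally show ?thesis by (simp only: J_def)
qed

lemma J_local:
 assumes f: "f \<in> L2 (wm 0 b)" and g: "g \<in> L2 (wm 0 b)" and b: "1/2 < b"
  and z: "(\<forall>r k. \<bar>r\<bar> \<le> T \<longrightarrow> ic f r k = 0) \<or> (\<forall>r k. \<bar>r\<bar> \<le> T \<longrightarrow> ic g r k = 0)" and t: "\<bar>t\<bar> \<le> T"
 shows "J f g t n = 0"
proof -
 have "of_real (seg t r) * phys f g n r = 0" for r
 proof (cases "\<bar>r\<bar> \<le> T")
  case True
  have "ic f r k * ic g r (- n - k) = 0" for k using z True by auto
  then show ?thesis unfolding phys_def by (simp only: mult_zero_right integral_zero)
 qed (use seg_eq_0[of t r] t in simp)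
 then show ?thesis by (simp only: J_phys[OF f g b] integral_zero complex_cnj_zero)
qed

text \<open>The link between \<open>J\<close> and the Duhamel term of the problem, for factors with
  honest values. The conjugations on both factors are collected in the one outside
  \<open>J\<close>.\<close>

lemma duhamel_J:
 assumes f: "f \<in> L2 (wm 0 b)" and g: "g \<in> L2 (wm 0 b)" and b: "1/2 < b" and t: "\<bar>t\<bar> \<le> T"
  and a: "\<And>r. \<bar>r\<bar> \<le> T ==> integrable ZZ (cv f r)"
  and A: "\<And>r x. \<bar>r\<bar> \<le> T ==> x \<in> {-pi..pi} ==> A r x = (\<integral>k. cv f r k * cis (of_int k * x) \<partial>ZZ)"
  and B: "\<And>r. \<bar>r\<bar> \<le> T ==> continuous_on UNIV (B r)" "\<And>r k. \<bar>r\<bar> \<le> T ==> fcoeff (B r) k = cv g r k"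
 shows "duhamel (\<lambda>r x. cnj (A r x) * cnj (B r x)) t n = cis (- ((of_int n)\<^sup>2 * t)) * J f g t n"
proof -
 have "of_real (seg t r) * schroedinger (t - r) (fcoeff (\<lambda>x. cnj (A r x) * cnj (B r x))) n =
   cis (- ((of_int n)\<^sup>2 * t)) * cnj (of_real (seg t r) * phys f g n r)" for r
 proof (cases "\<bar>r\<bar> \<le> T")
  case True
  have "fcoeff (\<lambda>x. cnj (A r x) * cnj (B r x)) n = cnj (\<integral>k. cv f r k * cv g r (- n - k) \<partial>ZZ)"
   using fcoeff_cnj_mult[OF a[OF True] B(1)[OF True] A[OF True]] B(2)[OF True] by simp
  also have "(\<integral>k. cv f r k * cv g r (- n - k) \<partial>ZZ) =
    (\<integral>k. cis ((of_int n)\<^sup>2 * r) * (cis (- (om n k * r)) * (ic f r k * ic g r (- n - k))) \<partial>ZZ)"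
  proof (rule Bochner_Integration.integral_cong[OF refl])
   fix k
   \<comment> \<open>The resonance identity in physical time: the free phases of the two factors
     combine to the conjugate of the output phase and the phase of \<open>om\<close>.\<close>
   have "- ((of_int k)\<^sup>2 * r) + - ((of_int (- n - k))\<^sup>2 * r) = (of_int n)\<^sup>2 * r + - (om n k * r)"
    by (simp add: om_def power2_eq_square algebra_simps)
   then have "cis (- ((of_int k)\<^sup>2 * r)) * cis (- ((of_int (- n - k))\<^sup>2 * r)) = cis ((of_int n)\<^sup>2 * r) * cis (- (om n k * r))"
    by (simp only: cis_mult)
   then have "cis (- ((of_int k)\<^sup>2 * r)) * cis (- ((of_int (- n - k))\<^sup>2 * r)) * (ic f r k * ic g r (- n - k)) =
     cis ((of_int n)\<^sup>2 * r) * cis (- (om n k * r)) * (ic f r k * ic g r (- n - k))" by (rule arg_cong)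
   then show "cv f r k * cv g r (- n - k) = cis ((of_int n)\<^sup>2 * r) * (cis (- (om n k * r)) * (ic f r k * ic g r (- n - k)))"
    unfolding cv_def by (simp only: mult_ac)
  qed
  also have "\<dots> = cis ((of_int n)\<^sup>2 * r) * phys f g n r" by (simp only: integral_mult_right_zero phys_def)
  finally have "fcoeff (\<lambda>x. cnj (A r x) * cnj (B r x)) n = cis (- ((of_int n)\<^sup>2 * r)) * cnj (phys f g n r)"
   by (simp add: cis_cnj)
  moreover have "exp (- (\<i> * (of_int n)\<^sup>2 * of_real (t - r))) * cis (- ((of_int n)\<^sup>2 * r)) = cis (- ((of_int n)\<^sup>2 * t))"
   by (simp add: cis_conv_exp exp_add[symmetric] algebra_simps)
  ultimately show ?thesis by (simp add: schroedinger_def mult_ac)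
 qed (use seg_eq_0[of t r] t in simp)
 then show ?thesis
  unfolding duhamel_def interval_integral_seg
  by (simp only: integral_mult_right_zero Bochner_Integration.integral_cnj J_phys[OF f g b])
qed

section \<open>Translation in time and truncation in frequency\<close>

text \<open>Translation in time acts on the interaction picture as a unitary multiplier.\<close>

definition tr :: "real => (int \<times> real => complex) => int \<times> real => complex" where
 "tr a f z = cis (a * (snd z - (of_int (fst z))\<^sup>2)) * f z"

lemma tr_measurable: "f \<in> bPM ==> tr a f \<in> bPM"
proof -
 assume f: "f \<in> bPM"
 have "(\<lambda>z. cis (a * (snd z - (of_int (fst z))\<^sup>2))) \<in> bPM"
  unfolding measurable_PM_iff by simp
 then show ?thesis unfolding tr_def[abs_def] using f by (rule borel_measurable_times)
qed

lemma tr_L2: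
 assumes "f \<in> L2 (wm s b)"
 shows "tr a f \<in> L2 (wm s b)" "l2 (wm s b) (tr a f) = l2 (wm s b) f"
proof -
 have "sqi (wm s b) (tr a f) = sqi (wm s b) f" by (simp add: sqi_def tr_def norm_mult)
 then show "tr a f \<in> L2 (wm s b)" "l2 (wm s b) (tr a f) = l2 (wm s b) f"
  using assms tr_measurable[OF L2_wm_measurable[OF assms]] by (simp_all add: L2_def l2_def)
qed

lemma ic_tr: "ic (tr a f) t n = cis (- (a * (of_int n)\<^sup>2)) * ic f (a + t) n"
proof -
 have "cis (t * y) * (cis (a * (y - (of_int n)\<^sup>2)) * f (n, y)) = cis (- (a * (of_int n)\<^sup>2)) * (cis ((a + t) * y) * f (n, y))" for y
  unfolding cis_mult_left by (rule arg_cong[where f="\<lambda>x. cis x * _"]) (simp add: algebra_simps)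
 then show ?thesis unfolding ic_def tr_def by (simp only: fst_conv snd_conv integral_mult_right_zero)
qed

text \<open>The part of the Duhamel integral between \<open>a\<close> and \<open>a + t\<close> is
  the Duhamel integral from \<open>0\<close> to \<open>t\<close> of the translated factors, brought
  back to time \<open>0\<close>.\<close>

lemma J_tr:
 assumes bil: "bil s1 s2 b' q A" "q < 1" and f: "f \<in> L2 (wm s1 b')" and g: "g \<in> L2 (wm s2 b')"
 shows "J f g (a + t) n - J f g a n = cis (a * (of_int n)\<^sup>2) * J (tr a f) (tr a g) t n"
proof -
 note Hm = H_measurable(1)[OF L2_wm_measurable[OF f] L2_wm_measurable[OF g]]
 have fin: "vsq (\<lambda>y. jbr y powr (- (q / 2))) (H f g) < \<infinity>"
  using vsq_H[OF bil(1) f g] by (auto elim: le_less_trans)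
 note int = J_integrable[OF Hm fin bil(2)]
 \<comment> \<open>The phases of the two factors depend together on the output alone, so the
   multiplier leaves the integral.\<close>
 have ph: "cis (a * (snd z - (of_int (fst z))\<^sup>2)) * cis (a * (snd (sh (n, y) z) - (of_int (fst (sh (n, y) z)))\<^sup>2)) = cis (a * (y + (of_int n)\<^sup>2))" for y z
  unfolding cis_mult by (rule arg_cong[where f=cis]) (simp add: sh_def om_def power2_eq_square algebra_simps)
 have "tr a f z * tr a g (sh (n, y) z) = cis (a * (y + (of_int n)\<^sup>2)) * (f z * g (sh (n, y) z))" for y z
  unfolding tr_def ph[of z y, symmetric] by (simp only: mult_ac)
 then have Ht: "H (tr a f) (tr a g) (n, y) = cis (a * (y + (of_int n)\<^sup>2)) * H f g (n, y)" for y
  unfolding H_def by (simp only: integral_mult_right_zero)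
 have "tker (a + t) y - tker a y = cis (- (a * (of_int n)\<^sup>2)) * (cis (a * (y + (of_int n)\<^sup>2)) * tker t y)" for y
  unfolding mult.assoc[symmetric] cis_mult tker_def
  by (simp add: diff_divide_distrib[symmetric] cis_mult algebra_simps)
 then have k: "H f g (n, y) * tker (a + t) y - H f g (n, y) * tker a y = cis (- (a * (of_int n)\<^sup>2)) * (H (tr a f) (tr a g) (n, y) * tker t y)" for y
  unfolding Ht right_diff_distrib[symmetric] by (simp only: mult_ac)
 have "J f g (a + t) n - J f g a n = cnj (LBINT y. H f g (n, y) * tker (a + t) y - H f g (n, y) * tker a y)"
  by (simp add: J_def Bochner_Integration.integral_diff[OF int int])
 also have "\<dots> = cis (a * (of_int n)\<^sup>2) * J (tr a f) (tr a g) t n"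
  by (simp only: k integral_mult_right_zero J_def complex_cnj_mult cis_cnj minus_minus)
 finally show ?thesis .
qed

text \<open>On finitely many rows the weights of \<open>wm s b\<close> and \<open>wm 0 b\<close> are
  comparable, so truncation approximates a rough \<open>f\<close> by elements to which the physical
  time formulas apply.\<close>

definition trunc :: "nat => (int \<times> real => complex) => int \<times> real => complex" where
 "trunc N f z = (if \<bar>fst z\<bar> \<le> int N then f z else 0)"

lemma trunc_L2:
 assumes f: "f \<in> L2 (wm s b)" and s: "s \<le> 0"
 shows "trunc N f \<in> L2 (wm 0 b)" "trunc N f \<in> L2 (wm s b)"
proof -
 have m: "trunc N f \<in> bPM"
  using L2_row_measurable[OF f] unfolding measurable_PM_iff trunc_def by simp
 show "trunc N f \<in> L2 (wm s b)"
  by (rule L2_mono_AE(1)[OF _ _ f]) (auto simp: trunc_def m)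
 define D where "D = jbr (real N) powr (- (2 * s))"
 have D: "wt 0 b k y * (norm (trunc N f (k, y)))\<^sup>2 \<le> D * (wt s b k y * (norm (f (k, y)))\<^sup>2)" for k y
 proof (cases "\<bar>k\<bar> \<le> int N")
  case True
  have "jbr (of_int k) powr (- (2 * s)) \<le> D"
   unfolding D_def using True s by (intro powr_mono2 jbr_mono) auto
  then have "jbr (of_int k) powr (- (2 * s)) * jbr (of_int k) powr (2 * s) \<le> D * jbr (of_int k) powr (2 * s)"
   by (rule mult_right_mono) simp
  then have "1 \<le> D * jbr (of_int k) powr (2 * s)" by (simp add: powr_add[symmetric])
  then have "1 * (jbr y powr (2 * b) * (norm (f (k, y)))\<^sup>2) \<le> D * jbr (of_int k) powr (2 * s) * (jbr y powr (2 * b) * (norm (f (k, y)))\<^sup>2)"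
   by (rule mult_right_mono) simp
  then show ?thesis using True by (simp add: wt_def trunc_def mult_ac)
 qed (simp add: trunc_def D_def)
 have "sqi (wm 0 b) (trunc N f) \<le> (\<integral>\<^sup>+k. \<integral>\<^sup>+y. ennreal D * ennreal (wt s b k y * (norm (f (k, y)))\<^sup>2) \<partial>lborel \<partial>ZZ)"
  unfolding sqi_wm[OF m] using D by (intro nn_integral_mono) (simp add: ennreal_mult[symmetric] D_def ennreal_leI)
 also have "\<dots> = ennreal D * sqi (wm s b) f"
  unfolding sqi_wm[OF L2_wm_measurable[OF f]] using L2_row_measurable[OF f] by (simp add: nn_integral_cmult)
 also have "\<dots> < \<infinity>" using f by (simp add: L2_def ennreal_mult_less_top)
 finally show "trunc N f \<in> L2 (wm 0 b)" using m by (simp add: L2_def)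
qed

lemma trunc_tendsto:
 assumes f: "f \<in> L2 (wm s b)" and s: "s \<le> 0"
 shows "null (\<lambda>N. l2 (wm s b) (\<lambda>z. trunc N f z - f z))"
proof (rule L2_dominated_convergence(2)[OF _ _ f])
 show "trunc N f \<in> borel_measurable (wm s b)" for N using trunc_L2(2)[OF assms] by (simp add: L2_def)
 show "AE z in wm s b. (\<lambda>N. trunc N f z) \<longlonglongrightarrow> f z"
 proof (rule AE_I2)
  fix z
  have "eventually (\<lambda>N. trunc N f z = f z) sequentially"
   using eventually_ge_at_top[of "nat \<bar>fst z\<bar>"] by eventually_elim (simp add: trunc_def nat_le_iff)
  then show "(\<lambda>N. trunc N f z) \<longlonglongrightarrow> f z" by (rule tendsto_eventually)
 qed
qed (use f in \<open>auto simp: trunc_def L2_def\<close>)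

lemma L2_wm_mono:
 assumes f: "f \<in> L2 (wm s' b')" and s: "s \<le> s'" "b \<le> b'"
 shows "f \<in> L2 (wm s b)" "l2 (wm s b) f \<le> l2 (wm s' b') f"
proof -
 have "wt s b k y \<le> wt s' b' k y" for k y
  unfolding wt_def by (rule mult_mono[OF jbr_powr_mono jbr_powr_mono]) (use s in auto)
 then have "sqi (wm s b) f \<le> sqi (wm s' b') f"
  unfolding sqi_wm[OF L2_wm_measurable[OF f]] by (intro nn_integral_mono ennreal_leI mult_right_mono) auto
 also have "\<dots> = ennreal ((l2 (wm s' b') f)\<^sup>2)" by (rule sqi_l2[OF f])
 finally have *: "sqi (wm s b) f \<le> ennreal ((l2 (wm s' b') f)\<^sup>2)" .
 show "f \<in> L2 (wm s b)" "l2 (wm s b) f \<le> l2 (wm s' b') f"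
  using l2_leI[OF _ *] L2_wm_measurable[OF f] by simp_all
qed

subsection \<open>Free evolutions\<close>

text \<open>In the interaction picture a free evolution is constant in time; it is cut off by
  \<open>bump\<close> to become square integrable. Since \<open>bump\<close> is 1 only on
  \<open>[-1, 1]\<close>, the argument works with \<open>T \<le> 1\<close>.\<close>

definition fr :: "(int => complex) => int \<times> real => complex" where
 "fr f z = f (fst z) * phat bump 1 (snd z)"

definition cf :: real where "cf = l2 (rw 1) (phat bump 1)"

text \<open>The constant is positive because a vanishing transform would contradict
  \<open>bump 0 = 1\<close>. Positivity allows passing from the norm of \<open>fr f\<close> back to
  that of \<open>f\<close>.\<close>

lemma phat_bump: "phat bump 1 \<in> L2 (rw 1)" "0 < cf"
proof -
 obtain C where C: "\<And>y. norm (ft bump y) \<le> C * jbr y powr (-2)" "0 \<le> C"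
  using ft_schwartz_decay[OF bump_schwartz] by blast
 have le: "norm (phat bump 1 y) \<le> norm (complex_of_real (C * jbr y powr (-2)))" for y
 proof -
  have "norm (phat bump 1 y) = 1 / (2 * pi) * norm (ft bump y)" by (simp add: phat_def norm_mult norm_divide)
  also have "\<dots> \<le> 1 * norm (ft bump y)" using pi_gt3 by (intro mult_right_mono) (auto simp: field_simps)
  finally show ?thesis using C(1)[of y] C(2) by (simp add: norm_mult)
 qed
 show L: "phat bump 1 \<in> L2 (rw 1)"
  using L2_mono_AE(1)[OF AE_I2[OF le] _ L2_rw_jbr] phat_kernel_measurable[OF bump_schwartz] by simp
 have "cf \<noteq> 0"
 proof
  assume "cf = 0"
  then have "AE y in lborel. phat bump 1 y = 0" using l2_eq_0_AE[OF L] by (simp add: cf_def AE_rw)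
  then have "(LBINT y. phat bump 1 y) = (LBINT y::real. 0)"
   using phat_kernel_measurable[OF bump_schwartz] by (intro integral_cong_AE) auto
  moreover have "(LBINT y. phat bump 1 y) = 1"
   using phat_inversion[OF bump_schwartz, of 1 0] by (simp add: bump_eq_1)
  ultimately show False by simp
 qed
 then show "0 < cf" by (metis cf_def l2_nonneg less_eq_real_def)
qed

lemma fr_measurable: "fr f \<in> bPM"
 unfolding measurable_PM_iff fr_def using phat_kernel_measurable[OF bump_schwartz] by simp

lemma ic_fr: "ic (fr f) t n = f n * bump t"
proof -
 have "cis (t * y) * fr f (n, y) = f n * (cis (t * y) * phat bump 1 y)" for y by (simp add: fr_def)
 then show ?thesis using phat_inversion[OF bump_schwartz, of 1 t] unfolding ic_def by (simp only: integral_mult_right_zero) simp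
qed

lemma fr_diff: "fr (\<lambda>n. f n - g n) = (\<lambda>z. fr f z - fr g z)"
 by (simp add: fr_def fun_eq_iff left_diff_distrib)

lemma Hs_iff: "f \<in> Hs s \<longleftrightarrow> fr f \<in> L2 (wm s 1)" and l2_fr: "f \<in> Hs s ==> l2 (wm s 1) (fr f) = cf * Hs_norm s f"
proof -
 define a where "a n = jbr (of_int n) powr (2 * s) * (norm (f n))\<^sup>2" for n
 define S where "S = nns (\<lambda>n. a n)"
 have a: "0 \<le> a n" for n by (simp add: a_def)
 have sq: "sqi (wm s 1) (fr f) = S * ennreal (cf\<^sup>2)"
 proof -
  have "nnl (\<lambda>y. wt s 1 n y * (norm (fr f (n, y)))\<^sup>2) = ennreal (a n) * sqi (rw 1) (phat bump 1)" for n
   using phat_kernel_measurable[OF bump_schwartz] unfolding sqi_rw[OF phat_kernel_measurable[OF bump_schwartz]]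
   by (subst nn_integral_cmult[symmetric]) (auto simp: wt_def fr_def a_def norm_mult power_mult_distrib ennreal_mult[symmetric] mult_ac)
  then show ?thesis by (simp add: sqi_wm[OF fr_measurable] S_def nn_integral_multc sqi_l2[OF phat_bump(1)] cf_def)
 qed
 have i: "f \<in> Hs s \<longleftrightarrow> integrable ZZ a"
  unfolding integrable_count_space_iff by (simp add: Hs_def a_def)
 also have "\<dots> \<longleftrightarrow> S < \<infinity>" unfolding integrable_iff_bounded S_def using a by simp
 also have "\<dots> \<longleftrightarrow> fr f \<in> L2 (wm s 1)"
  using phat_bump(2) fr_measurable by (auto simp: L2_def sq ennreal_mult_less_top)
 finally show "f \<in> Hs s \<longleftrightarrow> fr f \<in> L2 (wm s 1)" .
 assume "f \<in> Hs s"
 then have ai: "integrable ZZ a" by (simp add: i)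
 then have "S = ennreal (\<Sum>\<^sub>\<infinity>n. a n)"
  unfolding S_def infsum_eq_integral[OF ai] by (intro nn_integral_eq_integral) (use a in auto)
 moreover have "0 \<le> (\<Sum>\<^sub>\<infinity>n. a n)" by (rule infsum_nonneg) (rule a)
 ultimately show "l2 (wm s 1) (fr f) = cf * Hs_norm s f"
  using phat_bump(2) by (simp add: l2_def sq Hs_norm_def a_def[symmetric] enn2real_mult real_sqrt_mult)
qed

lemma Hs_diff: "f \<in> Hs s ==> g \<in> Hs s ==> (\<lambda>n. f n - g n) \<in> Hs s"
 unfolding Hs_iff fr_diff by (rule L2_diff(1))

section \<open>Smooth data and their free evolutions\<close>

lemma trig_sum_smooth_torus:
 assumes "finite I"
 shows "(\<lambda>x. \<Sum>n\<in>I. c n * cis (of_int n * x)) \<in> smooth_torus"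
proof -
 define D where "D j x = (\<Sum>n\<in>I. c n * ((\<i> * of_int n) ^ j * cis (of_int n * x)))" for j :: nat and x
 have "(D j has_vector_derivative D (Suc j) x) (at x)" for j x
  unfolding D_def
 proof (intro has_vector_derivative_sum has_vector_derivative_mult_right)
  fix n
  show "((\<lambda>y. (\<i> * of_int n) ^ j * cis (of_int n * y)) has_vector_derivative (\<i> * of_int n) ^ Suc j * cis (of_int n * x)) (at x)"
   using has_vector_derivative_mult_right[OF cis_has_vector_derivative[of "of_int n" x], of "(\<i> * of_int n) ^ j"]
   by (simp add: mult_ac)
 qed
 then show ?thesis unfolding smooth_torus_def
  by (auto simp: cis_int_plus_2pi D_def intro!: exI[of _ D])
qed

lemma Hs_density:
 assumes s: "s \<le> 0" and f: "f \<in> Hs s"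
 obtains p where "\<And>k. p k \<in> smooth_torus" "\<And>k. fcoeff (p k) \<in> Hs s"
  "null (\<lambda>k. Hs_norm s (\<lambda>n. fcoeff (p k) n - f n))"
proof
 define p where "p k x = (\<Sum>n\<in>{- int k..int k}. f n * cis (of_int n * x))" for k x
 have F: "fr f \<in> L2 (wm s 1)" using f by (simp add: Hs_iff)
 show "p k \<in> smooth_torus" for k unfolding p_def by (rule trig_sum_smooth_torus) simp
 have c: "fr (fcoeff (p k)) = trunc k (fr f)" for k
  unfolding p_def by (rule ext) (auto simp: fcoeff_trig_sum fr_def trunc_def)
 show pk: "fcoeff (p k) \<in> Hs s" for k unfolding Hs_iff c by (rule trunc_L2(2)[OF F s])
 have "(\<lambda>k. l2 (wm s 1) (fr (\<lambda>n. fcoeff (p k) n - f n)) / cf) \<longlonglongrightarrow> 0 / cf"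
  unfolding fr_diff c using trunc_tendsto[OF F s] phat_bump(2) by (intro tendsto_divide tendsto_const) auto
 then show "null (\<lambda>k. Hs_norm s (\<lambda>n. fcoeff (p k) n - f n))"
  using phat_bump(2) by (simp add: l2_fr[OF Hs_diff[OF pk f]])
qed

lemma smooth_torus_Hs:
 assumes "f \<in> smooth_torus" "s \<le> 0"
 shows "fcoeff f \<in> Hs s" "fr (fcoeff f) \<in> L2 (wm 0 1)"
proof -
 have sp: "smooth_periodic f" using assms by (simp add: smooth_torus_eq)
 obtain C where C: "0 \<le> C" "\<And>n. norm (fcoeff f n) \<le> C * jbr (of_int n) powr (-2)" using fcoeff_decay[OF sp] by blast
 have "norm (complex_of_real ((norm (fcoeff f n))\<^sup>2)) \<le> C\<^sup>2 * jbr (of_int n) powr (-2)" for n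
 proof -
  have "(norm (fcoeff f n))\<^sup>2 \<le> (C * jbr (of_int n) powr (-2))\<^sup>2" by (intro power_mono C) simp
  also have "\<dots> = C\<^sup>2 * jbr (of_int n) powr (-4)" by (simp add: power_mult_distrib power2_eq_square[of "_ powr _"] powr_add[symmetric])
  also have "\<dots> \<le> C\<^sup>2 * jbr (of_int n) powr (-2)" by (intro mult_left_mono jbr_powr_mono) auto
  finally show ?thesis by (simp add: norm_power)
 qed
 then have "integrable ZZ (\<lambda>n. complex_of_real ((norm (fcoeff f n))\<^sup>2))" by (rule integrable_count_space_decay)
 then have "fcoeff f \<in> Hs 0" unfolding integrable_count_space_iff by (simp add: Hs_def norm_power)
 then show *: "fr (fcoeff f) \<in> L2 (wm 0 1)" by (simp add: Hs_iff)
 show "fcoeff f \<in> Hs s" unfolding Hs_iff using assms(2) by (intro L2_wm_mono(1)[OF *]) auto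
qed

lemma free_smooth_series:
 assumes f: "f \<in> smooth_torus" and r: "\<bar>r\<bar> \<le> 1"
 shows "integrable ZZ (cv (fr (fcoeff f)) r)"
  and "free_smooth f r x = (\<integral>k. cv (fr (fcoeff f)) r k * cis (of_int k * x) \<partial>ZZ)"
proof -
 have a: "integrable ZZ (fcoeff f)" using f by (simp add: smooth_torus_eq fcoeff_integrable_count_space)
 have c: "cv (fr (fcoeff f)) r = (\<lambda>k. fcoeff f k * cis (- ((of_int k)\<^sup>2 * r)))"
  using r by (simp add: cv_def ic_fr bump_eq_1 fun_eq_iff)
 show i: "integrable ZZ (cv (fr (fcoeff f)) r)" unfolding c by (rule integrable_trig_series[OF a])
 have "schroedinger r (fcoeff f) k * exp (\<i> * of_int k * of_real x) = cv (fr (fcoeff f)) r k * cis (of_int k * x)" for k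
  by (simp add: c schroedinger_def cis_conv_exp mult_ac)
 then show "free_smooth f r x = (\<integral>k. cv (fr (fcoeff f)) r k * cis (of_int k * x) \<partial>ZZ)"
  unfolding free_smooth_def using infsum_eq_integral[OF integrable_trig_series[OF i, of "\<lambda>k. of_int k * x"]] by simp
qed

lemma free_smooth_fcoeff:
 assumes f: "f \<in> smooth_torus" and r: "\<bar>r\<bar> \<le> 1"
 shows "continuous_on UNIV (free_smooth f r)" "fcoeff (free_smooth f r) k = cv (fr (fcoeff f)) r k"
 unfolding free_smooth_series(2)[OF assms, abs_def]
 by (rule trig_series_continuous fcoeff_trig_series, rule free_smooth_series(1)[OF assms])+

lemma duhamel_cmult: "duhamel (\<lambda>t x. c * G t x) t n = c * duhamel G t n"
 unfolding duhamel_def interval_integral_seg schroedinger_def fcoeff_cmult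
 by (simp only: mult.left_commute[of _ c] integral_mult_right_zero)

lemma gam_series:
 assumes v: "v \<in> smooth_schwartz"
 shows "integrable ZZ (cv (gam v) r)" "fcoeff (v r) = cv (gam v) r"
  and "x \<in> {-pi..pi} ==> v r x = (\<integral>k. cv (gam v) r k * cis (of_int k * x) \<partial>ZZ)"
proof -
 obtain D where "ss_jet v D" using v by (auto simp: smooth_schwartz_iff)
 then have sp: "smooth_periodic (v r)" by (rule ss_jet_periodic)
 show c: "fcoeff (v r) = cv (gam v) r" by (simp add: cv_gam[OF v] fun_eq_iff)
 show "integrable ZZ (cv (gam v) r)" using fcoeff_integrable_count_space[OF sp] by (simp add: c)
 show "x \<in> {-pi..pi} ==> v r x = (\<integral>k. cv (gam v) r k * cis (of_int k * x) \<partial>ZZ)"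
  using fourier_series[OF sp] by (simp add: c)
qed

subsection \<open>Estimates on a time interval\<close>

text \<open>\<open>lb b T K B\<close>: the curve \<open>K\<close>, cut off to \<open>[-T, T]\<close>, has a representative of norm at most \<open>B\<close>.\<close>

definition lb :: "real => real => (real => int => complex) => real => bool" where
 "lb b T K B \<longleftrightarrow> (\<exists>h\<in>L2 (wm 0 b). l2 (wm 0 b) h \<le> B \<and> (\<forall>t n. ic h t n = cnj (bump (t / T)) * K t n))"

lemma lb_add:
 assumes "lb b T K B" "lb b T K' B'" "1/2 < b"
 shows "lb b T (\<lambda>t n. K t n + K' t n) (B + B')"
proof -
 obtain h h' where "h \<in> L2 (wm 0 b)" "l2 (wm 0 b) h \<le> B" "\<And>t n. ic h t n = cnj (bump (t / T)) * K t n"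
  "h' \<in> L2 (wm 0 b)" "l2 (wm 0 b) h' \<le> B'" "\<And>t n. ic h' t n = cnj (bump (t / T)) * K' t n"
  using assms(1,2) unfolding lb_def by auto
 then show ?thesis unfolding lb_def
  using L2_add[of h "wm 0 b" h'] ic_add[of h 0 b h' 0] assms(3)
  by (intro bexI[of _ "\<lambda>z. h z + h' z"]) (auto simp: distrib_left)
qed

lemma lb_cmult:
 assumes "lb b T K B"
 shows "lb b T (\<lambda>t n. c * K t n) (norm c * B)"
proof -
 obtain h where "h \<in> L2 (wm 0 b)" "l2 (wm 0 b) h \<le> B" "\<And>t n. ic h t n = cnj (bump (t / T)) * K t n"
  using assms unfolding lb_def by auto
 then show ?thesis unfolding lb_def
  using L2_cmult[of h "wm 0 b" c]
  by (intro bexI[of _ "\<lambda>z. c * h z"]) (auto simp: ic_cmult mult_left_mono)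
qed

lemma bump_1: "0 < T ==> \<bar>t\<bar> \<le> T ==> bump (t / T) = 1"
 by (rule bump_eq_1) simp

lemma lb_point:
 assumes "lb b T K B" "1/2 < b" "0 < T" "\<bar>t\<bar> \<le> T"
 shows "norm (K t n) \<le> sqrt (kb b) * B"
proof -
 obtain h where h: "h \<in> L2 (wm 0 b)" "l2 (wm 0 b) h \<le> B" "ic h t n = cnj (bump (t / T)) * K t n"
  using assms unfolding lb_def by auto
 have "norm (K t n) = norm (ic h t n)" by (simp add: h(3) bump_1[OF assms(3,4)])
 also have "\<dots> \<le> sqrt (kb b) * l2 (wm 0 b) h"
  using norm_ic_le[of h t n] rowL1_le[OF h(1) assms(2), of n] by simp
 also have "\<dots> \<le> sqrt (kb b) * B" by (intro mult_left_mono h) simp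
 finally show ?thesis .
qed

text \<open>Everything the fixed point argument takes from the analysis. A product of two remainders
  is covered by \<open>estR\<close> through the embedding of \<open>wm 0 b\<close> into
  \<open>wm s b\<close> for \<open>s \<le> 0\<close>.\<close>

locale flow =
 fixes s b \<theta> C :: real
 assumes s: "s \<le> 0" and b: "1/2 < b" "b < 1" and \<theta>: "0 < \<theta>" and C: "0 \<le> C"
  and bilF: "\<exists>A. bil s s 1 (2 * (1 - b - \<theta>)) A" and bilR: "\<exists>A. bil s 0 b (2 * (1 - b - \<theta>)) A"
  and estF: "\<And>T f g. 0 < T ==> T \<le> 1 ==> f \<in> L2 (wm s 1) ==> g \<in> L2 (wm s 1) ==>
   lb b T (J f g) (C * T powr \<theta> * l2 (wm s 1) f * l2 (wm s 1) g)"
  and estR: "\<And>T f g. 0 < T ==> T \<le> 1 ==> f \<in> L2 (wm s b) ==> g \<in> L2 (wm 0 b) ==>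
   lb b T (J f g) (C * T powr \<theta> * l2 (wm s b) f * l2 (wm 0 b) g)"
begin

abbreviation "W \<equiv> L2 (wm 0 b)"
abbreviation "nW \<equiv> l2 (wm 0 b)"
abbreviation "nR \<equiv> l2 (wm s b)"
abbreviation "nF \<equiv> l2 (wm s 1)"

lemma q: "2 * (1 - b - \<theta>) < 1" using b \<theta> by simp

lemma WR: "f \<in> W ==> f \<in> L2 (wm s b)" "f \<in> W ==> nR f \<le> nW f"
 using L2_wm_mono[of f 0 b s b] s by auto

lemma FR: "f \<in> L2 (wm s 1) ==> f \<in> L2 (wm s b)" "f \<in> L2 (wm s 1) ==> nR f \<le> nF f"
 using L2_wm_mono[of f s 1 s b] b by auto

lemma fr_F: "f \<in> Hs s ==> fr f \<in> L2 (wm s 1)" "f \<in> Hs s ==> fr f \<in> L2 (wm s b)"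
 by (simp_all add: Hs_iff FR(1))

lemma estF_diff:
 assumes T: "0 < T" "T \<le> 1" and f: "f \<in> L2 (wm s 1)" and f': "f' \<in> L2 (wm s 1)"
 shows "lb b T (\<lambda>t n. J f f t n - J f' f' t n) (C * T powr \<theta> * nF (\<lambda>z. f z - f' z) * (nF f + nF f'))"
proof -
 obtain A where A: "bil s s 1 (2 * (1 - b - \<theta>)) A" using bilF by blast
 note d = L2_diff(1)[OF f f']
 have "lb b T (\<lambda>t n. J (\<lambda>z. f z - f' z) f t n + J f' (\<lambda>z. f z - f' z) t n)
   (C * T powr \<theta> * nF (\<lambda>z. f z - f' z) * nF f + C * T powr \<theta> * nF f' * nF (\<lambda>z. f z - f' z))"
  by (intro lb_add estF T d f f' b)
 then show ?thesis
  by (simp add: J_diff_left[OF A q f f' f] J_diff_right[OF A q f' f f'] algebra_simps)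
qed

lemma estR_diff:
 assumes T: "0 < T" "T \<le> 1" and f: "f \<in> L2 (wm s b)" "f' \<in> L2 (wm s b)" and g: "g \<in> W" "g' \<in> W"
 shows "lb b T (\<lambda>t n. J f g t n - J f' g' t n) (C * T powr \<theta> * (nR (\<lambda>z. f z - f' z) * nW g + nR f' * nW (\<lambda>z. g z - g' z)))"
proof -
 obtain A where A: "bil s 0 b (2 * (1 - b - \<theta>)) A" using bilR by blast
 have "lb b T (\<lambda>t n. J (\<lambda>z. f z - f' z) g t n + J f' (\<lambda>z. g z - g' z) t n)
   (C * T powr \<theta> * nR (\<lambda>z. f z - f' z) * nW g + C * T powr \<theta> * nR f' * nW (\<lambda>z. g z - g' z))"
  by (intro lb_add estR T L2_diff(1) f g b)
 then show ?thesis
  by (simp add: J_diff_left[OF A q f g(1)] J_diff_right[OF A q f(2) g] algebra_simps)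
qed

text \<open>\<open>J_local\<close> needs both factors in \<open>wm 0 b\<close>. For rough
  \<open>f\<close> it is applied to truncations, and \<open>lb_point\<close> makes the values of
  \<open>J\<close> pass to the limit.\<close>

lemma J_local_rough:
 assumes T: "0 < T" "T \<le> 1" and f: "f \<in> L2 (wm s b)" and g: "g \<in> W"
  and z: "\<And>r k. \<bar>r\<bar> \<le> T ==> ic g r k = 0" and t: "\<bar>t\<bar> \<le> T"
 shows "J f g t n = 0"
proof -
 \<comment> \<open>The vanishing difference \<open>g z - g z\<close> only brings the estimate into
   the form of \<open>estR_diff\<close>.\<close>
 have "norm (J f g t n) \<le> sqrt (kb b) * (C * T powr \<theta> * (nR (\<lambda>z. trunc N f z - f z) * nW g + nR f * nW (\<lambda>z. g z - g z)))" for N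
  using lb_point[OF estR_diff[OF T trunc_L2(2)[OF f s, of N] f g g] b(1) T(1) t, of n]
   J_local[OF trunc_L2(1)[OF f s, of N] g b(1) _ t, of n] z by simp
 then have *: "\<exists>N0. \<forall>N\<ge>N0. norm (J f g t n) \<le> sqrt (kb b) * (C * T powr \<theta> * (nR (\<lambda>z. trunc N f z - f z) * nW g + nR f * nW (\<lambda>z. g z - g z)))"
  by blast
 have "(\<lambda>N. sqrt (kb b) * (C * T powr \<theta> * (nR (\<lambda>z. trunc N f z - f z) * nW g + nR f * nW (\<lambda>z. g z - g z))))
   \<longlonglongrightarrow> sqrt (kb b) * (C * T powr \<theta> * (0 * nW g + nR f * nW (\<lambda>z. g z - g z)))"
  by (intro tendsto_intros trunc_tendsto[OF f s])
 from LIMSEQ_le_const[OF this *]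
 show ?thesis by simp
qed

text \<open>On \<open>[-T, T]\<close> the value of \<open>J\<close> depends on the curve there and
  not on its extension, so \<open>J\<close> is well defined on the restriction space.\<close>

lemma J_cong:
 assumes T: "0 < T" "T \<le> 1" and g: "g \<in> W" "g' \<in> W"
  and eq: "\<And>t. \<bar>t\<bar> \<le> T ==> ic g t = ic g' t" and t: "\<bar>t\<bar> \<le> T"
 shows J_cong_right: "f \<in> L2 (wm s b) ==> J f g t n = J f g' t n"
  and J_cong_left: "f \<in> W ==> J g f t n = J g' f t n"
proof -
 obtain A where A: "bil s 0 b (2 * (1 - b - \<theta>)) A" using bilR by blast
 have z: "ic (\<lambda>z. g z - g' z) r k = 0" if "\<bar>r\<bar> \<le> T" for r k
  using eq[OF that] by (simp add: ic_diff[OF g b(1)])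
 show "J f g t n = J f g' t n" if f: "f \<in> L2 (wm s b)"
  using J_local_rough[OF T f L2_diff(1)[OF g] z t] J_diff_right[OF A q f g] by simp
 show "J g f t n = J g' f t n" if f: "f \<in> W"
  using J_local[OF L2_diff(1)[OF g] f b(1) _ t, of n] z J_diff_left[OF A q WR(1)[OF g(1)] WR(1)[OF g(2)] f] by simp
qed

end

subsection \<open>The continuous extensions of the Duhamel terms\<close>

context flow
begin

lemma b1: "b \<le> 1" and b0: "0 \<le> b" using b by auto

definition curve :: "real => (real => int => complex) => real => int => complex" where
 "curve T K = (\<lambda>t\<in>{-T..T}. \<lambda>n. cis (- ((of_int n)\<^sup>2 * t)) * K t n)"

lemma lb_curve:
 assumes "lb b T K B" "0 < T"
 obtains h where "h \<in> W" "nW h \<le> B" "\<And>t. t \<in> {-T..T} ==> cv h t = (\<lambda>n. cis (- ((of_int n)\<^sup>2 * t)) * K t n)"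
proof -
 obtain h where h: "h \<in> W" "nW h \<le> B" "\<And>t n. ic h t n = cnj (bump (t / T)) * K t n"
  using assms unfolding lb_def by auto
 have "cv h t = (\<lambda>n. cis (- ((of_int n)\<^sup>2 * t)) * K t n)" if "t \<in> {-T..T}" for t
  using that assms(2) by (simp add: cv_def h(3) bump_1 abs_le_iff fun_eq_iff)
 then show ?thesis using h that by blast
qed

lemma curve_XT: "lb b T K B ==> 0 < T ==> curve T K \<in> XT 0 b T"
 by (elim lb_curve, assumption) (auto simp: XT_iff[OF b(1) b1] curve_def intro!: bexI restrict_ext)

lemma curve_cong: "(\<And>t n. \<bar>t\<bar> \<le> T ==> K t n = K' t n) ==> curve T K = curve T K'"
 unfolding curve_def by (rule restrict_ext) (simp add: abs_le_iff)

lemma XT_norm_tendsto_0: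
 assumes T: "0 < T" and h: "\<And>k. \<exists>h\<in>W. nW h \<le> B k \<and> (\<forall>t\<in>{-T..T}. cv h t = F k t)" and B: "B \<longlonglongrightarrow> 0"
 shows "null (\<lambda>k. XT_norm 0 b T (F k))"
proof -
 obtain D where D: "0 \<le> D" "\<And>g F. g \<in> W ==> (\<And>t. t \<in> {-T..T} ==> cv g t = F t) ==> XT_norm 0 b T F \<le> D * nW g"
  using XT_norm_le[OF b T] by metis
 obtain h where h: "\<And>k. h k \<in> W" "\<And>k. nW (h k) \<le> B k" "\<And>k t. t \<in> {-T..T} ==> cv (h k) t = F k t"
  using h by metis
 have up: "XT_norm 0 b T (F k) \<le> D * B k" for k
  using D(2)[OF h(1) h(3)] mult_left_mono[OF h(2)[of k] D(1)] by (rule order_trans)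
 \<comment> \<open>Nonnegativity of the infimum is obtained from \<open>XT_norm_witness\<close>,
   which places a norm below it up to \<open>e\<close>.\<close>
 have lo: "0 \<le> XT_norm 0 b T (F k)" for k
 proof (rule field_le_epsilon)
  fix e :: real assume "0 < e"
  then obtain g where "nW g \<le> XT_norm 0 b T (F k) + e" using XT_norm_witness[OF b T h(1) h(3)] by metis
  then show "0 \<le> XT_norm 0 b T (F k) + e" by (rule order_trans[OF l2_nonneg])
 qed
 have l0: "null (\<lambda>k. D * B k)" using tendsto_mult[OF tendsto_const[of D] B] by simp
 show ?thesis by (rule tendsto_sandwich[OF _ _ tendsto_const l0]) (auto intro!: always_eventually lo up)
qed

lemma curve_tendsto:
 assumes T: "0 < T" and l: "\<And>k. lb b T (\<lambda>t n. K k t n - K' t n) (B k)" and B: "B \<longlonglongrightarrow> 0"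
 shows "null (\<lambda>k. XT_norm 0 b T (\<lambda>t n. curve T (K k) t n - curve T K' t n))"
proof (rule XT_norm_tendsto_0[OF T _ B])
 fix k
 obtain h where h: "h \<in> W" "nW h \<le> B k" "\<And>t. t \<in> {-T..T} ==> cv h t = (\<lambda>n. cis (- ((of_int n)\<^sup>2 * t)) * (K k t n - K' t n))"
  by (rule lb_curve[OF l[of k] T]) (rule that; assumption)
 show "\<exists>h\<in>W. nW h \<le> B k \<and> (\<forall>t\<in>{-T..T}. cv h t = (\<lambda>n. curve T (K k) t n - curve T K' t n))"
  by (intro bexI[OF _ h(1)] conjI h(2)) (simp add: h(3) curve_def right_diff_distrib)
qed

text \<open>An arbitrary extension, chosen once; by \<open>J_cong\<close> the choice does not affect
  the terms built from it.\<close>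

definition rep :: "real => (real => int => complex) => int \<times> real => complex" where
 "rep T v = (SOME g. g \<in> W \<and> v = restrict (cv g) {-T..T})"

lemma rep:
 assumes "v \<in> XT 0 b T"
 shows "rep T v \<in> W" "v = restrict (cv (rep T v)) {-T..T}"
 using someI_ex[of "\<lambda>g. g \<in> W \<and> v = restrict (cv g) {-T..T}"] assms
 unfolding rep_def[symmetric] XT_iff[OF b(1) b1] by blast+

lemma rep_at: "v \<in> XT 0 b T ==> t \<in> {-T..T} ==> v t = cv (rep T v) t"
 using rep(2)[of v T] by (metis restrict_apply)

lemma ic_eq_iff: "ic g t = ic g' t \<longleftrightarrow> cv g t = cv g' t"
 by (simp add: cv_def fun_eq_iff)

lemma rep_ic:
 assumes "g \<in> W" "\<And>t. t \<in> {-T..T} ==> v t = cv g t" "v \<in> XT 0 b T" "\<bar>t\<bar> \<le> T"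
 shows "ic (rep T v) t = ic g t"
proof -
 have t: "t \<in> {-T..T}" using assms(4) by auto
 show ?thesis using assms(2)[OF t] rep_at[OF assms(3) t] by (simp add: ic_eq_iff)
qed

text \<open>The chosen extensions \<open>rep T (vs k)\<close> need not converge, as the norm sees
  only the restrictions. Adding to \<open>rep T v\<close> nearly optimal extensions of the
  differences gives convergent ones with the same curves on \<open>[-T, T]\<close>.\<close>

lemma XT_sequence:
 assumes T: "0 < T" and vs: "\<And>k. vs k \<in> XT 0 b T" and v: "v \<in> XT 0 b T"
  and lim: "null (\<lambda>k. XT_norm 0 b T (\<lambda>t n. vs k t n - v t n))"
 obtains g where "\<And>k. g k \<in> W" "\<And>k t. \<bar>t\<bar> \<le> T ==> ic (rep T (vs k)) t = ic (g k) t"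
  "null (\<lambda>k. nW (\<lambda>z. g k z - rep T v z))"
proof -
 define D where "D k = XT_norm 0 b T (\<lambda>t n. vs k t n - v t n) + inverse (real (Suc k))" for k
 have "\<exists>d\<in>W. (\<forall>t\<in>{-T..T}. cv d t = (\<lambda>n. vs k t n - v t n)) \<and> nW d \<le> D k" for k
 proof -
  have c: "cv (\<lambda>z. rep T (vs k) z - rep T v z) t = (\<lambda>n. vs k t n - v t n)" if t: "t \<in> {-T..T}" for t
   by (simp add: cv_diff[OF rep(1)[OF vs] rep(1)[OF v] b(1)] rep_at[OF vs t] rep_at[OF v t] fun_eq_iff)
  show ?thesis
   by (rule XT_norm_witness[OF b T L2_diff(1)[OF rep(1)[OF vs] rep(1)[OF v]] c, of "inverse (real (Suc k))"]) (assumption, simp, unfold D_def, blast)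
 qed
 then obtain d where d: "\<And>k. d k \<in> W" "\<And>k t. t \<in> {-T..T} ==> cv (d k) t = (\<lambda>n. vs k t n - v t n)" "\<And>k. nW (d k) \<le> D k"
  by metis
 have D0: "D \<longlonglongrightarrow> 0" unfolding D_def using tendsto_add[OF lim LIMSEQ_inverse_real_of_nat] by simp
 show ?thesis
 proof (rule that[of "\<lambda>k z. d k z + rep T v z"])
  show *: "(\<lambda>z. d k z + rep T v z) \<in> W" for k by (intro L2_add(1) d rep v)
  show "ic (rep T (vs k)) t = ic (\<lambda>z. d k z + rep T v z) t" if t: "\<bar>t\<bar> \<le> T" for k t
  proof (rule rep_ic[OF * _ vs t])
   fix t assume t: "t \<in> {-T..T}"
   show "vs k t = cv (\<lambda>z. d k z + rep T v z) t"
    by (simp add: cv_add[OF d(1) rep(1)[OF v] b(1)] d(2)[OF t] rep_at[OF v t] fun_eq_iff)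
  qed
  show "null (\<lambda>k. nW (\<lambda>z. (d k z + rep T v z) - rep T v z))"
   by (rule tendsto_sandwich[OF _ _ tendsto_const D0]) (auto intro!: always_eventually d(3))
 qed
qed

text \<open>Convergence in the restriction norm is thus visible in every coefficient at every time,
  which is how two extensions of the Duhamel terms are compared.\<close>

lemma XT_norm_tendsto_point:
 assumes T: "0 < T" and vs: "\<And>k. vs k \<in> XT 0 b T" and v: "v \<in> XT 0 b T"
  and lim: "null (\<lambda>k. XT_norm 0 b T (\<lambda>t n. vs k t n - v t n))" and t: "t \<in> {-T..T}"
 shows "(\<lambda>k. vs k t n) \<longlonglongrightarrow> v t n"
proof -
 obtain g where g: "\<And>k. g k \<in> W" "\<And>k t. \<bar>t\<bar> \<le> T ==> ic (rep T (vs k)) t = ic (g k) t"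
  "null (\<lambda>k. nW (\<lambda>z. g k z - rep T v z))" by (rule XT_sequence[OF T vs v lim]) (rule that; assumption)
 have "vs k t = cv (g k) t" for k using rep_at[OF vs[of k] t] g(2)[of t k] t by (simp add: ic_eq_iff abs_le_iff)
 then show ?thesis using cv_tendsto[OF g(1) rep(1)[OF v] b(1) g(3)] rep_at[OF v t] by simp
qed

text \<open>Concrete candidates for the three continuous extensions; the factor 2 in the mixed term
  comes from the square.\<close>

definition Phi1 where "Phi1 T f = curve T (J (fr f) (fr f))"
definition Phi2 where "Phi2 T f v = curve T (\<lambda>t n. 2 * J (fr f) (rep T v) t n)"
definition Phi3 where "Phi3 T v = curve T (J (rep T v) (rep T v))"

lemma curve_duhamel:
 assumes "\<And>t n. \<bar>t\<bar> \<le> T ==> duhamel G t n = cis (- ((of_int n)\<^sup>2 * t)) * K t n"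
 shows "curve T K = restrict (duhamel G) {-T..T}"
 unfolding curve_def using assms by (intro restrict_ext) (auto simp: abs_le_iff)

lemma gam_W: "v \<in> smooth_schwartz ==> gam v \<in> W" by (rule gam_L2(1)[OF _ b0 b1])

lemma smooth_XT:
 assumes "v \<in> smooth_schwartz"
 shows "(\<lambda>t\<in>{-T..T}. fcoeff (v t)) \<in> XT 0 b T" "\<bar>t\<bar> \<le> T ==> ic (rep T (\<lambda>t\<in>{-T..T}. fcoeff (v t))) t = ic (gam v) t"
proof -
 have e: "fcoeff (v t) = cv (gam v) t" for t by (rule gam_series(2)[OF assms])
 show x: "(\<lambda>t\<in>{-T..T}. fcoeff (v t)) \<in> XT 0 b T"
  unfolding XT_iff[OF b(1) b1] e using gam_W[OF assms] by blast
 show "\<bar>t\<bar> \<le> T ==> ic (rep T (\<lambda>t\<in>{-T..T}. fcoeff (v t))) t = ic (gam v) t"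
  by (rule rep_ic[OF gam_W[OF assms] _ x]) (auto simp: e)
qed

lemma fr_smooth_W:
 assumes "f \<in> smooth_torus"
 shows "fr (fcoeff f) \<in> W"
 using L2_wm_mono(1)[OF smooth_torus_Hs(2)[OF assms s], of 0 b] b by simp

lemma Hs_lim:
 assumes fs: "\<And>k. fs k \<in> Hs s" and f: "f \<in> Hs s" and lim: "null (\<lambda>k. Hs_norm s (\<lambda>n. fs k n - f n))"
 shows "null (\<lambda>k. nF (\<lambda>z. fr (fs k) z - fr f z))" "null (\<lambda>k. nR (\<lambda>z. fr (fs k) z - fr f z))"
proof -
 have "(\<lambda>k. cf * Hs_norm s (\<lambda>n. fs k n - f n)) \<longlonglongrightarrow> cf * 0" by (intro tendsto_intros lim)
 then show *: "null (\<lambda>k. nF (\<lambda>z. fr (fs k) z - fr f z))"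
  by (simp add: fr_diff[symmetric] l2_fr[OF Hs_diff[OF fs f]])
 show "null (\<lambda>k. nR (\<lambda>z. fr (fs k) z - fr f z))"
  by (rule tendsto_sandwich[OF _ _ tendsto_const *]) (auto intro!: always_eventually FR(2) L2_diff(1) fr_F fs f)
qed

lemma extends_Phi1:
 assumes T: "0 < T" "T \<le> 1"
 shows "extends_free_free s b T (Phi1 T)"
 unfolding extends_free_free_def
proof (intro conjI ballI allI impI)
 show "Phi1 T f \<in> XT 0 b T" if "f \<in> Hs s" for f
  unfolding Phi1_def by (rule curve_XT[OF estF[OF T fr_F(1)[OF that] fr_F(1)[OF that]] T(1)])
next
 fix f assume f: "f \<in> smooth_torus"
 note W = fr_smooth_W[OF f]
 have r: "\<bar>r\<bar> \<le> 1" if "\<bar>r\<bar> \<le> T" for r using that T by linarith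
 show "Phi1 T (fcoeff f) = restrict (duhamel (\<lambda>t x. (cnj (free_smooth f t x))\<^sup>2)) {-T..T}"
  unfolding Phi1_def power2_eq_square
  by (intro curve_duhamel duhamel_J[OF W W b(1)] free_smooth_series[OF f r] free_smooth_fcoeff[OF f r])
next
 fix fs f assume fs: "\<forall>k. fs k \<in> Hs s" and f: "f \<in> Hs s" and lim: "null (\<lambda>k. Hs_norm s (\<lambda>n. fs k n - f n))"
 have F: "fr (fs k) \<in> L2 (wm s 1)" "fr f \<in> L2 (wm s 1)" for k using fs f by (auto intro: fr_F)
 note l = Hs_lim(1)[OF fs[rule_format] f lim]
 have "(\<lambda>k. C * T powr \<theta> * nF (\<lambda>z. fr (fs k) z - fr f z) * (nF (fr (fs k)) + nF (fr f))) \<longlonglongrightarrow> C * T powr \<theta> * 0 * (nF (fr f) + nF (fr f))"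
  by (intro tendsto_intros l l2_tendsto[OF F(1) F(2) l])
 then show "null (\<lambda>k. XT_norm 0 b T (\<lambda>t n. Phi1 T (fs k) t n - Phi1 T f t n))"
  unfolding Phi1_def by (intro curve_tendsto[OF T(1) estF_diff[OF T F(1) F(2)]]) simp
qed

lemma extends_Phi2:
 assumes T: "0 < T" "T \<le> 1"
 shows "extends_free_rest s b T (Phi2 T)"
 unfolding extends_free_rest_def
proof (intro conjI ballI allI impI)
 show "Phi2 T f v \<in> XT 0 b T" if "f \<in> Hs s" "v \<in> XT 0 b T" for f v
  unfolding Phi2_def by (rule curve_XT[OF lb_cmult[OF estR[OF T fr_F(2)[OF that(1)] rep(1)[OF that(2)]]] T(1)])
next
 fix f v assume f: "f \<in> smooth_torus" and v: "v \<in> smooth_schwartz"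
 have r: "\<bar>r\<bar> \<le> 1" if "\<bar>r\<bar> \<le> T" for r using that T by linarith
 have FS: "fr (fcoeff f) \<in> L2 (wm s b)" by (rule WR(1)[OF fr_smooth_W[OF f]])
 \<comment> \<open>\<open>rep\<close> may choose an extension other than \<open>gam v\<close>; on
   \<open>[-T, T]\<close> this does not change \<open>J\<close>.\<close>
 have e: "J (fr (fcoeff f)) (rep T (\<lambda>t\<in>{-T..T}. fcoeff (v t))) t n = J (fr (fcoeff f)) (gam v) t n" if "\<bar>t\<bar> \<le> T" for t n
  by (rule J_cong_right[OF T rep(1)[OF smooth_XT(1)[OF v]] gam_W[OF v] smooth_XT(2)[OF v] that FS])
 have "duhamel (\<lambda>t x. 2 * cnj (free_smooth f t x) * cnj (v t x)) t n = cis (- ((of_int n)\<^sup>2 * t)) * (2 * J (fr (fcoeff f)) (rep T (\<lambda>t\<in>{-T..T}. fcoeff (v t))) t n)"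
  if t: "\<bar>t\<bar> \<le> T" for t n
 proof -
  have "duhamel (\<lambda>t x. cnj (free_smooth f t x) * cnj (v t x)) t n = cis (- ((of_int n)\<^sup>2 * t)) * J (fr (fcoeff f)) (gam v) t n"
   by (intro duhamel_J[OF fr_smooth_W[OF f] gam_W[OF v] b(1) t] free_smooth_series[OF f r] smooth_schwartz_continuous_x[OF v])
    (simp_all add: gam_series(2)[OF v])
  then show ?thesis unfolding mult.assoc duhamel_cmult e[OF t] by simp
 qed
 then show "Phi2 T (fcoeff f) (\<lambda>t\<in>{-T..T}. fcoeff (v t)) =
   restrict (duhamel (\<lambda>t x. 2 * cnj (free_smooth f t x) * cnj (v t x))) {-T..T}"
  unfolding Phi2_def by (rule curve_duhamel)
next
 fix fs f vs v assume fs: "\<forall>k. fs k \<in> Hs s" and f: "f \<in> Hs s" and vs: "\<forall>k. vs k \<in> XT 0 b T" and v: "v \<in> XT 0 b T"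
  and lim: "null (\<lambda>k. Hs_norm s (\<lambda>n. fs k n - f n))" and vlim: "null (\<lambda>k. XT_norm 0 b T (\<lambda>t n. vs k t n - v t n))"
 obtain g where g: "\<And>k. g k \<in> W" "\<And>k t. \<bar>t\<bar> \<le> T ==> ic (rep T (vs k)) t = ic (g k) t"
  "null (\<lambda>k. nW (\<lambda>z. g k z - rep T v z))" by (rule XT_sequence[OF T(1) vs[rule_format] v vlim]) (rule that; assumption)
 have F: "fr (fs k) \<in> L2 (wm s b)" "fr f \<in> L2 (wm s b)" for k using fs f by (auto intro: fr_F)
 note l = Hs_lim(2)[OF fs[rule_format] f lim]
 have e: "Phi2 T (fs k) (vs k) = curve T (\<lambda>t n. 2 * J (fr (fs k)) (g k) t n)" for k
  unfolding Phi2_def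
  by (rule curve_cong) (simp add: J_cong_right[OF T rep(1)[OF vs[rule_format]] g(1) g(2) _ F(1)])
 have "(\<lambda>k. norm (2::complex) * (C * T powr \<theta> * (nR (\<lambda>z. fr (fs k) z - fr f z) * nW (g k) + nR (fr f) * nW (\<lambda>z. g k z - rep T v z))))
   \<longlonglongrightarrow> norm (2::complex) * (C * T powr \<theta> * (0 * nW (rep T v) + nR (fr f) * 0))"
  by (intro tendsto_intros l g(3) l2_tendsto[OF g(1) rep(1)[OF v] g(3)])
 then show "null (\<lambda>k. XT_norm 0 b T (\<lambda>t n. Phi2 T (fs k) (vs k) t n - Phi2 T f v t n))"
  unfolding e unfolding Phi2_def
  by (intro curve_tendsto[OF T(1) lb_cmult[OF estR_diff[OF T F(1) F(2) g(1) rep(1)[OF v]], of 2, unfolded right_diff_distrib]]) simp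
qed

lemma extends_Phi3:
 assumes T: "0 < T" "T \<le> 1"
 shows "extends_rest_rest b T (Phi3 T)"
 unfolding extends_rest_rest_def
proof (intro conjI ballI allI impI)
 show "Phi3 T v \<in> XT 0 b T" if "v \<in> XT 0 b T" for v
  unfolding Phi3_def by (rule curve_XT[OF estR[OF T WR(1)[OF rep(1)[OF that]] rep(1)[OF that]] T(1)])
next
 fix v assume v: "v \<in> smooth_schwartz"
 let ?e = "rep T (\<lambda>t\<in>{-T..T}. fcoeff (v t))"
 note E = rep(1)[OF smooth_XT(1)[OF v]] and G = gam_W[OF v] and i = smooth_XT(2)[OF v]
 have e: "J ?e ?e t n = J (gam v) (gam v) t n" if t: "\<bar>t\<bar> \<le> T" for t n
  using J_cong_right[OF T E G i t WR(1)[OF E]] J_cong_left[OF T E G i t G] by simp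
 have "duhamel (\<lambda>t x. cnj (v t x) * cnj (v t x)) t n = cis (- ((of_int n)\<^sup>2 * t)) * J ?e ?e t n" if t: "\<bar>t\<bar> \<le> T" for t n
  unfolding e[OF t]
  by (intro duhamel_J[OF G G b(1) t] gam_series[OF v] smooth_schwartz_continuous_x[OF v]) (simp_all add: gam_series(2)[OF v])
 then show "Phi3 T (\<lambda>t\<in>{-T..T}. fcoeff (v t)) = restrict (duhamel (\<lambda>t x. (cnj (v t x))\<^sup>2)) {-T..T}"
  unfolding Phi3_def power2_eq_square[of "cnj _"] by (rule curve_duhamel)
next
 fix vs v assume vs: "\<forall>k. vs k \<in> XT 0 b T" and v: "v \<in> XT 0 b T"
  and vlim: "null (\<lambda>k. XT_norm 0 b T (\<lambda>t n. vs k t n - v t n))"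
 obtain g where g: "\<And>k. g k \<in> W" "\<And>k t. \<bar>t\<bar> \<le> T ==> ic (rep T (vs k)) t = ic (g k) t"
  "null (\<lambda>k. nW (\<lambda>z. g k z - rep T v z))" by (rule XT_sequence[OF T(1) vs[rule_format] v vlim]) (rule that; assumption)
 note E = rep(1)[OF vs[rule_format]] and V = rep(1)[OF v]
 have e: "Phi3 T (vs k) = curve T (J (g k) (g k))" for k
  unfolding Phi3_def
  by (rule curve_cong) (simp add: J_cong_right[OF T E g(1) g(2) _ WR(1)[OF E]] J_cong_left[OF T E g(1) g(2) _ g(1)])
 have R: "null (\<lambda>k. nR (\<lambda>z. g k z - rep T v z))"
  by (rule tendsto_sandwich[OF _ _ tendsto_const g(3)]) (auto intro!: always_eventually WR(2) L2_diff(1) g V)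
 have "(\<lambda>k. C * T powr \<theta> * (nR (\<lambda>z. g k z - rep T v z) * nW (g k) + nR (rep T v) * nW (\<lambda>z. g k z - rep T v z)))
   \<longlonglongrightarrow> C * T powr \<theta> * (0 * nW (rep T v) + nR (rep T v) * 0)"
  by (intro tendsto_intros R g(3) l2_tendsto[OF g(1) V g(3)])
 then show "null (\<lambda>k. XT_norm 0 b T (\<lambda>t n. Phi3 T (vs k) t n - Phi3 T v t n))"
  unfolding e unfolding Phi3_def
  by (intro curve_tendsto[OF T(1) estR_diff[OF T WR(1)[OF g(1)] WR(1)[OF V] g(1) V]]) simp
qed

lemma XT_density:
 assumes T: "0 < T" and v: "v \<in> XT 0 b T"
 obtains w where "\<And>k. w k \<in> smooth_schwartz" "null (\<lambda>k. XT_norm 0 b T (\<lambda>t n. (\<lambda>t\<in>{-T..T}. fcoeff (w k t)) t n - v t n))"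
proof -
 obtain w where w: "\<And>k. w k \<in> smooth_schwartz" "null (\<lambda>k. nW (\<lambda>z. gam (w k) z - rep T v z))"
  by (rule smooth_density_sequence[OF rep(1)[OF v] b0 b1]) (rule that; assumption)
 note V = rep(1)[OF v]
 have "null (\<lambda>k. XT_norm 0 b T (\<lambda>t n. (\<lambda>t\<in>{-T..T}. fcoeff (w k t)) t n - v t n))"
 proof (rule XT_norm_tendsto_0[OF T _ w(2)])
  fix k
  have "cv (\<lambda>z. gam (w k) z - rep T v z) t = (\<lambda>n. (\<lambda>t\<in>{-T..T}. fcoeff (w k t)) t n - v t n)" if "t \<in> {-T..T}" for t
  proof -
   have "(\<lambda>t\<in>{-T..T}. fcoeff (w k t)) t = cv (gam (w k)) t" by (simp only: restrict_apply that if_True gam_series(2)[OF w(1)])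
   then show ?thesis unfolding rep_at[OF v that] by (intro HOL.ext) (simp only: cv_diff[OF gam_W[OF w(1)] V b(1)])
  qed
  then show "\<exists>h\<in>W. nW h \<le> nW (\<lambda>z. gam (w k) z - rep T v z) \<and> (\<forall>t\<in>{-T..T}. cv h t = (\<lambda>n. (\<lambda>t\<in>{-T..T}. fcoeff (w k t)) t n - v t n))"
   using L2_diff(1)[OF gam_W[OF w(1)[of k]] V] by blast
 qed
 then show ?thesis using w(1) that by blast
qed

end

subsection \<open>Solutions as fixed points\<close>

lemma J_zero: "J (\<lambda>z. 0) g t n = 0" "J f g 0 n = 0"
 by (simp_all add: J_def H_def tker_def)

lemma lb_mono: "lb b T K B ==> B \<le> B' ==> lb b T K B'"
 unfolding lb_def by (meson order_trans)

lemma small_time: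
 assumes "0 \<le> C" "0 < \<theta>" "0 \<le> A"
 obtains T :: real where "0 < T" "T \<le> 1" "\<And>T'. 0 < T' ==> T' \<le> T ==> C * T' powr \<theta> * A \<le> 1/2"
proof -
 \<comment> \<open>The \<open>+ 1\<close> guards against \<open>C * A = 0\<close>.\<close>
 define y where "y = 1 / (2 * (C * A + 1))"
 have CA: "0 \<le> C * A" using assms by simp
 then have y: "0 < y" "C * A * y \<le> 1/2" by (auto simp: y_def field_simps)
 show ?thesis
 proof (rule that[of "min 1 (y powr (1 / \<theta>))"])
  fix T' assume T': "0 < T'" "T' \<le> min 1 (y powr (1 / \<theta>))"
  then have "T' powr \<theta> \<le> (y powr (1 / \<theta>)) powr \<theta>" using assms by (intro powr_mono2) auto
  also have "\<dots> = y" using assms y by (simp add: powr_powr)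
  finally have "C * A * T' powr \<theta> \<le> C * A * y" using CA by (rule mult_left_mono)
  then show "C * T' powr \<theta> * A \<le> 1/2" using y by (simp add: mult_ac)
 qed (use y in auto)
qed

context flow
begin

text \<open>Two continuous extensions agree on smooth data, which are dense, and limits can be taken
  pointwise in time and frequency. The extensions quantified in \<open>is_solution\<close> can
  therefore be replaced by the concrete ones.\<close>

lemma free_free_unique:
 assumes T: "0 < T" "T \<le> 1" and E: "extends_free_free s b T \<Phi>" and f: "f \<in> Hs s" and t: "t \<in> {-T..T}"
 shows "\<Phi> f t n = Phi1 T f t n"
proof -
 obtain p where p: "\<And>k. p k \<in> smooth_torus" "\<And>k. fcoeff (p k) \<in> Hs s"
  "null (\<lambda>k. Hs_norm s (\<lambda>n. fcoeff (p k) n - f n))"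
  by (rule Hs_density[OF s f]) (rule that; assumption)
 have lim: "(\<lambda>k. \<Psi> (fcoeff (p k)) t n) \<longlonglongrightarrow> \<Psi> f t n" if E: "extends_free_free s b T \<Psi>" for \<Psi>
 proof -
  note D = E[unfolded extends_free_free_def]
  show ?thesis
   by (rule XT_norm_tendsto_point[OF T(1) D[THEN conjunct1, rule_format, OF p(2)] D[THEN conjunct1, rule_format, OF f]
      D[THEN conjunct2, THEN conjunct2, rule_format, OF p(2) f p(3)] t])
 qed
 have "\<Phi> (fcoeff (p k)) = Phi1 T (fcoeff (p k))" for k
  using E extends_Phi1[OF T] p(1) by (simp add: extends_free_free_def)
 then show ?thesis using LIMSEQ_unique[OF lim[OF E]] lim[OF extends_Phi1[OF T]] by simp
qed

lemma free_rest_unique: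
 assumes T: "0 < T" "T \<le> 1" and E: "extends_free_rest s b T \<Phi>" and f: "f \<in> Hs s" and v: "v \<in> XT 0 b T" and t: "t \<in> {-T..T}"
 shows "\<Phi> f v t n = Phi2 T f v t n"
proof -
 obtain p where p: "\<And>k. p k \<in> smooth_torus" "\<And>k. fcoeff (p k) \<in> Hs s"
  "null (\<lambda>k. Hs_norm s (\<lambda>n. fcoeff (p k) n - f n))"
  by (rule Hs_density[OF s f]) (rule that; assumption)
 obtain w where w: "\<And>k. w k \<in> smooth_schwartz" "null (\<lambda>k. XT_norm 0 b T (\<lambda>t n. (\<lambda>t\<in>{-T..T}. fcoeff (w k t)) t n - v t n))"
  by (rule XT_density[OF T(1) v]) (rule that; assumption)
 define V where "V k = (\<lambda>t\<in>{-T..T}. fcoeff (w k t))" for k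
 have V: "V k \<in> XT 0 b T" "null (\<lambda>k. XT_norm 0 b T (\<lambda>t n. V k t n - v t n))" for k
  using smooth_XT(1)[OF w(1)] w(2) by (simp_all only: V_def)
 have lim: "(\<lambda>k. \<Psi> (fcoeff (p k)) (V k) t n) \<longlonglongrightarrow> \<Psi> f v t n" if E: "extends_free_rest s b T \<Psi>" for \<Psi>
  by (rule XT_norm_tendsto_point[OF T(1) _ _ _ t]) (use E p f v V in \<open>simp_all add: extends_free_rest_def\<close>)
 have "\<Phi> (fcoeff (p k)) (V k) = Phi2 T (fcoeff (p k)) (V k)" for k
  using E extends_Phi2[OF T] p(1) w(1) by (simp add: extends_free_rest_def V_def)
 then show ?thesis using LIMSEQ_unique[OF lim[OF E]] lim[OF extends_Phi2[OF T]] by simp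
qed

lemma rest_rest_unique:
 assumes T: "0 < T" "T \<le> 1" and E: "extends_rest_rest b T \<Phi>" and v: "v \<in> XT 0 b T" and t: "t \<in> {-T..T}"
 shows "\<Phi> v t n = Phi3 T v t n"
proof -
 obtain w where w: "\<And>k. w k \<in> smooth_schwartz" "null (\<lambda>k. XT_norm 0 b T (\<lambda>t n. (\<lambda>t\<in>{-T..T}. fcoeff (w k t)) t n - v t n))"
  by (rule XT_density[OF T(1) v]) (rule that; assumption)
 define V where "V k = (\<lambda>t\<in>{-T..T}. fcoeff (w k t))" for k
 have V: "V k \<in> XT 0 b T" "null (\<lambda>k. XT_norm 0 b T (\<lambda>t n. V k t n - v t n))" for k
  using smooth_XT(1)[OF w(1)] w(2) by (simp_all only: V_def)
 have lim: "(\<lambda>k. \<Psi> (V k) t n) \<longlonglongrightarrow> \<Psi> v t n" if E: "extends_rest_rest b T \<Psi>" for \<Psi>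
  by (rule XT_norm_tendsto_point[OF T(1) _ _ _ t]) (use E v V in \<open>simp_all add: extends_rest_rest_def\<close>)
 have "\<Phi> (V k) = Phi3 T (V k)" for k
  using E extends_Phi3[OF T] w(1) by (simp add: extends_rest_rest_def V_def)
 then show ?thesis using LIMSEQ_unique[OF lim[OF E]] lim[OF extends_Phi3[OF T]] by simp
qed

section \<open>The integral equation in the interaction picture\<close>

definition NL :: "(int \<times> real => complex) => (int \<times> real => complex) => real => int => complex" where
 "NL F g t n = J F F t n + 2 * J F g t n + J g g t n"

definition Sol :: "real => real => (int => complex) => (int \<times> real => complex) => bool" where
 "Sol \<kappa> T f g \<longleftrightarrow> g \<in> W \<and> (\<forall>t n. \<bar>t\<bar> \<le> T \<longrightarrow> ic g t n = - (\<i> * of_real \<kappa>) * NL (fr f) g t n)"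

definition sol :: "real => (int => complex) => (int \<times> real => complex) => real => int => complex" where
 "sol T f g = (\<lambda>t\<in>{-T..T}. \<lambda>n. schroedinger t f n + cv g t n)"

lemma remainder_sol: "remainder T f (sol T f g) = restrict (cv g) {-T..T}"
 unfolding remainder_def sol_def by (rule restrict_ext) simp

lemma sum_Phi:
 assumes T: "0 < T" "T \<le> 1" and f: "f \<in> Hs s" and g: "g \<in> W" and t: "\<bar>t\<bar> \<le> T"
 shows "Phi1 T f t n + Phi2 T f (restrict (cv g) {-T..T}) t n + Phi3 T (restrict (cv g) {-T..T}) t n = cis (- ((of_int n)\<^sup>2 * t)) * NL (fr f) g t n"
proof -
 have v: "restrict (cv g) {-T..T} \<in> XT 0 b T" using g by (auto simp: XT_iff[OF b(1) b1])
 note E = rep(1)[OF v]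
 have i: "ic (rep T (restrict (cv g) {-T..T})) t = ic g t" if "\<bar>t\<bar> \<le> T" for t
  by (rule rep_ic[OF g _ v that]) simp
 have "t \<in> {-T..T}" using t by auto
 then show ?thesis
  using J_cong_right[OF T E g i t fr_F(2)[OF f], of n] J_cong_right[OF T E g i t WR(1)[OF E], of n] J_cong_left[OF T E g i t g, of n]
  by (simp add: Phi1_def Phi2_def Phi3_def curve_def NL_def algebra_simps)
qed

text \<open>From left to right this rests on uniqueness of the three extensions, from right to left
  on their existence. The phase common to all terms cancels because it never vanishes.\<close>

lemma is_solution_iff:
 assumes T: "0 < T" "T \<le> 1" and f: "f \<in> Hs s"
 shows "is_solution \<kappa> s b T f u \<longleftrightarrow> (\<exists>g. Sol \<kappa> T f g \<and> u = sol T f g)"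
proof -
 have key: "sol T f g t n = schroedinger t f n - \<i> * of_real \<kappa> * (Phi1 T f t n + Phi2 T f (restrict (cv g) {-T..T}) t n + Phi3 T (restrict (cv g) {-T..T}) t n)
   \<longleftrightarrow> ic g t n = - (\<i> * of_real \<kappa>) * NL (fr f) g t n" if g: "g \<in> W" and t: "t \<in> {-T..T}" for g t n
 proof -
  have c: "cis (- ((of_int n)\<^sup>2 * t)) \<noteq> 0" by simp
  have "\<bar>t\<bar> \<le> T" using t by auto
  then show ?thesis unfolding sum_Phi[OF T f g \<open>\<bar>t\<bar> \<le> T\<close>] using t
   mult_cancel_left[of "cis (- ((of_int n)\<^sup>2 * t))" "ic g t n" "- (\<i> * of_real \<kappa>) * NL (fr f) g t n"] c
   by (simp add: sol_def cv_def mult.left_commute eq_neg_iff_add_eq_0)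
 qed
 show ?thesis
 proof
  assume "is_solution \<kappa> s b T f u"
  then obtain \<Phi>1 \<Phi>2 \<Phi>3 where Y: "u \<in> YT b T f" and E: "extends_free_free s b T \<Phi>1" "extends_free_rest s b T \<Phi>2" "extends_rest_rest b T \<Phi>3"
   and eq: "\<forall>t\<in>{-T..T}. \<forall>n. u t n = schroedinger t f n - \<i> * of_real \<kappa> *
      (\<Phi>1 f t n + \<Phi>2 f (remainder T f u) t n + \<Phi>3 (remainder T f u) t n)"
   unfolding is_solution_def by (elim exE conjE) (rule that; assumption)
  obtain g where g: "g \<in> W" "u = sol T f g"
  proof -
   obtain v where v: "v \<in> XT 0 b T" "u = (\<lambda>t\<in>{-T..T}. \<lambda>n. schroedinger t f n + v t n)"
    using Y unfolding YT_def by blast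
   have "u = sol T f (rep T v)" unfolding v(2) sol_def by (rule restrict_ext) (simp add: rep_at[OF v(1)])
   then show ?thesis using rep(1)[OF v(1)] that by blast
  qed
  have v: "restrict (cv g) {-T..T} \<in> XT 0 b T" using g by (auto simp: XT_iff[OF b(1) b1])
  have "ic g t n = - (\<i> * of_real \<kappa>) * NL (fr f) g t n" if t: "\<bar>t\<bar> \<le> T" for t n
  proof -
   have t: "t \<in> {-T..T}" using t by auto
   show ?thesis
    unfolding key[OF g(1) t, symmetric]
    using eq[rule_format, OF t, of n] free_free_unique[OF T E(1) f t, of n] free_rest_unique[OF T E(2) f v t, of n] rest_rest_unique[OF T E(3) v t, of n]
    by (simp add: g(2) remainder_sol)
  qed
  then have "Sol \<kappa> T f g" using g(1) by (simp add: Sol_def)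
  then show "\<exists>g. Sol \<kappa> T f g \<and> u = sol T f g" using g(2) by blast
 next
  assume "\<exists>g. Sol \<kappa> T f g \<and> u = sol T f g"
  then obtain g where S: "Sol \<kappa> T f g" and u: "u = sol T f g" by blast
  then have g: "g \<in> W" by (simp add: Sol_def)
  have v: "restrict (cv g) {-T..T} \<in> XT 0 b T" using g by (auto simp: XT_iff[OF b(1) b1])
  have "u = (\<lambda>t\<in>{-T..T}. \<lambda>n. schroedinger t f n + restrict (cv g) {-T..T} t n)"
   unfolding u sol_def by (rule restrict_ext) simp
  then have Y: "u \<in> YT b T f" using v unfolding YT_def by blast
  have eq: "\<forall>t\<in>{-T..T}. \<forall>n. u t n = schroedinger t f n - \<i> * of_real \<kappa> *
      (Phi1 T f t n + Phi2 T f (remainder T f u) t n + Phi3 T (remainder T f u) t n)"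
  proof (intro ballI allI)
   fix t n assume t: "t \<in> {-T..T}"
   have "ic g t n = - (\<i> * of_real \<kappa>) * NL (fr f) g t n" using S t by (auto simp: Sol_def)
   then show "u t n = schroedinger t f n - \<i> * of_real \<kappa> *
      (Phi1 T f t n + Phi2 T f (remainder T f u) t n + Phi3 T (remainder T f u) t n)"
    unfolding u remainder_sol key[OF g t] .
  qed
  show "is_solution \<kappa> s b T f u"
   unfolding is_solution_def using Y eq extends_Phi1[OF T] extends_Phi2[OF T] extends_Phi3[OF T] by blast
 qed
qed

text \<open>Each product is telescoped, one factor changing at a time, so every term carries one
  difference. Norms of regularity \<open>s\<close> and exponent \<open>b\<close> are then enlarged
  to those of the two spaces in which the contraction runs.\<close>

lemma NL_diff:
 assumes T: "0 < T" "T \<le> 1" and F: "F \<in> L2 (wm s 1)" "F' \<in> L2 (wm s 1)" and g: "g \<in> W" "g' \<in> W"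
 shows "lb b T (\<lambda>t n. NL F g t n - NL F' g' t n) (C * T powr \<theta> *
  (nF (\<lambda>z. F z - F' z) * (nF F + nF F' + 2 * nW g) + (2 * nF F' + nW g + nW g') * nW (\<lambda>z. g z - g' z)))"
proof -
 define K where "K = C * T powr \<theta>"
 have K: "0 \<le> K" using C by (simp add: K_def)
 define d e where "d = (\<lambda>z. F z - F' z)" and "e = (\<lambda>z. g z - g' z)"
 note mem = L2_diff(1)[OF F, folded d_def] L2_diff(1)[OF g, folded e_def]
 have "lb b T (\<lambda>t n. (J F F t n - J F' F' t n) + 2 * (J F g t n - J F' g' t n) + (J g g t n - J g' g' t n))
   (K * nF d * (nF F + nF F') + norm (2::complex) * (K * (nR d * nW g + nR F' * nW e)) + K * (nR e * nW g + nR g' * nW e))"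
  unfolding K_def d_def e_def
  by (intro lb_add lb_cmult estF_diff estR_diff T F g FR(1) WR(1) b)
 moreover have "K * nF d * (nF F + nF F') + norm (2::complex) * (K * (nR d * nW g + nR F' * nW e)) + K * (nR e * nW g + nR g' * nW e)
   \<le> K * (nF d * (nF F + nF F' + 2 * nW g) + (2 * nF F' + nW g + nW g') * nW e)"
 proof -
  have "nR d * nW g \<le> nF d * nW g" "nR F' * nW e \<le> nF F' * nW e" "nR e * nW g \<le> nW e * nW g" "nR g' * nW e \<le> nW g' * nW e"
   by (intro mult_right_mono FR(2) WR(2) mem F g l2_nonneg)+
  then have "nF d * (nF F + nF F') + 2 * (nR d * nW g + nR F' * nW e) + (nR e * nW g + nR g' * nW e)
    \<le> nF d * (nF F + nF F' + 2 * nW g) + (2 * nF F' + nW g + nW g') * nW e" by (simp add: algebra_simps)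
  from mult_left_mono[OF this K] show ?thesis by (simp add: algebra_simps)
 qed
 ultimately have "lb b T (\<lambda>t n. (J F F t n - J F' F' t n) + 2 * (J F g t n - J F' g' t n) + (J g g t n - J g' g' t n))
   (K * (nF d * (nF F + nF F' + 2 * nW g) + (2 * nF F' + nW g + nW g') * nW e))" by (rule lb_mono)
 then show ?thesis by (simp add: NL_def K_def d_def e_def algebra_simps)
qed

section \<open>The truncated equation and its fixed point\<close>

text \<open>Unlike \<^const>\<open>Sol\<close>, the truncated equation holds for all times, and so it determines \<open>g\<close> almost everywhere.\<close>

definition Fix :: "real => real => (int \<times> real => complex) => (int \<times> real => complex) => bool" where
 "Fix \<kappa> T F g \<longleftrightarrow> g \<in> W \<and> (\<forall>t n. ic g t n = cnj (bump (t / T)) * (- (\<i> * of_real \<kappa>) * NL F g t n))"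

lemma Fix_Sol: "0 < T ==> Fix \<kappa> T (fr f) g ==> Sol \<kappa> T f g"
 by (simp add: Fix_def Sol_def bump_1)

text \<open>\<open>lb\<close> provides some representative of small norm. As the equation for
  \<open>g\<close> holds at all times, \<open>ic_injective\<close> shows that \<open>g\<close> has
  the same norm.\<close>

lemma nW_lb:
 assumes l: "lb b T K B" and g: "g \<in> W" and eq: "\<And>t n. ic g t n = cnj (bump (t / T)) * K t n"
 shows "nW g \<le> B"
proof -
 obtain h where h: "h \<in> W" "nW h \<le> B" "\<And>t n. ic h t n = cnj (bump (t / T)) * K t n"
  using l unfolding lb_def by auto
 have "nW (\<lambda>z. g z - h z) = 0"
  by (rule ic_injective[OF L2_diff(1)[OF g h(1)] b(1) b1]) (simp add: ic_diff[OF g h(1) b(1)] eq h(3))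
 then show ?thesis using l2_diff_ge[OF g h(1)] h(2) by simp
qed

text \<open>Under these bounds both coefficients in \<open>NL_diff\<close> are at most
  \<open>2 * (M + 1)\<close>, so the smallness hypothesis leaves the factor 1/2. One statement
  serves for the contraction (\<open>F = F'\<close>) and for the dependence on the data.\<close>

lemma step_diff:
 assumes T: "0 < T" "T \<le> 1" and \<kappa>: "\<bar>\<kappa>\<bar> = 1" and F: "F \<in> L2 (wm s 1)" "F' \<in> L2 (wm s 1)" and g: "g \<in> W" "g' \<in> W" and h: "h \<in> W" "h' \<in> W"
  and eq: "\<And>t n. ic h t n = cnj (bump (t / T)) * (- (\<i> * of_real \<kappa>) * NL F g t n)" "\<And>t n. ic h' t n = cnj (bump (t / T)) * (- (\<i> * of_real \<kappa>) * NL F' g' t n)"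
  and M: "0 \<le> M" "nF F \<le> M" "nF F' \<le> M" "nW g \<le> 1" "nW g' \<le> 1" "C * T powr \<theta> * (4 * (M + 1)) \<le> 1"
 shows "nW (\<lambda>z. h z - h' z) \<le> 1/2 * nF (\<lambda>z. F z - F' z) + 1/2 * nW (\<lambda>z. g z - g' z)"
proof -
 let ?x = "nF (\<lambda>z. F z - F' z)" and ?y = "nW (\<lambda>z. g z - g' z)" and ?K = "C * T powr \<theta>"
 have K: "0 \<le> ?K" using C by simp
 have n1: "norm (- (\<i> * of_real \<kappa>)) = 1" using \<kappa> by (simp add: norm_mult)
 have "nW (\<lambda>z. h z - h' z) \<le> norm (- (\<i> * of_real \<kappa>)) * (?K * (?x * (nF F + nF F' + 2 * nW g) + (2 * nF F' + nW g + nW g') * ?y))"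
  by (rule nW_lb[OF lb_cmult[OF NL_diff[OF T F g]] L2_diff(1)[OF h]])
   (simp only: ic_diff[OF h b(1)] eq right_diff_distrib)
 also have "\<dots> \<le> 1 * (?K * (?x * (2 * (M + 1)) + (2 * (M + 1)) * ?y))"
  unfolding n1 using M by (intro mult_left_mono K add_mono mult_right_mono) auto
 also have "\<dots> = 1/2 * (?K * (4 * (M + 1)) * (?x + ?y))" by (simp add: algebra_simps)
 also have "\<dots> \<le> 1/2 * (1 * (?x + ?y))" by (intro mult_left_mono mult_right_mono M) auto
 finally show ?thesis by simp
qed

lemma Fix_lipschitz:
 assumes T: "0 < T" "T \<le> 1" and \<kappa>: "\<bar>\<kappa>\<bar> = 1" and F: "F \<in> L2 (wm s 1)" "F' \<in> L2 (wm s 1)"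
  and g: "Fix \<kappa> T F g" "Fix \<kappa> T F' g'"
  and M: "0 \<le> M" "nF F \<le> M" "nF F' \<le> M" "nW g \<le> 1" "nW g' \<le> 1" "C * T powr \<theta> * (4 * (M + 1)) \<le> 1"
 shows "nW (\<lambda>z. g z - g' z) \<le> nF (\<lambda>z. F z - F' z)"
proof -
 have W: "g \<in> W" "g' \<in> W" using g by (simp_all add: Fix_def)
 have "nW (\<lambda>z. g z - g' z) \<le> 1/2 * nF (\<lambda>z. F z - F' z) + 1/2 * nW (\<lambda>z. g z - g' z)"
  by (rule step_diff[OF T \<kappa> F W W _ _ M]) (use g in \<open>simp_all add: Fix_def\<close>)
 then show ?thesis by simp
qed

text \<open>Picard iteration in the unit ball of \<open>W\<close>, started at 0. The iteration map
  is chosen from \<open>lb\<close>, so it is known through the curves of its values;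
  \<open>4 * (M + 1)\<^sup>2\<close> dominates the quadratic terms on the ball.\<close>

lemma Fix_exists:
 assumes T: "0 < T" "T \<le> 1" and \<kappa>: "\<bar>\<kappa>\<bar> = 1" and F: "F \<in> L2 (wm s 1)"
  and M: "0 \<le> M" "nF F \<le> M" and KM: "C * T powr \<theta> * (4 * (M + 1)\<^sup>2) \<le> 1"
 obtains g where "Fix \<kappa> T F g" "nW g \<le> 1"
proof -
 define K where "K = C * T powr \<theta>"
 have K: "0 \<le> K" using C by (simp add: K_def)
 have "K * (4 * (M + 1)) \<le> K * (4 * (M + 1)\<^sup>2)"
  using M(1) by (intro mult_left_mono K) (auto simp: power2_eq_square)
 then have KM1: "C * T powr \<theta> * (4 * (M + 1)) \<le> 1" using KM by (simp add: K_def)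
 define c where "c = - (\<i> * complex_of_real \<kappa>)"
 have c: "norm c = 1" using \<kappa> by (simp add: c_def norm_mult)
 have "\<exists>h\<in>W. (nW g \<le> 1 \<longrightarrow> nW h \<le> 1) \<and> (\<forall>t n. ic h t n = cnj (bump (t / T)) * (c * NL F g t n))" if g: "g \<in> W" for g
 proof -
  \<comment> \<open>A bound for \<open>NL F g\<close> itself is read off from the difference
    estimate, with zero data and zero remainder as the second pair.\<close>
  have z: "nF F * (nF F + 2 * nW g) + (nW g)\<^sup>2 = nF (\<lambda>z. F z - 0) * (nF F + nF (\<lambda>z. 0) + 2 * nW g) + (2 * nF (\<lambda>z. 0) + nW g + nW (\<lambda>z. 0)) * nW (\<lambda>z. g z - 0)"
   by (simp add: power2_eq_square)
  have "lb b T (\<lambda>t n. c * NL F g t n) (norm c * (K * (nF F * (nF F + 2 * nW g) + (nW g)\<^sup>2)))"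
   using lb_cmult[OF NL_diff[OF T F L2_zero(1) g L2_zero(1)], of c] unfolding z K_def by (simp add: NL_def J_zero)
  then obtain h where h: "h \<in> W" "nW h \<le> K * (nF F * (nF F + 2 * nW g) + (nW g)\<^sup>2)" "\<And>t n. ic h t n = cnj (bump (t / T)) * (c * NL F g t n)"
   unfolding lb_def c by auto
  have "nW h \<le> 1" if "nW g \<le> 1"
  proof -
   have "nF F * (nF F + 2 * nW g) + (nW g)\<^sup>2 \<le> M * (M + 2 * 1) + 1\<^sup>2"
    using M that by (intro add_mono mult_mono power_mono) auto
   also have "\<dots> \<le> 4 * (M + 1)\<^sup>2" using M(1) by (simp add: power2_eq_square algebra_simps)
   finally have "K * (nF F * (nF F + 2 * nW g) + (nW g)\<^sup>2) \<le> K * (4 * (M + 1)\<^sup>2)" by (rule mult_left_mono[OF _ K])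
   then show ?thesis using h(2) KM by (simp add: K_def)
  qed
  then show ?thesis using h by blast
 qed
 then obtain N where N: "\<And>g. g \<in> W ==> N g \<in> W" "\<And>g. g \<in> W ==> nW g \<le> 1 ==> nW (N g) \<le> 1"
   "\<And>g t n. g \<in> W ==> ic (N g) t n = cnj (bump (t / T)) * (c * NL F g t n)"
  by metis
 have con: "nW (\<lambda>z. N g z - N h z) \<le> 1/2 * nW (\<lambda>z. g z - h z)" if g: "g \<in> W" "nW g \<le> 1" and h: "h \<in> W" "nW h \<le> 1" for g h
  using step_diff[OF T \<kappa> F F g(1) h(1) N(1)[OF g(1)] N(1)[OF h(1)] N(3)[OF g(1), unfolded c_def] N(3)[OF h(1), unfolded c_def] M(1) M(2) M(2) g(2) h(2) KM1]
  by simp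
 define G where "G k = (N ^^ k) (\<lambda>z. 0)" for k
 have G: "G k \<in> W \<and> nW (G k) \<le> 1" for k
  by (induction k) (auto simp: G_def N)
 \<comment> \<open>Comparing with all later iterates at once, uniformly in \<open>j\<close>, gives
   the Cauchy property without summing a geometric series; the case \<open>k = 0\<close> is the
   bound by the unit ball.\<close>
 have dec: "nW (\<lambda>z. G (k + j) z - G k z) \<le> (1/2) ^ k" for k j
 proof (induction k)
  case 0 then show ?case using G[of j] by (simp add: G_def)
 next
  case (Suc k)
  have "nW (\<lambda>z. N (G (k + j)) z - N (G k) z) \<le> 1/2 * nW (\<lambda>z. G (k + j) z - G k z)" using G by (intro con) auto
  then show ?case using Suc by (simp add: G_def)
 qed
 have "\<exists>K. \<forall>k\<ge>K. \<forall>m\<ge>K. nW (\<lambda>z. G k z - G m z) < e" if e: "0 < e" for e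
 proof -
  obtain K where K: "(1/2) ^ K < e / 2" using real_arch_pow_inv[of "e / 2" "1/2"] e by auto
  have "nW (\<lambda>z. G k z - G m z) < e" if "K \<le> k" "K \<le> m" for k m
  proof -
   have "nW (\<lambda>z. (G k z - G K z) - (G m z - G K z)) \<le> nW (\<lambda>z. G k z - G K z) + nW (\<lambda>z. G m z - G K z)"
    using G by (intro L2_diff) auto
   then show ?thesis using dec[of K "k - K"] dec[of K "m - K"] that K by simp
  qed
  then show ?thesis by blast
 qed
 then obtain g where g: "g \<in> W" "null (\<lambda>k. nW (\<lambda>z. G k z - g z))"
  using L2_complete[of G "wm 0 b"] G by blast
 have g1: "nW g \<le> 1" using l2_tendsto[OF _ g(1) g(2)] G by (intro LIMSEQ_le_const2[of "\<lambda>k. nW (G k)"]) auto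
 have lim: "null (\<lambda>k. nW (\<lambda>z. G (Suc k) z - N g z))"
 proof (rule tendsto_sandwich[OF _ _ tendsto_const])
  show "null (\<lambda>k. 1/2 * nW (\<lambda>z. G k z - g z))" using tendsto_mult[OF tendsto_const g(2), of "1/2"] by simp
 qed (use con[OF _ _ g(1) g1] G in \<open>auto simp: G_def intro!: always_eventually\<close>)
 \<comment> \<open>\<open>g\<close> and \<open>N g\<close> are limits of the same sequence of
   iterates; their curves coincide, which is all that \<open>Fix\<close> asks.\<close>
 have "ic g t n = ic (N g) t n" for t n
  using LIMSEQ_unique[OF LIMSEQ_Suc[OF ic_tendsto[OF _ g(1) b(1) g(2), of t n]] ic_tendsto[OF _ N(1)[OF g(1)] b(1) lim, of t n]] G by simp
 then have "Fix \<kappa> T F g" using g(1) N(3)[OF g(1)] by (simp add: Fix_def c_def)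
 then show ?thesis using g1 that by blast
qed

end

subsection \<open>Uniqueness by continuation\<close>

context flow
begin

text \<open>The equation for the difference \<open>w\<close> of two solutions \<open>g\<close> and
  \<open>g'\<close>: the quadratic term is telescoped as \<open>J w g + J g' w\<close>.\<close>

definition lin :: "(int \<times> real => complex) => (int \<times> real => complex) => (int \<times> real => complex) =>
  (int \<times> real => complex) => real => int => complex" where
 "lin F g g' w t n = 2 * J F w t n + (J w g t n + J g' w t n)"

text \<open>The equation holds only for \<open>\<bar>t\<bar> \<le> z\<close>, so \<open>w\<close>
  itself, which is arbitrary outside, cannot be estimated by it. Instead the equation yields ever
  new extensions of the curve of \<open>w\<close> on this interval, each at most half as large as
  the one before, and the values of \<open>w\<close> there are bounded by all of them.\<close>

lemma zero_local:
 assumes T: "0 < z" "z \<le> 1" and c: "norm c = 1" and F: "F \<in> L2 (wm s b)" and W: "g \<in> W" "g' \<in> W" "w \<in> W"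
  and eq: "\<And>t n. \<bar>t\<bar> \<le> z ==> ic w t n = c * lin F g g' w t n"
  and small: "C * z powr \<theta> * (2 * nR F + nW g + nW g') \<le> 1/2" and t: "\<bar>t\<bar> \<le> z"
 shows "ic w t n = 0"
proof -
 define K where "K = C * z powr \<theta>"
 have K: "0 \<le> K" using C by (simp add: K_def)
 have ex: "\<exists>v\<in>W. nW v \<le> (1/2) ^ j * nW w \<and> (\<forall>t. \<bar>t\<bar> \<le> z \<longrightarrow> ic v t = ic w t)" for j
 proof (induction j)
  case 0 then show ?case using W by auto
 next
  case (Suc j)
  then obtain v where v: "v \<in> W" "nW v \<le> (1/2) ^ j * nW w" "\<And>t. \<bar>t\<bar> \<le> z ==> ic v t = ic w t" by blast
  have "lb b z (\<lambda>t n. c * lin F g g' v t n) (norm c * (norm (2::complex) * (K * nR F * nW v) + (K * nR v * nW g + K * nR g' * nW v)))"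
   unfolding lin_def K_def by (intro lb_cmult lb_add estR T F W WR(1) v b)
  then obtain h where h: "h \<in> W" "nW h \<le> 2 * (K * nR F * nW v) + (K * nR v * nW g + K * nR g' * nW v)"
    "\<And>t n. ic h t n = cnj (bump (t / z)) * (c * lin F g g' v t n)"
   unfolding lb_def c by auto
  note h(2)
  also have "2 * (K * nR F * nW v) + (K * nR v * nW g + K * nR g' * nW v) \<le> 2 * (K * nR F * nW v) + (K * nW v * nW g + K * nW g' * nW v)"
   by (intro add_mono mult_right_mono mult_left_mono order_refl WR(2) v W K l2_nonneg)
  also have "\<dots> = K * (2 * nR F + nW g + nW g') * nW v" by (simp add: algebra_simps)
  also have "\<dots> \<le> 1/2 * ((1/2) ^ j * nW w)"
   using small v(2) by (intro mult_mono) (auto simp: K_def)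
  finally have "nW h \<le> (1/2) ^ Suc j * nW w" by simp
  moreover have "ic h t n = ic w t n" if t: "\<bar>t\<bar> \<le> z" for t n
   using J_cong_right[OF T v(1) W(3) v(3) t F] J_cong_left[OF T v(1) W(3) v(3) t W(1)] J_cong_right[OF T v(1) W(3) v(3) t WR(1)[OF W(2)]]
   by (simp add: h(3) eq[OF t] lin_def bump_1[OF T(1) t])
  ultimately show ?case using h(1) by blast
 qed
 have "norm (ic w t n) \<le> sqrt (kb b) * ((1/2) ^ j * nW w)" for j
 proof -
  obtain v where v: "v \<in> W" "nW v \<le> (1/2) ^ j * nW w" "ic v t = ic w t" using ex[of j] t by blast
  have "norm (ic v t n) \<le> sqrt (kb b) * nW v"
   using norm_ic_le[of v t n] rowL1_le[OF v(1) b(1), of n] by simp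
  also have "\<dots> \<le> sqrt (kb b) * ((1/2) ^ j * nW w)" by (intro mult_left_mono v) simp
  finally show ?thesis by (simp add: v(3))
 qed
 then have le: "\<exists>N. \<forall>j\<ge>N. norm (ic w t n) \<le> sqrt (kb b) * ((1/2) ^ j * nW w)" by blast
 have "(\<lambda>j. sqrt (kb b) * ((1/2) ^ j * nW w)) \<longlonglongrightarrow> sqrt (kb b) * (0 * nW w)"
  by (intro tendsto_intros LIMSEQ_power_zero) simp
 from LIMSEQ_le_const[OF this le] show ?thesis by simp
qed

lemma lin_tr:
 assumes F: "F \<in> L2 (wm s b)" and W: "g \<in> W" "g' \<in> W" "w \<in> W"
 shows "lin F g g' w (a + t) n - lin F g g' w a n = cis (a * (of_int n)\<^sup>2) * lin (tr a F) (tr a g) (tr a g') (tr a w) t n"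
proof -
 obtain A where A: "bil s 0 b (2 * (1 - b - \<theta>)) A" using bilR by blast
 have "lin F g g' w (a + t) n - lin F g g' w a n = 2 * (J F w (a + t) n - J F w a n) +
   ((J w g (a + t) n - J w g a n) + (J g' w (a + t) n - J g' w a n))" by (simp add: lin_def algebra_simps)
 also have "\<dots> = cis (a * (of_int n)\<^sup>2) * lin (tr a F) (tr a g) (tr a g') (tr a w) t n"
  by (simp only: J_tr[OF A q F W(3)] J_tr[OF A q WR(1)[OF W(3)] W(1)] J_tr[OF A q WR(1)[OF W(2)] W(3)] lin_def) (simp add: algebra_simps)
 finally show ?thesis .
qed

text \<open>The step length \<open>u\<close> depends only on norms that translation preserves, so
  the same \<open>u\<close> serves from every point reached, and finitely many steps exhaust
  \<open>[-T, T]\<close>.\<close>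

lemma zero_global:
 assumes c: "norm c = 1" and F: "F \<in> L2 (wm s b)" and W: "g \<in> W" "g' \<in> W" "w \<in> W"
  and eq: "\<And>t n. \<bar>t\<bar> \<le> T ==> ic w t n = c * lin F g g' w t n" and t: "\<bar>t\<bar> \<le> T"
 shows "ic w t n = 0"
proof -
 obtain u where u: "0 < u" "u \<le> 1" "\<And>x. 0 < x ==> x \<le> u ==> C * x powr \<theta> * (2 * nR F + nW g + nW g') \<le> 1/2"
  using small_time[OF C \<theta>, of "2 * nR F + nW g + nW g'"] by auto
 have all: "\<forall>t n. \<bar>t\<bar> \<le> T \<longrightarrow> \<bar>t\<bar> \<le> real j * u \<longrightarrow> ic w t n = 0" for j
 proof (induction j)
  case 0 then show ?case by (auto simp: eq lin_def J_zero)
 next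
  case (Suc j)
  define a where "a = real j * u"
  show ?case
  proof (intro allI impI)
   fix t n assume t: "\<bar>t\<bar> \<le> T" "\<bar>t\<bar> \<le> real (Suc j) * u"
   show "ic w t n = 0"
   proof (cases "\<bar>t\<bar> \<le> a")
    case True then show ?thesis using Suc t by (simp add: a_def)
   next
    case False
    define \<sigma> where "\<sigma> = (if 0 \<le> t then a else - a)"
    \<comment> \<open>The last step is shortened so that the translated interval stays inside
      \<open>[-T, T]\<close>.\<close>
    define e where "e = min u (T - a)"
    have a: "0 \<le> a" "\<bar>\<sigma>\<bar> = a" using u(1) by (simp_all add: a_def \<sigma>_def)
    have e: "0 < e" "e \<le> u" "a + e \<le> T" "\<bar>t - \<sigma>\<bar> \<le> e"
     using False t u(1) a by (auto simp: e_def \<sigma>_def a_def algebra_simps)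
    \<comment> \<open>As \<open>w\<close> vanishes at \<open>\<sigma>\<close>, subtracting the
      equation there leaves the interaction between \<open>\<sigma>\<close> and
      \<open>\<sigma> + r\<close>, which is the equation for the translated functions.\<close>
    have z: "ic w \<sigma> m = 0" for m using Suc a e unfolding a_def[symmetric] by auto
    have "ic (tr \<sigma> w) (t - \<sigma>) n = 0"
    proof (rule zero_local[OF e(1) _ c tr_L2(1)[OF F] tr_L2(1)[OF W(1)] tr_L2(1)[OF W(2)] tr_L2(1)[OF W(3)] _ _ e(4)])
     show "e \<le> 1" using e u by simp
     show "C * e powr \<theta> * (2 * nR (tr \<sigma> F) + nW (tr \<sigma> g) + nW (tr \<sigma> g')) \<le> 1 / 2"
      using u(3)[OF e(1,2)] by (simp add: tr_L2(2)[OF F] tr_L2(2)[OF W(1)] tr_L2(2)[OF W(2)])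
     fix r m assume r: "\<bar>r\<bar> \<le> e"
     have "\<bar>\<sigma>\<bar> \<le> T" "\<bar>\<sigma> + r\<bar> \<le> T" using a e r by linarith+
     then have "ic w (\<sigma> + r) m = c * (lin F g g' w (\<sigma> + r) m - lin F g g' w \<sigma> m)"
      using eq[of \<sigma> m] eq[of "\<sigma> + r" m] z[of m] by (simp add: right_diff_distrib)
     also have "\<dots> = cis (\<sigma> * (of_int m)\<^sup>2) * (c * lin (tr \<sigma> F) (tr \<sigma> g) (tr \<sigma> g') (tr \<sigma> w) r m)"
      unfolding lin_tr[OF F W] by (rule mult.left_commute)
     finally show "ic (tr \<sigma> w) r m = c * lin (tr \<sigma> F) (tr \<sigma> g) (tr \<sigma> g') (tr \<sigma> w) r m"
      by (simp add: ic_tr cis_mult_left)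
    qed
    then show ?thesis by (simp add: ic_tr)
   qed
  qed
 qed
 obtain j where "\<bar>t\<bar> < real j * u" using reals_Archimedean3[OF u(1)] by blast
 then show ?thesis using all[of j] t by auto
qed

text \<open>Uniqueness among all solutions, of any size, whereas the contraction sees only those in
  the unit ball. This is why continuation in time is needed.\<close>

lemma Sol_unique:
 assumes \<kappa>: "\<bar>\<kappa>\<bar> = 1" and f: "f \<in> Hs s" and S: "Sol \<kappa> T f g" "Sol \<kappa> T f g'"
 shows "sol T f g = sol T f g'"
proof -
 obtain A where A: "bil s 0 b (2 * (1 - b - \<theta>)) A" using bilR by blast
 have W: "g \<in> W" "g' \<in> W" using S by (simp_all add: Sol_def)
 note F = fr_F(2)[OF f]
 have "ic (\<lambda>z. g z - g' z) t n = 0" if t: "\<bar>t\<bar> \<le> T" for t n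
 proof (rule zero_global[OF _ F W L2_diff(1)[OF W] _ t])
  show "norm (- (\<i> * complex_of_real \<kappa>)) = 1" using \<kappa> by (simp add: norm_mult)
  fix t n assume t: "\<bar>t\<bar> \<le> T"
  have "ic g t n - ic g' t n = - (\<i> * of_real \<kappa>) * (NL (fr f) g t n - NL (fr f) g' t n)"
   using S t by (simp add: Sol_def right_diff_distrib)
  also have "NL (fr f) g t n - NL (fr f) g' t n = lin (fr f) g g' (\<lambda>z. g z - g' z) t n"
   by (simp add: NL_def lin_def J_diff_right[OF A q F W] J_diff_left[OF A q WR(1)[OF W(1)] WR(1)[OF W(2)] W(1)] J_diff_right[OF A q WR(1)[OF W(2)] W] algebra_simps)
  finally show "ic (\<lambda>z. g z - g' z) t n = - (\<i> * of_real \<kappa>) * lin (fr f) g g' (\<lambda>z. g z - g' z) t n"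
   by (simp add: ic_diff[OF W b(1)])
 qed
 then have "cv g t = cv g' t" if "t \<in> {-T..T}" for t
  using that by (simp add: ic_diff[OF W b(1)] cv_def fun_eq_iff abs_le_iff)
 then show ?thesis unfolding sol_def by (intro restrict_ext) simp
qed

theorem wellposed:
 assumes \<kappa>: "\<bar>\<kappa>\<bar> = 1" and f: "f \<in> Hs s"
 shows "\<exists>T>0. (\<exists>!u. is_solution \<kappa> s b T f u) \<and>
  (\<forall>T'. 0 < T' \<and> T' < T \<longrightarrow>
   (\<exists>R>0. \<exists>S :: (int => complex) => real => int => complex.
    (\<forall>g\<in>Hs s. Hs_norm s (\<lambda>n. g n - f n) < R \<longrightarrow>
      is_solution \<kappa> s b T' g (S g) \<and> (\<forall>u. is_solution \<kappa> s b T' g u \<longrightarrow> u = S g)) \<and>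
    (\<exists>L\<ge>0. \<forall>g\<in>Hs s. \<forall>h\<in>Hs s.
      Hs_norm s (\<lambda>n. g n - f n) < R \<longrightarrow> Hs_norm s (\<lambda>n. h n - f n) < R \<longrightarrow>
      XT_norm 0 b T' (\<lambda>t n. remainder T' g (S g) t n - remainder T' h (S h) t n)
       \<le> L * Hs_norm s (\<lambda>n. g n - h n))))"
proof -
 \<comment> \<open>A bound for \<open>nF (fr g)\<close> over all data \<open>g\<close> at distance
   less than 1 from \<open>f\<close>: \<open>cf\<close> is the factor between the two norms.\<close>
 define M where "M = cf + nF (fr f)"
 have M: "0 \<le> M" using phat_bump(2) by (simp add: M_def)
 define U where "U = {g \<in> Hs s. Hs_norm s (\<lambda>n. g n - f n) < 1}"
 have U: "nF (fr g) \<le> M" if g: "g \<in> U" for g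
 proof -
  have H: "g \<in> Hs s" "Hs_norm s (\<lambda>n. g n - f n) < 1" using g by (simp_all add: U_def)
  have "nF (\<lambda>z. (fr g z - fr f z) + fr f z) \<le> nF (\<lambda>z. fr g z - fr f z) + nF (fr f)"
   by (intro L2_add(2) L2_diff(1) fr_F H f)
  also have "nF (\<lambda>z. fr g z - fr f z) = cf * Hs_norm s (\<lambda>n. g n - f n)"
   unfolding fr_diff[symmetric] by (rule l2_fr[OF Hs_diff[OF H(1) f]])
  also have "\<dots> \<le> cf * 1" using H(2) phat_bump(2) by (intro mult_left_mono) auto
  finally show ?thesis by (simp add: M_def)
 qed
 have "Hs_norm s (\<lambda>n. f n - f n) = 0" by (simp add: Hs_norm_def)
 then have fU: "f \<in> U" using f by (simp add: U_def)
 \<comment> \<open>\<open>T\<close> depends on \<open>f\<close> only through \<open>M\<close>. It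
   suits all data in the unit ball around \<open>f\<close> and all shorter times, so the radius can
   be 1 for every \<open>T'\<close>.\<close>
 obtain T where T: "0 < T" "T \<le> 1" "\<And>T'. 0 < T' ==> T' \<le> T ==> C * T' powr \<theta> * (4 * (M + 1)\<^sup>2) \<le> 1/2"
  using small_time[OF C \<theta>, of "4 * (M + 1)\<^sup>2"] by auto
 have ex: "\<exists>v. \<forall>g\<in>U. Fix \<kappa> T' (fr g) (v g) \<and> nW (v g) \<le> 1" if T': "0 < T'" "T' \<le> T" for T'
 proof (intro bchoice ballI)
  fix g assume g: "g \<in> U"
  then have H: "fr g \<in> L2 (wm s 1)" by (simp add: U_def fr_F)
  show "\<exists>v. Fix \<kappa> T' (fr g) v \<and> nW v \<le> 1"
   by (rule Fix_exists[OF T'(1) _ \<kappa> H M U[OF g]]) (use T' T(2) T(3)[OF T'] in auto)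
 qed
 have wp: "is_solution \<kappa> s b T' g (sol T' g h) \<and> (\<forall>u. is_solution \<kappa> s b T' g u \<longrightarrow> u = sol T' g h)"
  if T': "0 < T'" "T' \<le> T" and g: "g \<in> U" and h: "Fix \<kappa> T' (fr g) h" for T' g h
 proof -
  have T1: "T' \<le> 1" using T' T by simp
  have H: "g \<in> Hs s" using g by (simp add: U_def)
  note iff = is_solution_iff[OF T'(1) T1 H, of \<kappa>] and S = Fix_Sol[OF T'(1) h]
  show ?thesis unfolding iff using S Sol_unique[OF \<kappa> H _ S] by blast
 qed
 have main: "\<exists>!u. is_solution \<kappa> s b T f u"
  using ex[OF T(1) order_refl] wp[OF T(1) order_refl fU] fU by blast
 have lip: "\<exists>R>0. \<exists>S :: (int => complex) => real => int => complex.
    (\<forall>g\<in>Hs s. Hs_norm s (\<lambda>n. g n - f n) < R \<longrightarrow>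
      is_solution \<kappa> s b T' g (S g) \<and> (\<forall>u. is_solution \<kappa> s b T' g u \<longrightarrow> u = S g)) \<and>
    (\<exists>L\<ge>0. \<forall>g\<in>Hs s. \<forall>h\<in>Hs s.
      Hs_norm s (\<lambda>n. g n - f n) < R \<longrightarrow> Hs_norm s (\<lambda>n. h n - f n) < R \<longrightarrow>
      XT_norm 0 b T' (\<lambda>t n. remainder T' g (S g) t n - remainder T' h (S h) t n)
       \<le> L * Hs_norm s (\<lambda>n. g n - h n))" if T': "0 < T'" "T' < T" for T'
 proof -
  have T'T: "T' \<le> T" "T' \<le> 1" using T' T by auto
  obtain v where v: "\<And>g. g \<in> U ==> Fix \<kappa> T' (fr g) (v g)" "\<And>g. g \<in> U ==> nW (v g) \<le> 1"
   using ex[OF T'(1) T'T(1)] by blast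
  obtain D where D: "0 \<le> D" "\<And>g F. g \<in> W ==> (\<And>t. t \<in> {-T'..T'} ==> cv g t = F t) ==> XT_norm 0 b T' F \<le> D * nW g"
   using XT_norm_le[OF b T'(1)] by metis
  have "(M + 1) * 1 \<le> (M + 1) * (M + 1)" using M by (intro mult_left_mono) auto
  then have "4 * (M + 1) \<le> 4 * (M + 1)\<^sup>2" by (simp add: power2_eq_square)
  then have "C * T' powr \<theta> * (4 * (M + 1)) \<le> C * T' powr \<theta> * (4 * (M + 1)\<^sup>2)" using C by (intro mult_left_mono) auto
  then have KM: "C * T' powr \<theta> * (4 * (M + 1)) \<le> 1" using T(3)[OF T'(1) T'T(1)] by simp
  have L: "XT_norm 0 b T' (\<lambda>t n. remainder T' g (sol T' g (v g)) t n - remainder T' h (sol T' h (v h)) t n) \<le> D * cf * Hs_norm s (\<lambda>n. g n - h n)"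
   if g: "g \<in> U" and h: "h \<in> U" for g h
  proof -
   have W: "v g \<in> W" "v h \<in> W" using v g h by (auto simp: Fix_def)
   have H: "g \<in> Hs s" "h \<in> Hs s" using g h by (simp_all add: U_def)
   have "XT_norm 0 b T' (\<lambda>t n. remainder T' g (sol T' g (v g)) t n - remainder T' h (sol T' h (v h)) t n) \<le> D * nW (\<lambda>z. v g z - v h z)"
    by (rule D(2)[OF L2_diff(1)[OF W]]) (simp add: remainder_sol cv_diff[OF W b(1)] fun_eq_iff)
   also have "\<dots> \<le> D * nF (\<lambda>z. fr g z - fr h z)"
    by (intro mult_left_mono D(1) Fix_lipschitz[OF T'(1) T'T(2) \<kappa> fr_F(1)[OF H(1)] fr_F(1)[OF H(2)] v(1)[OF g] v(1)[OF h] M U[OF g] U[OF h] v(2)[OF g] v(2)[OF h] KM])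
   finally show ?thesis by (simp add: fr_diff[symmetric] l2_fr[OF Hs_diff[OF H]])
  qed
  have "\<forall>g\<in>Hs s. Hs_norm s (\<lambda>n. g n - f n) < 1 \<longrightarrow> is_solution \<kappa> s b T' g (sol T' g (v g)) \<and> (\<forall>u. is_solution \<kappa> s b T' g u \<longrightarrow> u = sol T' g (v g))"
   using wp[OF T'(1) T'T(1) _ v(1)] by (simp add: U_def)
  moreover have "\<forall>g\<in>Hs s. \<forall>h\<in>Hs s. Hs_norm s (\<lambda>n. g n - f n) < 1 \<longrightarrow> Hs_norm s (\<lambda>n. h n - f n) < 1 \<longrightarrow>
    XT_norm 0 b T' (\<lambda>t n. remainder T' g (sol T' g (v g)) t n - remainder T' h (sol T' h (v h)) t n) \<le> D * cf * Hs_norm s (\<lambda>n. g n - h n)"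
   using L by (simp add: U_def)
  moreover have "0 \<le> D * cf" using D(1) phat_bump(2) by simp
  ultimately show ?thesis
   by (intro exI[of _ 1] conjI exI[of _ "\<lambda>g. sol T' g (v g)"] exI[of _ "D * cf"]) simp_all
 qed
 show ?thesis by (intro exI[of _ T] conjI allI impI T(1) main lip) auto
qed

end

theorem theorem2p1:
  fixes \<kappa> s0 :: real and f :: "int \<Rightarrow> complex"
  assumes "\<kappa> = 1 \<or> \<kappa> = -1"
    and "-1/2 < s0" and "s0 \<le> 0"
    and "f \<in> Hs s0"
  shows "\<exists>b>1/2. \<exists>T>0.
    (\<exists>!u. is_solution \<kappa> s0 b T f u) \<and>
    (\<forall>T'. 0 < T' \<and> T' < T \<longrightarrow>
      (\<exists>R>0. \<exists>S :: (int \<Rightarrow> complex) \<Rightarrow> real \<Rightarrow> int \<Rightarrow> complex.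
        (\<forall>g\<in>Hs s0. Hs_norm s0 (\<lambda>n. g n - f n) < R \<longrightarrow>
           is_solution \<kappa> s0 b T' g (S g) \<and> (\<forall>u. is_solution \<kappa> s0 b T' g u \<longrightarrow> u = S g)) \<and>
        (\<exists>L\<ge>0. \<forall>g\<in>Hs s0. \<forall>h\<in>Hs s0.
           Hs_norm s0 (\<lambda>n. g n - f n) < R \<longrightarrow> Hs_norm s0 (\<lambda>n. h n - f n) < R \<longrightarrow>
           XT_norm 0 b T' (\<lambda>t n. remainder T' g (S g) t n - remainder T' h (S h) t n)
             \<le> L * Hs_norm s0 (\<lambda>n. g n - h n))))"
proof -
 \<comment> \<open>\<open>d\<close> is the distance to the critical regularity, doubled. Half of it
   is shared equally between \<open>2 * b - 1\<close> and \<open>2 * \<theta>\<close>, so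
   \<open>2 * (1 - b - \<theta>) = 1 - d/2\<close> lies midway between
   \<open>- 2 * s0 = 1 - d\<close> and 1.\<close>
 define d where "d = 1 + 2 * s0"
 define b where "b = 1/2 + d/8"
 define \<theta> where "\<theta> = d/8"
 have d: "0 < d" "d \<le> 1" using assms by (simp_all add: d_def)
 have b: "1/2 < b" "b < 1" and \<theta>: "0 < \<theta>" "b + \<theta> \<le> 1" using d by (simp_all add: b_def \<theta>_def)
 have q: "- 2 * s0 \<le> 2 * (1 - b - \<theta>)" "2 * (1 - b - \<theta>) < 1"
  using d by (simp_all add: b_def \<theta>_def d_def field_simps)
 obtain A where A: "bil s0 s0 1 (2 * (1 - b - \<theta>)) A" by (rule bil_free_free[OF assms(3) q])
 obtain A' where A': "bil s0 0 b (2 * (1 - b - \<theta>)) A'" by (rule bil_free_rest[OF assms(3) q b(1)])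
 note \<theta>' = less_imp_le[OF \<theta>(1)] \<theta>(2)
 obtain C where C: "0 \<le> C" "\<And>T f g. 0 < T ==> T \<le> 1 ==> f \<in> L2 (wm s0 1) ==> g \<in> L2 (wm s0 1) ==>
   lb b T (J f g) (C * T powr \<theta> * l2 (wm s0 1) f * l2 (wm s0 1) g)"
  by (rule bilinear_estimate[OF b \<theta>' A, folded lb_def]) (rule that; assumption)
 obtain C' where C': "0 \<le> C'" "\<And>T f g. 0 < T ==> T \<le> 1 ==> f \<in> L2 (wm s0 b) ==> g \<in> L2 (wm 0 b) ==>
   lb b T (J f g) (C' * T powr \<theta> * l2 (wm s0 b) f * l2 (wm 0 b) g)"
  by (rule bilinear_estimate[OF b \<theta>' A', folded lb_def]) (rule that; assumption)
 interpret flow s0 b \<theta> "max C C'"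
 proof
  show "lb b T (J f g) (max C C' * T powr \<theta> * l2 (wm s0 1) f * l2 (wm s0 1) g)"
   if "0 < T" "T \<le> 1" "f \<in> L2 (wm s0 1)" "g \<in> L2 (wm s0 1)" for T f g
   by (rule lb_mono[OF C(2)[OF that]]) (intro mult_right_mono; simp)
  show "lb b T (J f g) (max C C' * T powr \<theta> * l2 (wm s0 b) f * l2 (wm 0 b) g)"
   if "0 < T" "T \<le> 1" "f \<in> L2 (wm s0 b)" "g \<in> L2 (wm 0 b)" for T f g
   by (rule lb_mono[OF C'(2)[OF that]]) (intro mult_right_mono; simp)
 qed (use assms b \<theta> C A A' in auto)
 have \<kappa>: "\<bar>\<kappa>\<bar> = 1" using assms(1) by auto
 show ?thesis by (rule exI[of _ b], rule conjI[OF b(1) wellposed[OF \<kappa> assms(4)]])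
qed

end
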